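(* Let $a\in C^\infty(\mathbb S)$ be positive with $\int_0^{2\pi}a^{-1}d\theta=2\pi$ and $\hat a_k=0$ for $|k|>N$, for some $N\in\mathbb N$. Then there is a unique $\alpha\in C^\infty([0,\infty),C^\infty(\mathbb S))$ such that each $\alpha_\tau$ is positive, $\alpha_0=a$, $\frac{\partial\alpha_\tau}{\partial\tau}=-\alpha_\tau(\Lambda\alpha_\tau)+(\mathcal H\alpha_\tau)(D\alpha_\tau)$ for $\tau\ge0$, and $\widehat{(\alpha_\tau)}_k=0$ for all $\tau\ge0$ and $|k|>N$. Moreover, if $c=\{c_k\}_{k\ge0}$ is a sequence of positive reals with $c_0\ge\hat a_0$, $c_1\ge\zeta_a(-1)$ and $c_{m+1}\ge\zeta_a(-2m)$ for $m\ge1$, then $\alpha_\tau\in\mathcal K_c$ for every $\tau\ge0$.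
   Context: $u=\sum\hat u_ke^{ik\theta}$. $D=-i\,d/d\theta$, $\Lambda e^{in\theta}=|n|e^{in\theta}$, $\mathcal H\mathbf 1=0$, $\mathcal He^{in\theta}=\mathrm{sgn}(n)e^{in\theta}$ ($n\ne0$). For positive $b$ with $\int b^{-1}=2\pi$, $\zeta_b$ is the meromorphic continuation of $\sum_{k\ge1}\lambda_k(b)^{-s}$ over the positive eigenvalues of $b^{1/2}\Lambda b^{1/2}$. $\mathcal K_c=\{b\in C^\infty(\mathbb S): b>0,\ \int_0^{2\pi}b^{-1}=2\pi,\ \hat b_0\le c_0,\ \zeta_b(-1)\le c_1,\ \zeta_b(-2m)\le c_{m+1}\ (m\ge1)\}$. *)

theory Defs
  imports "HOL-Analysis.Analysis"
begin

text \<open>Functions on the circle S are represented as 2pi-periodic functions on the reals.\<close>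

definition smooth_fun :: "(real \<Rightarrow> real) \<Rightarrow> bool" where
  "smooth_fun f \<longleftrightarrow> (\<forall>n x. (deriv ^^ n) f differentiable (at x))"

definition circ_smooth :: "(real \<Rightarrow> real) \<Rightarrow> bool" where
  "circ_smooth f \<longleftrightarrow> smooth_fun f \<and> (\<forall>x. f (x + 2 * pi) = f x)"

definition circ_smooth_c :: "(real \<Rightarrow> complex) \<Rightarrow> bool" where
  "circ_smooth_c u \<longleftrightarrow> circ_smooth (\<lambda>x. Re (u x)) \<and> circ_smooth (\<lambda>x. Im (u x))"

definition cx :: "(real \<Rightarrow> real) \<Rightarrow> real \<Rightarrow> complex" where
  "cx f = (\<lambda>x. complex_of_real (f x))"

definition fourier :: "(real \<Rightarrow> complex) \<Rightarrow> int \<Rightarrow> complex" where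
  "fourier u k = integral {0..2*pi} (\<lambda>\<theta>. u \<theta> * exp (- \<i> * of_int k * of_real \<theta>)) / of_real (2*pi)"

definition Lam :: "(real \<Rightarrow> complex) \<Rightarrow> real \<Rightarrow> complex" where
  "Lam u \<theta> = (\<Sum>\<^sub>\<infinity>n::int. of_int \<bar>n\<bar> * fourier u n * exp (\<i> * of_int n * of_real \<theta>))"

definition Hil :: "(real \<Rightarrow> complex) \<Rightarrow> real \<Rightarrow> complex" where
  "Hil u \<theta> = (\<Sum>\<^sub>\<infinity>n::int. of_int (sgn n) * fourier u n * exp (\<i> * of_int n * of_real \<theta>))"

definition Dop :: "(real \<Rightarrow> complex) \<Rightarrow> real \<Rightarrow> complex" where
  "Dop u \<theta> = - \<i> * vector_derivative u (at \<theta>)"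

definition is_eigenfun :: "(real \<Rightarrow> real) \<Rightarrow> real \<Rightarrow> (real \<Rightarrow> complex) \<Rightarrow> bool" where
  "is_eigenfun b lam u \<longleftrightarrow> circ_smooth_c u \<and>
     (\<forall>\<theta>. of_real (sqrt (b \<theta>)) * Lam (\<lambda>x. of_real (sqrt (b x)) * u x) \<theta> = of_real lam * u \<theta>)"

definition lin_indep_fam :: "nat \<Rightarrow> (nat \<Rightarrow> real \<Rightarrow> complex) \<Rightarrow> bool" where
  "lin_indep_fam n u \<longleftrightarrow>
     (\<forall>c::nat \<Rightarrow> complex. (\<forall>\<theta>. (\<Sum>i<n. c i * u i \<theta>) = 0) \<longrightarrow> (\<forall>i<n. c i = 0))"

definition eig_mult :: "(real \<Rightarrow> real) \<Rightarrow> real \<Rightarrow> nat" where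
  "eig_mult b lam = (GREATEST n. \<exists>u. (\<forall>i<n. is_eigenfun b lam (u i)) \<and> lin_indep_fam n u)"

definition pos_eigs :: "(real \<Rightarrow> real) \<Rightarrow> real set" where
  "pos_eigs b = {lam. lam > 0 \<and> (\<exists>u. is_eigenfun b lam u \<and> (\<exists>\<theta>. u \<theta> \<noteq> 0))}"

definition zeta_series :: "(real \<Rightarrow> real) \<Rightarrow> complex \<Rightarrow> complex" where
  "zeta_series b s = (\<Sum>\<^sub>\<infinity>lam\<in>pos_eigs b. of_nat (eig_mult b lam) * (of_real lam) powr (- s))"

text \<open>v is the value at z of the meromorphic continuation of the zeta series:
  there is a holomorphic f on a connected open set containing the half plane Re s > 1
  (where the series converges) and z, agreeing with the series there.\<close>
definition zeta_val :: "(real \<Rightarrow> real) \<Rightarrow> complex \<Rightarrow> complex \<Rightarrow> bool" where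
  "zeta_val b z v \<longleftrightarrow> (\<exists>S f. open S \<and> connected S \<and> {s. Re s > 1} \<subseteq> S \<and> z \<in> S \<and>
      f holomorphic_on S \<and>
      (\<forall>s. Re s > 1 \<longrightarrow>
         (\<lambda>lam. of_nat (eig_mult b lam) * (of_real lam) powr (- s)) summable_on pos_eigs b \<and>
         zeta_series b s = f s) \<and>
      f z = v)"

definition zeta :: "(real \<Rightarrow> real) \<Rightarrow> complex \<Rightarrow> complex" where
  "zeta b z = (THE v. zeta_val b z v)"

definition Kc :: "(nat \<Rightarrow> real) \<Rightarrow> (real \<Rightarrow> real) set" where
  "Kc c = {b. circ_smooth b \<and> (\<forall>\<theta>. b \<theta> > 0) \<and>
      integral {0..2*pi} (\<lambda>\<theta>. 1 / b \<theta>) = 2 * pi \<and>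
      Re (fourier (cx b) 0) \<le> c 0 \<and>
      Re (zeta b (-1)) \<le> c 1 \<and>
      (\<forall>m::nat. m \<ge> 1 \<longrightarrow> Re (zeta b (- 2 * of_nat m)) \<le> c (m + 1))}"

text \<open>Curves [0,oo) -> C^oo(S) with the Frechet topology of the seminorms sup |d^j f|.\<close>
definition curve_cont :: "(real \<Rightarrow> real \<Rightarrow> real) \<Rightarrow> bool" where
  "curve_cont g \<longleftrightarrow> (\<forall>j \<tau>. \<tau> \<ge> 0 \<longrightarrow> (\<forall>e>0. \<forall>\<^sub>F \<sigma> in at \<tau> within {0..}.
      \<forall>\<theta>. \<bar>(deriv ^^ j) (g \<sigma>) \<theta> - (deriv ^^ j) (g \<tau>) \<theta>\<bar> \<le> e))"

definition curve_deriv :: "(real \<Rightarrow> real \<Rightarrow> real) \<Rightarrow> (real \<Rightarrow> real \<Rightarrow> real) \<Rightarrow> bool" where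
  "curve_deriv g g' \<longleftrightarrow> (\<forall>j \<tau>. \<tau> \<ge> 0 \<longrightarrow> (\<forall>e>0. \<forall>\<^sub>F \<sigma> in at \<tau> within {0..}.
      \<forall>\<theta>. \<bar>((deriv ^^ j) (g \<sigma>) \<theta> - (deriv ^^ j) (g \<tau>) \<theta>) / (\<sigma> - \<tau>)
             - (deriv ^^ j) (g' \<tau>) \<theta>\<bar> \<le> e))"

definition smooth_curve :: "(real \<Rightarrow> real \<Rightarrow> real) \<Rightarrow> bool" where
  "smooth_curve g \<longleftrightarrow> (\<exists>A. A 0 = g \<and> (\<forall>n. (\<forall>\<tau>\<ge>0. circ_smooth (A n \<tau>)) \<and>
      curve_cont (A n) \<and> curve_deriv (A n) (A (Suc n))))"

definition flow_sol :: "nat \<Rightarrow> (real \<Rightarrow> real) \<Rightarrow> (real \<Rightarrow> real \<Rightarrow> real) \<Rightarrow> bool" where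
  "flow_sol N a \<alpha> \<longleftrightarrow> smooth_curve \<alpha> \<and>
     (\<forall>\<tau>\<ge>0. \<forall>\<theta>. \<alpha> \<tau> \<theta> > 0) \<and>
     \<alpha> 0 = a \<and>
     (\<exists>\<beta>. curve_deriv \<alpha> \<beta> \<and> (\<forall>\<tau>\<ge>0. \<forall>\<theta>.
        complex_of_real (\<beta> \<tau> \<theta>) =
          - cx (\<alpha> \<tau>) \<theta> * Lam (cx (\<alpha> \<tau>)) \<theta> + Hil (cx (\<alpha> \<tau>)) \<theta> * Dop (cx (\<alpha> \<tau>)) \<theta>)) \<and>
     (\<forall>\<tau>\<ge>0. \<forall>k::int. \<bar>k\<bar> > int N \<longrightarrow> fourier (cx (\<alpha> \<tau>)) k = 0)"

end

theory Submission
 imports Defs "HOL-Complex_Analysis.Complex_Analysis"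
begin

text \<open>Let \<open>\<phi> = \<integral>d\<theta>/b\<close> and \<open>c n l\<close> the Fourier coefficients of \<open>cis (n \<phi>)\<close>. In the basis \<open>cis (n \<phi>)\<close> the operator
 \<open>b \<Lambda>\<close> becomes \<open>|n| \<delta> + r\<close> with \<open>r\<close> rapidly decreasing, because \<open>c n l\<close> decays rapidly when \<open>n l \<le> 0\<close>. Hence
 \<open>\<zeta>\<^sub>b(s) = 2 \<zeta>(s) + G(s)\<close> with \<open>G\<close> entire, \<open>G(-1)\<close> is the trace of \<open>r\<close>, and \<open>G(-2m)\<close> is the trace of the finite-rank
 operator \<open>T\<^bsup>2m\<^esup> - (J T)\<^bsup>2m\<^esup>\<close>, where \<open>T\<close> has entries \<open>\<surd>|l k| b\<^sub>l\<^sub>-\<^sub>k\<close> and \<open>J\<close> is the sign.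

 With \<open>\<beta> = -i H \<alpha>\<close> the flow reads \<open>\<alpha>' = \<beta> \<alpha>\<^sub>\<theta> - \<alpha> \<beta>\<^sub>\<theta>\<close>: a quadratic system for finitely many coefficients that transports
 \<open>1/\<alpha>\<close>. It preserves positivity by a minimum principle, hence \<open>|\<alpha>\<^sub>n| \<le> \<alpha>\<^sub>0\<close>, and \<open>\<alpha>\<^sub>0\<close> decreases, so solutions
 are global. For \<open>T\<close> it is a commutator \<open>[K, T]\<close> up to \<open>-2 F T\<close>, with \<open>F\<close> the part of \<open>T\<close> coupling opposite signs, which gives
 \<open>G(-2m)' = -4m Tr (F T\<^bsup>2m\<^esup>) \<le> 0\<close>; and \<open>G(-1)'\<close> is \<open>-4 \<Sum> l k |\<alpha>\<^sub>l\<^sub>+\<^sub>k|\<^sup>2\<close> over positive \<open>l\<close>, \<open>k\<close>.\<close>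

text \<open>Eigenvalues and multiplicities are given only through eigenfunctions, so a spectral
  theorem is proved in the basis \<open>cis (n \<phi>)\<close>, where the operator is diagonal plus
  smoothing. Instead of asymptotics of single eigenvalues, the doubly stochastic weights
  |psi_j(n)|^2 compare the spectrum with the integers: G(s) is the sum of |psi_j(n)|^2 (lam_j^(-s) -
  |n|^(-s)), and (lam_j - |n|) psi_j(n) = (r psi_j)(n) makes it converge for every s. At -2m the sum
  over n becomes a finite trace, because the sum over n of c n l times the conjugate of c n k is
  b_(l-k) and because T and JT differ only by a sign on frequencies far from zero. The number of
  sign changes must be even: T - JT itself is not of finite rank, so the value at -1 is a genuine
  double series. It is differentiated in time term by term, which is why the decay of
  \<open>c\<close> is proved for families, with constants uniform over compact time intervals. Band
  limitation survives the flow because the top coefficients of its right side are antisymmetric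
  sums.\<close>

abbreviation (input) infsum_UNIV (binder "ISUM " 10) where "infsum_UNIV f \<equiv> infsum f UNIV"

abbreviation (input) has_vd (infix "has'_vd" 50) where "(f has_vd f') F \<equiv> (f has_vector_derivative f') F"

lemmas abs_summable_dominated = Infinite_Sum.abs_summable_on_comparison_test'

section \<open>Exchanging unconditional sums with limits and integrals\<close>

section \<open>Infinite sums\<close>

text \<open>The majorant makes the finite partial sums converge uniformly in the sequence index, so
  the two limits may be swapped. This serves the weak limits in the compactness argument
  \<open>VV_compact\<close>.\<close>

lemma tendsto_infsum_dominated:
 fixes f :: "nat => 'a => 'b::banach"
 assumes lim: "!!x. x \<in> X ==> (%i. f i x) \<longlonglongrightarrow> g x"
  and bound: "!!i x. x \<in> X ==> norm (f i x) <= h x" and h: "h summable_on X"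
 shows "(%i. \<Sum>\<^sub>\<infinity>x\<in>X. f i x) \<longlonglongrightarrow> (\<Sum>\<^sub>\<infinity>x\<in>X. g x)"
proof -
 have gb: "norm (g x) <= h x" if "x \<in> X" for x
  using tendsto_norm[OF lim[OF that]] bound[OF that] by (intro LIMSEQ_le_const2) auto
 have gs: "g summable_on X"
  by (rule abs_summable_summable, rule abs_summable_dominated[OF h gb])
 have "uniform_limit UNIV (%X' i. \<Sum>x\<in>X'. f i x) (%i. \<Sum>\<^sub>\<infinity>x\<in>X. f i x) (finite_subsets_at_top X)"
  by (rule Weierstrass_m_test_general[OF bound h])
 moreover have "\<forall>\<^sub>F X' in finite_subsets_at_top X. (%i. \<Sum>x\<in>X'. f i x) \<longlonglongrightarrow> (\<Sum>x\<in>X'. g x)"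
  by (rule eventually_finite_subsets_at_top_weakI) (auto intro!: tendsto_sum lim)
 moreover have "((%X'. \<Sum>x\<in>X'. g x) \<longlongrightarrow> (\<Sum>\<^sub>\<infinity>x\<in>X. g x)) (finite_subsets_at_top X)"
  using gs by (simp add: infsum_tendsto)
 ultimately show ?thesis
  by (intro swap_uniform_limit'[where f="%X' i. \<Sum>x\<in>X'. f i x" and g="%X'. \<Sum>x\<in>X'. g x"
     and F="finite_subsets_at_top X" and S=UNIV]) auto
qed

text \<open>The majorant gives uniform convergence over the net of finite index sets, and uniform
  limits pass through the integral. Unordered sums avoid choosing an enumeration of the
  integers.\<close>

lemma has_sum_integral:
 fixes f :: "'a => real => 'b::banach"
 assumes cont: "!!x. continuous_on {a..b} (f x)"
  and bound: "!!x t. t \<in> {a..b} ==> norm (f x t) <= M x" and M: "M summable_on UNIV"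
 shows "((%x. integral {a..b} (f x)) has_sum integral {a..b} (%t. ISUM x. f x t)) UNIV"
proof -
 have u: "uniform_limit {a..b} (%X t. \<Sum>x\<in>X. f x t) (%t. ISUM x. f x t) (finite_subsets_at_top UNIV)"
  by (rule Weierstrass_m_test_general[OF bound M])
 obtain I J where IJ: "!!n. ((%t. \<Sum>x\<in>n. f x t) has_integral I n) {a..b}"
  "((%t. ISUM x. f x t) has_integral J) {a..b}" "(I \<longlongrightarrow> J) (finite_subsets_at_top UNIV)"
  by (rule uniform_limit_integral[OF u]) (auto intro!: cont continuous_on_sum)
 have "I X = (\<Sum>x\<in>X. integral {a..b} (f x))" for X
  using integral_unique[OF IJ(1)[of X]] integral_sum[of X f "{a..b}"] integrable_continuous_interval[OF cont]
  by (cases "finite X") auto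
 hence "I = (%X. \<Sum>x\<in>X. integral {a..b} (f x))" by auto
 with IJ show ?thesis unfolding has_sum_def by (metis integral_unique)
qed

lemma continuous_on_infsum:
 fixes f :: "'a => real => 'b::banach"
 assumes cont: "!!x. continuous_on S (f x)"
  and bound: "!!x t. t \<in> S ==> norm (f x t) <= M x" and M: "M summable_on UNIV"
 shows "continuous_on S (%t. ISUM x. f x t)"
 by (rule uniform_limit_theorem[OF _ Weierstrass_m_test_general[OF bound M]])
  (auto intro!: always_eventually continuous_on_sum cont)

section \<open>Polynomial weights for measuring decay\<close>

definition br :: "int => real" where "br n = 1 + \<bar>real_of_int n\<bar>"

lemma br_ge1: "br n >= 1" and br_pos [simp]: "br n > 0" and br_nz [simp]: "br n \<noteq> 0"
 and br_minus [simp]: "br (- n) = br n" and br_abs_le: "\<bar>real_of_int n\<bar> <= br n"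
 by (auto simp: br_def)

text \<open>Submultiplicativity lets a shift by a bounded amount cost only a constant factor in
  weighted bounds; the added 1 in \<open>br\<close> removes the special case of index 0.\<close>

lemma br_add_le: "br (m + n) <= br m * br n"
proof -
 have "br (m + n) <= 1 + \<bar>real_of_int m\<bar> + \<bar>real_of_int n\<bar>" by (simp add: br_def)
 also have "... <= br m * br n" by (simp add: br_def algebra_simps)
 finally show ?thesis .
qed

lemma br_power_ge1: "br n ^ K >= 1" by (simp add: br_ge1 one_le_power)

lemma summable_br: "(%n. 1 / br n ^ 2) summable_on UNIV"
proof -
 have "summable (%n::nat. inverse (real (Suc n) ^ 2))"
  using inverse_power_summable[of 2, where 'a=real] by (subst summable_Suc_iff) simp
 hence "(%n::nat. 1 / br (int n) ^ 2) summable_on UNIV"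
  by (subst summable_on_UNIV_nonneg_real_iff) (auto simp: br_def field_simps)
 hence "(%n. 1 / br n ^ 2) summable_on range int" "(%n. 1 / br n ^ 2) summable_on range (%n. - int n)"
  by (subst summable_on_reindex; simp add: inj_on_def o_def)+
 moreover have "range int \<union> range (%n. - int n) = UNIV"
  by (auto intro: int_cases2)
 ultimately show ?thesis
  using summable_on_union by metis
qed

lemma summable_br_bound:
 fixes f :: "int => 'a::banach"
 assumes "!!n. norm (f n) <= C / br n ^ 2"
 shows "f summable_on UNIV" "(%n. norm (f n)) summable_on UNIV"
proof -
 have "(%n. C / br n ^ 2) summable_on UNIV"
  using summable_on_cmult_right[OF summable_br, of C] by simp
 thus "(%n. norm (f n)) summable_on UNIV"
  by (rule abs_summable_dominated[OF _ assms])
 thus "f summable_on UNIV" by (rule abs_summable_summable)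
qed

lemma integral_Re:
 fixes a b :: real
 assumes "continuous_on {a..b} h"
 shows "integral {a..b} (%t. Re (h t)) = Re (integral {a..b} h)"
 using integral_linear[OF integrable_continuous_interval[OF assms] bounded_linear_Re] by (simp add: o_def)

section \<open>Fourier series in the variable phi, without inverting phi\<close>

section \<open>Fourier inversion in a reparametrised circle\<close>

lemma has_vector_derivative_cis:
 assumes "(\<phi> has_real_derivative d) (at x within S)"
 shows "((%x. cis (c * \<phi> x)) has_vd \<i> * of_real (c * d) * cis (c * \<phi> x)) (at x within S)"
proof -
 have "((%x. cis (c * \<phi> x)) has_derivative (%t. (c * (d * t)) *\<^sub>R (\<i> * cis (c * \<phi> x)))) (at x within S)"
  using assms by (auto intro!: derivative_eq_intros simp: has_field_derivative_def)
 thus ?thesis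
  by (simp add: has_vector_derivative_def scaleR_conv_of_real mult_ac)
qed

text \<open>\<open>\<phi>\<close> is the lift of an orientation preserving diffeomorphism of the
  circle. It is used twice: as the identity, for ordinary Fourier series, and with \<open>w\<close>
  = 1/b, where \<open>phi_period\<close> encodes the normalisation of the integral of 1/b.\<close>

locale circle_param =
 fixes \<phi> w :: "real => real"
 assumes deriv_phi: "!!x. (\<phi> has_real_derivative w x) (at x)"
  and w_pos: "!!x. w x > 0" and w_cont: "continuous_on UNIV w"
  and phi_period: "!!x. \<phi> (x + 2 * pi) = \<phi> x + 2 * pi"
begin

lemma w_cont' [continuous_intros]: "continuous_on S w"
 using w_cont continuous_on_subset by blast

lemma phi_cont [continuous_intros]: "continuous_on S \<phi>"
 by (meson DERIV_continuous_on deriv_phi has_field_derivative_at_within)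

lemma phi_strict: "x < y ==> \<phi> x < \<phi> y"
 by (meson DERIV_pos_imp_increasing deriv_phi w_pos)

text \<open>The Fourier coefficient of f composed with the inverse of \<open>\<phi>\<close>, written
  in the old variable by substitution.\<close>

definition pcoef :: "(real => complex) => int => complex" where
 "pcoef f n = integral {0..2*pi} (%t. f t * cis (- (of_int n * \<phi> t)) * of_real (w t)) / of_real (2*pi)"

lemma phi_2pi_int: "\<phi> (x + 2 * pi * of_int m) = \<phi> x + 2 * pi * of_int m"
proof -
 have *: "\<phi> (x + 2 * pi * real n) = \<phi> x + 2 * pi * real n" for x and n :: nat
 proof (induction n)
  case (Suc n)
  have "x + 2 * pi * real (Suc n) = (x + 2 * pi * real n) + 2 * pi"
   by (simp add: algebra_simps)
  thus ?case using Suc phi_period[of "x + 2 * pi * real n"] by (simp add: algebra_simps)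
 qed simp
 show ?thesis
 proof (cases "m >= 0")
  case True
  thus ?thesis using *[of x "nat m"] by simp
 next
  case False
  thus ?thesis using *[of "x + 2 * pi * of_int m" "nat (-m)"] by (simp add: algebra_simps)
 qed
qed

lemma integral_cis_phi:
 "integral {0..2*pi} (%t. cis (of_int m * \<phi> t) * of_real (w t)) = (if m = 0 then 2 * pi else 0)"
proof (cases "m = 0")
 case True
 have "((%t. of_real (w t)) has_integral complex_of_real (\<phi> (2*pi)) - of_real (\<phi> 0)) {0..2*pi}"
  by (rule fundamental_theorem_of_calculus)
   (auto intro!: has_vector_derivative_of_real DERIV_subset[OF deriv_phi])
 moreover have "complex_of_real (\<phi> (2*pi)) - of_real (\<phi> 0) = 2 * pi"
  using phi_period[of 0] by simp
 ultimately show ?thesis using True by (simp add: integral_unique)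
next
 case False
 have d: "((%t. (1 / (\<i> * of_int m)) * cis (of_int m * \<phi> t)) has_vd cis (of_int m * \<phi> t) * of_real (w t))
   (at t within {0..2*pi})" for t
  using has_vector_derivative_mult_right[OF has_vector_derivative_cis[OF DERIV_subset[OF deriv_phi[of t]]],
   of "{0..2*pi}" "1 / (\<i> * of_int m)" "of_int m"] False by (simp add: mult_ac)
 have "((%t. cis (of_int m * \<phi> t) * of_real (w t)) has_integral
   1 / (\<i> * of_int m) * cis (of_int m * \<phi> (2*pi)) - 1 / (\<i> * of_int m) * cis (of_int m * \<phi> 0)) {0..2*pi}"
  by (intro fundamental_theorem_of_calculus d) auto
 moreover have "cis (of_int m * \<phi> (2*pi)) = cis (of_int m * \<phi> 0)"
 proof -
  have "of_int m * \<phi> (2*pi) = of_int m * \<phi> 0 + 2 * pi * of_int m" using phi_period[of 0] by (simp add: algebra_simps)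
  thus ?thesis by (simp add: cis_multiple_2pi flip: cis_mult)
 qed
 ultimately show ?thesis using False by (simp add: integral_unique)
qed

text \<open>Expand the nonnegative weighted integral of |g - P|^2, where P is the partial sum with
  the coefficients of g: the cross term and the square of P both give the sum of squares.\<close>

lemma bessel:
 assumes g: "continuous_on {0..2*pi} g" and F: "finite F"
 shows "(\<Sum>n\<in>F. (cmod (pcoef g n))\<^sup>2) <= integral {0..2*pi} (%t. (cmod (g t))\<^sup>2 * w t) / (2*pi)"
proof -
 define P where "P t = (\<Sum>n\<in>F. pcoef g n * cis (of_int n * \<phi> t))" for t
 note [continuous_intros] = g
 have Pc [continuous_intros]: "continuous_on {0..2*pi} P"
  unfolding P_def by (intro continuous_intros)
 note int = integrable_continuous_interval
 have i1: "integral {0..2*pi} (%t. g t * cnj (P t) * of_real (w t)) = 2 * pi * (\<Sum>n\<in>F. (cmod (pcoef g n))\<^sup>2)"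
 proof -
  have "integral {0..2*pi} (%t. g t * cnj (P t) * of_real (w t))
   = integral {0..2*pi} (%t. \<Sum>n\<in>F. cnj (pcoef g n) * (g t * cis (- (of_int n * \<phi> t)) * of_real (w t)))"
   by (simp add: P_def sum_distrib_left sum_distrib_right mult_ac cis_cnj)
  also have "... = (\<Sum>n\<in>F. cnj (pcoef g n) * integral {0..2*pi} (%t. (g t * cis (- (of_int n * \<phi> t)) * of_real (w t))))"
   by (subst integral_sum) (auto intro!: int continuous_intros F)
  also have "... = (\<Sum>n\<in>F. cnj (pcoef g n) * (2 * pi * pcoef g n))"
   by (simp add: pcoef_def)
  also have "... = 2 * pi * (\<Sum>n\<in>F. (cmod (pcoef g n))\<^sup>2)"
   by (simp add: sum_distrib_left complex_norm_square mult_ac del: of_real_power flip: complex_norm_square)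
  finally show ?thesis .
 qed
 have i2: "integral {0..2*pi} (%t. P t * cnj (P t) * of_real (w t)) = 2 * pi * (\<Sum>n\<in>F. (cmod (pcoef g n))\<^sup>2)"
 proof -
  have "integral {0..2*pi} (%t. P t * cnj (P t) * of_real (w t))
   = integral {0..2*pi} (%t. \<Sum>n\<in>F. \<Sum>m\<in>F. pcoef g n * cnj (pcoef g m) * (cis (of_int (n - m) * \<phi> t) * of_real (w t)))"
   unfolding P_def cnj_sum sum_product unfolding sum_distrib_right
   by (intro arg_cong[where f="integral _"] ext sum.cong refl) (simp add: cis_cnj cis_mult algebra_simps)
  also have "... = (\<Sum>n\<in>F. \<Sum>m\<in>F. pcoef g n * cnj (pcoef g m) * integral {0..2*pi} (%t. cis (of_int (n - m) * \<phi> t) * of_real (w t)))"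
   by (intro integral_unique has_integral_sum F has_integral_mult_right integrable_integral int continuous_intros)
  also have "... = (\<Sum>n\<in>F. pcoef g n * cnj (pcoef g n) * (2 * pi))"
   unfolding integral_cis_phi using F by (simp add: if_distrib sum.delta cong: if_cong)
  also have "... = 2 * pi * (\<Sum>n\<in>F. (cmod (pcoef g n))\<^sup>2)"
   by (simp add: sum_distrib_left complex_norm_square mult_ac del: of_real_power flip: complex_norm_square)
  finally show ?thesis .
 qed
 have "0 <= integral {0..2*pi} (%t. (cmod (g t - P t))\<^sup>2 * w t)"
  using w_pos by (intro integral_nonneg int continuous_intros) (simp add: less_imp_le)
 also have "... = integral {0..2*pi} (%t. (cmod (g t))\<^sup>2 * w t
   - 2 * Re (g t * cnj (P t) * of_real (w t)) + Re (P t * cnj (P t) * of_real (w t)))"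
  by (intro arg_cong[where f="integral _"] ext) (simp add: cmod_power2, simp add: power2_eq_square algebra_simps)
 also have "... = integral {0..2*pi} (%t. (cmod (g t))\<^sup>2 * w t)
   - 2 * integral {0..2*pi} (%t. Re (g t * cnj (P t) * of_real (w t)))
   + integral {0..2*pi} (%t. Re (P t * cnj (P t) * of_real (w t)))"
  by (intro integral_unique has_integral_add has_integral_diff has_integral_mult_right integrable_integral int continuous_intros)
 also have "integral {0..2*pi} (%t. Re (g t * cnj (P t) * of_real (w t))) = 2 * pi * (\<Sum>n\<in>F. (cmod (pcoef g n))\<^sup>2)"
  by (subst integral_Re) (auto intro!: continuous_intros simp: i1)
 also have "integral {0..2*pi} (%t. Re (P t * cnj (P t) * of_real (w t))) = 2 * pi * (\<Sum>n\<in>F. (cmod (pcoef g n))\<^sup>2)"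
  by (subst integral_Re) (auto intro!: continuous_intros simp: i2)
 finally show ?thesis by (simp add: field_simps)
qed

text \<open>Riemann-Lebesgue, obtained from Bessel: the squares along any injective enumeration are
  summable.\<close>

lemma pcoef_tendsto_0:
 assumes g: "continuous_on {0..2*pi} g" and h: "inj h"
 shows "(%n::nat. pcoef g (h n)) \<longlonglongrightarrow> 0"
proof -
 have "summable (%n. (cmod (pcoef g (h n)))\<^sup>2)"
 proof (rule bounded_imp_summable)
  fix n
  have "(\<Sum>k\<le>n. (cmod (pcoef g (h k)))\<^sup>2) = (\<Sum>k\<in>h ` {..n}. (cmod (pcoef g k))\<^sup>2)"
   using h by (subst sum.reindex) (auto simp: inj_on_def)
  thus "(\<Sum>k\<le>n. (cmod (pcoef g (h k)))\<^sup>2) <= integral {0..2*pi} (%t. (cmod (g t))\<^sup>2 * w t) / (2*pi)"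
   using bessel[OF g, of "h ` {..n}"] by simp
 qed auto
 hence "(%n. (cmod (pcoef g (h n)))\<^sup>2) \<longlonglongrightarrow> 0" by (rule summable_LIMSEQ_zero)
 hence "(%n. sqrt ((cmod (pcoef g (h n)))\<^sup>2)) \<longlonglongrightarrow> sqrt 0" by (intro tendsto_intros)
 thus ?thesis by (simp add: tendsto_norm_zero_iff)
qed

text \<open>Chernoff's argument: dividing \<open>f - f x\<^sub>0\<close> by \<open>cis (\<phi> - \<phi> x\<^sub>0) - 1\<close> turns the partial sums into a telescope.\<close>

theorem inversion:
 assumes per: "!!x. f (x + 2 * pi) = f x"
  and deriv: "!!x. (f has_vd f' x) (at x)"
  and summable: "pcoef f summable_on UNIV"
 shows "f x0 = (ISUM n. pcoef f n * cis (of_int n * \<phi> x0))"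
proof -
 define d where "d t = cis (\<phi> t - \<phi> x0) - 1" for t
 \<comment> \<open>Where \<open>d\<close> vanishes the quotient is 0/0; the value there is the
   limit, the ratio of the derivatives of \<open>f\<close> and \<open>d\<close>, so \<open>g\<close>
   is continuous.\<close>
 define g where "g t = (if d t = 0 then f' t / (\<i> * of_real (w t)) else (f t - f x0) / d t)" for t
 have fper: "f (x + 2 * pi * of_int m) = f x" for x and m :: int
 proof -
  have *: "f (x + 2 * pi * real n) = f x" for x and n :: nat
  proof (induction n)
   case (Suc n)
   have "x + 2 * pi * real (Suc n) = (x + 2 * pi * real n) + 2 * pi"
    by (simp add: algebra_simps)
   thus ?case using Suc per[of "x + 2 * pi * real n"] by metis
  qed simp
  show ?thesis
  proof (cases "m >= 0")
   case True
   thus ?thesis using *[of x "nat m"] by simp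
  next
   case False
   thus ?thesis using *[of "x + 2 * pi * of_int m" "nat (-m)"] by (simp add: algebra_simps)
  qed
 qed
 have d0: "f t = f x0" if "d t = 0" for t
 proof -
  have "cis (\<phi> t - \<phi> x0) = 1" using that by (simp add: d_def)
  then obtain m :: int where m: "\<phi> t - \<phi> x0 = 2 * pi * of_int m"
   by (metis cis_conv_exp complex_exp_exists exp_eq_1 cis.sel(1) cis.sel(2) cos_one_2pi_int
     cos_one_sin_zero one_complex.sel(1) mult.commute mult.assoc)
  hence "\<phi> t = \<phi> (x0 + 2 * pi * of_int m)" by (simp add: phi_2pi_int)
  hence "t = x0 + 2 * pi * of_int m" using phi_strict by (metis less_irrefl linorder_neqE_linordered_idom)
  thus ?thesis using fper by simp
 qed
 have fcont: "continuous_on S f" for S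
  by (meson deriv has_vector_derivative_continuous continuous_at_imp_continuous_on)
 have dderiv: "(d has_vd \<i> * of_real (w t) * cis (\<phi> t - \<phi> x0)) (at t)" for t
 proof -
  have "((%t. cis (1 * (\<phi> t - \<phi> x0))) has_vd \<i> * of_real (1 * w t) * cis (1 * (\<phi> t - \<phi> x0))) (at t)"
   by (rule has_vector_derivative_cis) (auto intro!: derivative_eq_intros deriv_phi)
  from has_vector_derivative_diff[OF this has_vector_derivative_const[of 1]] show ?thesis
   by (simp add: d_def[abs_def])
 qed
 have gcont: "isCont g t" for t
 proof (cases "d t = 0")
  case False
  have dc: "isCont d t" using dderiv has_vector_derivative_continuous by blast
  hence "eventually (%s. d s \<noteq> 0) (at t)"
   using False tendsto_imp_eventually_ne[of d "d t" "at t" 0] by (simp add: continuous_at)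
  hence ev: "eventually (%s. g s = (f s - f x0) / d s) (nhds t)"
   using False by (auto simp: eventually_at_filter g_def elim!: eventually_mono)
  have "isCont (%s. (f s - f x0) / d s) t"
   using False dc fcont[of UNIV] by (intro continuous_intros) (auto simp: continuous_on_eq_continuous_at)
  thus ?thesis using isCont_cong[OF ev] by simp
 next
  case True
  have c1: "cis (\<phi> t - \<phi> x0) = 1" using True by (simp add: d_def)
  have nz: "\<i> * complex_of_real (w t) \<noteq> 0" using w_pos[of t] by simp
  have q: "((%s. (F s - F t) /\<^sub>R (s - t)) \<longlongrightarrow> D) (at t)"
   if "(F has_vd D) (at t)" for F :: "real => complex" and D
  proof -
   have "((%s. norm (F s - F t - (s - t) *\<^sub>R D) / norm (s - t)) \<longlongrightarrow> 0) (at t)"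
    using that by (simp add: has_vector_derivative_def has_derivative_iff_norm)
   moreover have "eventually (%s. norm (F s - F t - (s - t) *\<^sub>R D) / norm (s - t) = norm ((F s - F t) /\<^sub>R (s - t) - D)) (at t)"
    using eventually_neq_at_within[of t t UNIV]
   proof eventually_elim
    case (elim s)
    have "norm ((F s - F t) /\<^sub>R (s - t) - D) = norm ((F s - F t - (s - t) *\<^sub>R D) /\<^sub>R (s - t))"
     using elim by (simp add: scaleR_diff_right)
    thus ?case by (simp add: divide_inverse mult.commute)
   qed
   ultimately have "((%s. norm ((F s - F t) /\<^sub>R (s - t) - D)) \<longlongrightarrow> 0) (at t)" by (rule Lim_transform_eventually)
   thus ?thesis by (rule LIM_zero_cancel[OF tendsto_norm_zero_cancel])
  qed
  have "((%s. ((f s - f t) /\<^sub>R (s - t)) / ((d s - d t) /\<^sub>R (s - t))) \<longlongrightarrow> f' t / (\<i> * of_real (w t))) (at t)"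
   using q[OF deriv] q[OF dderiv[of t]] nz c1 by (intro tendsto_divide) auto
  moreover have "eventually (%s. d s \<noteq> 0) (at t)"
  proof -
   have "((%s. (d s - d t) /\<^sub>R (s - t)) \<longlongrightarrow> \<i> * of_real (w t)) (at t)" using q[OF dderiv[of t]] c1 by simp
   hence "eventually (%s. (d s - d t) /\<^sub>R (s - t) \<noteq> 0) (at t)" using nz tendsto_imp_eventually_ne by blast
   thus ?thesis using True by (auto elim!: eventually_mono)
  qed
  hence "eventually (%s. ((f s - f t) /\<^sub>R (s - t)) / ((d s - d t) /\<^sub>R (s - t)) = g s) (at t)"
   using eventually_neq_at_within[of t t UNIV]
  proof eventually_elim
   case (elim s)
     thus ?case using True d0[OF True] by (simp add: g_def scaleR_conv_of_real field_simps)
  qed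
  ultimately have "(g \<longlongrightarrow> f' t / (\<i> * of_real (w t))) (at t)" by (rule Lim_transform_eventually)
  thus ?thesis using True by (simp add: isCont_def g_def)
 qed
 have gc: "continuous_on {0..2*pi} g" using gcont continuous_at_imp_continuous_on by blast
 note [continuous_intros] = gc fcont
 note int = integrable_continuous_interval
 define \<gamma> where "\<gamma> n = cis (of_int n * \<phi> x0) * pcoef g n" for n
 \<comment> \<open>Insert f = f x0 + g (cis (\<phi> - \<phi> x0) - 1). Multiplying by cis \<phi>
   shifts the index by one, so the coefficient of f becomes a difference of consecutive coefficients
   of g.\<close>
 have tele: "cis (of_int n * \<phi> x0) * pcoef f n = (if n = 0 then f x0 else 0) + (\<gamma> (n - 1) - \<gamma> n)" for n
 proof -
  have fg: "f t = f x0 + g t * (cis (\<phi> t - \<phi> x0) - 1)" for t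
   using d0[of t] by (auto simp: g_def d_def)
  have "integral {0..2*pi} (%t. f t * cis (- (of_int n * \<phi> t)) * of_real (w t)) =
   integral {0..2*pi} (%t. f x0 * (cis (of_int (-n) * \<phi> t) * of_real (w t))
    + (cis (- \<phi> x0) * (g t * cis (- (of_int (n-1) * \<phi> t)) * of_real (w t))
    - g t * cis (- (of_int n * \<phi> t)) * of_real (w t)))"
  proof (intro arg_cong[where f="integral _"] ext)
   fix t
   have "cis (\<phi> t - \<phi> x0) * cis (- (of_int n * \<phi> t)) = cis (- \<phi> x0) * cis (- (of_int (n-1) * \<phi> t))"
    by (simp add: cis_mult algebra_simps)
   hence "g t * (cis (\<phi> t - \<phi> x0) * cis (- (of_int n * \<phi> t))) * of_real (w t)
     = g t * (cis (- \<phi> x0) * cis (- (of_int (n-1) * \<phi> t))) * of_real (w t)" by simp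
   thus "f t * cis (- (of_int n * \<phi> t)) * of_real (w t) = f x0 * (cis (of_int (-n) * \<phi> t) * of_real (w t))
    + (cis (- \<phi> x0) * (g t * cis (- (of_int (n-1) * \<phi> t)) * of_real (w t))
    - g t * cis (- (of_int n * \<phi> t)) * of_real (w t))"
    unfolding fg[of t] by (simp add: algebra_simps)
  qed
  also have "... = f x0 * integral {0..2*pi} (%t. cis (of_int (-n) * \<phi> t) * of_real (w t))
    + (cis (- \<phi> x0) * integral {0..2*pi} (%t. g t * cis (- (of_int (n-1) * \<phi> t)) * of_real (w t))
    - integral {0..2*pi} (%t. g t * cis (- (of_int n * \<phi> t)) * of_real (w t)))"
   by (intro integral_unique has_integral_add has_integral_diff has_integral_mult_right integrable_integral int continuous_intros)
  also have "... = 2 * pi * ((if n = 0 then f x0 else 0) + (cis (- \<phi> x0) * pcoef g (n-1) - pcoef g n))"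
   by (subst integral_cis_phi) (auto simp: pcoef_def field_simps)
  finally have "pcoef f n = (if n = 0 then f x0 else 0) + (cis (- \<phi> x0) * pcoef g (n-1) - pcoef g n)"
   by (simp add: pcoef_def)
  moreover have "cis (of_int n * \<phi> x0) * cis (- \<phi> x0) = cis (of_int (n - 1) * \<phi> x0)"
   by (simp add: cis_mult algebra_simps)
  ultimately show ?thesis
   by (simp add: \<gamma>_def distrib_left right_diff_distrib del: cis_mult flip: mult.assoc)
 qed
 define S where "S = (ISUM n. pcoef f n * cis (of_int n * \<phi> x0))"
 have "(%n. pcoef f n * cis (of_int n * \<phi> x0)) summable_on UNIV"
  using summable by (subst summable_on_iff_abs_summable_on_complex)
   (simp add: norm_mult summable_on_iff_abs_summable_on_complex[symmetric])
 hence "((%n. pcoef f n * cis (of_int n * \<phi> x0)) has_sum S) UNIV"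
  unfolding S_def by simp
 hence "((%F. \<Sum>n\<in>F. pcoef f n * cis (of_int n * \<phi> x0)) \<longlongrightarrow> S) (finite_subsets_at_top UNIV)"
  by (simp add: has_sum_def)
 \<comment> \<open>The unordered sum is read along symmetric intervals, where the telescope leaves
   two boundary terms that vanish by Riemann-Lebesgue.\<close>
 moreover have "filterlim (%M::nat. {- int M..int M}) (finite_subsets_at_top UNIV) sequentially"
  unfolding filterlim_finite_subsets_at_top
 proof (intro allI impI)
  fix X :: "int set" assume "finite X \<and> X \<subseteq> UNIV"
  then obtain B where B: "\<forall>x\<in>X. \<bar>x\<bar> <= B"
   by (metis finite_imageI finite_set abs_le_iff Max_ge imageI)
  show "eventually (%M::nat. finite {- int M..int M} \<and> X \<subseteq> {- int M..int M} \<and> {- int M..int M} \<subseteq> UNIV) sequentially"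
   using B by (intro eventually_sequentiallyI[of "nat B"]) fastforce
 qed
 ultimately have lim: "(%M::nat. \<Sum>n\<in>{- int M..int M}. pcoef f n * cis (of_int n * \<phi> x0)) \<longlonglongrightarrow> S"
  by (rule filterlim_compose)
 have part: "(\<Sum>n\<in>{- int M..int M}. pcoef f n * cis (of_int n * \<phi> x0)) = f x0 + (\<gamma> (- int M - 1) - \<gamma> (int M))" for M
 proof -
  have t: "(\<Sum>n\<in>{- int M..int M}. \<gamma> (n - 1) - \<gamma> n) = \<gamma> (- int M - 1) - \<gamma> (int M)"
  proof (induction M)
   case (Suc M)
   have "{- int (Suc M)..int (Suc M)} = insert (int (Suc M)) (insert (- int (Suc M)) {- int M..int M})" by auto
   moreover have "\<gamma> (- int M - 1) = \<gamma> (- 1 - int M)" by (rule arg_cong[where f=\<gamma>]) simp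
   ultimately show ?case using Suc by (simp add: algebra_simps)
  qed simp
  have "(\<Sum>n\<in>{- int M..int M}. pcoef f n * cis (of_int n * \<phi> x0))
   = (\<Sum>n\<in>{- int M..int M}. (if n = 0 then f x0 else 0) + (\<gamma> (n - 1) - \<gamma> n))"
   by (intro sum.cong refl) (metis tele mult.commute)
  also have "... = f x0 + (\<gamma> (- int M - 1) - \<gamma> (int M))"
   by (subst sum.distrib) (simp add: t sum.delta)
  finally show ?thesis .
 qed
 have g0: "(%M. \<gamma> (h M)) \<longlonglongrightarrow> 0" if "inj h" for h
  using tendsto_norm_zero[OF pcoef_tendsto_0[OF gc that]]
  by (intro tendsto_norm_zero_cancel[of "%M. \<gamma> (h M)"]) (simp add: \<gamma>_def norm_mult)
 have g1: "(%M. \<gamma> (int M)) \<longlonglongrightarrow> 0" "(%M. \<gamma> (- int M - 1)) \<longlonglongrightarrow> 0"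
  by (rule g0, simp add: inj_on_def)+
 have "(%M. f x0 + (\<gamma> (- int M - 1) - \<gamma> (int M))) \<longlonglongrightarrow> f x0 + (0 - 0)"
  by (intro tendsto_intros g1)
 hence "S = f x0" using lim LIMSEQ_unique unfolding part by fastforce
 thus ?thesis by (simp add: S_def)
qed

end

section \<open>Calculus of the ordinary Fourier coefficients\<close>

section \<open>Fourier coefficients\<close>

interpretation idc: circle_param "%x. x" "%_. 1"
 by unfold_locales (auto intro!: derivative_eq_intros)

lemma exp_cis: "exp (- \<i> * of_int k * of_real t) = cis (- (of_int k * t))"
 "exp (\<i> * of_int k * of_real t) = cis (of_int k * t)"
 by (simp_all add: cis_conv_exp mult_ac)

lemma fourier_cis: "fourier u k = integral {0..2*pi} (%t. u t * cis (- (of_int k * t))) / of_real (2*pi)"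
 unfolding fourier_def exp_cis ..

lemma fourier_pcoef: "fourier u k = idc.pcoef u k"
 by (simp add: fourier_cis idc.pcoef_def)

lemma fourier_inversion:
 assumes "!!x. f (x + 2 * pi) = f x" "!!x. (f has_vd f' x) (at x)"
  and "fourier f summable_on UNIV"
 shows "f x = (ISUM n. fourier f n * cis (of_int n * x))"
 using idc.inversion[of f f' x] assms unfolding fourier_pcoef[abs_def] by simp

lemma norm_fourier_le:
 assumes "continuous_on {0..2*pi} u" "!!t. t \<in> {0..2*pi} ==> cmod (u t) <= B"
 shows "cmod (fourier u k) <= B"
proof -
 have "cmod (integral {0..2*pi} (%t. u t * cis (- (of_int k * t)))) <= B * (2 * pi - 0)"
  by (rule integral_bound) (auto intro!: continuous_intros assms simp: norm_mult)
 thus ?thesis by (simp add: fourier_cis norm_divide field_simps)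
qed

lemma has_sum_fourier:
 assumes "!!x. continuous_on {0..2*pi} (f x)" "!!x t. t \<in> {0..2*pi} ==> cmod (f x t) <= M x" "M summable_on UNIV"
 shows "((%x. fourier (f x) k) has_sum fourier (%t. ISUM x. f x t) k) UNIV"
proof -
 have "((%x. integral {0..2*pi} (%t. f x t * cis (- (of_int k * t)))) has_sum
   integral {0..2*pi} (%t. ISUM x. f x t * cis (- (of_int k * t)))) UNIV"
  using assms by (intro has_sum_integral[where M=M]) (auto intro!: continuous_intros simp: norm_mult)
 hence "((%x. integral {0..2*pi} (%t. f x t * cis (- (of_int k * t))) / of_real (2*pi)) has_sum
   integral {0..2*pi} (%t. ISUM x. f x t * cis (- (of_int k * t))) / of_real (2*pi)) UNIV"
  by (rule has_sum_divide_const)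
 thus ?thesis by (simp add: fourier_cis infsum_cmult_left')
qed

lemma fourier_ek: "fourier (%t. cis (of_int n * t)) k = (if k = n then 1 else 0)"
proof -
 have "fourier (%t. cis (of_int n * t)) k = integral {0..2*pi} (%t. cis (of_int (n - k) * t) * of_real 1) / of_real (2*pi)"
  by (simp add: fourier_cis cis_mult algebra_simps)
 thus ?thesis using idc.integral_cis_phi[of "n - k"] by simp
qed

lemma fourier_cmult: "fourier (%t. c * u t) k = c * fourier u k"
 by (simp add: fourier_cis mult.assoc)

lemma fourier_sum:
 assumes "!!x. x \<in> X ==> continuous_on {0..2*pi} (f x)"
 shows "fourier (%t. \<Sum>x\<in>X. f x t) k = (\<Sum>x\<in>X. fourier (f x) k)"
proof (cases "finite X")
 case True
 have "integral {0..2*pi} (%t. \<Sum>x\<in>X. f x t * cis (- (of_int k * t))) = (\<Sum>x\<in>X. integral {0..2*pi} (%t. f x t * cis (- (of_int k * t))))"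
  using assms True by (intro integral_sum integrable_continuous_interval continuous_intros) auto
 thus ?thesis by (simp add: fourier_cis sum_distrib_right sum_divide_distrib)
qed (simp add: fourier_cis)

lemma fourier_shift: "fourier (%t. cis (of_int j * t) * u t) k = fourier u (k - j)"
 by (simp add: fourier_cis cis_mult algebra_simps mult.left_commute)

lemma fourier_series:
 assumes "(%n. cmod (a n)) summable_on UNIV"
 shows "fourier (%t. ISUM n. a n * cis (of_int n * t)) k = a k"
proof -
 have "((%n. fourier (%t. a n * cis (of_int n * t)) k) has_sum fourier (%t. ISUM n. a n * cis (of_int n * t)) k) UNIV"
  by (rule has_sum_fourier[OF _ _ assms]) (auto intro!: continuous_intros simp: norm_mult)
 moreover have "((%n. fourier (%t. a n * cis (of_int n * t)) k) has_sum a k) UNIV"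
  unfolding fourier_cmult fourier_ek
  by (rule has_sum_finite_neutralI[of "{k}"]) (auto split: if_splits)
 ultimately show ?thesis using has_sum_unique by blast
qed

lemma fourier_deriv:
 assumes per: "u (2 * pi) = u 0"
  and deriv: "!!x. (u has_vd u' x) (at x)" and cont: "continuous_on {0..2*pi} u'"
 shows "fourier u' k = \<i> * of_int k * fourier u k"
proof -
 have uc: "continuous_on {0..2*pi} u"
  using deriv by (meson has_vector_derivative_continuous continuous_at_imp_continuous_on)
 have e: "((%t. cis (- (of_int k * t))) has_vd - \<i> * of_int k * cis (- (of_int k * t))) (at t within S)" for t S
  using has_vector_derivative_cis[of "%x. x" 1 t S "- of_int k"] by (auto intro!: derivative_eq_intros)
 have "((%t. u t * (- \<i> * of_int k * cis (- (of_int k * t))) + u' t * cis (- (of_int k * t))) has_integral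
  u (2*pi) * cis (- (of_int k * (2*pi))) - u 0 * cis (- (of_int k * 0))) {0..2*pi}"
  by (intro fundamental_theorem_of_calculus has_vector_derivative_mult e has_vector_derivative_at_within[OF deriv]) auto
 moreover have "cis (- (of_int k * (2*pi))) = 1"
  using cis_multiple_2pi[of "of_int (-k)"] by (simp add: mult_ac)
 ultimately have "integral {0..2*pi} (%t. u t * (- \<i> * of_int k * cis (- (of_int k * t))) + u' t * cis (- (of_int k * t))) = 0"
  using per by (simp add: integral_unique)
 moreover have "integral {0..2*pi} (%t. (- \<i> * of_int k) * (u t * cis (- (of_int k * t))) + u' t * cis (- (of_int k * t)))
  = (- \<i> * of_int k) * integral {0..2*pi} (%t. u t * cis (- (of_int k * t))) + integral {0..2*pi} (%t. u' t * cis (- (of_int k * t)))"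
  by (intro integral_unique has_integral_add has_integral_mult_right integrable_integral integrable_continuous_interval
    continuous_intros uc cont)
 ultimately have "integral {0..2*pi} (%t. u' t * cis (- (of_int k * t))) = \<i> * of_int k * integral {0..2*pi} (%t. u t * cis (- (of_int k * t)))"
  by (simp add: mult_ac add_eq_0_iff)
 thus ?thesis by (simp add: fourier_cis)
qed

lemma cnj_fourier:
 assumes "continuous_on {0..2*pi} u"
 shows "cnj (fourier u k) = fourier (%t. cnj (u t)) (- k)"
proof -
 have "cnj (integral {0..2*pi} (%t. u t * cis (- (of_int k * t)))) = integral {0..2*pi} (%t. cnj (u t) * cis (of_int k * t))"
  using integral_linear[OF integrable_continuous_interval bounded_linear_cnj, of 0 "2*pi" "%t. u t * cis (- (of_int k * t))"] assms
  by (simp add: o_def cis_cnj continuous_intros)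
 thus ?thesis by (simp add: fourier_cis)
qed

text \<open>The absolutely convergent series with coefficients \<open>a\<close> is integrated term
  by term against the bounded function conjugate to \<open>v\<close>; each term is a shifted
  coefficient of that function.\<close>

lemma has_sum_parseval:
 assumes a: "(%n. cmod (a n)) summable_on UNIV" and v: "continuous_on {0..2*pi} v"
 shows "((%n. a n * cnj (fourier v n)) has_sum
  integral {0..2*pi} (%t. (ISUM n. a n * cis (of_int n * t)) * cnj (v t)) / of_real (2*pi)) UNIV"
proof -
 have "bounded (v ` {0..2*pi})" using v compact_continuous_image compact_imp_bounded by blast
 then obtain B where B: "!!t. t \<in> {0..2*pi} ==> cmod (v t) <= B" unfolding bounded_iff by blast
 have "((%n. fourier (%t. a n * cis (of_int n * t) * cnj (v t)) 0) has_sum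
   fourier (%t. ISUM n. a n * cis (of_int n * t) * cnj (v t)) 0) UNIV"
  by (rule has_sum_fourier[where M="%n. cmod (a n) * B"])
   (auto intro!: continuous_intros v a summable_on_cmult_left mult_left_mono B simp: norm_mult)
 moreover have "fourier (%t. a n * cis (of_int n * t) * cnj (v t)) 0 = a n * cnj (fourier v n)" for n
  using fourier_cmult[of "a n" "%t. cis (of_int n * t) * cnj (v t)" 0] fourier_shift[of n "%t. cnj (v t)" 0] cnj_fourier[OF v, of n]
  by (simp add: mult.assoc)
 ultimately show ?thesis by (simp add: fourier_cis infsum_cmult_left')
qed

section \<open>Decay of the transition matrix between the variables theta and phi\<close>

section \<open>Trigonometric polynomials and the change of variables\<close>

definition tp :: "nat => (int => complex) => real => complex" where
 "tp N a t = (\<Sum>k\<in>{- int N..int N}. a k * cis (of_int k * t))"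

lemma tp_cont [continuous_intros]: "continuous_on S (tp N a)"
 unfolding tp_def by (intro continuous_intros)

lemma cis_int_period: "cis (of_int k * (t + 2 * pi)) = cis (of_int k * t)"
proof -
 have "of_int k * (t + 2 * pi) = of_int k * t + 2 * pi * of_int k" by (simp add: algebra_simps)
 thus ?thesis by (simp add: cis_multiple_2pi flip: cis_mult)
qed

lemma tp_period: "tp N a (t + 2 * pi) = tp N a t"
 unfolding tp_def cis_int_period ..

lemma has_vector_derivative_ek:
 "((%t. cis (of_int k * t)) has_vd \<i> * of_int k * cis (of_int k * t)) (at t within S)"
 using has_vector_derivative_cis[of "%x. x" 1 t S "of_int k"] by (auto intro!: derivative_eq_intros)

lemma tp_deriv: "(tp N a has_vd tp N (%k. \<i> * of_int k * a k) t) (at t within S)"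
proof -
 have "((%t. \<Sum>k\<in>{- int N..int N}. a k * cis (of_int k * t)) has_vd
  (\<Sum>k\<in>{- int N..int N}. a k * (\<i> * of_int k * cis (of_int k * t)))) (at t within S)"
  by (intro has_vector_derivative_sum has_vector_derivative_mult_right has_vector_derivative_ek)
 thus ?thesis by (simp add: tp_def[abs_def] mult_ac)
qed

lemma fourier_tp: "fourier (tp N a) k = (if \<bar>k\<bar> <= int N then a k else 0)"
 unfolding tp_def[abs_def]
 by (subst fourier_sum) (auto intro!: continuous_intros simp: fourier_cmult fourier_ek if_distrib cong: if_cong)

text \<open>The data of one positive band-limited \<open>b\<close>. \<open>\<phi>\<close> may be any
  antiderivative of 1/b, so its base point is free; \<open>phi_p\<close> carries the hypothesis on
  the integral of 1/b.\<close>

locale trig1 =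
 fixes N :: nat and bc :: "int => complex" and b \<phi> :: "real => real"
 assumes band: "!!k. \<bar>k\<bar> > int N ==> bc k = 0"
  and b_tp: "!!t. of_real (b t) = tp N bc t"
  and b_pos: "!!t. b t > 0"
  and phi_d: "!!t. (\<phi> has_real_derivative 1 / b t) (at t)"
  and phi_p: "!!t. \<phi> (t + 2 * pi) = \<phi> t + 2 * pi"
begin

lemma b_Re: "b t = Re (tp N bc t)" using b_tp[of t] by (metis Re_complex_of_real)

lemma b_cont [continuous_intros]: "continuous_on S b"
 unfolding b_Re[abs_def] by (intro continuous_intros)

lemma b_nz [simp]: "b t \<noteq> 0" using b_pos[of t] by simp

sublocale circle_param \<phi> "%t. 1 / b t"
 by unfold_locales (auto intro!: continuous_intros phi_d phi_p b_pos)

lemma b_period: "b (t + 2 * pi) = b t"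
 by (simp add: b_Re tp_period)

lemma fourier_b: "fourier (cx b) k = bc k"
 using band[of k] unfolding cx_def b_tp fourier_tp by auto

lemma bc_cnj: "cnj (bc k) = bc (- k)"
proof -
 have "cnj (fourier (cx b) k) = fourier (cx b) (- k)"
  by (subst cnj_fourier) (auto intro!: continuous_intros simp: cx_def)
 thus ?thesis by (simp add: fourier_b)
qed

text \<open>These are the eigenfunctions of b D with integer eigenvalue n, orthogonal for the
  measure dtheta/b; \<open>c n\<close> is their coefficient vector in the basis of theta.\<close>

definition En :: "int => real => complex" where "En n t = cis (of_int n * \<phi> t)"
definition c :: "int => int => complex" where "c n l = fourier (En n) l"

lemma En_cont [continuous_intros]: "continuous_on S (En n)"
 unfolding En_def by (intro continuous_intros)

lemma En_deriv: "(En n has_vd \<i> * of_int n * (1 / of_real (b t)) * En n t) (at t within S)"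
 using has_vector_derivative_cis[OF DERIV_subset[OF phi_d], where c="of_int n"] by (simp add: En_def[abs_def])

lemma En_period: "En n (t + 2 * pi) = En n t"
proof -
 have "of_int n * \<phi> (t + 2 * pi) = of_int n * \<phi> t + 2 * pi * of_int n" unfolding phi_p by (simp add: algebra_simps)
 thus ?thesis by (simp add: En_def cis_multiple_2pi flip: cis_mult)
qed

lemma norm_c_le_1: "cmod (c n l) <= 1"
 unfolding c_def by (rule norm_fourier_le) (auto intro!: continuous_intros simp: En_def)

lemma c_0: "c 0 l = (if l = 0 then 1 else 0)"
 using fourier_ek[of 0 l] by (simp add: c_def En_def[abs_def])

lemma c_cnj: "cnj (c n l) = c (- n) (- l)"
 unfolding c_def by (subst cnj_fourier) (auto intro!: continuous_intros simp: En_def[abs_def] cis_cnj)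

lemma fourier_En_deriv: "fourier (%t. \<i> * of_int n * (1 / of_real (b t)) * En n t) m = \<i> * of_int m * c n m"
 unfolding c_def using En_period[of n 0]
 by (intro fourier_deriv En_deriv) (auto intro!: continuous_intros)

text \<open>The equation b D u = n u for u = \<open>En n\<close>, compared coefficient by
  coefficient. It is the source of both the decay in n and the eigenvector relation
  \<open>TJ_dn\<close>.\<close>

lemma c_recursion: "(\<Sum>j\<in>{- int N..int N}. bc j * of_int (l - j) * c n (l - j)) = of_int n * c n l"
proof -
 define u where "u t = \<i> * of_int n * (1 / of_real (b t)) * En n t" for t
 have uc: "continuous_on S u" for S unfolding u_def by (intro continuous_intros) auto
 have fu: "fourier u m = \<i> * of_int m * c n m" for m
  unfolding u_def by (rule fourier_En_deriv)
 have "\<i> * of_int n * En n t = (\<Sum>j\<in>{- int N..int N}. bc j * (cis (of_int j * t) * u t))" for t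
 proof -
  have "\<i> * of_int n * En n t = of_real (b t) * u t" by (simp add: u_def)
  thus ?thesis by (simp add: b_tp tp_def sum_distrib_right mult.assoc)
 qed
 hence "fourier (%t. \<i> * of_int n * En n t) l = fourier (%t. \<Sum>j\<in>{- int N..int N}. bc j * (cis (of_int j * t) * u t)) l"
  by simp
 also have "... = (\<Sum>j\<in>{- int N..int N}. bc j * (\<i> * of_int (l - j) * c n (l - j)))"
  by (subst fourier_sum) (auto intro!: continuous_intros uc simp: fourier_cmult fourier_shift fu)
 finally have "\<i> * (of_int n * c n l) = \<i> * (\<Sum>j\<in>{- int N..int N}. bc j * of_int (l - j) * c n (l - j))"
  unfolding fourier_cmult c_def[symmetric] by (simp add: sum_distrib_left mult_ac)
 thus ?thesis by simp
qed

end

text \<open>All constants below depend on the family only through N, delta and M. A one-point family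
  yields the static estimates, the times in 0..S the estimates along the flow.\<close>

locale trig_fam =
 fixes I :: "'i set" and N :: nat and \<delta> M :: real and bc :: "'i => int => complex" and b \<phi> :: "'i => real => real"
 assumes fam: "!!i. i \<in> I ==> trig1 N (bc i) (b i) (\<phi> i)"
  and low: "!!i t. i \<in> I ==> b i t >= \<delta>" and delta_pos: "\<delta> > 0"
  and bc_bound: "!!i k. i \<in> I ==> cmod (bc i k) <= M"
begin

abbreviation cc where "cc i \<equiv> trig1.c (\<phi> i)"

text \<open>The amplitudes produced by repeated integration by parts against \<open>cis (n * \<phi> - l * t)\<close>
 with \<open>s = n / l <= \<delta> / 2\<close>; everything in the class is bounded uniformly in \<open>i\<close> and \<open>s\<close>.\<close>

inductive amp :: "('i => real => real => complex) => bool" where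
 const: "(!!i. i \<in> I ==> cmod (f i) <= C) ==> amp (%i s t. f i)"
| ek: "amp (%i s t. cis (of_int k * t))"
| inv: "amp (%i s t. inverse (of_real (b i t) - of_real s))"
| add: "amp f ==> amp g ==> amp (%i s t. f i s t + g i s t)"
| mult: "amp f ==> amp g ==> amp (%i s t. f i s t * g i s t)"

lemma amp_sum: "finite X ==> (!!x. x \<in> X ==> amp (f x)) ==> amp (%i s t. \<Sum>x\<in>X. f x i s t)"
proof (induction X rule: finite_induct)
 case empty
 show ?case using amp.const[of "%_. 0" 0] by simp
next
 case (insert x X)
 thus ?case using amp.add[of "f x" "%i s t. \<Sum>x\<in>X. f x i s t"] by simp
qed

lemma amp_tp: assumes "!!i k. i \<in> I ==> cmod (a i k) <= C k" shows "amp (%i s t. tp N (a i) t)"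
 unfolding tp_def using assms by (intro amp_sum amp.mult amp.ek) (auto intro: amp.const[of "%i. a i k" "C k" for k])

lemma amp_bounded: "amp g ==> \<exists>C. \<forall>i\<in>I. \<forall>s\<le>\<delta>/2. \<forall>t. cmod (g i s t) <= C"
proof (induction rule: amp.induct)
 case (const f C)
 thus ?case by blast
next
 case (ek k)
 thus ?case by (intro exI[of _ 1]) simp
next
 case inv
 show ?case
 proof (intro exI[of _ "2 / \<delta>"] ballI allI impI)
  fix i s t assume "i \<in> I" "s <= \<delta>/2"
  hence "\<delta> / 2 <= b i t - s" using low[of i t] by (simp add: field_simps)
  moreover have "cmod (inverse (of_real (b i t) - of_real s)) = inverse \<bar>b i t - s\<bar>"
   by (metis norm_inverse norm_of_real of_real_diff)
  moreover have "inverse \<bar>b i t - s\<bar> <= inverse (\<delta> / 2)"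
   using calculation(1) delta_pos by (intro le_imp_inverse_le) auto
  ultimately show "cmod (inverse (of_real (b i t) - of_real s)) <= 2 / \<delta>" by simp
 qed
next
 case (add f g)
 then obtain C D where "\<forall>i\<in>I. \<forall>s\<le>\<delta>/2. \<forall>t. cmod (f i s t) <= C" "\<forall>i\<in>I. \<forall>s\<le>\<delta>/2. \<forall>t. cmod (g i s t) <= D" by blast
 thus ?case by (intro exI[of _ "C + D"] ballI allI impI norm_triangle_le add_mono) auto
next
 case (mult f g)
 then obtain C D where "\<forall>i\<in>I. \<forall>s\<le>\<delta>/2. \<forall>t. cmod (f i s t) <= C" "\<forall>i\<in>I. \<forall>s\<le>\<delta>/2. \<forall>t. cmod (g i s t) <= D" by blast
 thus ?case by (intro exI[of _ "C * D"] ballI allI impI) (auto simp: norm_mult intro!: mult_mono' )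
qed

lemma amp_period: "amp g ==> i \<in> I ==> g i s (t + 2 * pi) = g i s t"
 by (induction arbitrary: rule: amp.induct) (auto simp: cis_int_period trig1.b_period[OF fam])

lemma amp_deriv: "amp g ==> \<exists>g'. amp g' \<and> (\<forall>i\<in>I. \<forall>s\<le>\<delta>/2. \<forall>t. (g i s has_vd g' i s t) (at t))"
proof (induction rule: amp.induct)
 case (const f C)
 have "amp (%i s t. 0)" using amp.const[of "%_. 0" 0] by simp
 thus ?case by (intro exI[of _ "%i s t. 0"]) auto
next
 case (ek k)
 have "amp (%i s t. \<i> * of_int k * cis (of_int k * t))"
  by (intro amp.mult amp.ek amp.const[of "%_. \<i>" 1] amp.const[of "%_. of_int k" "cmod (of_int k)"]) auto
 thus ?case by (intro exI[of _ "%i s t. \<i> * of_int k * cis (of_int k * t)"]) (auto intro!: has_vector_derivative_ek)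
next
 case inv
 define B where "B = (%i. tp N (%k. \<i> * of_int k * bc i k))"
 have Ba: "amp (%i s t. B i t)"
  unfolding B_def by (rule amp_tp[where C="%k. \<bar>of_int k\<bar> * M"]) (auto simp: norm_mult intro!: mult_left_mono bc_bound)
 have m1: "amp (%i s t. -1)" using amp.const[of "%_. -1" 1] by simp
 have "amp (%i s t. -1 * (B i t * (inverse (of_real (b i t) - of_real s) * inverse (of_real (b i t) - of_real s))))"
  by (intro amp.mult amp.inv Ba m1)
 moreover have "((%t. inverse (of_real (b i t) - of_real s)) has_vd
  -1 * (B i t * (inverse (of_real (b i t) - of_real s) * inverse (of_real (b i t) - of_real s)))) (at t)"
  if i: "i \<in> I" and s: "s <= \<delta>/2" for i s t
 proof -
  have nz: "complex_of_real (b i t) - of_real s \<noteq> 0"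
   using low[OF i, of t] s delta_pos by (metis divide_pos_pos field_sum_of_halves less_add_same_cancel1 less_le_trans
    not_less of_real_eq_iff right_minus_eq zero_less_numeral)
  have "((%t. complex_of_real (b i t) - of_real s) has_vd B i t) (at t)"
   unfolding trig1.b_tp[OF fam[OF i]] B_def using has_vector_derivative_diff[OF tp_deriv has_vector_derivative_const] by force
  moreover have "(inverse has_field_derivative - (inverse (complex_of_real (b i t) - of_real s) ^ Suc (Suc 0)))
   (at (complex_of_real (b i t) - of_real s))"
   by (rule DERIV_inverse[OF nz])
  ultimately have "(inverse \<circ> (%t. complex_of_real (b i t) - of_real s) has_vd
   B i t * - (inverse (complex_of_real (b i t) - of_real s) ^ Suc (Suc 0))) (at t)"
   by (rule field_vector_diff_chain_at)
  thus ?thesis by (simp add: o_def)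
 qed
 ultimately show ?case by blast
next
 case (add f g)
 then obtain f' g' where *: "amp f'" "\<forall>i\<in>I. \<forall>s\<le>\<delta>/2. \<forall>t. (f i s has_vd f' i s t) (at t)"
  "amp g'" "\<forall>i\<in>I. \<forall>s\<le>\<delta>/2. \<forall>t. (g i s has_vd g' i s t) (at t)" by blast
 show ?case
  using * by (intro exI[of _ "%i s t. f' i s t + g' i s t"] conjI amp.add ballI allI impI has_vector_derivative_add) auto
next
 case (mult f g)
 then obtain f' g' where *: "amp f'" "\<forall>i\<in>I. \<forall>s\<le>\<delta>/2. \<forall>t. (f i s has_vd f' i s t) (at t)"
  "amp g'" "\<forall>i\<in>I. \<forall>s\<le>\<delta>/2. \<forall>t. (g i s has_vd g' i s t) (at t)" by blast
 show ?case
  using * mult by (intro exI[of _ "%i s t. f i s t * g' i s t + f' i s t * g i s t"] conjI amp.add amp.mult ballI allI impI has_vector_derivative_mult) auto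
qed

text \<open>Non-stationary phase. The phase n \<phi> - l t has derivative -(l/b)(b - s) with s =
  n/l, and b - s stays at least delta/2. Each integration by parts gains one power of l and stays
  inside the class \<open>amp\<close>; n enters the amplitudes only through s.\<close>

lemma amp_integral_decay:
 "amp g ==> \<exists>C. \<forall>i\<in>I. \<forall>n l::int. l \<noteq> 0 \<longrightarrow> real_of_int n / real_of_int l <= \<delta>/2 \<longrightarrow>
  \<bar>real_of_int l\<bar> ^ K * cmod (integral {0..2*pi} (%t. g i (of_int n / of_int l) t * cis (of_int n * \<phi> i t - of_int l * t))) <= C"
proof (induction K arbitrary: g)
 case 0
 obtain C where C: "\<forall>i\<in>I. \<forall>s\<le>\<delta>/2. \<forall>t. cmod (g i s t) <= C" using amp_bounded[OF 0] by blast
 obtain g' where g': "\<forall>i\<in>I. \<forall>s\<le>\<delta>/2. \<forall>t. (g i s has_vd g' i s t) (at t)" using amp_deriv[OF 0] by blast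
 show ?case
 proof (intro exI[of _ "C * (2 * pi - 0)"] ballI allI impI)
  fix i and n l :: int assume i: "i \<in> I" and l: "l \<noteq> 0" "real_of_int n / real_of_int l <= \<delta>/2"
  interpret trig1 N "bc i" "b i" "\<phi> i" by (rule fam[OF i])
  have "continuous_on {0..2*pi} (g i (of_int n / of_int l))"
   using g' i l by (meson has_vector_derivative_continuous continuous_at_imp_continuous_on)
  hence "cmod (integral {0..2*pi} (%t. g i (of_int n / of_int l) t * cis (of_int n * \<phi> i t - of_int l * t))) <= C * (2 * pi - 0)"
   using C i l by (intro integral_bound) (auto intro!: continuous_intros simp: norm_mult)
  thus "\<bar>real_of_int l\<bar> ^ 0 * cmod (integral {0..2*pi} (%t. g i (of_int n / of_int l) t * cis (of_int n * \<phi> i t - of_int l * t))) <= C * (2 * pi - 0)"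
   by simp
 qed
next
 case (Suc K)
 \<comment> \<open>The amplitude g b/(b - s): the derivative of h e is h' e - i l g e, so the
   integral of g e is that of h' e divided by i l, the boundary terms cancelling by
   periodicity.\<close>
 define h where "h i s t = g i s t * (tp N (bc i) t * inverse (of_real (b i t) - of_real s))" for i s t
 have "amp h" unfolding h_def[abs_def]
  by (intro amp.mult[of g] amp.mult[of "%i s t. tp N (bc i) t"] Suc.prems amp.inv amp_tp[where a=bc and C="%_. M"] bc_bound)
 then obtain h' where h': "amp h'" "\<forall>i\<in>I. \<forall>s\<le>\<delta>/2. \<forall>t. (h i s has_vd h' i s t) (at t)"
  using amp_deriv by blast
 obtain h'' where h'': "\<forall>i\<in>I. \<forall>s\<le>\<delta>/2. \<forall>t. (h' i s has_vd h'' i s t) (at t)" using amp_deriv[OF h'(1)] by blast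
 obtain g' where g': "\<forall>i\<in>I. \<forall>s\<le>\<delta>/2. \<forall>t. (g i s has_vd g' i s t) (at t)" using amp_deriv[OF Suc.prems] by blast
 from Suc.IH[OF h'(1)] obtain C where C: "\<forall>i\<in>I. \<forall>n l::int. l \<noteq> 0 \<longrightarrow> real_of_int n / real_of_int l <= \<delta>/2 \<longrightarrow>
  \<bar>real_of_int l\<bar> ^ K * cmod (integral {0..2*pi} (%t. h' i (of_int n / of_int l) t * cis (of_int n * \<phi> i t - of_int l * t))) <= C" by (elim exE)
 show ?case
 proof (intro exI[of _ C] ballI allI impI)
  fix i and n l :: int assume i: "i \<in> I" and l: "l \<noteq> 0" "real_of_int n / real_of_int l <= \<delta>/2"
  interpret trig1 N "bc i" "b i" "\<phi> i" by (rule fam[OF i])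
  define s where "s = real_of_int n / real_of_int l"
  define e where "e t = cis (of_int n * \<phi> i t - of_int l * t)" for t
  have s: "s <= \<delta>/2" using l by (simp add: s_def)
  have nsl: "of_int n = complex_of_real s * of_int l" using l by (simp add: s_def)
  have cont: "continuous_on S (g i s)" "continuous_on S (h' i s)" for S
   using g' h'' i s by (meson has_vector_derivative_continuous continuous_at_imp_continuous_on)+
  have ec: "continuous_on S e" for S unfolding e_def by (intro continuous_intros)
  have ed: "(e has_vd \<i> * of_real (of_int n / b i t - of_int l) * e t) (at t)" for t
  proof -
   have "((%t. of_int n * \<phi> i t - of_int l * t) has_real_derivative of_int n / b i t - of_int l) (at t)"
    by (auto intro!: derivative_eq_intros phi_d)
   from has_vector_derivative_cis[OF this, of 1] show ?thesis by (simp add: e_def[abs_def])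
  qed
  have d: "((%t. h i s t * e t) has_vd h' i s t * e t - \<i> * of_int l * (g i s t * e t)) (at t)" for t
  proof -
   have nz: "complex_of_real (b i t) - of_real s \<noteq> 0"
    using low[OF i, of t] s delta_pos by (metis divide_pos_pos field_sum_of_halves less_add_same_cancel1 less_le_trans
     not_less of_real_eq_iff right_minus_eq zero_less_numeral)
   have "h i s t * (\<i> * of_real (of_int n / b i t - of_int l) * e t) = - \<i> * of_int l * (g i s t * e t)"
    unfolding h_def b_tp[symmetric] using nz nsl by (simp add: field_simps)
   thus ?thesis using has_vector_derivative_mult[OF h'(2)[rule_format, OF i s] ed, of t] by simp
  qed
  have "((%t. h' i s t * e t - \<i> * of_int l * (g i s t * e t)) has_integral h i s (2*pi) * e (2*pi) - h i s 0 * e 0) {0..2*pi}"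
   by (intro fundamental_theorem_of_calculus has_vector_derivative_at_within[OF d]) auto
  moreover have "h i s (2*pi) = h i s 0" using amp_period[OF \<open>amp h\<close> i, of s 0] by simp
  moreover have "e (2*pi) = e 0"
  proof -
   have "of_int n * \<phi> i (2*pi) - of_int l * (2*pi) = of_int n * \<phi> i 0 - of_int l * 0 + 2 * pi * of_int (n - l)"
    using phi_p[of 0] by (simp add: algebra_simps)
   thus ?thesis by (simp add: e_def cis_multiple_2pi del: of_int_diff flip: cis_mult)
  qed
  ultimately have "integral {0..2*pi} (%t. h' i s t * e t - \<i> * of_int l * (g i s t * e t)) = 0"
   by (simp add: integral_unique)
  moreover have "integral {0..2*pi} (%t. h' i s t * e t - \<i> * of_int l * (g i s t * e t))
   = integral {0..2*pi} (%t. h' i s t * e t) - \<i> * of_int l * integral {0..2*pi} (%t. g i s t * e t)"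
   by (intro integral_unique has_integral_diff has_integral_mult_right integrable_integral integrable_continuous_interval
     continuous_intros cont ec)
  ultimately have "integral {0..2*pi} (%t. h' i s t * e t) = \<i> * of_int l * integral {0..2*pi} (%t. g i s t * e t)" by simp
  hence "cmod (integral {0..2*pi} (%t. h' i s t * e t)) = \<bar>real_of_int l\<bar> * cmod (integral {0..2*pi} (%t. g i s t * e t))"
   by (simp add: norm_mult)
  moreover have "\<bar>real_of_int l\<bar> ^ K * cmod (integral {0..2*pi} (%t. h' i s t * e t)) <= C"
   using C i l unfolding s_def e_def by blast
  ultimately show "\<bar>real_of_int l\<bar> ^ Suc K * cmod (integral {0..2*pi} (%t. g i (of_int n / of_int l) t * cis (of_int n * \<phi> i t - of_int l * t))) <= C"
   unfolding s_def[symmetric] e_def[symmetric] power_Suc by (simp add: mult.assoc mult.left_commute)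
 qed
qed

end

lemma br_pow_le: "br n ^ K <= 2 ^ K * (1 + \<bar>real_of_int n\<bar> ^ K)"
proof (cases "n = 0")
 case False
 hence "1 <= \<bar>real_of_int n\<bar>" by linarith
 hence "br n <= 2 * \<bar>real_of_int n\<bar>" by (simp add: br_def)
 hence "br n ^ K <= (2 * \<bar>real_of_int n\<bar>) ^ K" by (intro power_mono) (auto simp: less_imp_le)
 thus ?thesis by (simp add: power_mult_distrib distrib_left add_increasing)
qed (simp add: br_def add_increasing2 algebra_simps)

lemma br_diff_le: "br (m - n) <= br m * br n"
 using br_add_le[of m "- n"] by simp

text \<open>Geometric mean of two one-sided bounds, each taken with the doubled exponent.\<close>

lemma two_sided_decay:
 assumes "a >= (0::real)" "b >= 0" "x >= 0" "a ^ (2*K) * x <= C" "b ^ (2*K) * x <= D" "C >= 0"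
 shows "a ^ K * b ^ K * x <= sqrt (C * D)"
proof (rule real_le_rsqrt)
 have "(a ^ K * b ^ K * x)\<^sup>2 = (a ^ (2*K) * x) * (b ^ (2*K) * x)"
  by (simp add: power2_eq_square power_mult) (simp add: power_mult_distrib power2_eq_square mult_ac)
 also have "... <= C * D" using assms by (intro mult_mono) auto
 finally show "(a ^ K * b ^ K * x)\<^sup>2 <= C * D" .
qed

context trig_fam
begin

lemma cc_integral: "i \<in> I ==> cc i n l = integral {0..2*pi} (%t. cis (of_int n * \<phi> i t - of_int l * t)) / of_real (2*pi)"
 by (simp add: trig1.c_def[OF fam] trig1.En_def[OF fam] fourier_cis cis_mult)

lemma cc_decay_l: "\<exists>C. \<forall>i\<in>I. \<forall>n l::int. l \<noteq> 0 \<longrightarrow> real_of_int n / real_of_int l <= \<delta>/2 \<longrightarrow> \<bar>real_of_int l\<bar> ^ K * cmod (cc i n l) <= C"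
proof -
 have "amp (%i s t. 1)" using amp.const[of "%_. 1" 1] by simp
 from amp_integral_decay[OF this, of K] obtain C where C: "\<forall>i\<in>I. \<forall>n l::int. l \<noteq> 0 \<longrightarrow> real_of_int n / real_of_int l <= \<delta>/2 \<longrightarrow>
  \<bar>real_of_int l\<bar> ^ K * cmod (integral {0..2*pi} (%t. 1 * cis (of_int n * \<phi> i t - of_int l * t))) <= C" by (elim exE)
 show ?thesis
 proof (intro exI[of _ "C / (2 * pi)"] ballI allI impI)
  fix i and n l :: int assume "i \<in> I" "l \<noteq> 0" "real_of_int n / real_of_int l <= \<delta>/2"
  with C have "\<bar>real_of_int l\<bar> ^ K * cmod (integral {0..2*pi} (%t. cis (of_int n * \<phi> i t - of_int l * t))) <= C" by simp
  thus "\<bar>real_of_int l\<bar> ^ K * cmod (cc i n l) <= C / (2 * pi)"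
   using cc_integral[OF \<open>i \<in> I\<close>, of n l] by (simp add: norm_divide divide_right_mono)
 qed
qed

text \<open>By \<open>c_recursion\<close>, multiplication by n acts on \<open>cc i n\<close> as a
  banded operator in l of order one. Hence each power of n is paid for by one power of l.\<close>

lemma cc_decay_n: "\<exists>C\<ge>0. \<forall>i\<in>I. \<forall>n l. \<bar>real_of_int n\<bar> ^ K * cmod (cc i n l) <= C * br l ^ K"
proof (induction K)
 case 0
 show ?case using trig1.norm_c_le_1[OF fam] by (intro exI[of _ 1]) auto
next
 case (Suc K)
 then obtain C where C: "C >= 0" "!!i n l. i \<in> I ==> \<bar>real_of_int n\<bar> ^ K * cmod (cc i n l) <= C * br l ^ K" by blast
 define C' where "C' = (\<Sum>j\<in>{- int N..int N}. \<bar>M\<bar> * C * br j ^ Suc K)"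
 show ?case
 proof (intro exI[of _ C'] conjI ballI allI)
  show "C' >= 0" unfolding C'_def using C by (intro sum_nonneg) (auto simp: less_imp_le)
  fix i n l assume i: "i \<in> I"
  interpret trig1 N "bc i" "b i" "\<phi> i" by (rule fam[OF i])
  have "\<bar>real_of_int n\<bar> ^ Suc K * cmod (c n l) = \<bar>real_of_int n\<bar> ^ K * cmod (of_int n * c n l)"
   by (simp add: norm_mult)
  also have "... = \<bar>real_of_int n\<bar> ^ K * cmod (\<Sum>j\<in>{- int N..int N}. bc i j * of_int (l - j) * c n (l - j))"
   by (simp only: c_recursion)
  also have "... <= \<bar>real_of_int n\<bar> ^ K * (\<Sum>j\<in>{- int N..int N}. cmod (bc i j * of_int (l - j) * c n (l - j)))"
   by (intro mult_left_mono norm_sum) auto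
  also have "... = (\<Sum>j\<in>{- int N..int N}. cmod (bc i j) * (\<bar>real_of_int (l - j)\<bar> * (\<bar>real_of_int n\<bar> ^ K * cmod (c n (l - j)))))"
   by (simp add: sum_distrib_left norm_mult mult_ac del: of_int_diff)
  also have "... <= (\<Sum>j\<in>{- int N..int N}. \<bar>M\<bar> * (br (l - j) * (C * br (l - j) ^ K)))"
  proof (intro sum_mono mult_mono[of "cmod x" for x] mult_mono[of "\<bar>x\<bar>" for x] br_abs_le C(2)[OF i])
   show "cmod (bc i j) <= \<bar>M\<bar>" for j using bc_bound[OF i, of j] by linarith
  qed (use C(1) in \<open>auto simp: less_imp_le\<close>)
  also have "... = (\<Sum>j\<in>{- int N..int N}. \<bar>M\<bar> * C * br (l - j) ^ Suc K)" by (simp add: mult_ac)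
  also have "... <= (\<Sum>j\<in>{- int N..int N}. \<bar>M\<bar> * C * (br l * br j) ^ Suc K)"
   using C(1) by (intro sum_mono mult_left_mono power_mono br_diff_le) (auto simp: less_imp_le)
  also have "... = C' * br l ^ Suc K"
   by (simp add: C'_def sum_distrib_right sum_distrib_left power_mult_distrib mult_ac)
  finally show "\<bar>real_of_int n\<bar> ^ Suc K * cmod (c n l) <= C' * br l ^ Suc K" .
 qed
qed

lemma cc_decay_br_n: "\<exists>C\<ge>0. \<forall>i\<in>I. \<forall>n l. br n ^ K * cmod (cc i n l) <= C * br l ^ K"
proof -
 obtain C where C: "C >= 0" "!!i n l. i \<in> I ==> \<bar>real_of_int n\<bar> ^ K * cmod (cc i n l) <= C * br l ^ K"
  using cc_decay_n by blast
 show ?thesis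
 proof (intro exI[of _ "2 ^ K * (1 + C)"] conjI ballI allI)
  fix i n l assume i: "i \<in> I"
  have "br n ^ K * cmod (cc i n l) <= 2 ^ K * (1 + \<bar>real_of_int n\<bar> ^ K) * cmod (cc i n l)"
   by (intro mult_right_mono br_pow_le) auto
  also have "... = 2 ^ K * (cmod (cc i n l) + \<bar>real_of_int n\<bar> ^ K * cmod (cc i n l))" by (simp add: algebra_simps)
  also have "... <= 2 ^ K * (br l ^ K + C * br l ^ K)"
   using C(2)[OF i] trig1.norm_c_le_1[OF fam[OF i], of n l] br_power_ge1[of l K] by (intro mult_left_mono add_mono) auto
  finally show "br n ^ K * cmod (cc i n l) <= 2 ^ K * (1 + C) * br l ^ K" by (simp add: algebra_simps)
 qed (use C in auto)
qed

lemma cc_decay_br_l: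
 "\<exists>C\<ge>0. \<forall>i\<in>I. \<forall>n l::int. l = 0 \<or> real_of_int n / real_of_int l <= \<delta>/2 \<longrightarrow> br l ^ K * cmod (cc i n l) <= C"
proof -
 obtain C where C: "\<forall>i\<in>I. \<forall>n l::int. l \<noteq> 0 \<longrightarrow> real_of_int n / real_of_int l <= \<delta>/2 \<longrightarrow> \<bar>real_of_int l\<bar> ^ K * cmod (cc i n l) <= C"
  using cc_decay_l by blast
 show ?thesis
 proof (intro exI[of _ "2 ^ K * (2 + \<bar>C\<bar>)"] conjI ballI allI impI)
  fix i and n l :: int assume i: "i \<in> I" and l: "l = 0 \<or> real_of_int n / real_of_int l <= \<delta>/2"
  have x: "cmod (cc i n l) <= 1" using trig1.norm_c_le_1[OF fam[OF i]] .
  have "br l ^ K * cmod (cc i n l) <= 2 ^ K * (1 + \<bar>real_of_int l\<bar> ^ K) * cmod (cc i n l)"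
   by (intro mult_right_mono br_pow_le) auto
  also have "... = 2 ^ K * (cmod (cc i n l) + \<bar>real_of_int l\<bar> ^ K * cmod (cc i n l))" by (simp add: algebra_simps)
  also have "... <= 2 ^ K * (2 + \<bar>C\<bar>)"
  proof (cases "l = 0")
   case True
   hence "\<bar>real_of_int l\<bar> ^ K * cmod (cc i n l) <= 1" using x by (auto simp: power_0_left)
   thus ?thesis using x by (intro mult_left_mono) auto
  next
   case False
   hence "\<bar>real_of_int l\<bar> ^ K * cmod (cc i n l) <= C" using C i l by blast
   thus ?thesis using x by (intro mult_left_mono) auto
  qed
  finally show "br l ^ K * cmod (cc i n l) <= 2 ^ K * (2 + \<bar>C\<bar>)" .
 qed auto
qed

text \<open>If n and l have opposite signs then n/l is nonpositive, which is the non-stationary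
  range. Decay of order 4K in l pays for the growth l^(2K) that 2K powers of n cost; the geometric
  mean then gives decay in both indices.\<close>

lemma cc_cross: "\<exists>C\<ge>0. \<forall>i\<in>I. \<forall>n l::int. n * l <= 0 \<longrightarrow> br n ^ K * br l ^ K * cmod (cc i n l) <= C"
proof -
 obtain C where C: "C >= 0" "!!i n l. i \<in> I ==> l = 0 \<or> real_of_int n / real_of_int l <= \<delta>/2 ==> br l ^ (4*K) * cmod (cc i n l) <= C"
  using cc_decay_br_l[of "4*K"] by meson
 obtain D where D: "D >= 0" "!!i n l. i \<in> I ==> br n ^ (2*K) * cmod (cc i n l) <= D * br l ^ (2*K)"
  using cc_decay_br_n[of "2*K"] by meson
 show ?thesis
 proof (intro exI[of _ "sqrt (D * C)"] conjI ballI allI impI real_le_rsqrt)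
  fix i and n l :: int assume i: "i \<in> I" and nl: "n * l <= 0"
  let ?x = "cmod (cc i n l)"
  have "l = 0 \<or> real_of_int n / real_of_int l <= \<delta>/2"
  proof -
   have "real_of_int n / real_of_int l <= 0" if "l \<noteq> 0"
    using nl that by (auto simp: mult_le_0_iff divide_le_0_iff)
   thus ?thesis using delta_pos by fastforce
  qed
  from C(2)[OF i this] have 1: "br l ^ (4*K) * ?x <= C" .
  have "(br n ^ K * br l ^ K * ?x)\<^sup>2 = (br n ^ (2*K) * ?x) * (br l ^ (2*K) * ?x)"
   by (simp add: power2_eq_square power_mult) (simp add: power_mult_distrib power2_eq_square mult_ac)
  also have "... <= (D * br l ^ (2*K)) * (br l ^ (2*K) * ?x)"
   by (intro mult_right_mono D(2) i) (auto simp: less_imp_le)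
  also have "... = D * (br l ^ (4*K) * ?x)"
   by (simp add: mult_ac flip: power_add)
  also have "... <= D * C" using 1 D by (intro mult_left_mono)
  finally show "(br n ^ K * br l ^ K * ?x)\<^sup>2 <= D * C" .
 qed (use C D in auto)
qed

text \<open>Either n/l is in the non-stationary range and there is decay in l, or |l| < (2/delta)|n|
  and the weight of l is dominated by that of n.\<close>

lemma cc_poly: "\<exists>C\<ge>0. \<forall>i\<in>I. \<forall>n l::int. br l ^ K * cmod (cc i n l) <= C * br n ^ K"
proof -
 obtain C where C: "C >= 0" "!!i n l. i \<in> I ==> l = 0 \<or> real_of_int n / real_of_int l <= \<delta>/2 ==> br l ^ K * cmod (cc i n l) <= C"
  using cc_decay_br_l[of K] by meson
 show ?thesis
 proof (intro exI[of _ "C + (1 + 2 / \<delta>) ^ K"] conjI ballI allI)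
  fix i and n l :: int assume i: "i \<in> I"
  show "br l ^ K * cmod (cc i n l) <= (C + (1 + 2 / \<delta>) ^ K) * br n ^ K"
  proof (cases "l = 0 \<or> real_of_int n / real_of_int l <= \<delta>/2")
   case True
   hence "br l ^ K * cmod (cc i n l) <= C * 1" using C(2) i by simp
   also have "... <= (C + (1 + 2 / \<delta>) ^ K) * br n ^ K"
    using C delta_pos by (intro mult_mono br_power_ge1) auto
   finally show ?thesis .
  next
   case False
   hence l0: "l \<noteq> 0" and "\<delta>/2 < \<bar>real_of_int n / real_of_int l\<bar>" by (simp, linarith)
   hence "\<delta> * \<bar>real_of_int l\<bar> < 2 * \<bar>real_of_int n\<bar>" by (simp add: abs_divide field_simps)
   hence "br l <= 1 + 2 / \<delta> * \<bar>real_of_int n\<bar>" using delta_pos by (simp add: br_def field_simps)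
   also have "... <= (1 + 2 / \<delta>) * br n" using delta_pos by (simp add: br_def algebra_simps add_divide_distrib)
   finally have "br l ^ K <= ((1 + 2 / \<delta>) * br n) ^ K" by (intro power_mono) (auto simp: less_imp_le)
   hence "br l ^ K * cmod (cc i n l) <= ((1 + 2 / \<delta>) * br n) ^ K * 1"
    using trig1.norm_c_le_1[OF fam[OF i]] delta_pos by (intro mult_mono) (auto simp: less_imp_le)
   also have "... <= (C + (1 + 2 / \<delta>) ^ K) * br n ^ K"
    unfolding power_mult_distrib using C(1) by (simp add: distrib_right less_imp_le)
   finally show ?thesis .
  qed
 qed (use C delta_pos in auto)
qed

end

section \<open>Bases, Gram relations and the smoothing remainder for a single b\<close>

context trig1
begin

lemma b_lower_bound: obtains \<delta> where "\<delta> > 0" "!!t. b t >= \<delta>"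
proof -
 obtain t0 where t0: "!!t. t \<in> {0..2*pi} ==> b t0 <= b t"
  using continuous_attains_inf[of "{0..2*pi}" b, OF compact_Icc _ b_cont] by force
 have "b t0 <= b t" for t
 proof -
  define m where "m = \<lfloor>t / (2*pi)\<rfloor>"
  have per: "b (x + 2 * pi * real k) = b x" for x and k :: nat
  proof (induction k)
   case (Suc k)
   have "x + 2 * pi * real (Suc k) = (x + 2 * pi * real k) + 2 * pi" by (simp add: algebra_simps)
   thus ?case using Suc b_period[of "x + 2 * pi * real k"] by metis
  qed simp
  have per': "b (x + 2 * pi * of_int k) = b x" for x and k :: int
  proof (cases "k >= 0")
   case True
   thus ?thesis using per[of x "nat k"] by simp
  next
   case False
   thus ?thesis using per[of "x + 2 * pi * of_int k" "nat (-k)"] by (simp add: algebra_simps)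
  qed
  have "of_int m <= t / (2*pi)" "t / (2*pi) < of_int m + 1" by (simp_all add: m_def)
  hence "t - 2 * pi * of_int m \<in> {0..2*pi}" by (auto simp: field_simps)
  hence "b t0 <= b (t - 2 * pi * of_int m)" by (rule t0)
  thus ?thesis using per'[of "t - 2 * pi * of_int m" m] by simp
 qed
 thus ?thesis using that[OF b_pos] by blast
qed

lemma fam_exists: obtains \<delta> M where "trig_fam {()} N \<delta> M (%_. bc) (%_. b) (%_. \<phi>)"
proof -
 obtain \<delta> where d: "\<delta> > 0" "!!t. b t >= \<delta>" using b_lower_bound by blast
 define M where "M = (\<Sum>k\<in>{- int N..int N}. cmod (bc k))"
 have "cmod (bc k) <= M" for k
 proof (cases "\<bar>k\<bar> <= int N")
  case True
  thus ?thesis unfolding M_def by (intro member_le_sum) auto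
 next
  case False
  thus ?thesis using band[of k] by (auto simp: M_def sum_nonneg)
 qed
 hence "trig_fam {()} N \<delta> M (%_. bc) (%_. b) (%_. \<phi>)"
  using d trig1_axioms by unfold_locales (auto simp: trig1_def)
 thus ?thesis by (rule that)
qed

lemma c_cross: obtains C where "C >= 0" "!!n l. n * l <= 0 ==> br n ^ K * br l ^ K * cmod (c n l) <= C"
proof -
 obtain \<delta> M where "trig_fam {()} N \<delta> M (%_. bc) (%_. b) (%_. \<phi>)" by (rule fam_exists)
 from trig_fam.cc_cross[OF this, of K] that show thesis by auto
qed

lemma c_poly: obtains C where "C >= 0" "!!n l. br l ^ K * cmod (c n l) <= C * br n ^ K"
proof -
 obtain \<delta> M where "trig_fam {()} N \<delta> M (%_. bc) (%_. b) (%_. \<phi>)" by (rule fam_exists)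
 from trig_fam.cc_poly[OF this, of K] that show thesis by auto
qed

lemma c_poly_n: obtains C where "C >= 0" "!!n l. br n ^ K * cmod (c n l) <= C * br l ^ K"
proof -
 obtain \<delta> M where "trig_fam {()} N \<delta> M (%_. bc) (%_. b) (%_. \<phi>)" by (rule fam_exists)
 from trig_fam.cc_decay_br_n[OF this, of K] that show thesis by auto
qed

lemma cnj_c_integral: "cnj (c n k) = integral {0..2*pi} (%t. cis (of_int k * t) * cis (- (of_int n * \<phi> t))) / of_real (2*pi)"
 unfolding c_cnj by (simp add: c_def En_def fourier_cis mult.commute)

text \<open>Expand b cis (k t) in the basis \<open>En n\<close>: the weight 1/b of
  \<open>pcoef\<close> cancels the factor b, so the coefficients are the conjugates of c n k. The
  l-th ordinary coefficient of this expansion is the claim.\<close>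

lemma c_completeness: "((%n. c n l * cnj (c n k)) has_sum bc (l - k)) UNIV"
proof -
 define f where "f t = of_real (b t) * cis (of_int k * t)" for t
 obtain C where C: "C >= 0" "!!n l. br n ^ 2 * cmod (c n l) <= C * br l ^ 2" using c_poly_n[where K=2] by blast
 have cb: "cmod (c n l) <= C * br l ^ 2 / br n ^ 2" for n l using C(2)[of n l] by (simp add: field_simps)
 have p: "pcoef f n = cnj (c n k)" for n
  by (simp add: pcoef_def f_def cnj_c_integral mult_ac)
 have cs: "(%n. cmod (c n k)) summable_on UNIV" by (rule summable_br_bound(2)[of "%n. c n k" "C * br k ^ 2"]) (rule cb)
 hence s: "pcoef f summable_on UNIV"
  unfolding p[abs_def] by (rule abs_summable_summable[where f="%n. cnj (c n k)", unfolded complex_mod_cnj])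
 have per: "f (t + 2 * pi) = f t" for t by (simp add: f_def b_period cis_int_period)
 have d: "(f has_vd (tp N bc t * (\<i> * of_int k * cis (of_int k * t)) + tp N (%k. \<i> * of_int k * bc k) t * cis (of_int k * t))) (at t)" for t
  unfolding f_def b_tp by (intro has_vector_derivative_mult tp_deriv has_vector_derivative_ek)
 have f_eq: "f t = (ISUM n. cnj (c n k) * En n t)" for t
  using inversion[of f, OF per d s, of t] by (simp add: p En_def)
 have "((%n. fourier (%t. cnj (c n k) * En n t) l) has_sum fourier (%t. ISUM n. cnj (c n k) * En n t) l) UNIV"
  by (rule has_sum_fourier[OF _ _ cs]) (auto intro!: continuous_intros simp: norm_mult En_def)
 moreover have "fourier (%t. ISUM n. cnj (c n k) * En n t) l = bc (l - k)"
  using fourier_shift[of k "cx b" l] fourier_b[of "l - k"] unfolding f_eq[symmetric] f_def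
  by (simp add: cx_def mult.commute)
 ultimately show ?thesis unfolding fourier_cmult c_def[symmetric] by (simp add: mult.commute[of "cnj x" for x])
qed

lemma c_abs_summable: "(%l. (\<bar>real_of_int l\<bar>) * cmod (c k l)) summable_on UNIV"
proof -
 obtain C where C: "C >= 0" "!!n l. br l ^ 3 * cmod (c n l) <= C * br n ^ 3" using c_poly[where K=3] by blast
 have "norm (\<bar>real_of_int l\<bar> * cmod (c k l)) <= (C * br k ^ 3) / br l ^ 2" for l
 proof -
  have "\<bar>real_of_int l\<bar> * cmod (c k l) * br l ^ 2 <= br l * cmod (c k l) * br l ^ 2"
   by (intro mult_right_mono br_abs_le) auto
  also have "... <= C * br k ^ 3" using C(2)[of l k] by (simp add: power3_eq_cube power2_eq_square mult_ac)
  finally show ?thesis by (simp add: field_simps)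
 qed
 from summable_br_bound(1)[OF this] show ?thesis .
qed

text \<open>Orthogonality of the \<open>En\<close> for dtheta/b. The numbers l c k l are the
  coefficients of D \<open>En k\<close> = (k/b) \<open>En k\<close>, and Parseval pairs them with
  \<open>En n\<close>.\<close>

lemma c_orthogonality: "((%l. of_int l * c k l * cnj (c n l)) has_sum (if k = n then of_int k else 0)) UNIV"
proof -
 define u where "u t = of_int k * (1 / of_real (b t)) * En k t" for t
 have uc: "continuous_on S u" for S unfolding u_def by (intro continuous_intros) auto
 have fu: "fourier u l = of_int l * c k l" for l
 proof -
  have "\<i> * fourier u l = fourier (%t. \<i> * u t) l" by (simp add: fourier_cmult)
  also have "... = \<i> * of_int l * c k l" using fourier_En_deriv[of k l] by (simp add: u_def mult.assoc)
  finally show ?thesis by simp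
 qed
 have s: "(%l. cmod (of_int l * c k l)) summable_on UNIV"
  using c_abs_summable[of k] by (simp add: norm_mult)
 have "u t = (ISUM l. (of_int l * c k l) * cis (of_int l * t))" for t
 proof -
  have per: "u (t + 2 * pi) = u t" for t by (simp add: u_def b_period En_period)
  have bd: "((%t. complex_of_real (b t)) has_vd tp N (%k. \<i> * of_int k * bc k) t) (at t)" for t
   unfolding b_tp by (rule tp_deriv)
  have "\<exists>d. (u has_vd d) (at t)" for t
   unfolding u_def
   using has_vector_derivative_mult[OF has_vector_derivative_mult_right[OF field_vector_diff_chain_at[OF bd DERIV_inverse]] En_deriv, of t "of_int k" k]
   by (auto simp: o_def inverse_eq_divide)
  then obtain u' where u': "!!t. (u has_vd u' t) (at t)" by metis
  have "fourier u summable_on UNIV" unfolding fu[abs_def] by (rule abs_summable_summable[OF s])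
  from fourier_inversion[of u, OF per u' this, of t] show ?thesis by (simp add: fu)
 qed
 note u_eq = this
 have "((%l. (of_int l * c k l) * cnj (fourier (En n) l)) has_sum integral {0..2*pi} (%t. u t * cnj (En n t)) / of_real (2*pi)) UNIV"
  using has_sum_parseval[OF s, of "En n"] unfolding u_eq[symmetric] by (simp add: continuous_intros)
 moreover have "integral {0..2*pi} (%t. u t * cnj (En n t)) = of_int k * integral {0..2*pi} (%t. cis (of_int (k - n) * \<phi> t) * of_real (1 / b t))"
  by (subst integral_mult_right[symmetric]) (auto intro!: arg_cong[where f="integral _"] simp: u_def En_def cis_cnj cis_mult algebra_simps fun_eq_iff)
 ultimately show ?thesis
  unfolding integral_cis_phi by (auto simp: c_def[symmetric])
qed

text \<open>The matrix of b Lambda in the basis \<open>En\<close> with the inner product dtheta/b,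
  whose weight cancels the factor b; hence it is hermitian.\<close>

definition am :: "int => int => complex" where "am n k = (ISUM l. of_int \<bar>l\<bar> * cnj (c n l) * c k l)"
text \<open>Subtracting \<open>sgn n\<close> times the orthogonality relation removes the diagonal
  |n|. The remaining weight |l| - sgn n * l vanishes when n and l have the same sign, so only the
  rapidly small entries of \<open>c\<close> survive.\<close>

definition r :: "int => int => complex" where "r n k = (ISUM l. of_int (\<bar>l\<bar> - sgn n * l) * cnj (c n l) * c k l)"

lemma am_abs_summable: "(%l. cmod (of_int \<bar>l\<bar> * cnj (c n l) * c k l)) summable_on UNIV"
proof (rule abs_summable_dominated[OF c_abs_summable[of n], where f="%l. of_int \<bar>l\<bar> * cnj (c n l) * c k l"])
 fix l
 show "cmod (of_int \<bar>l\<bar> * cnj (c n l) * c k l) <= \<bar>real_of_int l\<bar> * cmod (c n l)"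
  using norm_c_le_1[of k l] by (simp add: norm_mult mult_left_le)
qed

lemma am_summable: "(%l. of_int \<bar>l\<bar> * cnj (c n l) * c k l) summable_on UNIV"
 by (rule abs_summable_summable[OF am_abs_summable])

lemma am_r: "am n k = r n k + (if n = k then of_int \<bar>n\<bar> else 0)"
proof -
 have o: "((%l. of_int (sgn n) * (of_int l * c k l * cnj (c n l))) has_sum (of_int (sgn n) * (if k = n then of_int k else 0))) UNIV"
  by (intro has_sum_cmult_right c_orthogonality)
 have "((%l. of_int \<bar>l\<bar> * cnj (c n l) * c k l + (- (of_int (sgn n) * (of_int l * c k l * cnj (c n l)))))
  has_sum (am n k + (- (of_int (sgn n) * (if k = n then of_int k else 0))))) UNIV"
  unfolding am_def by (intro has_sum_add has_sum_infsum am_summable has_sum_uminusI o)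
 hence "r n k = am n k - of_int (sgn n) * (if k = n then of_int k else 0)"
  unfolding r_def by (intro infsumI) (simp add: algebra_simps)
 moreover have "complex_of_int (sgn n) * of_int n = of_int \<bar>n\<bar>"
  by (metis abs_sgn mult.commute of_int_mult)
 ultimately show ?thesis by auto
qed

lemma am_cnj: "cnj (am n k) = am k n"
 unfolding am_def infsum_cnj[symmetric] by (simp add: mult_ac)

lemma r_cnj: "cnj (r n k) = r k n"
proof -
 have "cnj (r n k + (if n = k then of_int \<bar>n\<bar> else 0)) = r k n + (if k = n then of_int \<bar>k\<bar> else 0)"
  using am_cnj[of n k] unfolding am_r .
 thus ?thesis by (auto split: if_splits)
qed

lemma r_decay1: obtains C where "C >= 0" "!!n k. br n ^ K * cmod (r n k) <= C"
proof -
 obtain C where C: "C >= 0" "!!n l. n * l <= 0 ==> br n ^ (K + 3) * br l ^ (K + 3) * cmod (c n l) <= C" using c_cross[where K="K + 3"] by blast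
 have b: "cmod (of_int (\<bar>l\<bar> - sgn n * l) * cnj (c n l) * c k l) <= (2 * C / br n ^ K) * (1 / br l ^ 2)" for n k l
 proof (cases "n * l <= 0")
  case True
  have "\<bar>real_of_int (\<bar>l\<bar> - sgn n * l)\<bar> <= 2 * br l"
   by (auto simp: sgn_if br_def abs_if)
  hence "cmod (of_int (\<bar>l\<bar> - sgn n * l) * cnj (c n l) * c k l) <= (2 * br l) * cmod (c n l) * 1"
   unfolding norm_mult complex_mod_cnj norm_of_int using norm_c_le_1[of k l] by (intro mult_mono) (auto simp: less_imp_le)
  moreover have "br n ^ K * br l ^ 3 * cmod (c n l) <= br n ^ (K + 3) * br l ^ (K + 3) * cmod (c n l)"
   by (intro mult_right_mono mult_mono power_increasing br_ge1) (auto simp: less_imp_le)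
  hence "br n ^ K * br l ^ 3 * cmod (c n l) <= C" using C(2)[OF True] by linarith
  hence "(2 * br l) * cmod (c n l) <= (2 * C / br n ^ K) * (1 / br l ^ 2)"
   by (simp add: field_simps power3_eq_cube power2_eq_square)
  ultimately show ?thesis by linarith
 next
  case False
  hence "\<bar>l\<bar> - sgn n * l = 0" by (auto simp: not_le zero_less_mult_iff sgn_if)
  thus ?thesis using C by (simp add: less_imp_le)
 qed
 have s2: "(%l. (2 * C / br n ^ K) * (1 / br l ^ 2)) summable_on UNIV" for n
  by (intro summable_on_cmult_right summable_br)
 show thesis
 proof (rule that[of "2 * C * (ISUM l. 1 / br l ^ 2)"])
  show "0 <= 2 * C * (ISUM l. 1 / br l ^ 2)" using C by (intro mult_nonneg_nonneg infsum_nonneg) auto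
  fix n k
  have as: "(%l. cmod (of_int (\<bar>l\<bar> - sgn n * l) * cnj (c n l) * c k l)) summable_on UNIV"
   by (rule abs_summable_dominated[OF s2 b])
  have "cmod (r n k) <= (ISUM l. cmod (of_int (\<bar>l\<bar> - sgn n * l) * cnj (c n l) * c k l))"
   unfolding r_def by (rule norm_infsum_bound[OF as])
  also have "... <= (ISUM l. (2 * C / br n ^ K) * (1 / br l ^ 2))"
   by (intro infsum_mono as s2 b)
  also have "... = (2 * C / br n ^ K) * (ISUM l. 1 / br l ^ 2)"
   by (intro infsum_cmult_right summable_br)
  finally show "br n ^ K * cmod (r n k) <= 2 * C * (ISUM l. 1 / br l ^ 2)"
   by (simp add: field_simps)
 qed
qed

text \<open>\<open>r_decay1\<close> bounds the row index; hermitian symmetry transfers the bound to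
  the column index and the geometric mean combines the two.\<close>

lemma r_decay: obtains C where "C >= 0" "!!n k. br n ^ K * br k ^ K * cmod (r n k) <= C"
proof -
 obtain C where C: "C >= 0" "!!n k. br n ^ (2*K) * cmod (r n k) <= C" using r_decay1[where K="2*K"] by blast
 have "br k ^ (2*K) * cmod (r n k) <= C" for n k
  using C(2)[of k n] r_cnj[of n k] by (metis complex_mod_cnj)
 thus thesis
  using C two_sided_decay[of "br n" "br k" "cmod (r n k)" K C C for n k]
  by (intro that[of "sqrt (C * C)"]) (auto simp: less_imp_le)
qed

end

section \<open>Eigenvalues by successive minimisation of the Rayleigh quotient\<close>

section \<open>The spectral theorem for forms with compact sublevel sets\<close>

text \<open>V is a set, not a type, so linear combinations enter through \<open>cmb v z w\<close>,
  which stands for v + z w. The infinite orthonormal family \<open>e\<close> ensures that no finite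
  system exhausts V. \<open>compact\<close> says that bounded energy gives a weak limit of full norm
  with lower semicontinuous energy.\<close>

locale spectral_form =
 fixes V :: "'v set" and z0 :: 'v and cmb :: "'v => complex => 'v => 'v"
  and G B :: "'v => 'v => complex" and e :: "nat => 'v" and \<kappa> :: real
 assumes z0: "z0 \<in> V" "!!v. v \<in> V ==> G z0 v = 0" "!!v. v \<in> V ==> B z0 v = 0"
  and cmb_V: "!!v z w. v \<in> V ==> w \<in> V ==> cmb v z w \<in> V"
  and G_cmb: "!!v z w u. v \<in> V ==> w \<in> V ==> u \<in> V ==> G (cmb v z w) u = G v u + z * G w u"
  and B_cmb: "!!v z w u. v \<in> V ==> w \<in> V ==> u \<in> V ==> B (cmb v z w) u = B v u + z * B w u"
  and G_cnj: "!!v u. v \<in> V ==> u \<in> V ==> G v u = cnj (G u v)"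
  and B_cnj: "!!v u. v \<in> V ==> u \<in> V ==> B v u = cnj (B u v)"
  and G_pos: "!!v. v \<in> V ==> Re (G v v) >= 0"
  and lower: "!!v. v \<in> V ==> Re (B v v) >= - \<kappa> * Re (G v v)"
  and e: "!!n. e n \<in> V" "!!m n. G (e m) (e n) = (if m = n then 1 else 0)"
  and compact: "!!v C c. (!!i::nat. v i \<in> V) ==> (!!i. Re (G (v i) (v i)) = 1) ==> (!!i. Re (B (v i) (v i)) <= C i) ==>
   C \<longlonglongrightarrow> c ==> \<exists>s u. strict_mono s \<and> u \<in> V \<and> Re (G u u) = 1 \<and> Re (B u u) <= c \<and>
     (\<forall>w\<in>V. (%i. G (v (s i)) w) \<longlonglongrightarrow> G u w)"
begin

lemma G_cmb2: "v \<in> V ==> w \<in> V ==> u \<in> V ==> G u (cmb v z w) = G u v + cnj z * G u w"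
 using G_cmb[of v w u z] G_cnj[of u] cmb_V[of v w z] by (metis complex_cnj_add complex_cnj_mult)

lemma B_cmb2: "v \<in> V ==> w \<in> V ==> u \<in> V ==> B u (cmb v z w) = B u v + cnj z * B u w"
 using B_cmb[of v w u z] B_cnj[of u] cmb_V[of v w z] by (metis complex_cnj_add complex_cnj_mult)

lemma G_real: "v \<in> V ==> G v v = of_real (Re (G v v))"
 using G_cnj[of v v] by (metis Reals_cnj_iff of_real_Re)

lemma B_real: "v \<in> V ==> B v v = of_real (Re (B v v))"
 using B_cnj[of v v] by (metis Reals_cnj_iff of_real_Re)

definition orthon :: "(nat => 'v) => nat => bool" where
 "orthon \<psi> j \<longleftrightarrow> (\<forall>i<j. \<psi> i \<in> V) \<and> (\<forall>i<j. \<forall>k<j. G (\<psi> i) (\<psi> k) = (if i = k then 1 else 0))"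

text \<open>Projection onto the orthogonal complement of the first j vectors. The coefficients are
  taken from \<open>f\<close> itself, which is the same for an orthonormal system and keeps
  \<open>pr_G\<close> a plain sum.\<close>

primrec pr :: "(nat => 'v) => 'v => nat => 'v" where
 "pr \<psi> f 0 = f"
| "pr \<psi> f (Suc j) = cmb (pr \<psi> f j) (- G f (\<psi> j)) (\<psi> j)"

lemma orthon_Suc: "orthon \<psi> (Suc j) ==> orthon \<psi> j" by (auto simp: orthon_def)

lemma pr_V: "orthon \<psi> j ==> f \<in> V ==> pr \<psi> f j \<in> V"
proof (induction j)
 case (Suc j)
 thus ?case using orthon_Suc by (auto simp: orthon_def intro!: cmb_V)
qed simp

lemma pr_G: "orthon \<psi> j ==> f \<in> V ==> u \<in> V ==> G (pr \<psi> f j) u = G f u - (\<Sum>i<j. G f (\<psi> i) * G (\<psi> i) u)"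
proof (induction j)
 case (Suc j)
 thus ?case using orthon_Suc[of \<psi> j] pr_V[of \<psi> j f] by (subst pr.simps, subst G_cmb) (auto simp: orthon_def)
qed simp

lemma pr_B: "orthon \<psi> j ==> f \<in> V ==> u \<in> V ==> B (pr \<psi> f j) u = B f u - (\<Sum>i<j. G f (\<psi> i) * B (\<psi> i) u)"
proof (induction j)
 case (Suc j)
 thus ?case using orthon_Suc[of \<psi> j] pr_V[of \<psi> j f] by (subst pr.simps, subst B_cmb) (auto simp: orthon_def)
qed simp

lemma pr_orth:
 assumes o: "orthon \<psi> j" and f: "f \<in> V" and i: "i < j"
 shows "G (pr \<psi> f j) (\<psi> i) = 0"
proof -
 have "(\<Sum>k<j. G f (\<psi> k) * G (\<psi> k) (\<psi> i)) = (\<Sum>k<j. if k = i then G f (\<psi> i) else 0)"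
  using o i by (intro sum.cong) (auto simp: orthon_def)
 thus ?thesis using o i f by (subst pr_G) (auto simp: orthon_def)
qed

lemma pr_norm:
 assumes o: "orthon \<psi> j" and f: "f \<in> V"
 shows "Re (G (pr \<psi> f j) (pr \<psi> f j)) = Re (G f f) - (\<Sum>i<j. (cmod (G f (\<psi> i)))\<^sup>2)"
proof -
 have pV: "pr \<psi> f j \<in> V" by (rule pr_V[OF o f])
 have psi: "\<psi> i \<in> V" if "i < j" for i using o that by (auto simp: orthon_def)
 have "G (pr \<psi> f j) (pr \<psi> f j) = G f (pr \<psi> f j)"
  using pr_orth[OF o f] psi G_cnj[of "\<psi> i" "pr \<psi> f j" for i] pV by (subst pr_G[OF o f pV]) simp
 also have "... = cnj (G (pr \<psi> f j) f)" by (rule G_cnj[OF f pV])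
 also have "G (pr \<psi> f j) f = G f f - (\<Sum>i<j. of_real ((cmod (G f (\<psi> i)))\<^sup>2))"
  using psi G_cnj[OF _ f] by (subst pr_G[OF o f f]) (simp flip: complex_norm_square)
 finally show ?thesis by simp
qed

lemma bessel_G: "orthon \<psi> j ==> f \<in> V ==> (\<Sum>i<j. (cmod (G f (\<psi> i)))\<^sup>2) <= Re (G f f)"
 using pr_norm[of \<psi> j f] G_pos[OF pr_V[of \<psi> j f]] by simp

definition minimal :: "(nat => 'v) => nat => 'v => bool" where
 "minimal \<psi> j r \<longleftrightarrow> r \<in> V \<and> G r r = 1 \<and> (\<forall>i<j. G r (\<psi> i) = 0) \<and>
  (\<forall>u\<in>V. (\<forall>i<j. G u (\<psi> i) = 0) \<longrightarrow> Re (B u u) >= Re (B r r) * Re (G u u))"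

lemma normalise:
 assumes u: "u \<in> V" and g: "Re (G u u) > 0"
 obtains y where "y \<in> V" "Re (G y y) = 1" "Re (B y y) = Re (B u u) / Re (G u u)" "!!w. w \<in> V ==> G u w = 0 ==> G y w = 0"
proof -
 define z where "z = complex_of_real (1 / sqrt (Re (G u u)))"
 define y where "y = cmb z0 z u"
 have zz: "z * cnj z = of_real (1 / Re (G u u))"
  using g by (simp add: z_def flip: of_real_mult)
 have yV: "y \<in> V" unfolding y_def by (intro cmb_V z0 u)
 have Gy: "G y w = z * G u w" if "w \<in> V" for w using that u z0 by (simp add: y_def G_cmb)
 have By: "B y w = z * B u w" if "w \<in> V" for w using that u z0 by (simp add: y_def B_cmb)
 have "G y y = z * (cnj z * G u u)" using Gy[OF yV] Gy[OF u] G_cnj[OF u yV] G_cnj[OF u u] by simp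
 hence G: "G y y = of_real (1 / Re (G u u)) * of_real (Re (G u u))" using zz G_real[OF u] by (simp flip: mult.assoc)
 have "B y y = z * (cnj z * B u u)" using By[OF yV] By[OF u] B_cnj[OF u yV] B_cnj[OF u u] by simp
 hence B: "B y y = of_real (1 / Re (G u u)) * of_real (Re (B u u))" using zz B_real[OF u] by (simp flip: mult.assoc)
 show thesis using that[OF yV] G B g Gy by simp
qed

text \<open>Counting with Bessel: if the projections of j+1 vectors of \<open>e\<close> all had norm
  zero, then j+1 would equal a double sum that Bessel bounds by j.\<close>

lemma exists_orth:
 assumes o: "orthon \<psi> j"
 obtains u where "u \<in> V" "Re (G u u) > 0" "!!i. i < j ==> G u (\<psi> i) = 0"
proof -
 have psi: "\<psi> i \<in> V" if "i < j" for i using o that by (auto simp: orthon_def)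
 have "\<exists>n. Re (G (pr \<psi> (e n) j) (pr \<psi> (e n) j)) > 0"
 proof (rule ccontr)
  assume "\<not> ?thesis"
  hence "Re (G (pr \<psi> (e n) j) (pr \<psi> (e n) j)) = 0" for n
   using G_pos[OF pr_V[OF o e(1)]] by (meson order_antisym_conv not_le)
  hence 1: "(\<Sum>i<j. (cmod (G (e n) (\<psi> i)))\<^sup>2) = 1" for n
   using pr_norm[OF o e(1), of n] e(2)[of n n] by simp
  have oe: "orthon e (Suc j)" using e by (simp add: orthon_def)
  have "real (Suc j) = (\<Sum>n<Suc j. \<Sum>i<j. (cmod (G (e n) (\<psi> i)))\<^sup>2)" by (simp add: 1)
  also have "... = (\<Sum>i<j. \<Sum>n<Suc j. (cmod (G (\<psi> i) (e n)))\<^sup>2)"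
  proof (subst sum.swap, intro sum.cong refl)
   fix i n assume "i \<in> {..<j}"
   thus "(cmod (G (e n) (\<psi> i)))\<^sup>2 = (cmod (G (\<psi> i) (e n)))\<^sup>2"
    using G_cnj[OF e(1) psi, of i n] by simp
  qed
  also have "... <= (\<Sum>i<j. Re (G (\<psi> i) (\<psi> i)))"
   by (intro sum_mono bessel_G[OF oe] psi) auto
  also have "... = real j" using o by (simp add: orthon_def)
  finally show False by simp
 qed
 then obtain n where "Re (G (pr \<psi> (e n) j) (pr \<psi> (e n) j)) > 0" by blast
 thus thesis using that pr_V[OF o e(1)] pr_orth[OF o e(1)] by blast
qed

text \<open>Direct method: a minimising sequence of unit vectors in the complement, within 1/(k+1)
  of the infimum, has a weak limit by \<open>compact\<close>; the orthogonality conditions pass to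
  it.\<close>

lemma minimal_exists:
 assumes o: "orthon \<psi> j"
 shows "\<exists>r. minimal \<psi> j r"
proof -
 have psi: "\<psi> i \<in> V" if "i < j" for i using o that by (auto simp: orthon_def)
 define S where "S = {Re (B u u) | u. u \<in> V \<and> (\<forall>i<j. G u (\<psi> i) = 0) \<and> Re (G u u) = 1}"
 obtain u where u: "u \<in> V" "Re (G u u) > 0" "!!i. i < j ==> G u (\<psi> i) = 0" by (rule exists_orth[OF o]) blast
 obtain y where "y \<in> V" "Re (G y y) = 1" "!!w. w \<in> V ==> G u w = 0 ==> G y w = 0" by (rule normalise[OF u(1,2)]) blast
 hence ne: "S \<noteq> {}" using u psi by (auto simp: S_def)
 have bdd: "bdd_below S" using lower by (intro bdd_belowI[of _ "-\<kappa>"]) (fastforce simp: S_def)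
 define m where "m = Inf S"
 have "\<exists>v. v \<in> V \<and> (\<forall>i<j. G v (\<psi> i) = 0) \<and> Re (G v v) = 1 \<and> Re (B v v) <= m + 1 / real (Suc k)" for k
 proof -
  have "Inf S < m + 1 / real (Suc k)" by (simp add: m_def)
  then obtain x where "x \<in> S" "x < m + 1 / real (Suc k)" using cInf_lessD[OF ne] by blast
  thus ?thesis by (force simp: S_def)
 qed
 then obtain v where v: "!!k::nat. v k \<in> V" "!!k i. i < j ==> G (v k) (\<psi> i) = 0" "!!k. Re (G (v k) (v k)) = 1"
  "!!k. Re (B (v k) (v k)) <= m + 1 / real (Suc k)" by metis
 have "(%k. m + 1 / real (Suc k)) \<longlonglongrightarrow> m + 0"
  using LIMSEQ_inverse_real_of_nat by (intro tendsto_intros) (simp add: inverse_eq_divide)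
hence "(%k. m + 1 / real (Suc k)) \<longlonglongrightarrow> m" by simp
 from compact[of v, OF v(1) v(3) v(4) this]
 obtain s r where r: "r \<in> V" "Re (G r r) = 1" "Re (B r r) <= m" "!!w. w \<in> V ==> (%i. G (v (s i)) w) \<longlonglongrightarrow> G r w"
  by blast
 have ro: "G r (\<psi> i) = 0" if "i < j" for i
  using r(4)[OF psi[OF that]] v(2)[OF that] by (simp add: LIMSEQ_const_iff)
 have "Re (B u u) >= Re (B r r) * Re (G u u)" if u: "u \<in> V" "!!i. i < j ==> G u (\<psi> i) = 0" for u
 proof (cases "Re (G u u) > 0")
  case True
  obtain y where y: "y \<in> V" "Re (G y y) = 1" "Re (B y y) = Re (B u u) / Re (G u u)" "!!w. w \<in> V ==> G u w = 0 ==> G y w = 0"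
   by (rule normalise[OF u(1) True]) blast
  hence "Re (B y y) \<in> S" unfolding S_def using u psi by blast
  hence "m <= Re (B u u) / Re (G u u)" unfolding m_def y(3)[symmetric] using bdd by (rule cInf_lower)
  hence "m * Re (G u u) <= Re (B u u)" using True by (simp add: field_simps)
  moreover have "Re (B r r) * Re (G u u) <= m * Re (G u u)" using r(3) True by (intro mult_right_mono) auto
  ultimately show ?thesis by linarith
 next
  case False
  hence "Re (G u u) = 0" using G_pos[OF u(1)] by simp
  thus ?thesis using lower[OF u(1)] by simp
 qed
 hence "minimal \<psi> j r" using r ro G_real[OF r(1)] by (auto simp: minimal_def)
 thus ?thesis by blast
qed

text \<open>First variation of the quotient at r in directions u orthogonal to the earlier vectors.
  A general v is first projected; the earlier eigenvectors contribute nothing because both forms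
  vanish between them and r.\<close>

lemma minimal_eigen:
 assumes o: "orthon \<psi> j" and r: "minimal \<psi> j r"
  and ev: "!!i v. i < j ==> v \<in> V ==> B v (\<psi> i) = of_real (lam i) * G v (\<psi> i)" and v: "v \<in> V"
 shows "B v r = of_real (Re (B r r)) * G v r"
proof -
 have psi: "\<psi> i \<in> V" if "i < j" for i using o that by (auto simp: orthon_def)
 have rV: "r \<in> V" and Gr: "G r r = 1" and ro: "!!i. i < j ==> G r (\<psi> i) = 0" using r by (auto simp: minimal_def)
 define l where "l = Re (B r r)"
 have W: "B u r = of_real l * G u r" if u: "u \<in> V" "!!i. i < j ==> G u (\<psi> i) = 0" for u
 proof -
  define d where "d = B u r - of_real l * G u r"
  define q where "q = Re (B u u) - l * Re (G u u)"
  have q: "q >= 0" using r u unfolding minimal_def q_def l_def by auto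
  \<comment> \<open>With q the second variation, this step makes the linear term -2|d|^2/(q+1)
    outweigh the quadratic term |d|^2 q/(q+1)^2 unless d = 0; the added 1 covers q = 0.\<close>
  define z where "z = - of_real (1 / (q + 1)) * cnj d"
  define x where "x = cmb r z u"
  have xV: "x \<in> V" unfolding x_def by (intro cmb_V rV u)
  have "\<forall>i<j. G x (\<psi> i) = 0" using u ro psi rV by (simp add: x_def G_cmb)
  hence "Re (B x x) >= l * Re (G x x)" using r xV by (auto simp: minimal_def l_def)
  moreover have "B x x = B r r + z * B u r + cnj z * (cnj (B u r) + z * B u u)"
   using xV u rV B_cnj[OF rV u(1)] by (simp add: x_def B_cmb B_cmb2 cmb_V algebra_simps)
  hence "Re (B x x) = l + 2 * Re (z * B u r) + (cmod z)\<^sup>2 * Re (B u u)"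
   using B_real[OF u(1)] by (simp add: l_def cmod_power2, simp add: power2_eq_square algebra_simps)
  moreover have "G x x = 1 + z * G u r + cnj z * (cnj (G u r) + z * G u u)"
   using xV u rV G_cnj[OF rV u(1)] Gr by (simp add: x_def G_cmb G_cmb2 cmb_V algebra_simps)
  hence "Re (G x x) = 1 + 2 * Re (z * G u r) + (cmod z)\<^sup>2 * Re (G u u)"
   using G_real[OF u(1)] by (simp add: cmod_power2, simp add: power2_eq_square algebra_simps)
  ultimately have "0 <= 2 * Re (z * d) + (cmod z)\<^sup>2 * q"
   by (simp add: d_def q_def algebra_simps)
  also have "Re (z * d) = - ((cmod d)\<^sup>2 / (q + 1))"
   unfolding z_def using q by (simp add: cmod_power2, simp add: power2_eq_square add_divide_distrib)
  also have "(cmod z)\<^sup>2 = (cmod d)\<^sup>2 / (q + 1)\<^sup>2"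
   unfolding z_def using q by (simp add: norm_mult power_mult_distrib power_divide norm_divide)
  finally have "0 <= 2 * - ((cmod d)\<^sup>2 / (q + 1)) + (cmod d)\<^sup>2 / (q + 1)\<^sup>2 * q" .
  hence "0 <= ((cmod d)\<^sup>2 / (q + 1)) * (q / (q + 1) - 2)"
  proof -
   define y where "y = (cmod d)\<^sup>2 / (q + 1)"
   have "(cmod d)\<^sup>2 / (q + 1)\<^sup>2 * q = ((cmod d)\<^sup>2 / (q + 1)) * (q / (q + 1))" by (simp add: power2_eq_square)
   thus ?thesis unfolding y_def[symmetric] using \<open>0 <= 2 * - ((cmod d)\<^sup>2 / (q + 1)) + (cmod d)\<^sup>2 / (q + 1)\<^sup>2 * q\<close>
    unfolding y_def[symmetric] by (simp add: right_diff_distrib)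
  qed
  moreover have "q / (q + 1) - 2 < 0" using q by (simp add: field_simps)
  ultimately have "(cmod d)\<^sup>2 / (q + 1) <= 0" by (meson linorder_not_le mult_pos_neg)
  hence "(cmod d)\<^sup>2 <= 0" using q by (simp add: field_simps)
  thus ?thesis by (simp add: d_def)
 qed
 have 1: "B (\<psi> i) r = 0" "G (\<psi> i) r = 0" if "i < j" for i
  using B_cnj[OF psi[OF that] rV] G_cnj[OF psi[OF that] rV] ev[OF that rV] ro[OF that] by auto
 have "B (pr \<psi> v j) r = of_real l * G (pr \<psi> v j) r" using W pr_V[OF o v] pr_orth[OF o v] by blast
 thus ?thesis using pr_B[OF o v rV] pr_G[OF o v rV] 1 by (simp add: l_def)
qed

text \<open>Minimisers are chosen recursively. Divergence of \<open>lam\<close> comes from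
  compactness, and divergence in turn forces completeness, since the remainder of f after j
  projections has norm square at most K / lam j.\<close>

theorem spectral:
 "\<exists>\<psi> lam. (\<forall>j. \<psi> j \<in> V) \<and> (\<forall>i j. G (\<psi> i) (\<psi> j) = (if i = j then 1 else 0)) \<and>
  (\<forall>j. \<forall>v\<in>V. B v (\<psi> j) = of_real (lam j) * G v (\<psi> j)) \<and> filterlim lam at_top sequentially \<and>
  (\<forall>f\<in>V. (%j. (cmod (G f (\<psi> j)))\<^sup>2) sums Re (G f f))"
proof -
 have ext: "orthon \<psi> j" if "!!i. i < j ==> minimal \<psi> i (\<psi> i)" for \<psi> :: "nat => 'v" and j
 proof -
  have V: "\<psi> i \<in> V" if "i < j" for i using \<open>!!i. i < j ==> minimal \<psi> i (\<psi> i)\<close>[OF that] by (simp add: minimal_def)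
  have "G (\<psi> i) (\<psi> k) = 0" if "k < i" "i < j" for i k using \<open>!!i. i < j ==> minimal \<psi> i (\<psi> i)\<close>[OF that(2)] that by (simp add: minimal_def)
  moreover have "G (\<psi> i) (\<psi> i) = 1" if "i < j" for i using \<open>!!i. i < j ==> minimal \<psi> i (\<psi> i)\<close>[OF that] by (simp add: minimal_def)
  ultimately show ?thesis unfolding orthon_def using V G_cnj
   by (metis complex_cnj_zero linorder_neqE_nat order.strict_trans)
 qed
 have "\<exists>\<psi>. \<forall>j. minimal \<psi> j (\<psi> j)"
 proof (rule dependent_wellorder_choice)
  show "minimal f x r = minimal g x r" if "!!y. y < x ==> f y = g y" for r f g x
   using that by (auto simp: minimal_def)
  show "\<exists>r. minimal f x r" if "!!y. y < x ==> minimal f y (f y)" for x f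
   using minimal_exists[OF ext[OF that]] by blast
 qed
 then obtain \<psi> where m: "!!j. minimal \<psi> j (\<psi> j)" by blast
 have o: "orthon \<psi> j" for j using ext m by blast
 have psi: "\<psi> i \<in> V" for i using m by (auto simp: minimal_def)
 have ON: "G (\<psi> i) (\<psi> j) = (if i = j then 1 else 0)" for i j
  using o[of "Suc (max i j)"] by (simp add: orthon_def less_Suc_eq_le)
 define lam where "lam j = Re (B (\<psi> j) (\<psi> j))" for j
 have ev: "B v (\<psi> j) = of_real (lam j) * G v (\<psi> j)" if "v \<in> V" for v j
  using that
 proof (induction j arbitrary: v rule: less_induct)
  case (less j)
  thus ?case using minimal_eigen[OF o m, of j lam v] by (simp add: lam_def)
 qed
 have mono: "lam j <= lam k" if "j <= k" for j k
 proof -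
  have "\<forall>i<j. G (\<psi> k) (\<psi> i) = 0" using that by (auto simp: ON)
  hence "Re (B (\<psi> k) (\<psi> k)) >= Re (B (\<psi> j) (\<psi> j)) * Re (G (\<psi> k) (\<psi> k))"
   using m[of j] psi[of k] unfolding minimal_def by blast
  thus ?thesis by (simp add: ON lam_def)
 qed
 \<comment> \<open>If \<open>lam\<close> were bounded, a subsequence of the \<psi> would have a weak
   limit of norm one that is orthogonal to every \<psi>, hence to itself.\<close>
 have unb: "\<exists>j. lam j > C" for C
 proof (rule ccontr)
  assume "\<not> ?thesis"
  hence le: "Re (B (\<psi> j) (\<psi> j)) <= C" for j by (simp add: lam_def not_less)
  have "Re (G (\<psi> i) (\<psi> i)) = 1" for i by (simp add: ON)
  from compact[of \<psi>, OF psi this le tendsto_const]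
  obtain s u where u: "u \<in> V" "Re (G u u) = 1" "!!w. w \<in> V ==> (%i. G (\<psi> (s i)) w) \<longlonglongrightarrow> G u w" "strict_mono s"
   by blast
  have "G u (\<psi> k) = 0" for k
  proof -
   have "eventually (%i. G (\<psi> (s i)) (\<psi> k) = 0) sequentially"
    unfolding eventually_sequentially
   proof (intro exI[of _ "Suc k"] allI impI)
    fix n assume "Suc k <= n"
    hence "s n \<noteq> k" using strict_mono_imp_increasing[OF u(4), of n] by linarith
    thus "G (\<psi> (s n)) (\<psi> k) = 0" by (simp add: ON)
   qed
   hence "(%i. G (\<psi> (s i)) (\<psi> k)) \<longlonglongrightarrow> 0" by (rule tendsto_eventually)
   thus ?thesis using u(3)[OF psi[of k]] LIMSEQ_unique by blast
  qed
  hence "G (\<psi> (s i)) u = 0" for i using G_cnj[OF psi u(1)] by simp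
  hence "G u u = 0" using u(3)[OF u(1)] by (simp add: LIMSEQ_const_iff)
  thus False using u(2) by simp
 qed
 have top: "filterlim lam at_top sequentially"
  unfolding filterlim_at_top eventually_sequentially
 proof
  fix Z
  obtain j where "lam j > Z" using unb by blast
  thus "\<exists>N. \<forall>n\<ge>N. Z <= lam n" using mono by (intro exI[of _ j]) (meson less_le_trans order.strict_implies_order)
 qed
 have pars: "(%j. (cmod (G f (\<psi> j)))\<^sup>2) sums Re (G f f)" if f: "f \<in> V" for f
 proof -
  \<comment> \<open>A bound for the energy of every remainder: removing components changes the
    energy of f by the sum of lam i |G f (\<psi> i)|^2, and each lam i is at least
    -|\<kappa>|.\<close>
  define K where "K = \<bar>Re (B f f)\<bar> + \<bar>\<kappa>\<bar> * Re (G f f)"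
  have K: "lam j * (Re (G f f) - (\<Sum>i<j. (cmod (G f (\<psi> i)))\<^sup>2)) <= K" for j
  proof -
   let ?p = "pr \<psi> f j"
   have pV: "?p \<in> V" by (rule pr_V[OF o f])
   have Bp: "B (\<psi> i) ?p = 0" if "i < j" for i
    using B_cnj[OF psi pV] ev[OF pV] pr_orth[OF o f that] by simp
   have "B ?p ?p = B f ?p" using pr_B[OF o f pV] Bp by simp
   also have "... = cnj (B ?p f)" by (rule B_cnj[OF f pV])
   also have "B ?p f = B f f - (\<Sum>i<j. of_real (lam i * (cmod (G f (\<psi> i)))\<^sup>2))"
   proof -
    have "G f (\<psi> i) * B (\<psi> i) f = of_real (lam i * (cmod (G f (\<psi> i)))\<^sup>2)" for i
     using B_cnj[OF psi f, of i] ev[OF f, of i] by (simp flip: complex_norm_square)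
    thus ?thesis using pr_B[OF o f f, of j] by simp
   qed
   finally have "Re (B ?p ?p) = Re (B f f) - (\<Sum>i<j. lam i * (cmod (G f (\<psi> i)))\<^sup>2)" by simp
   moreover have "(\<Sum>i<j. lam i * (cmod (G f (\<psi> i)))\<^sup>2) >= (\<Sum>i<j. (- \<bar>\<kappa>\<bar>) * (cmod (G f (\<psi> i)))\<^sup>2)"
   proof (intro sum_mono mult_right_mono)
    fix i show "- \<bar>\<kappa>\<bar> <= lam i" using lower[OF psi[of i]] by (simp add: ON lam_def)
   qed auto
   moreover have "(\<Sum>i<j. (- \<bar>\<kappa>\<bar>) * (cmod (G f (\<psi> i)))\<^sup>2) = - (\<bar>\<kappa>\<bar> * (\<Sum>i<j. (cmod (G f (\<psi> i)))\<^sup>2))"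
    by (simp add: sum_distrib_left sum_negf)
   moreover have "\<bar>\<kappa>\<bar> * (\<Sum>i<j. (cmod (G f (\<psi> i)))\<^sup>2) <= \<bar>\<kappa>\<bar> * Re (G f f)"
    by (intro mult_left_mono bessel_G[OF o f]) auto
   moreover have "Re (B ?p ?p) >= lam j * Re (G ?p ?p)"
    using m[of j] pV pr_orth[OF o f] by (simp add: minimal_def lam_def)
   ultimately show ?thesis unfolding K_def pr_norm[OF o f] by linarith
  qed
  have "(%j. Re (G f f) - (\<Sum>i<j. (cmod (G f (\<psi> i)))\<^sup>2)) \<longlonglongrightarrow> 0"
  proof (rule tendsto_sandwich)
   show "eventually (%j. 0 <= Re (G f f) - (\<Sum>i<j. (cmod (G f (\<psi> i)))\<^sup>2)) sequentially"
    using bessel_G[OF o f] by simp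
   have "eventually (%j. lam j > 0) sequentially" using top by (simp add: filterlim_at_top_dense)
   thus "eventually (%j. Re (G f f) - (\<Sum>i<j. (cmod (G f (\<psi> i)))\<^sup>2) <= K / lam j) sequentially"
    by eventually_elim (use K in \<open>simp add: field_simps\<close>)
   show "(%j. K / lam j) \<longlonglongrightarrow> 0" using top by (intro tendsto_divide_0[OF tendsto_const] filterlim_at_top_imp_at_infinity)
  qed simp
  hence "(%j. Re (G f f) - (Re (G f f) - (\<Sum>i<j. (cmod (G f (\<psi> i)))\<^sup>2))) \<longlonglongrightarrow> Re (G f f) - 0"
   by (intro tendsto_intros)
  thus ?thesis by (simp add: sums_def)
 qed
 show ?thesis using psi ON ev top pars by blast
qed

end

section \<open>Hermitian smoothing perturbations of the diagonal operator |n|\<close>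

lemma summable_br2: "(%(n,k). 1 / (br n ^ 2 * br k ^ 2)) summable_on UNIV"
proof -
 have "(%(n,k). 1 / (br n ^ 2 * br k ^ 2)) summable_on (Sigma UNIV (%_. UNIV))"
 proof (rule summable_on_SigmaI[where g="%n. 1 / br n ^ 2 * (ISUM k. 1 / br k ^ 2)"])
  fix n
  have "((%k. 1 / br n ^ 2 * (1 / br k ^ 2)) has_sum 1 / br n ^ 2 * (ISUM k. 1 / br k ^ 2)) UNIV"
   by (intro has_sum_cmult_right has_sum_infsum summable_br)
  thus "((%k. case (n, k) of (n, k) => 1 / (br n ^ 2 * br k ^ 2)) has_sum 1 / br n ^ 2 * (ISUM k. 1 / br k ^ 2)) UNIV" by simp
 next
  show "(%n. 1 / br n ^ 2 * (ISUM k. 1 / br k ^ 2)) summable_on UNIV"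
   by (intro summable_on_cmult_left summable_br)
 qed auto
 thus ?thesis by simp
qed

lemma infsum_single: "(!!k. k \<noteq> n ==> f k = 0) ==> infsum f UNIV = f n"
 using infsum_cong_neutral[of UNIV "{n}" f f] by simp

lemma two_mult_le: "2 * (x * y) <= x\<^sup>2 + (y::real)\<^sup>2"
 using sum_squares_bound[of x y] by (simp add: mult.assoc)

locale smoothing_matrix =
 fixes r :: "int => int => complex"
 assumes r_herm: "!!n k. cnj (r n k) = r k n"
  and r_rapid: "!!K. \<exists>C\<ge>0. \<forall>n k. br n ^ K * br k ^ K * cmod (r n k) <= C"
begin

text \<open>The form domain, a sequence model of the Sobolev space of order 1/2: on it the form of
  |n| is finite.\<close>

definition VV :: "(int => complex) set" where "VV = {v. (%n. br n * (cmod (v n))\<^sup>2) summable_on UNIV}"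
definition GG :: "(int => complex) => (int => complex) => complex" where "GG v w = (ISUM n. v n * cnj (w n))"
definition LL :: "(int => complex) => (int => complex) => complex" where "LL v w = (ISUM n. of_int \<bar>n\<bar> * (v n * cnj (w n)))"
definition RR :: "(int => complex) => (int => complex) => complex" where "RR v w = (\<Sum>\<^sub>\<infinity>(n,k). r n k * v k * cnj (w n))"

lemma r_summable: "(%(n,k). cmod (r n k)) summable_on UNIV"
proof -
 obtain C where C: "C >= 0" "!!n k. br n ^ 2 * br k ^ 2 * cmod (r n k) <= C" using r_rapid[of 2] by blast
 have "(%p. C * (case p of (n,k) => 1 / (br n ^ 2 * br k ^ 2))) summable_on UNIV"
  by (intro summable_on_cmult_right summable_br2)
 thus ?thesis
 proof (rule summable_on_comparison_test)
  fix p show "(case p of (n,k) => cmod (r n k)) <= C * (case p of (n,k) => 1 / (br n ^ 2 * br k ^ 2))"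
   using C(2)[of "fst p" "snd p"] by (auto simp: case_prod_beta field_simps)
 qed auto
qed

definition kap :: real where "kap = (\<Sum>\<^sub>\<infinity>(n,k). cmod (r n k))"

lemma VV_prod: assumes "v \<in> VV" "w \<in> VV" shows "(%n. br n * (cmod (v n) * cmod (w n))) summable_on UNIV"
proof -
 have "(%n. br n * (cmod (v n))\<^sup>2 + br n * (cmod (w n))\<^sup>2) summable_on UNIV"
  using assms unfolding VV_def by (intro summable_on_add) auto
 thus ?thesis
 proof (rule summable_on_comparison_test)
  fix n
  have "cmod (v n) * cmod (w n) <= (cmod (v n))\<^sup>2 + (cmod (w n))\<^sup>2"
   using two_mult_le[of "cmod (v n)" "cmod (w n)"] by (smt (verit) zero_le_power2 mult_nonneg_nonneg norm_ge_zero)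
  thus "br n * (cmod (v n) * cmod (w n)) <= br n * (cmod (v n))\<^sup>2 + br n * (cmod (w n))\<^sup>2"
   by (simp flip: distrib_left)
 qed (auto simp: less_imp_le)
qed

lemma GG_abs: assumes "v \<in> VV" "w \<in> VV" shows "(%n. cmod (v n * cnj (w n))) summable_on UNIV"
proof (rule summable_on_comparison_test[OF VV_prod[OF assms]])
 fix n show "cmod (v n * cnj (w n)) <= br n * (cmod (v n) * cmod (w n))"
  using mult_right_mono[OF br_ge1[of n], of "cmod (v n) * cmod (w n)"] by (simp add: norm_mult)
qed auto

lemma LL_abs: assumes "v \<in> VV" "w \<in> VV" shows "(%n. cmod (of_int \<bar>n\<bar> * (v n * cnj (w n)))) summable_on UNIV"
proof (rule summable_on_comparison_test[OF VV_prod[OF assms]])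
 fix n show "cmod (of_int \<bar>n\<bar> * (v n * cnj (w n))) <= br n * (cmod (v n) * cmod (w n))"
  unfolding norm_mult by (auto intro!: mult_right_mono simp: br_def)
qed auto

lemmas GG_sum = abs_summable_summable[OF GG_abs]
lemmas LL_sum = abs_summable_summable[OF LL_abs]

lemma VV_bound: assumes "v \<in> VV" obtains C where "C >= 0" "!!n. cmod (v n) <= C"
proof -
 define S where "S = (ISUM n. br n * (cmod (v n))\<^sup>2)"
 have "(cmod (v n))\<^sup>2 <= S" for n
 proof -
  have "(\<Sum>n\<in>{n}. br n * (cmod (v n))\<^sup>2) <= S"
   unfolding S_def using assms by (intro finite_sum_le_infsum) (auto simp: VV_def less_imp_le)
  moreover have "(cmod (v n))\<^sup>2 <= br n * (cmod (v n))\<^sup>2" using br_ge1[of n] by (simp add: mult_le_cancel_right1)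
  ultimately show ?thesis by simp
 qed
 hence "cmod (v n) <= sqrt S" for n by (simp add: real_le_rsqrt)
 thus thesis using that by (metis norm_ge_zero order_trans)
qed

lemma RR_abs: assumes "v \<in> VV" "w \<in> VV" shows "(%p. cmod (case p of (n,k) => r n k * v k * cnj (w n))) summable_on UNIV"
proof -
 obtain C where C: "C >= 0" "!!n. cmod (v n) <= C" using VV_bound[OF assms(1)] by blast
 obtain D where D: "D >= 0" "!!n. cmod (w n) <= D" using VV_bound[OF assms(2)] by blast
 have "(%p. (case p of (n,k) => cmod (r n k)) * (C * D)) summable_on UNIV"
  by (intro summable_on_cmult_left r_summable)
 thus ?thesis
 proof (rule summable_on_comparison_test)
  fix p :: "int \<times> int"
  obtain n k where p: "p = (n,k)" by force
  have "cmod (v k) * cmod (w n) <= C * D" using C D by (intro mult_mono) auto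
  hence "cmod (r n k) * (cmod (v k) * cmod (w n)) <= cmod (r n k) * (C * D)" by (intro mult_left_mono) auto
  thus "cmod (case p of (n,k) => r n k * v k * cnj (w n)) <= (case p of (n,k) => cmod (r n k)) * (C * D)"
   by (simp add: p norm_mult mult.assoc)
 qed auto
qed

lemmas RR_sum = abs_summable_summable[OF RR_abs]

lemma VV_cmb: assumes "v \<in> VV" "w \<in> VV" shows "(%n. v n + z * w n) \<in> VV"
proof -
 have "(%n. 2 * (br n * (cmod (v n))\<^sup>2) + 2 * (cmod z)\<^sup>2 * (br n * (cmod (w n))\<^sup>2)) summable_on UNIV"
  using assms unfolding VV_def by (intro summable_on_add summable_on_cmult_right) auto
 hence "(%n. br n * (cmod (v n + z * w n))\<^sup>2) summable_on UNIV"
 proof (rule summable_on_comparison_test)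
  fix n
  have "(cmod (v n + z * w n))\<^sup>2 <= (cmod (v n) + cmod (z * w n))\<^sup>2"
   by (intro power_mono norm_triangle_ineq) auto
  also have "... <= 2 * (cmod (v n))\<^sup>2 + 2 * (cmod (z * w n))\<^sup>2"
   using two_mult_le[of "cmod (v n)" "cmod (z * w n)"] by (simp add: power2_sum)
  finally have "br n * (cmod (v n + z * w n))\<^sup>2 <= br n * (2 * (cmod (v n))\<^sup>2 + 2 * (cmod (z * w n))\<^sup>2)"
   by (intro mult_left_mono) (auto simp: less_imp_le)
  thus "br n * (cmod (v n + z * w n))\<^sup>2 <= 2 * (br n * (cmod (v n))\<^sup>2) + 2 * (cmod z)\<^sup>2 * (br n * (cmod (w n))\<^sup>2)"
   by (simp add: norm_mult power_mult_distrib algebra_simps)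
 qed (auto simp: less_imp_le)
 thus ?thesis by (simp add: VV_def)
qed

definition del :: "int => int => complex" where "del m n = (if n = m then 1 else 0)"

lemma finite_support_VV: assumes "finite F" "!!n. n \<notin> F ==> v n = 0" shows "v \<in> VV"
 unfolding VV_def mem_Collect_eq
 by (rule finite_nonzero_values_imp_summable_on, rule finite_subset[OF _ assms(1)]) (use assms in auto)

lemma del_VV: "del m \<in> VV" by (rule finite_support_VV[of "{m}"]) (auto simp: del_def)

lemma GG_cmb: assumes "v \<in> VV" "w \<in> VV" "u \<in> VV" shows "GG (%n. v n + z * w n) u = GG v u + z * GG w u"
 unfolding GG_def infsum_cmult_right'[symmetric]
 by (subst infsum_add[symmetric]) (auto intro!: GG_sum summable_on_cmult_right assms simp: algebra_simps)

lemma LL_cmb: assumes "v \<in> VV" "w \<in> VV" "u \<in> VV" shows "LL (%n. v n + z * w n) u = LL v u + z * LL w u"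
 unfolding LL_def infsum_cmult_right'[symmetric]
 by (subst infsum_add[OF LL_sum summable_on_cmult_right[OF LL_sum], symmetric]) (auto intro!: infsum_cong assms simp: algebra_simps)

lemma RR_cmb: assumes "v \<in> VV" "w \<in> VV" "u \<in> VV" shows "RR (%n. v n + z * w n) u = RR v u + z * RR w u"
 unfolding RR_def infsum_cmult_right'[symmetric]
 by (subst infsum_add[OF RR_sum summable_on_cmult_right[OF RR_sum], symmetric]) (auto intro!: infsum_cong assms simp: algebra_simps)

lemma GG_herm: "GG v u = cnj (GG u v)" unfolding GG_def infsum_cnj[symmetric] by (simp add: mult_ac)
lemma LL_herm: "LL v u = cnj (LL u v)" unfolding LL_def infsum_cnj[symmetric] by (simp add: mult_ac)

lemma RR_herm: "RR v u = cnj (RR u v)"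
proof -
 have "cnj (RR u v) = (\<Sum>\<^sub>\<infinity>(n,k). r k n * cnj (u k) * v n)"
  unfolding RR_def infsum_cnj[symmetric] by (intro infsum_cong) (auto simp: r_herm)
 also have "... = (\<Sum>\<^sub>\<infinity>(n,k). r n k * cnj (u n) * v k)"
  by (rule infsum_reindex_bij_witness[of _ prod.swap prod.swap]) auto
 finally show ?thesis unfolding RR_def by (simp add: mult_ac)
qed

lemma GG_norm: assumes "v \<in> VV" shows "((%n. (cmod (v n))\<^sup>2) has_sum Re (GG v v)) UNIV"
proof -
 have "((%n. Re (v n * cnj (v n))) has_sum Re (GG v v)) UNIV"
  unfolding GG_def by (intro has_sum_Re has_sum_infsum GG_sum assms)
 thus ?thesis by (simp add: complex_mult_cnj cmod_power2)
qed

lemma LL_norm: assumes "v \<in> VV" shows "((%n. of_int \<bar>n\<bar> * (cmod (v n))\<^sup>2) has_sum Re (LL v v)) UNIV"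
proof -
 have "((%n. Re (of_int \<bar>n\<bar> * (v n * cnj (v n)))) has_sum Re (LL v v)) UNIV"
  unfolding LL_def by (intro has_sum_Re has_sum_infsum LL_sum assms)
 thus ?thesis by (simp add: complex_mult_cnj cmod_power2)
qed

lemma coord_le_GG: assumes "v \<in> VV" shows "(cmod (v n))\<^sup>2 <= Re (GG v v)"
proof -
 have "(\<Sum>n\<in>{n}. (cmod (v n))\<^sup>2) <= Re (GG v v)"
  using GG_norm[OF assms] by (intro finite_sum_le_has_sum) auto
 thus ?thesis by simp
qed

lemma RR_le: assumes "v \<in> VV" shows "cmod (RR v v) <= kap * Re (GG v v)"
proof -
 have "cmod (RR v v) <= (ISUM p. cmod (case p of (n,k) => r n k * v k * cnj (v n)))"
  unfolding RR_def by (rule norm_infsum_bound[OF RR_abs[OF assms assms]])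
 also have "... <= (ISUM p. (case p of (n,k) => cmod (r n k)) * Re (GG v v))"
 proof (intro infsum_mono RR_abs assms summable_on_cmult_left r_summable)
  fix p :: "int \<times> int"
  obtain n k where p: "p = (n,k)" by force
  have "2 * (cmod (v k) * cmod (v n)) <= 2 * Re (GG v v)"
   using two_mult_le[of "cmod (v k)" "cmod (v n)"] coord_le_GG[OF assms, of n] coord_le_GG[OF assms, of k] by linarith
  hence "cmod (r n k) * (cmod (v k) * cmod (v n)) <= cmod (r n k) * Re (GG v v)" by (intro mult_left_mono) auto
  thus "cmod (case p of (n,k) => r n k * v k * cnj (v n)) <= (case p of (n,k) => cmod (r n k)) * Re (GG v v)"
   by (simp add: p norm_mult mult.assoc)
 qed
 also have "... = kap * Re (GG v v)" unfolding kap_def by (intro infsum_cmult_left r_summable)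
 finally show ?thesis .
qed

text \<open>Rellich compactness. A diagonal subsequence converges coordinatewise; the energy bound
  makes the tails uniformly small, so no norm is lost. The \<open>LL\<close> part is lower
  semicontinuous through finite sums and \<open>RR\<close> converges by domination with the summable
  |r n k|.\<close>

lemma VV_compact:
 assumes v: "!!i::nat. v i \<in> VV" and n1: "!!i. Re (GG (v i) (v i)) = 1"
  and B: "!!i. Re (LL (v i) (v i) + RR (v i) (v i)) <= C i" and C: "C \<longlonglongrightarrow> c"
 shows "\<exists>s u. strict_mono s \<and> u \<in> VV \<and> Re (GG u u) = 1 \<and> Re (LL u u + RR u u) <= c \<and>
     (\<forall>w\<in>VV. (%i. GG (v (s i)) w) \<longlonglongrightarrow> GG u w)"
proof -
 have "bounded (range C)" using C convergent_def convergent_imp_bounded by blast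
 then obtain Cb where Cb: "!!i. C i <= Cb" unfolding bounded_iff by (metis abs_le_D1 rangeI real_norm_def)
 \<comment> \<open>Bounds 1 + LL for every member: Cb bounds the whole form, kap the perturbation
   \<open>RR\<close> on unit vectors, and 1 is the norm.\<close>
 define D where "D = Cb + kap + 1"
 have c1: "cmod (v i n) <= 1" for i n
  using coord_le_GG[OF v, of i n] n1[of i] by (simp add: power2_le_iff_abs_le abs_square_le_1)
 have hs: "((%n. br n * (cmod (v i n))\<^sup>2) has_sum 1 + Re (LL (v i) (v i))) UNIV" for i
  using has_sum_add[OF GG_norm[OF v[of i]] LL_norm[OF v[of i]]] n1[of i] by (simp add: br_def algebra_simps)
 have hsD: "1 + Re (LL (v i) (v i)) <= D" for i
 proof -
  have "\<bar>Re (RR (v i) (v i))\<bar> <= kap" using RR_le[OF v[of i]] n1[of i] abs_Re_le_cmod[of "RR (v i) (v i)"] by simp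
  thus ?thesis using B[of i] Cb[of i] by (simp add: D_def)
 qed
 have finD: "(\<Sum>n\<in>F. br n * (cmod (v i n))\<^sup>2) <= D" if "finite F" for F i
  using finite_sum_le_has_sum[OF hs that] hsD[of i] by (force simp: less_imp_le intro: order_trans)
 obtain s where s: "strict_mono s" "!!n. n \<in> UNIV ==> \<exists>l. (%i. v (s i) n) \<longlonglongrightarrow> l"
  using function_convergent_subsequence[of "UNIV::int set" v 1] c1 by blast
 then obtain u where u: "!!n. (%i. v (s i) n) \<longlonglongrightarrow> u n" by (metis UNIV_I)
 have ufin: "(\<Sum>n\<in>F. br n * (cmod (u n))\<^sup>2) <= D" if "finite F" for F
 proof (rule LIMSEQ_le_const2)
  show "(%i. \<Sum>n\<in>F. br n * (cmod (v (s i) n))\<^sup>2) \<longlonglongrightarrow> (\<Sum>n\<in>F. br n * (cmod (u n))\<^sup>2)"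
   by (intro tendsto_intros u)
 qed (use finD[OF that] in blast)
 have uV: "u \<in> VV" unfolding VV_def mem_Collect_eq
  by (rule nonneg_bdd_above_summable_on) (auto simp: less_imp_le bdd_above_def intro!: exI[of _ D] ufin)
 have w: "(%i. GG (v (s i)) w) \<longlonglongrightarrow> GG u w" if wV: "w \<in> VV" for w
  unfolding GG_def
 proof (rule tendsto_infsum_dominated[where h="%n. br n * (cmod (w n))\<^sup>2 + D * (1 / br n ^ 2)"])
  show "(%i. v (s i) n * cnj (w n)) \<longlonglongrightarrow> u n * cnj (w n)" for n by (intro tendsto_intros u)
  show "(%n. br n * (cmod (w n))\<^sup>2 + D * (1 / br n ^ 2)) summable_on UNIV"
   using wV by (intro summable_on_add summable_on_cmult_right summable_br) (simp add: VV_def)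
  fix i n
  let ?x = "cmod (v (s i) n)" and ?y = "cmod (w n)"
  have bD: "br n * ?x\<^sup>2 <= D" using finD[of "{n}" "s i"] by simp
  have "2 * ((?x / br n) * ?y) <= (?x / br n)\<^sup>2 + ?y\<^sup>2" by (rule two_mult_le)
  hence "br n * (2 * ((?x / br n) * ?y)) <= br n * ((?x / br n)\<^sup>2 + ?y\<^sup>2)" by (intro mult_left_mono) (auto simp: less_imp_le)
  hence "2 * (?x * ?y) <= br n * ?y\<^sup>2 + ?x\<^sup>2 / br n" by (simp add: power2_eq_square algebra_simps)
  moreover have "?x\<^sup>2 / br n = (br n * ?x\<^sup>2) * (1 / br n ^ 2)" by (simp add: power2_eq_square)
  moreover have "(br n * ?x\<^sup>2) * (1 / br n ^ 2) <= D * (1 / br n ^ 2)" using bD by (intro mult_right_mono) auto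
  ultimately have "2 * (?x * ?y) <= br n * ?y\<^sup>2 + D * (1 / br n ^ 2)" by linarith
  moreover have "?x * ?y <= 2 * (?x * ?y)" by simp
  ultimately show "cmod (v (s i) n * cnj (w n)) <= br n * (cmod (w n))\<^sup>2 + D * (1 / br n ^ 2)"
   unfolding norm_mult complex_mod_cnj by linarith
 qed
 have u1: "Re (GG u u) = 1"
 proof (rule antisym)
  have "(\<Sum>n\<in>F. (cmod (u n))\<^sup>2) <= 1" if "finite F" for F
  proof (rule LIMSEQ_le_const2)
   show "(%i. \<Sum>n\<in>F. (cmod (v (s i) n))\<^sup>2) \<longlonglongrightarrow> (\<Sum>n\<in>F. (cmod (u n))\<^sup>2)" by (intro tendsto_intros u)
   show "\<exists>N. \<forall>i\<ge>N. (\<Sum>n\<in>F. (cmod (v (s i) n))\<^sup>2) <= 1"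
    using finite_sum_le_has_sum[OF GG_norm[OF v] that] n1 by fastforce
  qed
  thus "Re (GG u u) <= 1" by (intro has_sum_le_finite_sums[OF GG_norm[OF uV]])
  \<comment> \<open>Indices with \<open>br n\<close> > M carry mass at most D/M, so the finitely
    many others keep at least 1 - D/M in the limit; then M tends to infinity.\<close>
  have "1 - D / M <= Re (GG u u)" if M: "M > 0" for M
  proof -
   define F where "F = {n. br n <= M}"
   have "F \<subseteq> {- \<lceil>M\<rceil>..\<lceil>M\<rceil>}"
   proof
    fix n assume "n \<in> F"
    hence "\<bar>real_of_int n\<bar> <= M" by (simp add: F_def br_def)
    thus "n \<in> {- \<lceil>M\<rceil>..\<lceil>M\<rceil>}" by (auto simp: le_ceiling_iff) linarith+
   qed
   hence F: "finite F" by (rule finite_subset) auto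
   have "1 <= (\<Sum>n\<in>F. (cmod (v i n))\<^sup>2) + D / M" for i
   proof -
    have h1: "((%n. if n \<in> F then (cmod (v i n))\<^sup>2 else 0) has_sum (\<Sum>n\<in>F. (cmod (v i n))\<^sup>2)) UNIV"
     by (rule has_sum_finite_neutralI[of F]) (auto intro: F)
    have "((%n. (if n \<in> F then (cmod (v i n))\<^sup>2 else 0) + 1 / M * (br n * (cmod (v i n))\<^sup>2)) has_sum
     ((\<Sum>n\<in>F. (cmod (v i n))\<^sup>2) + 1 / M * (1 + Re (LL (v i) (v i))))) UNIV"
     by (intro has_sum_add h1 has_sum_cmult_right hs)
    from has_sum_mono[OF GG_norm[OF v[of i]] this]
    have "1 <= (\<Sum>n\<in>F. (cmod (v i n))\<^sup>2) + 1 / M * (1 + Re (LL (v i) (v i)))"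
    proof -
     have "(cmod (v i n))\<^sup>2 <= (if n \<in> F then (cmod (v i n))\<^sup>2 else 0) + 1 / M * (br n * (cmod (v i n))\<^sup>2)" for n
     proof (cases "n \<in> F")
      case False
      hence "M * (cmod (v i n))\<^sup>2 <= br n * (cmod (v i n))\<^sup>2" by (intro mult_right_mono) (auto simp: F_def)
      thus ?thesis using False M by (simp add: field_simps)
     qed (use M in \<open>auto simp: less_imp_le\<close>)
     thus ?thesis using has_sum_mono[OF GG_norm[OF v[of i]]
      \<open>((%n. (if n \<in> F then (cmod (v i n))\<^sup>2 else 0) + 1 / M * (br n * (cmod (v i n))\<^sup>2)) has_sum
     ((\<Sum>n\<in>F. (cmod (v i n))\<^sup>2) + 1 / M * (1 + Re (LL (v i) (v i))))) UNIV\<close>] n1[of i] by simp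
    qed
    moreover have "1 / M * (1 + Re (LL (v i) (v i))) <= D / M" using hsD[of i] M by (simp add: divide_right_mono)
    ultimately show ?thesis by linarith
   qed
   hence "1 - D / M <= (\<Sum>n\<in>F. (cmod (v (s i) n))\<^sup>2)" for i by (simp add: diff_le_eq)
   moreover have "(%i. \<Sum>n\<in>F. (cmod (v (s i) n))\<^sup>2) \<longlonglongrightarrow> (\<Sum>n\<in>F. (cmod (u n))\<^sup>2)" by (intro tendsto_intros u)
   ultimately have "1 - D / M <= (\<Sum>n\<in>F. (cmod (u n))\<^sup>2)" by (intro LIMSEQ_le_const) auto
   also have "... <= Re (GG u u)" by (rule finite_sum_le_has_sum[OF GG_norm[OF uV] F]) auto
   finally show ?thesis .
  qed
  hence "eventually (%M. 1 - D / M <= Re (GG u u)) at_top" by (meson eventually_at_top_dense)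
  moreover have "((%M. 1 - D / M) \<longlongrightarrow> 1 - 0) at_top"
   by (intro tendsto_intros tendsto_divide_0[OF tendsto_const] filterlim_at_top_imp_at_infinity filterlim_ident)
  ultimately show "1 <= Re (GG u u)"
   using tendsto_le[of at_top "%_. Re (GG u u)" "Re (GG u u)" "%M. 1 - D / M" 1] by simp
 qed
 have Rlim: "(%i. RR (v (s i)) (v (s i))) \<longlonglongrightarrow> RR u u"
  unfolding RR_def
 proof (rule tendsto_infsum_dominated[OF _ _ r_summable])
  fix p :: "int \<times> int" obtain n k where p: "p = (n,k)" by force
  show "(%i. case p of (n,k) => r n k * v (s i) k * cnj (v (s i) n)) \<longlonglongrightarrow> (case p of (n,k) => r n k * u k * cnj (u n))"
   unfolding p prod.case by (intro tendsto_intros u)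
  fix i
  have "cmod (v (s i) k) * cmod (v (s i) n) <= 1 * 1" using c1 by (intro mult_mono) auto
  hence "cmod (r n k) * (cmod (v (s i) k) * cmod (v (s i) n)) <= cmod (r n k) * 1" by (intro mult_left_mono) auto
  thus "cmod (case p of (n,k) => r n k * v (s i) k * cnj (v (s i) n)) <= (case p of (n,k) => cmod (r n k))"
   by (simp add: p norm_mult mult.assoc)
 qed
 have "Re (LL u u) <= c - Re (RR u u)"
 proof (rule has_sum_le_finite_sums[OF LL_norm[OF uV]])
  fix F :: "int set" assume F: "finite F"
  have "(%i. (\<Sum>n\<in>F. of_int \<bar>n\<bar> * (cmod (v (s i) n))\<^sup>2) + Re (RR (v (s i)) (v (s i)))) \<longlonglongrightarrow> (\<Sum>n\<in>F. of_int \<bar>n\<bar> * (cmod (u n))\<^sup>2) + Re (RR u u)"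
   by (intro tendsto_intros u Rlim)
  moreover have "(%i. C (s i)) \<longlonglongrightarrow> c" using C s(1) LIMSEQ_subseq_LIMSEQ by (force simp: o_def)
  moreover have "(\<Sum>n\<in>F. of_int \<bar>n\<bar> * (cmod (v (s i) n))\<^sup>2) + Re (RR (v (s i)) (v (s i))) <= C (s i)" for i
   using finite_sum_le_has_sum[OF LL_norm[OF v[of "s i"]] F] B[of "s i"] by simp
  ultimately have "(\<Sum>n\<in>F. of_int \<bar>n\<bar> * (cmod (u n))\<^sup>2) + Re (RR u u) <= c" by (intro LIMSEQ_le) auto
  thus "(\<Sum>n\<in>F. of_int \<bar>n\<bar> * (cmod (u n))\<^sup>2) <= c - Re (RR u u)" by simp
 qed
 thus ?thesis using s(1) uV u1 w by (intro exI[of _ s] exI[of _ u]) auto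
qed

sublocale spectral_form VV "%_. 0" "%v z w n. v n + z * w n" GG "%v w. LL v w + RR v w" "%j. del (int j)" kap
proof
 show "(%_. 0) \<in> VV" by (simp add: VV_def)
 show "GG (%_. 0) v = 0" "LL (%_. 0) v + RR (%_. 0) v = 0" for v
  by (simp_all add: GG_def LL_def RR_def case_prod_unfold)
 show "LL (%n. v n + z * w n) u + RR (%n. v n + z * w n) u = LL v u + RR v u + z * (LL w u + RR w u)"
  if "v \<in> VV" "w \<in> VV" "u \<in> VV" for v z w u using that by (simp add: LL_cmb RR_cmb algebra_simps)
 show "LL v u + RR v u = cnj (LL u v + RR u v)" for v u using LL_herm[of v u] RR_herm[of v u] by simp
 show "0 <= Re (GG v v)" if "v \<in> VV" for v
  using GG_norm[OF that] by (rule has_sum_nonneg) auto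
 show "- kap * Re (GG v v) <= Re (LL v v + RR v v)" if v: "v \<in> VV" for v
 proof -
  have "Re (LL v v) >= 0" using LL_norm[OF v] by (rule has_sum_nonneg) auto
  moreover have "- (kap * Re (GG v v)) <= Re (RR v v)" using RR_le[OF v] abs_Re_le_cmod[of "RR v v"] by linarith
  ultimately show ?thesis by simp
 qed
 show "GG (del (int m)) (del (int n)) = (if m = n then 1 else 0)" for m n
  unfolding GG_def by (subst infsum_single[of "int m"]) (auto simp: del_def)
 show "\<exists>s u. strict_mono s \<and> u \<in> VV \<and> Re (GG u u) = 1 \<and> Re (LL u u + RR u u) <= c \<and>
   (\<forall>w\<in>VV. (%i. GG (v (s i)) w) \<longlonglongrightarrow> GG u w)"
  if "!!i::nat. v i \<in> VV" "!!i. Re (GG (v i) (v i)) = 1" "!!i. Re (LL (v i) (v i) + RR (v i) (v i)) <= C i" "C \<longlonglongrightarrow> c" for v C c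
  by (rule VV_compact[OF that])
qed (auto intro: VV_cmb GG_cmb GG_herm del_VV)

lemma GG_del: "GG (del n) v = cnj (v n)"
 unfolding GG_def by (subst infsum_single[of n]) (auto simp: del_def)

lemma LL_del: "LL (del n) v = of_int \<bar>n\<bar> * cnj (v n)"
 unfolding LL_def by (subst infsum_single[of n]) (auto simp: del_def)

lemma RR_del: assumes "v \<in> VV" shows "RR (del n) v = (ISUM k. r k n * cnj (v k))"
proof -
 have inner: "(ISUM k. r m k * del n k * cnj (v m)) = r m n * cnj (v m)" for m
  by (subst infsum_single[of n]) (auto simp: del_def)
 have "RR (del n) v = (ISUM m. ISUM k. r m k * del n k * cnj (v m))"
  unfolding RR_def using infsum_Sigma'_banach[of "%m k. r m k * del n k * cnj (v m)" UNIV "%_. UNIV"] RR_sum[OF del_VV assms, of n] by simp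
 thus ?thesis by (simp add: inner)
qed

text \<open>Testing the weak eigenvalue equation against unit sequences gives it coordinatewise. The
  rapid decay of eigenvectors is elliptic regularity: \<open>r\<close> applied to a bounded sequence
  is already rapidly decreasing.\<close>

theorem eigenbasis:
 obtains \<psi> lam where
  "!!j v. v \<in> VV ==> LL v (\<psi> j) + RR v (\<psi> j) = of_real (lam j) * GG v (\<psi> j)"
  "!!j K. \<exists>C\<ge>0. \<forall>n. br n ^ K * cmod (\<psi> j n) <= C"
  "!!j n. of_real (lam j - of_int \<bar>n\<bar>) * \<psi> j n = (ISUM k. r n k * \<psi> j k)"
  "!!i j. ((%n. \<psi> i n * cnj (\<psi> j n)) has_sum (if i = j then 1 else 0)) UNIV"
  "filterlim lam at_top sequentially"
  "!!f. (%n. br n * (cmod (f n))\<^sup>2) summable_on UNIV ==>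
   (%j. (cmod (ISUM n. f n * cnj (\<psi> j n)))\<^sup>2) sums (ISUM n. (cmod (f n))\<^sup>2)"
proof -
 obtain \<psi> lam where *: "!!j. \<psi> j \<in> VV" "!!i j. GG (\<psi> i) (\<psi> j) = (if i = j then 1 else 0)"
  "!!j v. v \<in> VV ==> LL v (\<psi> j) + RR v (\<psi> j) = of_real (lam j) * GG v (\<psi> j)" "filterlim lam at_top sequentially"
  "!!f. f \<in> VV ==> (%j. (cmod (GG f (\<psi> j)))\<^sup>2) sums Re (GG f f)"
  using spectral by blast
 have ev: "of_real (lam j - of_int \<bar>n\<bar>) * \<psi> j n = (ISUM k. r n k * \<psi> j k)" for j n
 proof -
  have "of_int \<bar>n\<bar> * cnj (\<psi> j n) + (ISUM k. r k n * cnj (\<psi> j k)) = of_real (lam j) * cnj (\<psi> j n)"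
   using *(3)[OF del_VV[of n], of j] RR_del[OF *(1)[of j], of n] by (simp add: GG_del LL_del)
  hence "cnj (of_int \<bar>n\<bar> * cnj (\<psi> j n) + (ISUM k. r k n * cnj (\<psi> j k))) = cnj (of_real (lam j) * cnj (\<psi> j n))" by simp
  hence "of_int \<bar>n\<bar> * \<psi> j n + (ISUM k. r n k * \<psi> j k) = of_real (lam j) * \<psi> j n"
   by (simp add: r_herm flip: infsum_cnj)
  thus ?thesis by (simp add: left_diff_distrib eq_diff_eq[symmetric] flip: of_int_abs)
 qed
 have le1: "cmod (\<psi> j n) <= 1" for j n
  using coord_le_GG[OF *(1), of j n] by (simp add: *(2) power2_le_iff_abs_le abs_square_le_1)
 have rapid: "\<exists>C\<ge>0. \<forall>n. br n ^ K * cmod (\<psi> j n) <= C" for j K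
 proof -
  obtain C where C: "C >= 0" "!!n k. br n ^ (K+2) * br k ^ (K+2) * cmod (r n k) <= C" using r_rapid[of "K+2"] by blast
  define S where "S = C * (ISUM k. 1 / br k ^ 2)"
  have rb: "cmod (r n k * \<psi> j k) <= (C / br n ^ K) * (1 / br k ^ 2)" for n k
  proof -
   have "br n ^ K * br k ^ 2 * cmod (r n k) <= br n ^ (K+2) * br k ^ (K+2) * cmod (r n k)"
    by (intro mult_right_mono mult_mono power_increasing br_ge1) (auto simp: less_imp_le)
   hence "br n ^ K * br k ^ 2 * cmod (r n k) <= C" using C(2)[of n k] by linarith
   hence "cmod (r n k) <= (C / br n ^ K) * (1 / br k ^ 2)" by (simp add: field_simps)
   moreover have "cmod (r n k * \<psi> j k) <= cmod (r n k)" using le1[of j k] by (simp add: norm_mult mult_left_le)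
   ultimately show ?thesis by linarith
  qed
  have s2: "(%k. (C / br n ^ K) * (1 / br k ^ 2)) summable_on UNIV" for n
   by (intro summable_on_cmult_right summable_br)
  have Rb: "br n ^ K * cmod (ISUM k. r n k * \<psi> j k) <= S" for n
  proof -
   have as: "(%k. cmod (r n k * \<psi> j k)) summable_on UNIV"
    by (rule abs_summable_dominated[OF s2 rb])
   have "cmod (ISUM k. r n k * \<psi> j k) <= (ISUM k. cmod (r n k * \<psi> j k))"
    by (rule norm_infsum_bound[OF as])
   also have "... <= (ISUM k. (C / br n ^ K) * (1 / br k ^ 2))" by (intro infsum_mono as s2 rb)
   also have "... = (C / br n ^ K) * (ISUM k. 1 / br k ^ 2)" by (intro infsum_cmult_right summable_br)
   finally show ?thesis by (simp add: S_def field_simps)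
  qed
  \<comment> \<open>For |n| at least |lam j| + 1 the factor lam j - |n| has modulus at least 1 and
    can be divided out; the finitely many other n are covered by the constant (|lam j| +
    2)^K.\<close>
  have "br n ^ K * cmod (\<psi> j n) <= S + (\<bar>lam j\<bar> + 2) ^ K" for n
  proof (cases "\<bar>real_of_int n\<bar> >= \<bar>lam j\<bar> + 1")
   case True
   hence "1 <= \<bar>lam j - of_int \<bar>n\<bar>\<bar>" by simp
   hence "br n ^ K * cmod (\<psi> j n) <= br n ^ K * (\<bar>lam j - of_int \<bar>n\<bar>\<bar> * cmod (\<psi> j n))"
    by (intro mult_left_mono) (auto simp: mult_le_cancel_right1 less_imp_le)
   also have "\<bar>lam j - of_int \<bar>n\<bar>\<bar> * cmod (\<psi> j n) = cmod (ISUM k. r n k * \<psi> j k)"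
    unfolding ev[symmetric] norm_mult norm_of_real ..
   finally show ?thesis using Rb[of n] by (smt (verit) zero_le_power abs_ge_zero)
  next
   case False
   hence "br n ^ K <= (\<bar>lam j\<bar> + 2) ^ K" by (intro power_mono) (auto simp: br_def)
   hence "br n ^ K * cmod (\<psi> j n) <= (\<bar>lam j\<bar> + 2) ^ K * 1" using le1[of j n] by (intro mult_mono) auto
   moreover have "S >= 0" unfolding S_def using C by (intro mult_nonneg_nonneg infsum_nonneg) auto
   ultimately show ?thesis by simp
  qed
  moreover have "0 <= S + (\<bar>lam j\<bar> + 2) ^ K" unfolding S_def using C by (intro add_nonneg_nonneg mult_nonneg_nonneg infsum_nonneg) auto
  ultimately show ?thesis by blast
 qed
 have on: "((%n. \<psi> i n * cnj (\<psi> j n)) has_sum (if i = j then 1 else 0)) UNIV" for i j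
  using has_sum_infsum[OF GG_sum[OF *(1) *(1)], of i j] *(2)[of i j] by (simp add: GG_def)
 have pars: "(%j. (cmod (ISUM n. f n * cnj (\<psi> j n)))\<^sup>2) sums (ISUM n. (cmod (f n))\<^sup>2)"
  if "(%n. br n * (cmod (f n))\<^sup>2) summable_on UNIV" for f
 proof -
  have f: "f \<in> VV" using that by (simp add: VV_def)
  show ?thesis using *(5)[OF f] infsumI[OF GG_norm[OF f]] by (simp add: GG_def)
 qed
 show thesis by (rule that[OF *(3) rapid ev on *(4) pars])
qed

end

section \<open>The dictionary between smooth periodic functions and rapid sequences\<close>

section \<open>Smooth functions and rapidly decreasing Fourier coefficients\<close>

lemma smooth_funD:
 assumes "smooth_fun f" shows "(f has_real_derivative deriv f x) (at x)" "smooth_fun (deriv f)"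
proof -
 have "f differentiable (at x)" using assms[unfolded smooth_fun_def, rule_format, of 0 x] by simp
 thus "(f has_real_derivative deriv f x) (at x)"
  by (simp add: DERIV_deriv_iff_real_differentiable)
 have "(deriv ^^ n) (deriv f) = (deriv ^^ Suc n) f" for n by (simp only: funpow_Suc_right o_apply)
 thus "smooth_fun (deriv f)" using assms unfolding smooth_fun_def by presburger
qed

text \<open>Turns smoothness into a closure property: it suffices to exhibit a set of functions
  stable under differentiation.\<close>

lemma smooth_class:
 assumes cl: "!!f. f \<in> S ==> \<exists>f'\<in>S. \<forall>x. (f has_real_derivative f' x) (at x)" and f: "f \<in> S"
 shows "smooth_fun f"
proof -
 have step: "deriv g \<in> S" if "g \<in> S" for g
 proof -
  obtain g' where g': "g' \<in> S" "!!x. (g has_real_derivative g' x) (at x)" using cl \<open>g \<in> S\<close> by blast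
  hence "deriv g = g'" by (intro ext DERIV_imp_deriv)
  thus ?thesis using g' by simp
 qed
 have "(deriv ^^ n) f \<in> S" for n by (induction n) (auto intro: f step)
 thus ?thesis unfolding smooth_fun_def using cl real_differentiable_def by metis
qed

text \<open>The algebra generated by smooth functions and real powers of b is closed under
  differentiation when b is smooth and positive. It yields smoothness of products with b^(1/2) and
  b^(-1/2).\<close>

inductive smalg :: "(real => real) => (real => real) => bool" for b where
 smooth: "smooth_fun f ==> smalg b f"
| powr: "smalg b (%x. b x powr p)"
| add: "smalg b f ==> smalg b g ==> smalg b (%x. f x + g x)"
| mult: "smalg b f ==> smalg b g ==> smalg b (%x. f x * g x)"

lemma smooth_const: "smooth_fun (%x. c)"
 by (rule smooth_class[of "range (%c x. c)"]) (auto intro!: derivative_eq_intros exI[of _ 0])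

lemma smalg_smooth:
 assumes b: "smooth_fun b" "!!x. b x > 0" and f: "smalg b f"
 shows "smooth_fun f"
proof (rule smooth_class[of "Collect (smalg b)"])
 fix f assume "f \<in> Collect (smalg b)"
 hence "smalg b f" by simp
 thus "\<exists>f'\<in>Collect (smalg b). \<forall>x. (f has_real_derivative f' x) (at x)"
 proof (induction rule: smalg.induct)
  case (smooth f)
  thus ?case using smooth_funD[OF smooth] by (auto intro: smalg.smooth)
 next
  case (powr p)
  have "smalg b (%x. p * (b x powr (p - 1) * deriv b x))"
   by (intro smalg.mult smalg.powr smalg.smooth[OF smooth_funD(2)[OF b(1)]] smalg.smooth[OF smooth_const])
  moreover have "((%x. b x powr p) has_real_derivative p * (b x powr (p - 1) * deriv b x)) (at x)" for x
   using smooth_funD(1)[OF b(1), of x] b(2)[of x]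
   by (auto intro!: derivative_eq_intros)
  ultimately show ?case by (intro bexI[of _ "%x. p * (b x powr (p - 1) * deriv b x)"]) auto
 next
  case (add f g)
  then obtain f' g' where "smalg b f'" "smalg b g'" "\<forall>x. (f has_real_derivative f' x) (at x)" "\<forall>x. (g has_real_derivative g' x) (at x)" by blast
  thus ?case by (intro bexI[of _ "%x. f' x + g' x"]) (auto intro!: derivative_eq_intros smalg.add)
 next
  case (mult f g)
  then obtain f' g' where "smalg b f'" "smalg b g'" "\<forall>x. (f has_real_derivative f' x) (at x)" "\<forall>x. (g has_real_derivative g' x) (at x)" by blast
  thus ?case using mult by (intro bexI[of _ "%x. f' x * g x + f x * g' x"]) (auto intro!: derivative_eq_intros smalg.add smalg.mult)
 qed
qed (use f in simp)

lemma circ_smooth_c_powr_mult: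
 assumes b: "circ_smooth b" "!!x. b x > 0" and u: "circ_smooth_c u"
 shows "circ_smooth_c (%x. of_real (b x powr p) * u x)"
 using assms unfolding circ_smooth_c_def circ_smooth_def
 by (auto intro!: smalg_smooth[of b] smalg.mult smalg.powr intro: smalg.smooth)

definition cderiv :: "(real => complex) => real => complex" where
 "cderiv u x = Complex (deriv (%x. Re (u x)) x) (deriv (%x. Im (u x)) x)"

lemma circ_smooth_deriv:
 assumes "circ_smooth f" shows "circ_smooth (deriv f)"
proof -
 have "deriv f (x + 2 * pi) = deriv f x" for x
 proof -
  have "((%x. f (x + 2 * pi)) has_real_derivative deriv f (x + 2 * pi)) (at x)"
   using smooth_funD(1)[of f "x + 2 * pi"] assms DERIV_shift by (simp add: circ_smooth_def DERIV_shift)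
  thus ?thesis using assms DERIV_imp_deriv by (force simp: circ_smooth_def)
 qed
 thus ?thesis using assms smooth_funD(2) by (simp add: circ_smooth_def)
qed

lemma cderiv:
 assumes "circ_smooth_c u"
 shows "(u has_vd cderiv u x) (at x)" "circ_smooth_c (cderiv u)"
proof -
 show "(u has_vd cderiv u x) (at x)"
  unfolding has_vector_derivative_complex_iff cderiv_def
  using assms by (auto simp: circ_smooth_c_def circ_smooth_def has_real_derivative_iff_has_vector_derivative[symmetric] intro: smooth_funD)
 show "circ_smooth_c (cderiv u)"
  using assms circ_smooth_deriv unfolding circ_smooth_c_def cderiv_def by simp
qed

lemma circ_smooth_c_period: "circ_smooth_c u ==> u (x + 2 * pi) = u x"
 unfolding circ_smooth_c_def circ_smooth_def by (auto intro: complex_eqI)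

lemma circ_smooth_c_cont: "circ_smooth_c u ==> continuous_on S u"
 by (meson cderiv(1) has_vector_derivative_continuous continuous_at_imp_continuous_on)

definition rapid :: "(int => complex) => bool" where
 "rapid a \<longleftrightarrow> (\<forall>K. \<exists>C\<ge>0. \<forall>n. br n ^ K * cmod (a n) <= C)"

lemma rapidD: "rapid a ==> \<exists>C\<ge>0. \<forall>n. cmod (a n) <= C / br n ^ K"
 unfolding rapid_def by (metis br_pos mult.commute pos_le_divide_eq zero_less_power)

lemma rapid_fourier:
 assumes "circ_smooth_c u" shows "rapid (fourier u)"
 unfolding rapid_def
proof
 fix K
 have *: "\<exists>C\<ge>0. \<forall>k. \<bar>real_of_int k\<bar> ^ K * cmod (fourier u k) <= C" if "circ_smooth_c u" for K u
  using that
 proof (induction K arbitrary: u)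
  case 0
  have c: "continuous_on {0..2*pi} u" by (rule circ_smooth_c_cont[OF 0])
  hence "bounded (u ` {0..2*pi})" using compact_continuous_image compact_imp_bounded by blast
  then obtain B where "!!t. t \<in> {0..2*pi} ==> cmod (u t) <= B" unfolding bounded_iff by blast
  hence "cmod (fourier u k) <= B" for k by (intro norm_fourier_le c)
  thus ?case by (intro exI[of _ B]) (auto intro: order_trans[OF norm_ge_zero])
 next
  case (Suc K)
  have "fourier (cderiv u) k = \<i> * of_int k * fourier u k" for k
   using circ_smooth_c_period[OF Suc.prems, of 0]
   by (intro fourier_deriv cderiv(1) circ_smooth_c_cont cderiv(2) Suc.prems) auto
  hence "\<bar>real_of_int k\<bar> ^ Suc K * cmod (fourier u k) = \<bar>real_of_int k\<bar> ^ K * cmod (fourier (cderiv u) k)" for k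
   by (simp add: norm_mult)
  thus ?case using Suc.IH[OF cderiv(2)[OF Suc.prems]] by presburger
 qed
 obtain C D where C: "C >= 0" "\<forall>k. \<bar>real_of_int k\<bar> ^ K * cmod (fourier u k) <= C"
  and D: "D >= 0" "\<forall>k. \<bar>real_of_int k\<bar> ^ 0 * cmod (fourier u k) <= D" using * assms by meson
 have "br n ^ K * cmod (fourier u n) <= 2 ^ K * (D + C)" for n
 proof -
  have "br n ^ K * cmod (fourier u n) <= 2 ^ K * (1 + \<bar>real_of_int n\<bar> ^ K) * cmod (fourier u n)"
   by (intro mult_right_mono br_pow_le) auto
  also have "... = 2 ^ K * (cmod (fourier u n) + \<bar>real_of_int n\<bar> ^ K * cmod (fourier u n))" by (simp add: algebra_simps)
  also have "... <= 2 ^ K * (D + C)" using C D by (intro mult_left_mono add_mono) auto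
  finally show ?thesis .
 qed
 thus "\<exists>C\<ge>0. \<forall>n. br n ^ K * cmod (fourier u n) <= C" using C D by (intro exI[of _ "2 ^ K * (D + C)"]) auto
qed

lemma rapid_mult:
 assumes "rapid a" and q: "!!n. cmod (q n) <= D * br n ^ M"
 shows "rapid (%n. q n * a n)"
 unfolding rapid_def
proof
 fix K
 have D: "D >= 0" using order_trans[OF norm_ge_zero q[of 0]] by (simp add: br_def)
 obtain C where C: "C >= 0" "!!n. br n ^ (K + M) * cmod (a n) <= C" using assms(1) unfolding rapid_def by blast
 have "br n ^ K * cmod (q n * a n) <= D * C" for n
 proof -
  have "br n ^ K * cmod (q n * a n) <= br n ^ K * (D * br n ^ M * cmod (a n))"
   unfolding norm_mult by (intro mult_left_mono mult_right_mono q) (auto simp: less_imp_le)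
  also have "... = D * (br n ^ (K + M) * cmod (a n))" by (simp add: power_add mult_ac)
  also have "... <= D * C" using C D by (intro mult_left_mono)
  finally show ?thesis .
 qed
 thus "\<exists>C\<ge>0. \<forall>n. br n ^ K * cmod (q n * a n) <= C" using C D by (intro exI[of _ "D * C"]) auto
qed

lemma rapid_cmult: "rapid a ==> rapid (%n. z * a n)"
 using rapid_mult[of a "%_. z" "cmod z" 0] by simp

lemma rapid_int: "rapid a ==> rapid (%n. \<i> * of_int n * a n)" "rapid a ==> rapid (%n. of_int \<bar>n\<bar> * a n)"
 using rapid_mult[of a "%n. \<i> * of_int n" 1 1] rapid_mult[of a "%n. of_int \<bar>n\<bar>" 1 1] by (auto simp: norm_mult br_def)

lemma rapid_add: assumes "rapid a" "rapid a'" shows "rapid (%n. a n + a' n)"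
 unfolding rapid_def
proof
 fix K
 obtain C where C: "C >= 0" "!!n. br n ^ K * cmod (a n) <= C" using assms(1) unfolding rapid_def by blast
 obtain D where D: "D >= 0" "!!n. br n ^ K * cmod (a' n) <= D" using assms(2) unfolding rapid_def by blast
 have "br n ^ K * cmod (a n + a' n) <= C + D" for n
 proof -
  have "br n ^ K * cmod (a n + a' n) <= br n ^ K * (cmod (a n) + cmod (a' n))" by (intro mult_left_mono norm_triangle_ineq) (auto simp: less_imp_le)
  thus ?thesis using C(2)[of n] D(2)[of n] by (simp add: distrib_left)
 qed
 thus "\<exists>C\<ge>0. \<forall>n. br n ^ K * cmod (a n + a' n) <= C" using C D by (intro exI[of _ "C + D"]) auto
qed

lemma rapid_zero: "rapid (%n. 0)" by (auto simp: rapid_def)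

lemma rapid_sum: "(!!x. x \<in> X ==> rapid (f x)) ==> rapid (%n. \<Sum>x\<in>X. f x n)"
 by (induction X rule: infinite_finite_induct) (auto intro: rapid_zero rapid_add)

lemma rapid_abs: assumes "rapid a" shows "(%n. cmod (a n)) summable_on UNIV"
proof -
 obtain C where "!!n. cmod (a n) <= C / br n ^ 2" using rapidD[OF assms, of 2] by blast
 thus ?thesis by (rule summable_br_bound(2))
qed

lemma rapid_l2: assumes "rapid a" shows "(%n. br n * (cmod (a n))\<^sup>2) summable_on UNIV"
proof -
 obtain C where C: "C >= 0" "!!n. br n ^ 3 * cmod (a n) <= C" using assms unfolding rapid_def by blast
 have "norm (br n * (cmod (a n))\<^sup>2) <= (C * C) / br n ^ 2" for n
 proof -
  have "cmod (a n) <= br n ^ 3 * cmod (a n)" using mult_right_mono[OF br_power_ge1[of n 3], of "cmod (a n)"] by simp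
  hence a: "cmod (a n) <= C" using C(2)[of n] by linarith
  have "br n ^ 2 * (br n * (cmod (a n))\<^sup>2) = (br n ^ 3 * cmod (a n)) * cmod (a n)" by (simp add: power3_eq_cube power2_eq_square)
  also have "... <= C * C" using C a by (intro mult_mono) auto
  finally show ?thesis by (simp add: field_simps less_imp_le)
 qed
 thus ?thesis by (rule summable_br_bound(1))
qed

definition Fs :: "(int => complex) => real => complex" where "Fs a t = (ISUM n. a n * cis (of_int n * t))"

lemma Fs_summable: assumes "rapid a" shows "(%n. a n * cis (of_int n * t)) summable_on UNIV"
proof (rule abs_summable_summable)
 show "(%n. cmod (a n * cis (of_int n * t))) summable_on UNIV" using rapid_abs[OF assms] by (simp add: norm_mult)
qed

lemma Fs_cont: "rapid a ==> continuous_on S (Fs a)"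
 unfolding Fs_def by (rule continuous_on_infsum[OF _ _ rapid_abs]) (auto intro!: continuous_intros simp: norm_mult)

lemma fourier_Fs: "rapid a ==> fourier (Fs a) k = a k"
 unfolding Fs_def by (rule fourier_series[OF rapid_abs])

lemma Fs_period: "Fs a (t + 2 * pi) = Fs a t" unfolding Fs_def cis_int_period ..

text \<open>The series of derivatives is integrated term by term over an interval around t; the
  fundamental theorem of calculus then gives the derivative of the original series.\<close>

lemma Fs_deriv:
 assumes a: "rapid a" shows "(Fs a has_vd Fs (%n. \<i> * of_int n * a n) t) (at t)"
proof -
 let ?a' = "%n. \<i> * of_int n * a n"
 have ra': "rapid ?a'" by (rule rapid_int(1)[OF a])
 have eq: "Fs a s = Fs a (t - 1) + integral {t - 1..s} (Fs ?a')" if "s \<in> {t-1..t+1}" for s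
 proof -
  have i: "integral {t-1..s} (%x. ?a' n * cis (of_int n * x)) = a n * cis (of_int n * s) - a n * cis (of_int n * (t-1))" for n
  proof (rule integral_unique, rule fundamental_theorem_of_calculus)
   show "((%x. a n * cis (of_int n * x)) has_vd ?a' n * cis (of_int n * x)) (at x within {t-1..s})" for x
    using has_vector_derivative_mult_right[OF has_vector_derivative_ek, of "a n" n x] by (simp add: mult_ac)
  qed (use that in auto)
  have "((%n. integral {t-1..s} (%x. ?a' n * cis (of_int n * x))) has_sum integral {t-1..s} (%x. ISUM n. ?a' n * cis (of_int n * x))) UNIV"
   by (rule has_sum_integral[OF _ _ rapid_abs[OF ra']]) (auto intro!: continuous_intros simp: norm_mult)
  hence "((%n. a n * cis (of_int n * s) - a n * cis (of_int n * (t-1))) has_sum integral {t-1..s} (Fs ?a')) UNIV"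
   unfolding i Fs_def[abs_def] .
  moreover have "((%n. a n * cis (of_int n * s) + (- (a n * cis (of_int n * (t-1))))) has_sum (Fs a s + (- Fs a (t - 1)))) UNIV"
   unfolding Fs_def by (intro has_sum_add has_sum_uminusI has_sum_infsum Fs_summable a)
  ultimately show ?thesis using has_sum_unique by fastforce
 qed
 have "((%s. Fs a (t - 1) + integral {t - 1..s} (Fs ?a')) has_vd 0 + Fs ?a' t) (at t within {t-1..t+1})"
  by (intro has_vector_derivative_add has_vector_derivative_const integral_has_vector_derivative Fs_cont ra') auto
 hence "(Fs a has_vd Fs ?a' t) (at t within {t-1..t+1})"
  by (intro has_vector_derivative_transform[OF _ eq]) auto
 moreover have "at t within {t-1..t+1} = at t" by (rule at_within_Icc_at) auto
 ultimately show ?thesis by (simp only:)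
qed

lemma Fs_smooth: assumes "rapid a" shows "circ_smooth_c (Fs a)"
proof -
 have R: "smooth_fun (%x. Re (Fs a x))" if a: "rapid a" for a
 proof (rule smooth_class[of "{%x. Re (Fs a x) | a. rapid a}"])
  fix f assume "f \<in> {%x. Re (Fs a x) | a. rapid a}"
  then obtain a where a: "rapid a" "f = (%x. Re (Fs a x))" by blast
  have "(f has_real_derivative Re (Fs (%n. \<i> * of_int n * a n) x)) (at x)" for x
   using Fs_deriv[OF a(1), of x] by (simp add: a(2) has_vector_derivative_complex_iff has_real_derivative_iff_has_vector_derivative)
  thus "\<exists>f'\<in>{%x. Re (Fs a x) | a. rapid a}. \<forall>x. (f has_real_derivative f' x) (at x)"
   using rapid_int(1)[OF a(1)] by (intro bexI[of _ "%x. Re (Fs (%n. \<i> * of_int n * a n) x)"]) auto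
 qed (use a in blast)
 have "Im (Fs a x) = Re (Fs (%n. (-\<i>) * a n) x)" for x
  unfolding Fs_def mult.assoc infsum_cmult_right' by simp
 thus ?thesis
  using R[OF assms] R[OF rapid_cmult[OF assms, of "-\<i>"]]
  by (auto simp: circ_smooth_c_def circ_smooth_def Fs_period)
qed

lemma Fs_inversion: "circ_smooth_c u ==> u t = Fs (fourier u) t"
 unfolding Fs_def by (intro fourier_inversion[of u "cderiv u"] circ_smooth_c_period cderiv(1) abs_summable_summable[OF rapid_abs[OF rapid_fourier]])

lemma Lam_eq: "Lam u t = Fs (%n. of_int \<bar>n\<bar> * fourier u n) t"
 unfolding Lam_def Fs_def exp_cis ..

section \<open>Transfer of the spectrum between smooth eigenfunctions and sequences in the basis cis
  (n phi)\<close>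

section \<open>Positive eigenvalues and their multiplicities\<close>

lemma has_sum_sum:
 fixes f :: "'a => 'b => complex"
 assumes "finite X" "!!x. x \<in> X ==> (f x has_sum s x) A"
 shows "((%n. \<Sum>x\<in>X. f x n) has_sum (\<Sum>x\<in>X. s x)) A"
 using assms by (induction X rule: finite_induct) (auto intro: has_sum_add)

lemma summable_product:
 fixes f g :: "'a => real"
 assumes "f summable_on UNIV" "g summable_on UNIV" "!!x. f x >= 0" "!!x. g x >= 0"
 shows "(%(x,y). f x * g y) summable_on UNIV"
proof -
 have "(%(x,y). f x * g y) summable_on (Sigma UNIV (%_. UNIV))"
  by (rule summable_on_SigmaI[where g="%x. f x * (ISUM y. g y)"])
   (auto intro!: has_sum_cmult_right has_sum_infsum summable_on_cmult_left mult_nonneg_nonneg assms)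
 thus ?thesis by simp
qed

lemma infsum_swap_product:
 fixes h :: "'a => 'a => complex"
 assumes "f summable_on UNIV" "g summable_on UNIV" "!!x. f x >= 0" "!!x. g x >= (0::real)"
  and "!!x y. cmod (h x y) <= f x * g y"
 shows "(ISUM x. ISUM y. h x y) = (ISUM y. ISUM x. h x y)"
proof (rule infsum_swap_banach)
 have "(%p. cmod (case p of (x,y) => h x y)) summable_on UNIV"
  by (rule abs_summable_dominated[OF summable_product[OF assms(1-4)]]) (use assms(5) in auto)
 thus "(%(x, y). h x y) summable_on UNIV \<times> UNIV" using abs_summable_summable by fastforce
qed

text \<open>K powers of decay in the output index l cost K+1 powers of the input index n, which the
  rapid sequence \<open>y\<close> can pay, together with two more for summability.\<close>

lemma rapid_kernel:
 assumes y: "rapid y" and M: "!!K. \<exists>C\<ge>0. \<forall>n l. br l ^ K * cmod (M n l) <= C * br n ^ (K + 1)"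
 shows "rapid (%l. ISUM n. y n * M n l)" "(%n. cmod (y n * M n l)) summable_on UNIV"
proof -
 have *: "\<exists>D\<ge>0. \<forall>n l. br l ^ K * cmod (y n * M n l) <= D * (1 / br n ^ 2)" for K
 proof -
  obtain C where C: "C >= 0" "!!n l. br l ^ K * cmod (M n l) <= C * br n ^ (K + 1)" using M by blast
  obtain D where D: "D >= 0" "!!n. br n ^ (K + 3) * cmod (y n) <= D" using y unfolding rapid_def by blast
  have "br l ^ K * cmod (y n * M n l) <= C * D * (1 / br n ^ 2)" for n l
  proof -
   have "br n ^ 2 * (br l ^ K * cmod (y n * M n l)) = br n ^ 2 * cmod (y n) * (br l ^ K * cmod (M n l))" by (simp add: norm_mult mult_ac)
   also have "... <= br n ^ 2 * cmod (y n) * (C * br n ^ (K + 1))" by (intro mult_left_mono C) auto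
   also have "... = C * (br n ^ (K + 3) * cmod (y n))" by (simp add: power_add power2_eq_square power3_eq_cube mult_ac)
   also have "... <= C * D" using C D by (intro mult_left_mono)
   finally show ?thesis by (simp add: field_simps)
  qed
  thus ?thesis using C D by (intro exI[of _ "C * D"]) auto
 qed
 obtain D0 where D0: "!!n l. cmod (y n * M n l) <= D0 * (1 / br n ^ 2)" using *[of 0] by auto
 show s: "(%n. cmod (y n * M n l)) summable_on UNIV" for l
  using D0[of _ l] by (intro summable_br_bound(2)[where C=D0]) (simp add: norm_mult)
 show "rapid (%l. ISUM n. y n * M n l)"
  unfolding rapid_def
 proof
  fix K
  obtain D where D: "D >= 0" "!!n l. br l ^ K * cmod (y n * M n l) <= D * (1 / br n ^ 2)" using * by blast
  have "br l ^ K * cmod (ISUM n. y n * M n l) <= D * (ISUM n. 1 / br n ^ 2)" for l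
  proof -
   have "br l ^ K * cmod (ISUM n. y n * M n l) <= br l ^ K * (ISUM n. cmod (y n * M n l))"
    by (intro mult_left_mono norm_infsum_bound s) (auto simp: less_imp_le)
   also have "... = (ISUM n. br l ^ K * cmod (y n * M n l))" by (intro infsum_cmult_right[symmetric] s)
   also have "... <= (ISUM n. D * (1 / br n ^ 2))"
    by (intro infsum_mono summable_on_cmult_right s summable_br D)
   also have "... = D * (ISUM n. 1 / br n ^ 2)" by (intro infsum_cmult_right summable_br)
   finally show ?thesis .
  qed
  moreover have "0 <= D * (ISUM n. 1 / br n ^ 2)" using D by (intro mult_nonneg_nonneg infsum_nonneg) auto
  ultimately show "\<exists>C\<ge>0. \<forall>l. br l ^ K * cmod (ISUM n. y n * M n l) <= C" by blast
 qed
qed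

lemma rapid_shift: assumes "rapid g" shows "rapid (%l. g (l - j))"
 unfolding rapid_def
proof
 fix K
 obtain C where C: "C >= 0" "!!n. br n ^ K * cmod (g n) <= C" using assms unfolding rapid_def by blast
 have "br l ^ K * cmod (g (l - j)) <= br j ^ K * C" for l
 proof -
  have "br l ^ K <= (br (l - j) * br j) ^ K" using br_add_le[of "l - j" j] by (intro power_mono) (auto simp: less_imp_le)
  hence "br l ^ K * cmod (g (l - j)) <= br j ^ K * (br (l - j) ^ K * cmod (g (l - j)))"
   using mult_right_mono[of "br l ^ K" "(br (l - j) * br j) ^ K" "cmod (g (l - j))"] by (simp add: power_mult_distrib mult_ac)
  also have "... <= br j ^ K * C" by (intro mult_left_mono C) (auto simp: less_imp_le)
  finally show ?thesis .
 qed
 thus "\<exists>C\<ge>0. \<forall>l. br l ^ K * cmod (g (l - j)) <= C" using C by (intro exI[of _ "br j ^ K * C"]) (auto simp: less_imp_le)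
qed

context trig1
begin

sublocale smoothing_matrix r
proof
 show "cnj (r n k) = r k n" for n k by (rule r_cnj)
 show "\<exists>C\<ge>0. \<forall>n k. br n ^ K * br k ^ K * cmod (r n k) <= C" for K by (rule r_decay[of K]) metis
qed

definition conv :: "(int => complex) => int => complex" where "conv g l = (\<Sum>j\<in>{- int N..int N}. bc j * g (l - j))"
definition Yop :: "(int => complex) => int => complex" where "Yop x = conv (%l. of_int \<bar>l\<bar> * x l)"
text \<open>From coefficients in the basis cis (n \<phi>) to coefficients in the basis of
  theta.\<close>

definition toth :: "(int => complex) => int => complex" where "toth y l = (ISUM n. y n * c n l)"
text \<open>The coefficients of b Lambda u in the basis cis (n \<phi>), from those of u in theta;
  the weight 1/b cancels b. Thus \<open>toth\<close> after \<open>toph\<close> is b Lambda in theta,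
  and \<open>toph\<close> after \<open>toth\<close> is the matrix \<open>am\<close>: the nonzero
  spectra of AB and BA agree.\<close>

definition toph :: "(int => complex) => int => complex" where "toph x n = (ISUM l. x l * (of_int \<bar>l\<bar> * cnj (c n l)))"

lemma rapid_conv: "rapid g ==> rapid (conv g)"
 unfolding conv_def[abs_def] by (intro rapid_sum rapid_cmult rapid_shift)

lemma rapid_Yop: "rapid x ==> rapid (Yop x)"
 unfolding Yop_def by (intro rapid_conv rapid_int(2))

lemma Fs_conv: assumes g: "rapid g" shows "of_real (b t) * Fs g t = Fs (conv g) t"
proof -
 have "((%l. bc j * g (l - j) * cis (of_int l * t)) has_sum bc j * cis (of_int j * t) * Fs g t) UNIV" for j
 proof -
  have "((%n. bc j * cis (of_int j * t) * (g n * cis (of_int n * t))) has_sum bc j * cis (of_int j * t) * Fs g t) UNIV"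
   unfolding Fs_def by (intro has_sum_cmult_right has_sum_infsum Fs_summable g)
  moreover have "bc j * cis (of_int j * t) * (g n * cis (of_int n * t)) = bc j * g n * cis (of_int (n + j) * t)" for n
  proof -
   have "cis (of_int j * t) * cis (of_int n * t) = cis (of_int (n + j) * t)" by (simp add: cis_mult algebra_simps)
   thus ?thesis by (simp add: mult_ac)
  qed
  ultimately have "((%n. bc j * g n * cis (of_int (n + j) * t)) has_sum bc j * cis (of_int j * t) * Fs g t) UNIV" by simp
  moreover have "bij_betw (%n. n + j) UNIV UNIV" by (rule bij_betwI[of _ _ _ "%l. l - j"]) auto
  from has_sum_reindex_bij_betw[OF this, of "%l. bc j * g (l - j) * cis (of_int l * t)"]
  have "((%n. bc j * g n * cis (of_int (n + j) * t)) has_sum S) UNIV \<longleftrightarrow> ((%l. bc j * g (l - j) * cis (of_int l * t)) has_sum S) UNIV" for S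
   by simp
  ultimately show ?thesis by blast
 qed
 hence "((%l. \<Sum>j\<in>{- int N..int N}. bc j * g (l - j) * cis (of_int l * t)) has_sum (\<Sum>j\<in>{- int N..int N}. bc j * cis (of_int j * t) * Fs g t)) UNIV"
  by (intro has_sum_sum) auto
 hence "Fs (conv g) t = (\<Sum>j\<in>{- int N..int N}. bc j * cis (of_int j * t) * Fs g t)"
  unfolding Fs_def[of "conv g"] conv_def by (intro infsumI) (simp add: sum_distrib_right)
 thus ?thesis by (simp add: b_tp tp_def sum_distrib_right)
qed

lemma rapid_bc: "rapid bc"
 unfolding rapid_def
proof
 fix K
 define C where "C = (\<Sum>k\<in>{- int N..int N}. br k ^ K * cmod (bc k))"
 have "br k ^ K * cmod (bc k) <= C" for k
 proof (cases "\<bar>k\<bar> <= int N")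
  case True
  thus ?thesis unfolding C_def
   by (intro member_le_sum[of k _ "%k. br k ^ K * cmod (bc k)"]) (auto simp: less_imp_le)
 next
  case False
  thus ?thesis using band[of k] by (auto simp: C_def less_imp_le intro!: sum_nonneg)
 qed
 thus "\<exists>C\<ge>0. \<forall>n. br n ^ K * cmod (bc n) <= C"
  by (intro exI[of _ C]) (auto simp: C_def less_imp_le intro!: sum_nonneg)
qed

lemma b_Fs: "of_real (b t) = Fs bc t"
proof -
 have "Fs bc t = (\<Sum>k\<in>{- int N..int N}. bc k * cis (of_int k * t))"
  unfolding Fs_def by (rule infsumI, rule has_sum_finite_neutralI) (auto simp: band)
 thus ?thesis by (simp add: b_tp tp_def)
qed

lemma b_smooth: "circ_smooth b"
 using Fs_smooth[OF rapid_bc] unfolding circ_smooth_c_def b_Fs[symmetric] by simp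

lemma c_kernel: "\<exists>C\<ge>0. \<forall>n l. br l ^ K * cmod (c n l) <= C * br n ^ (K + 1)"
proof -
 obtain C where C: "C >= 0" "!!n l. br l ^ K * cmod (c n l) <= C * br n ^ K" using c_poly by blast
 have "C * br n ^ K <= C * br n ^ (K + 1)" for n
  using C br_ge1[of n] by (intro mult_left_mono power_increasing) auto
 thus ?thesis using C by (meson order_trans)
qed

lemma c_kernel2: "\<exists>C\<ge>0. \<forall>l n. br n ^ K * cmod (of_int \<bar>l\<bar> * cnj (c n l)) <= C * br l ^ (K + 1)"
proof -
 obtain C where C: "C >= 0" "!!n l. br n ^ K * cmod (c n l) <= C * br l ^ K" using c_poly_n by blast
 have "br n ^ K * cmod (of_int \<bar>l\<bar> * cnj (c n l)) <= C * br l ^ (K + 1)" for n l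
 proof -
  have "br n ^ K * cmod (of_int \<bar>l\<bar> * cnj (c n l)) = \<bar>real_of_int l\<bar> * (br n ^ K * cmod (c n l))" by (simp add: norm_mult)
  also have "... <= br l * (C * br l ^ K)" by (intro mult_mono[OF br_abs_le C(2)]) (auto simp: less_imp_le)
  finally show ?thesis by (simp add: mult_ac)
 qed
 thus ?thesis using C by blast
qed

lemma rapid_toth: "rapid y ==> rapid (toth y)"
 unfolding toth_def[abs_def] by (rule rapid_kernel(1)[OF _ c_kernel])

lemma rapid_toph: "rapid x ==> rapid (toph x)"
 unfolding toph_def[abs_def] by (rule rapid_kernel(1)[OF _ c_kernel2])

lemma toth_summable: "rapid y ==> (%n. y n * c n l) summable_on UNIV"
 by (rule abs_summable_summable[OF rapid_kernel(2)[OF _ c_kernel]])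

lemma toph_summable: "rapid x ==> (%l. x l * (of_int \<bar>l\<bar> * cnj (c n l))) summable_on UNIV"
 by (rule abs_summable_summable[OF rapid_kernel(2)[OF _ c_kernel2]])

lemma toth_cmult: "toth (%n. z * y n) l = z * toth y l"
 unfolding toth_def mult.assoc by (rule infsum_cmult_right')

lemma toph_cmult: "toph (%n. z * x n) l = z * toph x l"
 unfolding toph_def mult.assoc by (rule infsum_cmult_right')

lemma toth_sum: "finite X ==> (!!i. i \<in> X ==> rapid (y i)) ==> toth (%n. \<Sum>i\<in>X. y i n) l = (\<Sum>i\<in>X. toth (y i) l)"
 unfolding toth_def sum_distrib_right by (intro infsumI has_sum_sum has_sum_infsum toth_summable) auto

lemma toph_sum: "finite X ==> (!!i. i \<in> X ==> rapid (x i)) ==> toph (%n. \<Sum>i\<in>X. x i n) l = (\<Sum>i\<in>X. toph (x i) l)"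
 unfolding toph_def sum_distrib_right by (intro infsumI has_sum_sum has_sum_infsum toph_summable) auto

lemma toph_toth: assumes y: "rapid y" shows "toph (toth y) n = (ISUM k. am n k * y k)"
proof -
 have "toph (toth y) n = (ISUM l. ISUM k. y k * c k l * (of_int \<bar>l\<bar> * cnj (c n l)))"
  unfolding toph_def toth_def infsum_cmult_left' ..
 also have "... = (ISUM k. ISUM l. y k * c k l * (of_int \<bar>l\<bar> * cnj (c n l)))"
 proof (rule infsum_swap_product[OF c_abs_summable[of n] rapid_abs[OF y]])
  fix l k
  show "cmod (y k * c k l * (of_int \<bar>l\<bar> * cnj (c n l))) <= \<bar>real_of_int l\<bar> * cmod (c n l) * cmod (y k)"
   using mult_left_mono[OF norm_c_le_1[of k l], of "\<bar>real_of_int l\<bar> * cmod (c n l) * cmod (y k)"] by (simp add: norm_mult mult_ac)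
 qed auto
 also have "... = (ISUM k. am n k * y k)"
  unfolding am_def infsum_cmult_left'[symmetric] by (simp add: mult_ac)
 finally show ?thesis .
qed

lemma toth_toph: assumes x: "rapid x" shows "toth (toph x) l = Yop x l"
proof -
 obtain C where C: "C >= 0" "!!n l. br n ^ 2 * cmod (c n l) <= C * br l ^ 2" using c_poly_n[where K=2] by blast
 have "norm (c n l) <= (C * br l ^ 2) / br n ^ 2" for n using C(2)[of n l] by (simp add: field_simps)
 hence cs: "(%n. cmod (c n l)) summable_on UNIV" by (rule summable_br_bound(2))
 have "toth (toph x) l = (ISUM n. ISUM k. x k * (of_int \<bar>k\<bar> * cnj (c n k)) * c n l)"
  unfolding toph_def toth_def infsum_cmult_left' ..
 also have "... = (ISUM k. ISUM n. x k * (of_int \<bar>k\<bar> * cnj (c n k)) * c n l)"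
 proof (rule infsum_swap_product[OF cs rapid_abs[OF rapid_int(2)[OF x]]])
  fix n k
  show "cmod (x k * (of_int \<bar>k\<bar> * cnj (c n k)) * c n l) <= cmod (c n l) * cmod (of_int \<bar>k\<bar> * x k)"
   using mult_left_mono[OF norm_c_le_1[of n k], of "\<bar>real_of_int k\<bar> * cmod (c n l) * cmod (x k)"] by (simp add: norm_mult mult_ac)
 qed auto
 also have "... = (ISUM k. of_int \<bar>k\<bar> * x k * bc (l - k))"
 proof (rule infsum_cong)
  fix k
  have "((%n. of_int \<bar>k\<bar> * x k * (c n l * cnj (c n k))) has_sum of_int \<bar>k\<bar> * x k * bc (l - k)) UNIV"
   by (intro has_sum_cmult_right c_completeness)
  thus "(ISUM n. x k * (of_int \<bar>k\<bar> * cnj (c n k)) * c n l) = of_int \<bar>k\<bar> * x k * bc (l - k)"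
   by (intro infsumI) (simp add: mult_ac)
 qed
 also have "... = (ISUM j. of_int \<bar>l - j\<bar> * x (l - j) * bc j)"
  by (rule infsum_reindex_bij_witness[of _ "%j. l - j" "%j. l - j"]) auto
 also have "... = (\<Sum>j\<in>{- int N..int N}. of_int \<bar>l - j\<bar> * x (l - j) * bc j)"
  by (rule infsumI, rule has_sum_finite_neutralI) (auto simp: band)
 finally show ?thesis by (simp add: Yop_def conv_def mult_ac)
qed

lemma rapid_VV: "rapid y ==> y \<in> VV" using rapid_l2 by (simp add: VV_def)

lemma ry_summable: assumes y: "rapid y" shows "(%k. r n k * y k) summable_on UNIV"
proof -
 obtain C where C: "C >= 0" "!!n k. br n ^ 0 * br k ^ 0 * cmod (r n k) <= C" using r_decay[of 0] by blast
 have "rapid (%k. r n k * y k)" by (rule rapid_mult[OF y, of _ C 0]) (use C in auto)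
 thus ?thesis by (rule abs_summable_summable[OF rapid_abs])
qed

lemma am_split: assumes y: "rapid y" shows "(ISUM k. am n k * y k) = of_int \<bar>n\<bar> * y n + (ISUM k. r n k * y k)"
proof -
 have h: "((%k. (if n = k then of_int \<bar>n\<bar> else 0) * y k) has_sum of_int \<bar>n\<bar> * y n) UNIV"
  by (rule has_sum_finite_neutralI[of "{n}"]) auto
 have "((%k. (if n = k then of_int \<bar>n\<bar> else 0) * y k + r n k * y k) has_sum (of_int \<bar>n\<bar> * y n + (ISUM k. r n k * y k))) UNIV"
  by (intro has_sum_add h has_sum_infsum ry_summable y)
 thus ?thesis by (intro infsumI) (simp add: am_r algebra_simps)
qed

lemma GG_A:
 assumes y: "rapid y" and w: "w \<in> VV"
 shows "GG (toph (toth y)) w = LL y w + RR y w"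
proof -
 have yV: "y \<in> VV" by (rule rapid_VV[OF y])
 have "RR y w = (ISUM n. ISUM k. r n k * y k * cnj (w n))"
  unfolding RR_def using infsum_Sigma'_banach[of "%n k. r n k * y k * cnj (w n)" UNIV "%_. UNIV"] RR_sum[OF yV w] by simp
 moreover have "(%n. ISUM k. r n k * y k * cnj (w n)) summable_on UNIV"
  using summable_on_Sigma_banach[of "%n k. r n k * y k * cnj (w n)" UNIV "%_. UNIV"] RR_sum[OF yV w] by simp
 ultimately have "LL y w + RR y w = (ISUM n. of_int \<bar>n\<bar> * (y n * cnj (w n)) + (ISUM k. r n k * y k * cnj (w n)))"
  unfolding LL_def by (subst infsum_add) (auto intro!: LL_sum yV w)
 also have "... = GG (toph (toth y)) w"
  unfolding GG_def toph_toth[OF y] am_split[OF y] infsum_cmult_left' by (simp add: algebra_simps)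
 finally show ?thesis by simp
qed

lemma eig_form:
 assumes y: "rapid y" and ev: "!!n. toph (toth y) n = \<mu> * y n" and w: "w \<in> VV"
 shows "LL y w + RR y w = \<mu> * GG y w"
 using GG_A[OF y w] unfolding GG_def ev mult.assoc infsum_cmult_right' by simp

text \<open>Conjugation by b^(1/2): v = b^(1/2) u turns the equation for b^(1/2) Lambda b^(1/2) into
  b Lambda v = lam v, which is \<open>Yop\<close> on the coefficients of v.\<close>

lemma eigenfun_coeffs:
 assumes e: "is_eigenfun b lam u"
 defines "x \<equiv> fourier (%x. of_real (sqrt (b x)) * u x)"
 shows "rapid x" "Yop x l = of_real lam * x l" "of_real (sqrt (b t)) * u t = Fs x t"
proof -
 define v where "v = (%x. complex_of_real (sqrt (b x)) * u x)"
 have "circ_smooth_c (%x. of_real (b x powr (1/2)) * u x)"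
  using e unfolding is_eigenfun_def by (intro circ_smooth_c_powr_mult b_smooth b_pos) auto
 hence v: "circ_smooth_c v" unfolding v_def using b_pos by (simp add: powr_half_sqrt less_imp_le)
 show rx: "rapid x" unfolding x_def v_def[symmetric] by (rule rapid_fourier[OF v])
 have vF: "v t = Fs x t" for t unfolding x_def v_def[symmetric] by (rule Fs_inversion[OF v])
 thus "of_real (sqrt (b t)) * u t = Fs x t" by (simp add: v_def)
 have "of_real (sqrt (b t)) * Lam v t = of_real lam * u t" for t
  using e unfolding is_eigenfun_def v_def by blast
 note L = this
 have "of_real (b t) * Lam v t = of_real lam * v t" for t
 proof -
  have "complex_of_real (sqrt (b t)) * of_real (sqrt (b t)) = of_real (b t)" using b_pos[of t] by (simp flip: of_real_mult)
  hence "of_real (b t) * Lam v t = of_real (sqrt (b t)) * (of_real (sqrt (b t)) * Lam v t)" by (metis mult.assoc)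
  also have "... = of_real lam * v t" unfolding L unfolding v_def by (simp add: mult_ac)
  finally show ?thesis .
 qed
 hence "Fs (Yop x) t = Fs (%n. of_real lam * x n) t" for t
  unfolding Lam_eq v_def x_def[symmetric]
  using Fs_conv[OF rapid_int(2)[OF rx], of t] vF[of t] unfolding v_def
  by (simp add: Yop_def Fs_def mult.assoc infsum_cmult_right')
 hence "Fs (Yop x) = Fs (%n. of_real lam * x n)" by (rule ext)
 hence "fourier (Fs (Yop x)) l = fourier (Fs (%n. of_real lam * x n)) l" by (rule arg_cong)
 thus "Yop x l = of_real lam * x l" using rx by (simp add: fourier_Fs rapid_Yop rapid_cmult)
qed

definition efun :: "(int => complex) => real => complex" where "efun x t = of_real (b t powr (-1/2)) * Fs x t"

lemma efun_sqrt: "of_real (sqrt (b t)) * efun x t = Fs x t"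
proof -
 have "sqrt (b t) * b t powr (-1/2) = 1"
  using b_pos[of t] by (simp add: powr_half_sqrt[symmetric] less_imp_le flip: powr_add)
 thus ?thesis unfolding efun_def mult.assoc[symmetric] by (simp flip: of_real_mult)
qed

lemma efun_eigenfun:
 assumes x: "rapid x" and Y: "!!l. Yop x l = of_real lam * x l"
 shows "is_eigenfun b lam (efun x)"
 unfolding is_eigenfun_def efun_sqrt
proof (intro conjI allI)
 show "circ_smooth_c (efun x)"
  unfolding efun_def[abs_def] by (intro circ_smooth_c_powr_mult b_smooth b_pos Fs_smooth x)
 fix t
 have "of_real (b t) * Lam (Fs x) t = Fs (Yop x) t"
  unfolding Lam_eq fourier_Fs[OF x] Yop_def by (rule Fs_conv[OF rapid_int(2)[OF x]])
 also have "... = of_real lam * Fs x t" unfolding Fs_def Y mult.assoc by (rule infsum_cmult_right')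
 also have "... = of_real (sqrt (b t)) * (of_real lam * efun x t)" unfolding efun_sqrt[symmetric] by (simp add: mult_ac)
 finally have "of_real (sqrt (b t)) * (of_real (sqrt (b t)) * Lam (Fs x) t) = of_real (sqrt (b t)) * (of_real lam * efun x t)"
  using b_pos[of t] by (simp flip: mult.assoc of_real_mult)
 thus "of_real (sqrt (b t)) * Lam (Fs x) t = of_real lam * efun x t" using b_pos[of t] by simp
qed

end

text \<open>Gaussian elimination of one equation per step, pivoting on a nonzero entry. It supplies
  the dimension count behind the upper bound for multiplicities.\<close>

lemma linear_system_nontrivial:
 fixes M :: "'a => 'b => complex"
 assumes "finite J" "finite I" "card J < card I"
 shows "\<exists>z. (\<exists>i\<in>I. z i \<noteq> 0) \<and> (\<forall>j\<in>J. (\<Sum>i\<in>I. z i * M i j) = 0)"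
 using assms
proof (induction J arbitrary: I M rule: finite_induct)
 case empty
 hence "I \<noteq> {}" by auto
 thus ?case by (intro exI[of _ "%_. 1"]) auto
next
 case (insert j0 J)
 show ?case
 proof (cases "\<forall>i\<in>I. M i j0 = 0")
  case True
  have "card J < card I" using insert by simp
  from insert.IH[OF \<open>finite I\<close> this, of M] True show ?thesis by auto
 next
  case False
  then obtain i0 where i0: "i0 \<in> I" "M i0 j0 \<noteq> 0" by blast
  let ?I = "I - {i0}"
  define M' where "M' i j = M i j - M i j0 / M i0 j0 * M i0 j" for i j
  have "card J < card ?I" using insert i0 by simp
  from insert.IH[OF _ this, of M'] insert.prems obtain z where z: "\<exists>i\<in>?I. z i \<noteq> 0" "\<forall>j\<in>J. (\<Sum>i\<in>?I. z i * M' i j) = 0" by auto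
  define w where "w = - (\<Sum>i\<in>?I. z i * M i j0) / M i0 j0"
  define z' where "z' i = (if i = i0 then w else z i)" for i
  have s: "(\<Sum>i\<in>I. z' i * M i j) = w * M i0 j + (\<Sum>i\<in>?I. z i * M i j)" for j
   using insert.prems i0 by (subst sum.remove[of I i0]) (auto simp: z'_def intro!: sum.cong)
  have "(\<Sum>i\<in>?I. z i * M' i j) = (\<Sum>i\<in>?I. z i * M i j) + w * M i0 j" for j
   by (simp add: M'_def w_def algebra_simps sum_subtractf sum_distrib_left sum_distrib_right sum_divide_distrib)
  hence "(\<Sum>i\<in>I. z' i * M i j) = 0" if "j \<in> J" for j using z(2) that s by (metis add.commute)
  moreover have "(\<Sum>i\<in>I. z' i * M i j0) = 0" using i0 by (simp add: s w_def)
  moreover have "\<exists>i\<in>I. z' i \<noteq> 0" using z(1) by (auto simp: z'_def)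
  ultimately show ?thesis by auto
 qed
qed

text \<open>Names the eigenbasis whose existence \<open>eigenbasis\<close> proves, so that zeta can
  be computed with it; \<open>eig_exists\<close> instantiates the locale for every
  \<open>b\<close>.\<close>

locale trig_eig = trig1 +
 fixes \<psi> :: "nat => int => complex" and lam :: "nat => real"
 assumes psi_form: "!!j v. v \<in> VV ==> LL v (\<psi> j) + RR v (\<psi> j) = of_real (lam j) * GG v (\<psi> j)"
  and psi_rapid: "!!j. rapid (\<psi> j)"
  and psi_eig: "!!j n. of_real (lam j - of_int \<bar>n\<bar>) * \<psi> j n = (ISUM k. r n k * \<psi> j k)"
  and psi_on: "!!i j. ((%n. \<psi> i n * cnj (\<psi> j n)) has_sum (if i = j then 1 else 0)) UNIV"
  and lam_top: "filterlim lam at_top sequentially"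
  and psi_parseval: "!!f. (%n. br n * (cmod (f n))\<^sup>2) summable_on UNIV ==>
   (%j. (cmod (ISUM n. f n * cnj (\<psi> j n)))\<^sup>2) sums (ISUM n. (cmod (f n))\<^sup>2)"
begin

lemma psi_A: "toph (toth (\<psi> j)) n = of_real (lam j) * \<psi> j n"
 using toph_toth[OF psi_rapid, of j n] am_split[OF psi_rapid, of n j] psi_eig[of j n] by (simp add: algebra_simps del: of_int_abs)

lemma zero_of_orth:
 assumes y: "rapid y" and "!!j. (ISUM n. y n * cnj (\<psi> j n)) = 0"
 shows "y n = 0"
proof -
 have "(%j::nat. 0) sums (ISUM n. (cmod (y n))\<^sup>2)" using psi_parseval[OF rapid_l2[OF y]] assms(2) by simp
 hence "(ISUM n. (cmod (y n))\<^sup>2) = 0" using sums_unique2 sums_zero by blast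
 moreover have "((%n. (cmod (y n))\<^sup>2) has_sum (ISUM n. (cmod (y n))\<^sup>2)) UNIV"
  using has_sum_imp_summable[OF GG_norm[OF rapid_VV[OF y]]] by (rule has_sum_infsum)
 ultimately have "(cmod (y n))\<^sup>2 = 0" using nonneg_has_sum_le_0D[of "%n. (cmod (y n))\<^sup>2" UNIV 0 n] by simp
 thus ?thesis by simp
qed

lemma eig_orth:
 assumes y: "rapid y" and ev: "!!n. toph (toth y) n = of_real \<mu> * y n" and "lam j \<noteq> \<mu>"
 shows "(ISUM n. y n * cnj (\<psi> j n)) = 0"
proof -
 have "of_real \<mu> * GG y (\<psi> j) = of_real (lam j) * GG y (\<psi> j)"
  using eig_form[OF y ev rapid_VV[OF psi_rapid[of j]]] psi_form[OF rapid_VV[OF y], of j] by metis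
 thus ?thesis using assms(3) by (auto simp: GG_def)
qed

lemma psi_Yop: "Yop (toth (\<psi> j)) l = of_real (lam j) * toth (\<psi> j) l"
 using toth_toph[OF rapid_toth[OF psi_rapid], of j l] unfolding psi_A[abs_def] toth_cmult by simp

text \<open>Passing from BA to AB: y = \<open>toph x\<close> / mu is an eigenvector of
  \<open>toph\<close> after \<open>toth\<close> and is mapped back to x. This is where mu must be
  nonzero.\<close>

lemma eigenfun_phi:
 assumes e: "is_eigenfun b \<mu> u" and mu: "\<mu> > 0"
 obtains y where "rapid y" "!!n. toph (toth y) n = of_real \<mu> * y n" "!!t. of_real (sqrt (b t)) * u t = Fs (toth y) t"
proof -
 define x where "x = fourier (%x. of_real (sqrt (b x)) * u x)"
 note x = eigenfun_coeffs[OF e, folded x_def]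
 define y where "y n = of_real (1 / \<mu>) * toph x n" for n
 have ry: "rapid y" unfolding y_def by (intro rapid_cmult rapid_toph x)
 have ty: "toth y = x"
 proof
  fix l
  have "toth y l = of_real (1 / \<mu>) * toth (toph x) l" unfolding y_def[abs_def] by (rule toth_cmult)
  thus "toth y l = x l" using toth_toph[OF x(1), of l] x(2)[of l] mu by simp
 qed
 have "toph (toth y) n = of_real \<mu> * y n" for n unfolding ty y_def using mu by simp
 thus thesis using that[OF ry] x(3) ty by simp
qed

lemma b_sqrt_nz: "complex_of_real (sqrt (b t)) \<noteq> 0" using b_pos[of t] by simp

lemma Fs_zero: assumes "rapid x" "!!t. Fs x t = 0" shows "x l = 0"
proof -
 have "Fs x = (%t. 0)" using assms(2) by auto
 thus ?thesis using fourier_Fs[OF assms(1), of l] by (simp add: fourier_cis)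
qed

lemma psi_norm: "\<exists>n. \<psi> j n \<noteq> 0"
proof (rule ccontr)
 assume "\<nexists>n. \<psi> j n \<noteq> 0"
 hence "((%n::int. 0) has_sum (1::complex)) UNIV" using psi_on[of j j] by simp
 thus False using has_sum_unique[OF _ has_sum_0_simp] by fastforce
qed

lemma finite_eig: "finite {j. lam j <= C}"
proof -
 have "eventually (%j. lam j > C) sequentially" using lam_top by (simp add: filterlim_at_top_dense)
 then obtain m where "!!j. j >= m ==> lam j > C" unfolding eventually_sequentially by blast
 hence "{j. lam j <= C} \<subseteq> {..<m}" by (metis (no_types, lifting) lessThan_iff linorder_not_le mem_Collect_eq subsetI)
 thus ?thesis by (rule finite_subset) auto
qed

lemma finite_eigspace: "finite {j. lam j = \<mu>}"
 by (rule finite_subset[OF _ finite_eig[of \<mu>]]) auto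

lemma lincomb_zero:
 assumes "finite J" and z: "!!n. (\<Sum>j\<in>J. z j * \<psi> j n) = 0" and "i \<in> J"
 shows "z i = 0"
proof -
 have "((%n. \<Sum>j\<in>J. z j * (\<psi> j n * cnj (\<psi> i n))) has_sum (\<Sum>j\<in>J. z j * (if j = i then 1 else 0))) UNIV"
  by (intro has_sum_sum has_sum_cmult_right psi_on assms)
 moreover have "(\<Sum>j\<in>J. z j * (\<psi> j n * cnj (\<psi> i n))) = 0" for n
  using z[of n] by (metis (no_types, lifting) mult.assoc mult_zero_left sum.cong sum_distrib_right)
 ultimately have "((%n::int. 0) has_sum z i) UNIV" using assms by (simp add: if_distrib sum.delta cong: if_cong)
 thus ?thesis using has_sum_0_simp has_sum_unique by blast
qed

text \<open>The greatest size is attained by the eigenfunctions built from the \<psi> j with lam j =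
  mu. More eigenfunctions than that admit a nontrivial combination orthogonal to those \<psi> j; it
  is orthogonal to all others automatically, so completeness makes it zero.\<close>

lemma eig_mult_eq: assumes mu: "\<mu> > 0" shows "eig_mult b \<mu> = card {j. lam j = \<mu>}"
 unfolding eig_mult_def
proof (rule Greatest_equality)
 let ?J = "{j. lam j = \<mu>}"
 obtain f where f: "bij_betw f {..<card ?J} ?J"
  using ex_bij_betw_nat_finite[OF finite_eigspace[of \<mu>]] by (auto simp: atLeast0LessThan)
 define u where "u i = efun (toth (\<psi> (f i)))" for i
 have "is_eigenfun b \<mu> (u i)" if "i < card ?J" for i
 proof -
  have "lam (f i) = \<mu>" using f that by (auto simp: bij_betw_def)
  thus ?thesis unfolding u_def using psi_Yop[of "f i"] by (intro efun_eigenfun rapid_toth psi_rapid) auto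
 qed
 moreover have "lin_indep_fam (card ?J) u"
  unfolding lin_indep_fam_def
 proof (intro allI impI)
  fix z i assume z: "\<forall>t. (\<Sum>i<card ?J. z i * u i t) = 0" and i: "i < card ?J"
  define y where "y n = (\<Sum>i<card ?J. z i * \<psi> (f i) n)" for n
  have ry: "rapid y" unfolding y_def[abs_def] by (intro rapid_sum rapid_cmult psi_rapid)
  have ty: "toth y l = (\<Sum>i<card ?J. z i * toth (\<psi> (f i)) l)" for l
   unfolding y_def[abs_def] by (subst toth_sum) (auto simp: toth_cmult intro: rapid_cmult psi_rapid)
  have "Fs (toth y) t = (\<Sum>i<card ?J. z i * Fs (toth (\<psi> (f i))) t)" for t
   unfolding Fs_def ty sum_distrib_right
   by (intro infsumI has_sum_sum) (auto simp: mult.assoc intro!: has_sum_cmult_right has_sum_infsum Fs_summable rapid_toth psi_rapid)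
  also have "... t = of_real (sqrt (b t)) * (\<Sum>i<card ?J. z i * u i t)" for t
   unfolding u_def sum_distrib_left efun_sqrt[symmetric] by (simp add: mult_ac)
  finally have "Fs (toth y) t = 0" for t using z by simp
  hence "toth y l = 0" for l using Fs_zero[OF rapid_toth[OF ry]] by blast
  hence "toth y = (%l. 0)" by auto
  hence t0: "toph (toth y) n = 0" for n by (simp add: toph_def)
  have "toph (toth y) n = of_real \<mu> * y n" for n
  proof -
   have "toph (toth y) n = (\<Sum>i<card ?J. z i * toph (toth (\<psi> (f i))) n)"
    unfolding ty[abs_def] by (subst toph_sum) (auto simp: toph_cmult intro: rapid_cmult rapid_toth psi_rapid)
   also have "... = (\<Sum>i<card ?J. z i * (of_real \<mu> * \<psi> (f i) n))"
    unfolding psi_A using f by (intro sum.cong) (auto simp: bij_betw_def)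
   finally show ?thesis by (simp add: y_def sum_distrib_left mult_ac)
  qed
  hence y0: "y n = 0" for n using t0 mu by simp
  define g where "g = inv_into {..<card ?J} f"
  have gf: "g (f i) = i" if "i < card ?J" for i unfolding g_def using f that by (intro inv_into_f_f) (auto simp: bij_betw_def)
  have "(\<Sum>j\<in>?J. z (g j) * \<psi> j n) = 0" for n
  proof -
   have "(\<Sum>j\<in>?J. z (g j) * \<psi> j n) = (\<Sum>i<card ?J. z (g (f i)) * \<psi> (f i) n)" by (rule sum.reindex_bij_betw[OF f, symmetric])
   thus ?thesis using y0[of n] by (simp add: y_def gf)
  qed
  from lincomb_zero[OF finite_eigspace this, of "f i"] show "z i = 0" using gf[OF i] f i by (auto simp: bij_betw_def)
 qed
 ultimately show "\<exists>u. (\<forall>i<card ?J. is_eigenfun b \<mu> (u i)) \<and> lin_indep_fam (card ?J) u" by blast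
next
 let ?J = "{j. lam j = \<mu>}"
 fix n assume "\<exists>u. (\<forall>i<n. is_eigenfun b \<mu> (u i)) \<and> lin_indep_fam n u"
 then obtain u where u: "!!i. i < n ==> is_eigenfun b \<mu> (u i)" "lin_indep_fam n u" by blast
 show "n <= card ?J"
 proof (rule ccontr)
  assume "\<not> n <= card ?J"
  hence lt: "card ?J < card {..<n}" by simp
  have "\<exists>y. rapid y \<and> (\<forall>n. toph (toth y) n = of_real \<mu> * y n) \<and> (\<forall>t. of_real (sqrt (b t)) * u i t = Fs (toth y) t)" if "i < n" for i
   using eigenfun_phi[OF u(1)[OF that] mu] by metis
  then obtain y where y: "!!i. i < n ==> rapid (y i)" "!!i m. i < n ==> toph (toth (y i)) m = of_real \<mu> * y i m"
   "!!i t. i < n ==> of_real (sqrt (b t)) * u i t = Fs (toth (y i)) t" by metis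
  obtain z where z: "\<exists>i\<in>{..<n}. z i \<noteq> 0" "\<forall>j\<in>?J. (\<Sum>i\<in>{..<n}. z i * GG (y i) (\<psi> j)) = 0"
   using linear_system_nontrivial[OF finite_eigspace finite_lessThan lt, of "%i j. GG (y i) (\<psi> j)"] by blast
  define Y where "Y m = (\<Sum>i<n. z i * y i m)" for m
  have rY: "rapid Y" unfolding Y_def[abs_def] using y(1) by (intro rapid_sum rapid_cmult) auto
  have "(ISUM m. Y m * cnj (\<psi> j m)) = (\<Sum>i<n. z i * GG (y i) (\<psi> j))" for j
   unfolding Y_def sum_distrib_right GG_def
   by (intro infsumI has_sum_sum) (auto simp: mult.assoc intro!: has_sum_cmult_right has_sum_infsum GG_sum rapid_VV y psi_rapid)
  moreover have "(\<Sum>i<n. z i * GG (y i) (\<psi> j)) = 0" for j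
  proof (cases "lam j = \<mu>")
   case True
   thus ?thesis using z(2) by auto
  next
   case False
   thus ?thesis using eig_orth[of "y i" \<mu> j for i] y by (simp add: GG_def)
  qed
  ultimately have "Y m = 0" for m using zero_of_orth[OF rY] by simp
  hence "toth Y l = 0" for l by (simp add: toth_def)
  moreover have "toth Y l = (\<Sum>i<n. z i * toth (y i) l)" for l
   unfolding Y_def[abs_def] by (subst toth_sum) (auto simp: toth_cmult intro: rapid_cmult y)
  ultimately have t0: "(\<Sum>i<n. z i * toth (y i) l) = 0" for l by simp
  have "of_real (sqrt (b t)) * (\<Sum>i<n. z i * u i t) = 0" for t
  proof -
   have "of_real (sqrt (b t)) * (\<Sum>i<n. z i * u i t) = (\<Sum>i<n. z i * Fs (toth (y i)) t)"
    unfolding sum_distrib_left using y(3) by (intro sum.cong refl) (simp add: mult.left_commute)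
   also have "... = (ISUM l. \<Sum>i<n. z i * (toth (y i) l * cis (of_int l * t)))"
    unfolding Fs_def by (intro infsumI[symmetric] has_sum_sum) (auto intro!: has_sum_cmult_right has_sum_infsum Fs_summable rapid_toth y)
   also have "... = (ISUM l. (\<Sum>i<n. z i * toth (y i) l) * cis (of_int l * t))" by (simp add: sum_distrib_right mult.assoc)
   finally show ?thesis using t0 by simp
  qed
  hence "(\<Sum>i<n. z i * u i t) = 0" for t using b_sqrt_nz[of t] by (metis mult_eq_0_iff)
  hence "\<forall>i<n. z i = 0" using u(2) unfolding lin_indep_fam_def by blast
  thus False using z(1) by auto
 qed
qed

lemma pos_eigs_eq: "pos_eigs b = {\<mu>. \<mu> > 0 \<and> (\<exists>j. lam j = \<mu>)}"
proof (intro equalityI subsetI; clarsimp simp: pos_eigs_def)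
 fix \<mu> u t assume mu: "\<mu> > 0" and e: "is_eigenfun b \<mu> u" and nz: "u t \<noteq> 0"
 show "\<exists>j. lam j = \<mu>"
 proof (rule ccontr)
  assume no: "\<nexists>j. lam j = \<mu>"
  obtain y where y: "rapid y" "!!n. toph (toth y) n = of_real \<mu> * y n" "!!t. of_real (sqrt (b t)) * u t = Fs (toth y) t"
   using eigenfun_phi[OF e mu] by metis
  have "y n = 0" for n using zero_of_orth[OF y(1)] eig_orth[OF y(1,2)] no by blast
  hence "Fs (toth y) t = 0" by (simp add: toth_def Fs_def)
  thus False using y(3)[of t] b_sqrt_nz[of t] nz by simp
 qed
next
 fix j assume l: "lam j > 0"
 have "is_eigenfun b (lam j) (efun (toth (\<psi> j)))" by (intro efun_eigenfun rapid_toth psi_rapid psi_Yop)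
 moreover have "\<exists>t. efun (toth (\<psi> j)) t \<noteq> 0"
 proof (rule ccontr)
  assume "\<nexists>t. efun (toth (\<psi> j)) t \<noteq> 0"
  hence "Fs (toth (\<psi> j)) t = 0" for t using efun_sqrt[of t "toth (\<psi> j)"] by simp
  hence "toth (\<psi> j) l = 0" for l using Fs_zero[OF rapid_toth[OF psi_rapid]] by blast
  hence "of_real (lam j) * \<psi> j n = 0" for n unfolding psi_A[symmetric] by (simp add: toph_def)
  thus False using psi_norm[of j] l by auto
 qed
 ultimately show "\<exists>u. is_eigenfun b (lam j) u \<and> (\<exists>t. u t \<noteq> 0)" by blast
qed

lemma psi_pos_0: assumes "lam j > 0" shows "\<psi> j 0 = 0"
proof -
 have "toph (toth (\<psi> j)) 0 = 0"
  unfolding toph_def by (rule infsum_0) (simp add: c_0)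
 thus ?thesis using psi_A[of j 0] assms by simp
qed

text \<open>With x = \<open>toth (\<psi> j)\<close>, the energy of x equals lam j, so lam j <= 0
  leaves only the constant mode. Together with \<open>psi_pos_0\<close>, the index 0 and the
  nonpositive eigenvalues split off, and sums over n \<noteq> 0 match sums over positive
  eigenvalues.\<close>

lemma psi_nonpos: assumes l: "lam j <= 0" and n: "n \<noteq> 0" shows "\<psi> j n = 0"
proof -
 define x where "x = toth (\<psi> j)"
 have rx: "rapid x" unfolding x_def by (intro rapid_toth psi_rapid)
 have "((%n. of_real (lam j) * (\<psi> j n * cnj (\<psi> j n))) has_sum of_real (lam j)) UNIV"
  using has_sum_cmult_right[OF psi_on[of j j], of "of_real (lam j)"] by simp
 hence 1: "(ISUM n. toph x n * cnj (\<psi> j n)) = of_real (lam j)"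
  unfolding x_def psi_A by (intro infsumI) (simp add: mult.assoc)
 have "(ISUM n. toph x n * cnj (\<psi> j n)) = (ISUM n. ISUM l. x l * (of_int \<bar>l\<bar> * cnj (c n l)) * cnj (\<psi> j n))"
  unfolding toph_def infsum_cmult_left' ..
 also have "... = (ISUM l. ISUM n. x l * (of_int \<bar>l\<bar> * cnj (c n l)) * cnj (\<psi> j n))"
 proof (rule infsum_swap_product[OF rapid_abs[OF psi_rapid[of j]] rapid_abs[OF rapid_int(2)[OF rx]]])
  fix n l
  show "cmod (x l * (of_int \<bar>l\<bar> * cnj (c n l)) * cnj (\<psi> j n)) <= cmod (\<psi> j n) * cmod (of_int \<bar>l\<bar> * x l)"
   using mult_left_mono[OF norm_c_le_1[of n l], of "\<bar>real_of_int l\<bar> * cmod (\<psi> j n) * cmod (x l)"] by (simp add: norm_mult mult_ac)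
 qed auto
 also have "... = (ISUM l. of_int \<bar>l\<bar> * (x l * cnj (x l)))"
 proof (rule infsum_cong)
  fix l
  have "cnj (x l) = (ISUM n. cnj (\<psi> j n * c n l))" unfolding x_def toth_def infsum_cnj ..
  moreover have "(ISUM n. x l * (of_int \<bar>l\<bar> * cnj (c n l)) * cnj (\<psi> j n)) = (ISUM n. (of_int \<bar>l\<bar> * x l) * cnj (\<psi> j n * c n l))"
   by (simp add: mult_ac)
  ultimately show "(ISUM n. x l * (of_int \<bar>l\<bar> * cnj (c n l)) * cnj (\<psi> j n)) = of_int \<bar>l\<bar> * (x l * cnj (x l))"
   unfolding infsum_cmult_right' by (simp add: mult.assoc)
 qed
 also have "... = LL x x" by (simp add: LL_def)
 \<comment> \<open>All terms |l| |x l|^2 are nonnegative with nonpositive sum, so l x l = 0; pairing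
   with c n l and using orthogonality turns this into n \<psi> j n = 0.\<close>
 finally have "LL x x = of_real (lam j)" using 1 by simp
 hence "((%l. of_int \<bar>l\<bar> * (cmod (x l))\<^sup>2) has_sum lam j) UNIV" using LL_norm[OF rapid_VV[OF rx]] by simp
 hence z: "of_int \<bar>l\<bar> * (cmod (x l))\<^sup>2 = 0" for l using l nonneg_has_sum_le_0D[of "%l. of_int \<bar>l\<bar> * (cmod (x l))\<^sup>2" UNIV "lam j" l] by simp
 have lx: "of_int l * x l = 0" for l using z[of l] by auto
 have "(ISUM l. of_int l * x l * cnj (c n l)) = (ISUM l. ISUM k. \<psi> j k * c k l * (of_int l * cnj (c n l)))"
  unfolding x_def toth_def infsum_cmult_left' by (simp add: mult_ac)
 also have "... = (ISUM k. ISUM l. \<psi> j k * c k l * (of_int l * cnj (c n l)))"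
 proof (rule infsum_swap_product[OF c_abs_summable[of n] rapid_abs[OF psi_rapid[of j]]])
  fix l k
  show "cmod (\<psi> j k * c k l * (of_int l * cnj (c n l))) <= \<bar>real_of_int l\<bar> * cmod (c n l) * cmod (\<psi> j k)"
   using mult_left_mono[OF norm_c_le_1[of k l], of "\<bar>real_of_int l\<bar> * cmod (c n l) * cmod (\<psi> j k)"] by (simp add: norm_mult mult_ac)
 qed auto
 also have "... = (ISUM k. \<psi> j k * (if k = n then of_int k else 0))"
 proof (rule infsum_cong)
  fix k
  have "((%l. \<psi> j k * (of_int l * c k l * cnj (c n l))) has_sum \<psi> j k * (if k = n then of_int k else 0)) UNIV"
   by (intro has_sum_cmult_right c_orthogonality)
  thus "(ISUM l. \<psi> j k * c k l * (of_int l * cnj (c n l))) = \<psi> j k * (if k = n then of_int k else 0)"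
   by (intro infsumI) (simp add: mult_ac)
 qed
 also have "... = \<psi> j n * of_int n" by (subst infsum_single[of n]) auto
 finally show ?thesis using lx n by simp
qed

end

lemma (in trig1) eig_exists: obtains \<psi> lam where "trig_eig N bc b \<phi> \<psi> lam"
proof -
 obtain \<psi> lam where
  "!!j v. v \<in> VV ==> LL v (\<psi> j) + RR v (\<psi> j) = of_real (lam j) * GG v (\<psi> j)"
  "!!j K. \<exists>C\<ge>0. \<forall>n. br n ^ K * cmod (\<psi> j n) <= C"
  "!!j n. of_real (lam j - of_int \<bar>n\<bar>) * \<psi> j n = (ISUM k. r n k * \<psi> j k)"
  "!!i j. ((%n. \<psi> i n * cnj (\<psi> j n)) has_sum (if i = j then 1 else 0)) UNIV"
  "filterlim lam at_top sequentially"
  "!!f. (%n. br n * (cmod (f n))\<^sup>2) summable_on UNIV ==>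
   (%j. (cmod (ISUM n. f n * cnj (\<psi> j n)))\<^sup>2) sums (ISUM n. (cmod (f n))\<^sup>2)"
  by (rule eigenbasis) blast
 hence "trig_eig N bc b \<phi> \<psi> lam" by unfold_locales (auto simp: rapid_def)
 thus thesis by (rule that)
qed

section \<open>Continuation through the alternating series and iterated differences\<close>

section \<open>The Riemann zeta function\<close>

lemma norm_diff_le_deriv:
 fixes f :: "real => complex"
 assumes "x <= y" "!!t. t \<in> {x..y} ==> (f has_vd f' t) (at t within {x..y})" "!!t. t \<in> {x..y} ==> norm (f' t) <= B"
 shows "norm (f y - f x) <= B * (y - x)"
proof -
 have "norm (f y - f x) <= B * norm (y - x)"
 proof (rule differentiable_bound[of "{x..y}" f "%t h. h *\<^sub>R f' t"])
  show "(f has_derivative (%h. h *\<^sub>R f' t)) (at t within {x..y})" if "t \<in> {x..y}" for t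
   using assms(2)[OF that] by (simp add: has_vector_derivative_def)
  show "onorm (%h. h *\<^sub>R f' t) <= B" if "t \<in> {x..y}" for t
   by (rule onorm_le) (metis assms(3)[OF that] mult.commute mult_right_mono norm_ge_zero norm_scaleR real_norm_def)
 qed (use assms(1) in auto)
 thus ?thesis using assms(1) by simp
qed

lemma holomorphic_infsum:
 assumes S: "open S" and hol: "!!x. x \<in> X ==> f x holomorphic_on S"
  and bd: "!!z. z \<in> S ==> \<exists>d M. d > 0 \<and> cball z d \<subseteq> S \<and> M summable_on X \<and> (\<forall>x\<in>X. \<forall>w\<in>cball z d. cmod (f x w) <= M x)"
 shows "(%s. \<Sum>\<^sub>\<infinity>x\<in>X. f x s) holomorphic_on S"
proof -
 have "(%s. \<Sum>\<^sub>\<infinity>x\<in>X. f x s) field_differentiable (at z)" if z: "z \<in> S" for z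
 proof -
  obtain d M where d: "d > 0" "cball z d \<subseteq> S" "M summable_on X" "!!x w. x \<in> X ==> w \<in> cball z d ==> cmod (f x w) <= M x"
   using bd[OF z] by blast
  have u: "uniform_limit (cball z d) (%Y s. \<Sum>x\<in>Y. f x s) (%s. \<Sum>\<^sub>\<infinity>x\<in>X. f x s) (finite_subsets_at_top X)"
   by (rule Weierstrass_m_test_general[OF d(4) d(3)])
  have h: "(%s. \<Sum>x\<in>Y. f x s) holomorphic_on S" if "Y \<subseteq> X" for Y
   using hol that by (intro holomorphic_intros) auto
  have "eventually (%Y. continuous_on (cball z d) (%s. \<Sum>x\<in>Y. f x s) \<and> (%s. \<Sum>x\<in>Y. f x s) holomorphic_on ball z d) (finite_subsets_at_top X)"
  proof (rule eventually_finite_subsets_at_top_weakI)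
   fix Y assume "finite Y" "Y \<subseteq> X"
   thus "continuous_on (cball z d) (%s. \<Sum>x\<in>Y. f x s) \<and> (%s. \<Sum>x\<in>Y. f x s) holomorphic_on ball z d"
    using holomorphic_on_subset[OF h d(2)] holomorphic_on_subset[OF h, of Y "ball z d"] d(2) ball_subset_cball
    by (meson holomorphic_on_imp_continuous_on order_trans)
  qed
  hence "(%s. \<Sum>\<^sub>\<infinity>x\<in>X. f x s) holomorphic_on ball z d"
   using holomorphic_uniform_limit[OF _ u] by auto
  thus ?thesis using d(1) holomorphic_on_imp_differentiable_at[of _ "ball z d"] by (simp add: centre_in_ball)
 qed
 thus ?thesis using holomorphic_on_def field_differentiable_at_within by blast
qed

text \<open>Each difference of x^(-s) gains a factor 1/x by the mean value inequality, so the K-th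
  difference decays like x^(-Re s - K); see \<open>norm_fdif\<close>.\<close>

primrec fdif :: "nat => complex => real => complex" where
 "fdif 0 s x = of_real x powr (- s)"
| "fdif (Suc K) s x = fdif K s x - fdif K s (x + 1)"

lemma has_vector_derivative_powr:
 assumes "x > 0" shows "((%x. complex_of_real x powr s) has_vd s * of_real x powr (s - 1)) (at x within A)"
proof -
 have "((%z. z powr s) has_field_derivative s * of_real x powr (s - 1)) (at (complex_of_real x))"
  using assms by (intro has_field_derivative_powr) (auto simp: complex_nonpos_Reals_iff)
 thus ?thesis by (rule has_vector_derivative_real_field)
qed

lemma fdif_deriv: "x > 0 ==> (fdif K s has_vd (- s) * fdif K (s + 1) x) (at x within A)"
proof (induction K arbitrary: x A)
 case 0
 have "- (s + 1) = - s - 1" by simp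
 thus ?case using has_vector_derivative_powr[OF 0, of "- s" A] by (simp only: fdif.simps(1)[abs_def])
next
 case (Suc K)
 have "((%x. x + 1) has_real_derivative 1) (at x)" by (auto intro!: derivative_eq_intros)
 hence "((%x. x + 1) has_vd 1) (at x)" by (simp add: has_real_derivative_iff_has_vector_derivative)
 hence "((%x. fdif K s (x + 1)) has_vd (- s) * fdif K (s + 1) (x + 1)) (at x)"
  using vector_diff_chain_at[of "%x. x + 1" 1 x "fdif K s" "(- s) * fdif K (s + 1) (x + 1)"] Suc.IH[of "x + 1" UNIV] Suc.prems
  by (simp add: o_def)
 hence "((%x. fdif K s x - fdif K s (x + 1)) has_vd (- s) * fdif K (s + 1) x - (- s) * fdif K (s + 1) (x + 1)) (at x)"
  using Suc by (intro has_vector_derivative_diff) auto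
 moreover have "fdif (Suc K) s = (%x. fdif K s x - fdif K s (x + 1))" by (rule ext) simp
 ultimately have "(fdif (Suc K) s has_vd (- s) * fdif (Suc K) (s + 1) x) (at x)" by (simp add: right_diff_distrib)
 thus ?case by (rule has_vector_derivative_at_within)
qed

lemma norm_fdif: "x >= 1 ==> Re s + real K >= 0 ==> cmod (fdif K s x) <= (\<Prod>i<K. cmod (s + of_nat i)) * x powr (- (Re s + real K))"
proof (induction K arbitrary: s x)
 case 0
 thus ?case by (simp add: norm_powr_real_powr)
next
 case (Suc K)
 have "norm (fdif K s (x + 1) - fdif K s x) <= (cmod s * ((\<Prod>i<K. cmod (s + 1 + of_nat i)) * x powr (- (Re s + 1 + real K)))) * (x + 1 - x)"
 proof (rule norm_diff_le_deriv)
  fix t assume t: "t \<in> {x..x + 1}"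
  show "(fdif K s has_vd (- s) * fdif K (s + 1) t) (at t within {x..x+1})"
   using t Suc.prems by (intro fdif_deriv) auto
  have "cmod (fdif K (s + 1) t) <= (\<Prod>i<K. cmod (s + 1 + of_nat i)) * t powr (- (Re (s + 1) + real K))"
   using t Suc.prems by (intro Suc.IH) auto
  also have "... <= (\<Prod>i<K. cmod (s + 1 + of_nat i)) * x powr (- (Re s + 1 + real K))"
   using t Suc.prems by (intro mult_left_mono prod_nonneg) (auto intro!: powr_mono2')
  finally show "norm ((- s) * fdif K (s + 1) t) <= cmod s * ((\<Prod>i<K. cmod (s + 1 + of_nat i)) * x powr (- (Re s + 1 + real K)))"
   by (simp add: norm_mult mult_left_mono)
 qed simp
 thus ?case
  unfolding prod.lessThan_Suc_shift by (simp add: norm_minus_commute algebra_simps)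
qed

lemma holomorphic_fdif: "x > 0 ==> (%s. fdif K s x) holomorphic_on A"
 by (induction K arbitrary: x) (auto intro!: holomorphic_intros)

lemma summable_powr_nat: assumes "a > 1" shows "(%n::nat. real (Suc n) powr (- a)) summable_on UNIV"
proof -
 have "summable (%n. real (Suc n) powr (- a))"
  using assms by (subst summable_Suc_iff[of "%n. real n powr (- a)"]) (simp add: summable_real_powr_iff)
 thus ?thesis by (subst summable_on_UNIV_nonneg_real_iff) auto
qed

text \<open>The K-fold Euler transform of the alternating series of n^(-s). It converges for Re s >
  1 - K, and K = 0 is the original series.\<close>

definition etaK :: "nat => complex => complex" where
 "etaK K s = (\<Sum>i<K. fdif i s 1 / 2 ^ Suc i) + (ISUM n::nat. (-1) ^ n * fdif K s (real (Suc n))) / 2 ^ K"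

lemma fdif_abs_summable:
 assumes "Re s + real K > 1" shows "(%n::nat. cmod ((-1) ^ n * fdif K s (real (Suc n)))) summable_on UNIV"
proof -
 have "(%n::nat. (\<Prod>i<K. cmod (s + of_nat i)) * real (Suc n) powr (- (Re s + real K))) summable_on UNIV"
  using assms by (intro summable_on_cmult_right summable_powr_nat)
 thus ?thesis
  by (rule summable_on_comparison_test) (use assms norm_fdif[of "real (Suc n)" s K for n] in \<open>auto simp: norm_mult norm_power\<close>)
qed

text \<open>Add the alternating series to its own shift: neighbouring terms combine into one further
  difference, and the first term stays behind as a boundary contribution.\<close>

lemma etaK_Suc: assumes "Re s + real K > 1" shows "etaK (Suc K) s = etaK K s"
proof -
 define a where "a n = (-1) ^ n * fdif K s (real (Suc n))" for n
 have sa: "a summable_on UNIV" unfolding a_def by (rule abs_summable_summable[OF fdif_abs_summable[OF assms]])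
 hence "a sums (ISUM n. a n)" by (intro has_sum_imp_sums) simp
 hence "(%n. a (Suc n)) sums ((ISUM n. a n) - a 0)" by (simp add: sums_Suc_iff)
 from sums_add[OF \<open>a sums (ISUM n. a n)\<close> this]
 have "(%n. a n + a (Suc n)) sums (2 * (ISUM n. a n) - fdif K s 1)" by (simp add: a_def algebra_simps)
 moreover have "a n + a (Suc n) = (-1) ^ n * fdif (Suc K) s (real (Suc n))" for n
  by (simp add: a_def algebra_simps)
 moreover have "(%n. (-1) ^ n * fdif (Suc K) s (real (Suc n))) sums (ISUM n. (-1) ^ n * fdif (Suc K) s (real (Suc n)))"
  using assms by (intro has_sum_imp_sums has_sum_infsum abs_summable_summable[OF fdif_abs_summable]) auto
 ultimately have eq: "(ISUM n. (-1) ^ n * fdif (Suc K) s (real (Suc n))) = 2 * (ISUM n. a n) - fdif K s 1"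
  using sums_unique2 by (metis (no_types, lifting) sums_cong)
 show ?thesis unfolding etaK_def eq unfolding a_def[symmetric] by (simp add: field_simps)
qed

lemma etaK_mono: assumes "K <= L" "Re s + real K > 1" shows "etaK L s = etaK K s"
 using assms(1)
proof (induction L rule: dec_induct)
 case (step n)
 thus ?case using etaK_Suc[of s n] assms(2) by simp
qed simp

lemma holomorphic_etaK: "etaK K holomorphic_on {s. Re s + real K > 1}"
proof -
 have "(%s. ISUM n::nat. (-1) ^ n * fdif K s (real (Suc n))) holomorphic_on {s. Re s + real K > 1}"
 proof (rule holomorphic_infsum)
  have "{s. Re s + real K > 1} = {s. Re s > 1 - real K}" by auto
  thus op: "open {s. Re s + real K > 1}" by (simp add: open_halfspace_Re_gt)
  show "(%s. (-1) ^ n * fdif K s (real (Suc n))) holomorphic_on {s. Re s + real K > 1}" for n :: nat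
   by (intro holomorphic_intros holomorphic_fdif) auto
  fix z assume "z \<in> {s. Re s + real K > 1}"
  hence z: "Re z + real K > 1" by simp
  define d where "d = (Re z + real K - 1) / 2"
  have d: "d > 0" using z by (simp add: d_def)
  have re: "Re w + real K >= 1 + d" if "w \<in> cball z d" for w
  proof -
   have "\<bar>Re (z - w)\<bar> <= d" using that abs_Re_le_cmod[of "z - w"] by (simp add: dist_norm)
   moreover have "Re z + real K = 1 + 2 * d" by (simp add: d_def field_simps)
   ultimately show ?thesis by simp
  qed
  have "continuous_on (cball z d) (%s. \<Prod>i<K. cmod (s + of_nat i))" by (intro continuous_intros)
  from compact_imp_bounded[OF compact_continuous_image[OF this compact_cball]]
  obtain B where BB: "\<forall>y\<in>(%s. \<Prod>i<K. cmod (s + of_nat i)) ` cball z d. norm y <= B" unfolding bounded_iff by (elim exE)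
  have B0: "\<bar>\<Prod>i<K. cmod (w + of_nat i)\<bar> <= B" if "w \<in> cball z d" for w
   using bspec[OF BB imageI[OF that]] unfolding real_norm_def .
  have B: "(\<Prod>i<K. cmod (w + of_nat i)) <= B" if "w \<in> cball z d" for w
   by (rule order_trans[OF abs_ge_self B0[OF that]])
  have "cmod ((-1) ^ n * fdif K w (real (Suc n))) <= B * real (Suc n) powr (- (1 + d))" if w: "w \<in> cball z d" for n w
  proof -
   have "cmod ((-1) ^ n * fdif K w (real (Suc n))) <= (\<Prod>i<K. cmod (w + of_nat i)) * real (Suc n) powr (- (Re w + real K))"
    using norm_fdif[of "real (Suc n)" w K] re[OF w] d by (simp add: norm_mult norm_power)
   also have "... <= B * real (Suc n) powr (- (1 + d))"
    using B[OF w] re[OF w] order_trans[OF abs_ge_zero B0[OF w]] by (intro mult_mono powr_mono) auto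
   finally show ?thesis .
  qed
  moreover have "(%n. B * real (Suc n) powr (- (1 + d))) summable_on UNIV"
   using d by (intro summable_on_cmult_right summable_powr_nat) auto
  moreover have "cball z d \<subseteq> {s. Re s + real K > 1}" using re d by force
  ultimately show "\<exists>d M. d > 0 \<and> cball z d \<subseteq> {s. Re s + real K > 1} \<and> M summable_on UNIV \<and>
    (\<forall>n\<in>UNIV. \<forall>w\<in>cball z d. cmod ((-1) ^ n * fdif K w (real (Suc n))) <= M n)"
   using d by (intro exI[of _ d] exI[of _ "%n. B * real (Suc n) powr (- (1 + d))"] conjI ballI) auto
 qed
 thus ?thesis
  unfolding etaK_def[abs_def] by (intro holomorphic_intros holomorphic_fdif) auto
qed

text \<open>The chosen number of transforms makes Re s + K at least 2, inside the region of
  convergence; \<open>etaK_mono\<close> shows that any admissible K gives the same value.\<close>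

definition etaF :: "complex => complex" where "etaF s = etaK (nat \<lceil>2 - Re s\<rceil>) s"

lemma etaF_eq: assumes "Re s + real K > 1" shows "etaF s = etaK K s"
proof -
 define L where "L = nat \<lceil>2 - Re s\<rceil>"
 have "Re s + real L > 1" unfolding L_def by linarith
 hence "etaK (max K L) s = etaK L s" "etaK (max K L) s = etaK K s" using assms by (auto intro!: etaK_mono)
 thus ?thesis by (simp add: etaF_def L_def)
qed

lemma holomorphic_etaF: "etaF holomorphic_on A"
proof -
 have "etaF field_differentiable (at z)" for z
 proof -
  define K where "K = nat \<lceil>2 - Re z\<rceil>"
  have z: "z \<in> {s. Re s + real K > 1}" unfolding K_def by simp linarith
  have "{s. Re s + real K > 1} = {s. Re s > 1 - real K}" by auto
  hence op: "open {s. Re s + real K > 1}" by (simp add: open_halfspace_Re_gt)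
  have "etaF holomorphic_on {s. Re s + real K > 1}"
   using holomorphic_etaK[of K] by (rule holomorphic_transform) (simp add: etaF_eq)
  thus ?thesis using z op holomorphic_on_imp_differentiable_at by blast
 qed
 thus ?thesis using holomorphic_on_def field_differentiable_at_within by blast
qed

text \<open>The zeta series minus the alternating one keeps twice the terms of the even integers,
  which are 2^(1-s) times the zeta series.\<close>

lemma etaF_zeta:
 assumes s: "Re s > 1"
 shows "((%n::nat. of_real (real (Suc n)) powr (- s)) has_sum (etaF s / (1 - 2 powr (1 - s)))) UNIV" "2 powr (1 - s) \<noteq> 1"
proof -
 define f where "f n = complex_of_real (real (Suc n)) powr (- s)" for n :: nat
 have fa: "(%n. cmod (f n)) summable_on UNIV"
  using summable_powr_nat[OF s] by (simp add: f_def norm_powr_real_powr)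
 have fs: "f summable_on UNIV" by (rule abs_summable_summable[OF fa])
 define Z where "Z = (ISUM n. f n)"
 have Z: "(f has_sum Z) UNIV" unfolding Z_def using fs by simp
 have alt: "((%n. (-1) ^ n * f n) has_sum etaF s) UNIV"
 proof -
  have "(%n. (-1) ^ n * f n) summable_on UNIV"
   by (rule abs_summable_summable) (use fa in \<open>simp add: norm_mult norm_power\<close>)
  moreover have "etaF s = (ISUM n. (-1) ^ n * f n)" using etaF_eq[of s 0] s by (simp add: etaK_def f_def)
  ultimately show ?thesis by simp
 qed
 have d1: "((%n. f n + (- ((-1) ^ n * f n))) has_sum (Z + (- etaF s))) UNIV"
  by (intro has_sum_add Z has_sum_uminusI alt)
 have inj: "inj (%m::nat. 2 * m + 1)" by (auto simp: inj_on_def)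
 have "((%n. f n + (- ((-1) ^ n * f n))) has_sum (Z + (- etaF s))) (range (%m. 2 * m + 1))"
 proof (rule has_sum_cong_neutral[THEN iffD1, OF _ _ _ d1])
  fix n :: nat assume "n \<in> UNIV - range (%m. 2 * m + 1)"
  hence "even n" by (metis DiffD2 oddE rangeI)
  thus "f n + (- ((-1) ^ n * f n)) = 0" by simp
 qed auto
 hence "((%n. f n + (- ((-1) ^ n * f n))) \<circ> (%m. 2 * m + 1) has_sum (Z + (- etaF s))) UNIV"
  by (subst (asm) has_sum_reindex[OF inj])
 moreover have "((%n. f n + (- ((-1) ^ n * f n))) \<circ> (%m. 2 * m + 1)) m = 2 powr (1 - s) * f m" for m
 proof -
  have "complex_of_real (real (Suc (2 * m + 1))) = 2 * of_real (real (Suc m))" by simp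
  hence "f (2 * m + 1) = 2 powr (- s) * f m"
   unfolding f_def using powr_times_real[of 2 "of_real (real (Suc m))" "- s"] by simp
  moreover have "(2::complex) powr (1 - s) = 2 * 2 powr (- s)" by (simp add: powr_diff powr_minus field_simps)
  ultimately show ?thesis by simp
 qed
 ultimately have "((%m. 2 powr (1 - s) * f m) has_sum (Z - etaF s)) UNIV" by (simp add: o_def)
 moreover have "((%m. 2 powr (1 - s) * f m) has_sum (2 powr (1 - s) * Z)) UNIV" by (intro has_sum_cmult_right Z)
 ultimately have eq: "2 powr (1 - s) * Z = Z - etaF s" using has_sum_unique by blast
 show nz: "2 powr (1 - s) \<noteq> 1"
 proof
  assume "2 powr (1 - s) = 1"
  hence "cmod (2 powr (1 - s)) = 1" by simp
  hence "2 powr (1 - Re s) = (1::real)" using norm_powr_real_powr[of 2 "1 - s"] by simp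
  thus False using s by (simp add: powr_eq_one_iff_gen)
 qed
 have "Z = etaF s / (1 - 2 powr (1 - s))" using eq nz by (simp add: field_simps)
 thus "((%n::nat. of_real (real (Suc n)) powr (- s)) has_sum (etaF s / (1 - 2 powr (1 - s)))) UNIV"
  using Z unfolding f_def[abs_def] by simp
qed

text \<open>All zeros of the denominator, including those that \<open>etaF\<close> cancels. The set
  is closed and countable, so removing it keeps open connected sets connected, which is enough for
  unique continuation.\<close>

definition Zpole :: "complex set" where "Zpole = {s. 2 powr (1 - s) = 1}"
definition Zc :: "complex => complex" where "Zc s = etaF s / (1 - 2 powr (1 - s))"

lemma Zpole_Re: assumes "s \<in> Zpole" shows "Re s = 1"
proof -
 have "cmod (2 powr (1 - s)) = 1" using assms by (simp add: Zpole_def)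
 hence "2 powr (1 - Re s) = (1::real)" using norm_powr_real_powr[of 2 "1 - s"] by simp
 thus ?thesis by (simp add: powr_eq_one_iff_gen)
qed

lemma Zpole_closed: "closed Zpole"
proof -
 have "continuous_on UNIV (%s::complex. 2 powr (1 - s))" by (intro continuous_intros) auto
 thus ?thesis unfolding Zpole_def using continuous_closed_preimage_constant[of UNIV "%s::complex. 2 powr (1 - s)" 1] by simp
qed

lemma Zpole_countable: "countable Zpole"
proof -
 have "Zpole \<subseteq> range (%n::int. 1 - of_real (2 * of_int n * pi / ln 2) * \<i>)"
 proof
  fix s assume s: "s \<in> Zpole"
  have "Ln 2 = complex_of_real (ln 2)" using Ln_of_real[of 2] by simp
  with s have "exp ((1 - s) * of_real (ln 2)) = 1" by (simp add: Zpole_def powr_def)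
  then obtain n :: int where n: "Im ((1 - s) * of_real (ln 2)) = of_int (2 * n) * pi" using exp_eq_1 by blast
  hence "Im s = - (2 * of_int n * pi / ln 2)" by (simp add: field_simps)
  hence "s = 1 - of_real (2 * of_int n * pi / ln 2) * \<i>" using Zpole_Re[OF s] by (intro complex_eqI) auto
  thus "s \<in> range (%n::int. 1 - of_real (2 * of_int n * pi / ln 2) * \<i>)" by blast
 qed
 thus ?thesis by (rule countable_subset) auto
qed

lemma holomorphic_Zc: "Zc holomorphic_on (- Zpole)"
 unfolding Zc_def[abs_def] by (intro holomorphic_intros holomorphic_etaF) (auto simp: Zpole_def)

lemma zeta_int_has_sum:
 assumes s: "Re s > 1"
 shows "((%n::int. of_real \<bar>of_int n\<bar> powr (- s)) has_sum 2 * Zc s) {n. n \<noteq> 0}"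
  "(%n::int. cmod (of_real \<bar>of_int n\<bar> powr (- s))) summable_on {n. n \<noteq> 0}"
proof -
 let ?g = "%n::int. complex_of_real \<bar>of_int n\<bar> powr (- s)"
 have h: "((%n::nat. of_real (real (Suc n)) powr (- s)) has_sum Zc s) UNIV" using etaF_zeta[OF s] by (simp add: Zc_def)
 have 1: "(?g has_sum Zc s) (range (%n. int (Suc n)))"
  using h by (subst has_sum_reindex) (auto simp: inj_on_def o_def add.commute)
 have 2: "(?g has_sum Zc s) (range (%n. - int (Suc n)))"
  using h by (subst has_sum_reindex) (auto simp: inj_on_def o_def add.commute)
 have d: "range (%n. int (Suc n)) \<inter> range (%n. - int (Suc n)) = {}" by auto
 have u: "range (%n. int (Suc n)) \<union> range (%n. - int (Suc n)) = {n. n \<noteq> 0}"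
 proof (intro equalityI subsetI)
  fix n :: int assume "n \<in> {n. n \<noteq> 0}"
  thus "n \<in> range (%n. int (Suc n)) \<union> range (%n. - int (Suc n))"
   by (cases n rule: int_cases3) (auto simp: image_iff gr0_conv_Suc)
 qed auto
 show hs: "(?g has_sum 2 * Zc s) {n. n \<noteq> 0}" using has_sum_Un_disjoint[OF 1 2 d] unfolding u by simp
 show "(%n::int. cmod (?g n)) summable_on {n. n \<noteq> 0}"
  by (rule iffD1[OF summable_on_iff_abs_summable_on_complex has_sum_imp_summable[OF hs]])
qed

section \<open>The entire correction obtained from the doubly stochastic weights\<close>

section \<open>The zeta function of a positive trigonometric polynomial\<close>

text \<open>Mean value inequality for x^(-s) with one constant for all |s| <= K: the powers of 1 + x
  and 1 + y handle growth, the lower bound x0 handles negative exponents.\<close>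

lemma powr_diff_bound:
 assumes x0: "0 < x0" "x0 <= 1" and x: "x >= x0" and y: "y >= x0" and s: "cmod s <= real K"
 shows "cmod (of_real x powr (- s) - of_real y powr (- s)) <= real K * (1 + (1 / x0) ^ (K + 1)) * (\<bar>x - y\<bar> * ((1 + x) ^ K * (1 + y) ^ K))"
proof -
 have *: "cmod (of_real y powr (- s) - of_real x powr (- s)) <= real K * (1 + (1 / x0) ^ (K + 1)) * ((1 + x) ^ K * (1 + y) ^ K) * (y - x)"
  if xy: "x0 <= x" "x <= y" for x y
 proof (rule norm_diff_le_deriv)
  fix t assume t: "t \<in> {x..y}"
  have t0: "t > 0" "x0 <= t" using t xy x0 by auto
  show "((%x. complex_of_real x powr - s) has_vd (- s) * of_real t powr (- s - 1)) (at t within {x..y})"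
   by (rule has_vector_derivative_powr[OF t0(1)])
  have Res: "\<bar>Re s\<bar> <= real K" using s abs_Re_le_cmod[of s] by linarith
  have "t powr (- Re s - 1) <= (1 + t) ^ K + (1 / x0) ^ (K + 1)"
  proof (cases "- Re s - 1 >= 0")
   case True
   have "t powr (- Re s - 1) <= (1 + t) powr (- Re s - 1)" using True t0 by (intro powr_mono2) auto
   also have "... <= (1 + t) powr real K" using t0 Res by (intro powr_mono) auto
   also have "... = (1 + t) ^ K" using t0 by (simp add: powr_realpow)
   finally show ?thesis using x0 by (simp add: add_increasing2)
  next
   case False
   have "t powr (- Re s - 1) <= x0 powr (- Re s - 1)" using False t0 x0 by (intro powr_mono2') auto
   also have "... = (1 / x0) powr (Re s + 1)" using x0 by (simp add: powr_divide powr_minus_divide powr_diff powr_add field_simps)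
   also have "... <= (1 / x0) powr real (K + 1)" using x0 Res by (intro powr_mono) auto
   also have "... = (1 / x0) ^ (K + 1)" using x0 by (intro powr_realpow) auto
   finally show ?thesis using t0 by (simp add: add_increasing)
  qed
  also have "... <= (1 + t) ^ K * (1 + (1 / x0) ^ (K + 1))"
  proof -
   have "1 * (1 / x0) ^ (K + 1) <= (1 + t) ^ K * (1 / x0) ^ (K + 1)" using t0 x0 by (intro mult_right_mono one_le_power) auto
   thus ?thesis by (simp add: distrib_left)
  qed
  also have "(1 + t) ^ K <= (1 + y) ^ K" using t t0 by (intro power_mono) auto
  also have "(1 + y) ^ K <= (1 + x) ^ K * (1 + y) ^ K"
   using mult_right_mono[of 1 "(1 + x) ^ K" "(1 + y) ^ K"] xy x0 t0 by (simp add: one_le_power)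
  finally have tb: "t powr (- Re s - 1) <= (1 + x) ^ K * (1 + y) ^ K * (1 + (1 / x0) ^ (K + 1))" using x0 by (simp add: mult_right_mono)
  have "norm ((- s) * of_real t powr (- s - 1)) = cmod s * t powr (- Re s - 1)"
   using t0 norm_powr_real_powr[of t "- s - 1"] by (simp add: norm_mult)
  also have "... <= real K * ((1 + x) ^ K * (1 + y) ^ K * (1 + (1 / x0) ^ (K + 1)))"
   using s tb by (intro mult_mono) auto
  finally show "norm ((- s) * of_real t powr (- s - 1)) <= real K * (1 + (1 / x0) ^ (K + 1)) * ((1 + x) ^ K * (1 + y) ^ K)"
   by (simp add: mult_ac)
 qed (use xy in auto)
 show ?thesis
 proof (cases "x <= y")
  case True
  thus ?thesis using *[OF x True] by (simp add: norm_minus_commute mult_ac)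
 next
  case False
  thus ?thesis using *[of y x] y by (simp add: mult_ac)
 qed
qed

lemma (in trig1) rapid_del: "rapid (del n)"
 unfolding rapid_def by (intro allI exI[of _ "br n ^ K" for K]) (auto simp: del_def less_imp_le)

context trig_eig
begin

definition brapid :: "(int => int => complex) => bool" where
 "brapid s \<longleftrightarrow> (\<forall>K. \<exists>C\<ge>0. \<forall>n k. br n ^ K * br k ^ K * cmod (s n k) <= C)"

lemma brapid_row: assumes "brapid s" shows "rapid (s n)"
 unfolding rapid_def
proof
 fix K
 obtain C where C: "C >= 0" "!!n k. br n ^ K * br k ^ K * cmod (s n k) <= C" using assms unfolding brapid_def by blast
 have "br k ^ K * cmod (s n k) <= C" for k
 proof -
  have "1 * (br k ^ K * cmod (s n k)) <= br n ^ K * (br k ^ K * cmod (s n k))"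
   by (intro mult_right_mono br_power_ge1) (auto simp: less_imp_le)
  thus ?thesis using C(2)[of n k] unfolding mult.assoc by linarith
 qed
 thus "\<exists>C\<ge>0. \<forall>k. br k ^ K * cmod (s n k) <= C" using C(1) by blast
qed

lemma psi_A_expand: "of_real (1 + lam j) * \<psi> j k = of_real (br k) * \<psi> j k + (ISUM l. r k l * \<psi> j l)"
proof -
 have "complex_of_real (br k) = 1 + of_int \<bar>k\<bar>"
  unfolding br_def by (metis of_int_abs of_real_1 of_real_add of_real_of_int_eq)
 thus ?thesis using psi_eig[of j k] by (simp add: algebra_simps del: of_int_abs)
qed

text \<open>Powers of 1 + lam j are absorbed by the kernel: on \<psi> j they act as powers of 1 +
  |n| + r, and a smoothing kernel times this operator is again smoothing. So r \<psi> j also decays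
  in lam j.\<close>

lemma smoothing_power:
 "\<exists>s. brapid s \<and> (\<forall>j n. of_real ((1 + lam j) ^ K) * (ISUM k. r n k * \<psi> j k) = (ISUM k. s n k * \<psi> j k))"
proof (induction K)
 case 0
 show ?case using r_rapid by (intro exI[of _ r]) (auto simp: brapid_def)
next
 case (Suc K)
 then obtain s where s: "brapid s" "!!j n. of_real ((1 + lam j) ^ K) * (ISUM k. r n k * \<psi> j k) = (ISUM k. s n k * \<psi> j k)" by blast
 define t where "t n k = of_real (br k) * s n k + (ISUM l. s n l * r l k)" for n k
 obtain R where R: "R >= 0" "!!n k. br n ^ 0 * br k ^ 0 * cmod (r n k) <= R" using r_rapid[of 0] by blast
 have R': "cmod (r n k) <= R" for n k using R(2)[of n k] by simp
 have row: "rapid (s n)" for n by (rule brapid_row[OF s(1)])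
 have "brapid t" unfolding brapid_def
 proof
  fix L
  obtain C where C: "C >= 0" "!!n k. br n ^ (L+2) * br k ^ (L+2) * cmod (s n k) <= C" using s(1) unfolding brapid_def by blast
  obtain D where D: "D >= 0" "!!n k. br n ^ L * br k ^ L * cmod (r n k) <= D" using r_rapid[of L] by blast
  define S where "S = (ISUM l. 1 / br l ^ 2)"
  have "br n ^ L * br k ^ L * cmod (t n k) <= C + C * D * S" for n k
  proof -
   have 1: "br n ^ L * br k ^ L * cmod (of_real (br k) * s n k) <= C"
   proof -
    have "br n ^ L * br k ^ L * cmod (of_real (br k) * s n k) = br n ^ L * br k ^ (L+1) * cmod (s n k)" by (simp add: norm_mult less_imp_le)
    also have "... <= br n ^ (L+2) * br k ^ (L+2) * cmod (s n k)"
     by (intro mult_right_mono mult_mono power_increasing br_ge1) (auto simp: less_imp_le)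
    finally show ?thesis using C(2)[of n k] by linarith
   qed
   have b: "cmod (s n l * r l k) <= (C * D / (br n ^ L * br k ^ L)) * (1 / br l ^ 2)" for l
   proof -
    have "br n ^ L * br l ^ 2 * cmod (s n l) <= br n ^ (L+2) * br l ^ (L+2) * cmod (s n l)"
     by (intro mult_right_mono mult_mono power_increasing br_ge1) (auto simp: less_imp_le)
    hence a1: "br n ^ L * br l ^ 2 * cmod (s n l) <= C" using C(2)[of n l] by linarith
    have "1 * (br k ^ L * cmod (r l k)) <= br l ^ L * (br k ^ L * cmod (r l k))"
     by (intro mult_right_mono br_power_ge1) (auto simp: less_imp_le)
    hence a2: "br k ^ L * cmod (r l k) <= D" using D(2)[of l k] unfolding mult.assoc by linarith
    have "(br n ^ L * br l ^ 2 * cmod (s n l)) * (br k ^ L * cmod (r l k)) <= C * D"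
     using a1 a2 C(1) by (intro mult_mono) (auto simp: less_imp_le)
    thus ?thesis by (simp add: norm_mult field_simps)
   qed
   have sm: "(%l. (C * D / (br n ^ L * br k ^ L)) * (1 / br l ^ 2)) summable_on UNIV" by (intro summable_on_cmult_right summable_br)
   have as: "(%l. cmod (s n l * r l k)) summable_on UNIV" by (rule abs_summable_dominated[OF sm b])
   have "cmod (ISUM l. s n l * r l k) <= (ISUM l. cmod (s n l * r l k))" by (rule norm_infsum_bound[OF as])
   also have "... <= (ISUM l. (C * D / (br n ^ L * br k ^ L)) * (1 / br l ^ 2))" by (intro infsum_mono as sm b)
   also have "... = (C * D / (br n ^ L * br k ^ L)) * S" unfolding S_def by (intro infsum_cmult_right summable_br)
   finally have 2: "br n ^ L * br k ^ L * cmod (ISUM l. s n l * r l k) <= C * D * S" by (simp add: field_simps)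
   have "br n ^ L * br k ^ L * cmod (t n k) <= br n ^ L * br k ^ L * (cmod (of_real (br k) * s n k) + cmod (ISUM l. s n l * r l k))"
    unfolding t_def by (intro mult_left_mono norm_triangle_ineq) (auto simp: less_imp_le)
   thus ?thesis using 1 2 by (simp add: distrib_left)
  qed
  moreover have "0 <= C + C * D * S" unfolding S_def using C D by (intro add_nonneg_nonneg mult_nonneg_nonneg infsum_nonneg) auto
  ultimately show "\<exists>C\<ge>0. \<forall>n k. br n ^ L * br k ^ L * cmod (t n k) <= C" by blast
 qed
 moreover have "of_real ((1 + lam j) ^ Suc K) * (ISUM k. r n k * \<psi> j k) = (ISUM k. t n k * \<psi> j k)" for j n
 proof -
  have s1: "(%k. of_real (br k) * s n k * \<psi> j k) summable_on UNIV"
  proof -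
   obtain C where C: "C >= 0" "!!k. br k ^ 1 * cmod (s n k) <= C" using row[of n] unfolding rapid_def by blast
   have "rapid (%k. (of_real (br k) * s n k) * \<psi> j k)"
   proof (rule rapid_mult[OF psi_rapid])
    show "cmod (of_real (br k) * s n k) <= C * br k ^ 0" for k using C(2)[of k] by (simp add: norm_mult less_imp_le)
   qed
   thus ?thesis by (rule abs_summable_summable[OF rapid_abs])
  qed
  have sw: "(ISUM k. ISUM l. s n k * (r k l * \<psi> j l)) = (ISUM l. ISUM k. s n k * (r k l * \<psi> j l))"
  proof (rule infsum_swap_product[OF summable_on_cmult_right[OF rapid_abs[OF row], of R n] rapid_abs[OF psi_rapid[of j]]])
   show "cmod (s n k * (r k l * \<psi> j l)) <= R * cmod (s n k) * cmod (\<psi> j l)" for k l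
    using mult_right_mono[OF R'[of k l], of "cmod (s n k) * cmod (\<psi> j l)"] by (simp add: norm_mult mult_ac)
  qed (use R in auto)
  have s2: "(%k. s n k * (ISUM l. r k l * \<psi> j l)) summable_on UNIV"
  proof -
   define Q where "Q = R * (ISUM l. cmod (\<psi> j l))"
   have "cmod (ISUM l. r k l * \<psi> j l) <= Q" for k
   proof -
    have sm: "(%l. R * cmod (\<psi> j l)) summable_on UNIV" by (intro summable_on_cmult_right rapid_abs psi_rapid)
    have b: "cmod (r k l * \<psi> j l) <= R * cmod (\<psi> j l)" for l unfolding norm_mult by (intro mult_right_mono R') auto
    have as: "(%l. cmod (r k l * \<psi> j l)) summable_on UNIV" by (rule abs_summable_dominated[OF sm b])
    have "cmod (ISUM l. r k l * \<psi> j l) <= (ISUM l. cmod (r k l * \<psi> j l))" by (rule norm_infsum_bound[OF as])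
    also have "... <= (ISUM l. R * cmod (\<psi> j l))" by (intro infsum_mono as sm b)
    also have "... = Q" unfolding Q_def by (intro infsum_cmult_right rapid_abs psi_rapid)
    finally show ?thesis .
   qed
   hence "rapid (%k. (ISUM l. r k l * \<psi> j l) * s n k)" by (intro rapid_mult[OF row, of _ Q 0]) simp
   from abs_summable_summable[OF rapid_abs[OF this]] show ?thesis by (simp add: mult.commute)
  qed
  have "of_real ((1 + lam j) ^ Suc K) * (ISUM k. r n k * \<psi> j k) = of_real (1 + lam j) * (ISUM k. s n k * \<psi> j k)"
   unfolding s(2)[symmetric] by simp
  also have "... = (ISUM k. s n k * (of_real (1 + lam j) * \<psi> j k))"
   unfolding infsum_cmult_right'[symmetric] by (simp add: mult.left_commute)
  also have "... = (ISUM k. of_real (br k) * s n k * \<psi> j k + s n k * (ISUM l. r k l * \<psi> j l))"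
   unfolding psi_A_expand by (simp add: algebra_simps)
  also have "... = (ISUM k. of_real (br k) * s n k * \<psi> j k) + (ISUM k. s n k * (ISUM l. r k l * \<psi> j l))"
   by (rule infsum_add[OF s1 s2])
  also have "(ISUM k. s n k * (ISUM l. r k l * \<psi> j l)) = (ISUM l. (ISUM k. s n k * r k l) * \<psi> j l)"
   using sw unfolding infsum_cmult_right' infsum_cmult_left'[symmetric] by (simp add: mult.assoc)
  also have "(ISUM k. of_real (br k) * s n k * \<psi> j k) + (ISUM l. (ISUM k. s n k * r k l) * \<psi> j l)
   = (ISUM k. of_real (br k) * s n k * \<psi> j k + (ISUM l. s n l * r l k) * \<psi> j k)"
  proof (rule infsum_add[OF s1, symmetric])
   have "rapid (%l. (ISUM k. s n k * r k l) * \<psi> j l)"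
   proof (rule rapid_mult[OF psi_rapid])
    fix l
    have sm: "(%k. R * cmod (s n k)) summable_on UNIV" by (intro summable_on_cmult_right rapid_abs row)
    have b: "cmod (s n k * r k l) <= R * cmod (s n k)" for k
     using mult_left_mono[OF R'[of k l], of "cmod (s n k)"] by (simp add: norm_mult mult_ac)
    have as: "(%k. cmod (s n k * r k l)) summable_on UNIV" by (rule abs_summable_dominated[OF sm b])
    have "cmod (ISUM k. s n k * r k l) <= (ISUM k. cmod (s n k * r k l))" by (rule norm_infsum_bound[OF as])
    also have "... <= (ISUM k. R * cmod (s n k))" by (intro infsum_mono as sm b)
    finally show "cmod (ISUM k. s n k * r k l) <= (ISUM k. R * cmod (s n k)) * br l ^ 0" by simp
   qed
   thus "(%k. (ISUM l. s n l * r l k) * \<psi> j k) summable_on UNIV" by (rule abs_summable_summable[OF rapid_abs])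
  qed
  finally show ?thesis by (simp add: t_def algebra_simps)
 qed
 ultimately show ?case by blast
qed

text \<open>Squared overlaps of the two orthonormal bases: the sums over n and over j are both 1,
  and after restriction to \<open>Q\<close> they still are.\<close>

definition wt :: "int => nat => real" where "wt n j = (cmod (\<psi> j n))\<^sup>2"

lemma wt_nonneg: "wt n j >= 0" by (simp add: wt_def)

lemma parseval_has_sum:
 assumes f: "rapid f" shows "((%j. (cmod (ISUM n. f n * cnj (\<psi> j n)))\<^sup>2) has_sum (ISUM n. (cmod (f n))\<^sup>2)) UNIV"
 by (rule sums_nonneg_imp_has_sum[OF psi_parseval[OF rapid_l2[OF f]]]) auto

lemma wt_sum_j: "((%j. wt n j) has_sum 1) UNIV"
proof -
 have "((%j. (cmod (ISUM k. del n k * cnj (\<psi> j k)))\<^sup>2) has_sum (ISUM k. (cmod (del n k))\<^sup>2)) UNIV"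
  by (rule parseval_has_sum[OF rapid_del])
 moreover have "(ISUM k. (cmod (del n k))\<^sup>2) = 1" by (subst infsum_single[of n]) (auto simp: del_def)
 moreover have "(ISUM k. del n k * cnj (\<psi> j k)) = cnj (\<psi> j n)" for j using GG_del[of n "\<psi> j"] by (simp add: GG_def)
 ultimately show ?thesis by (simp add: wt_def)
qed

lemma wt_sum_n: "((%n. wt n j) has_sum 1) UNIV"
 using GG_norm[OF rapid_VV[OF psi_rapid[of j]]] infsumI[OF psi_on[of j j]] by (simp add: GG_def wt_def)

definition Jp :: "nat set" where "Jp = {j. lam j > 0}"
definition Q :: "(int \<times> nat) set" where "Q = {n. n \<noteq> 0} \<times> Jp"

lemma wt_sum_Jp: assumes "n \<noteq> 0" shows "((%j. wt n j) has_sum 1) Jp"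
 by (rule has_sum_cong_neutral[THEN iffD1, OF _ _ _ wt_sum_j[of n]]) (auto simp: Jp_def wt_def not_less psi_nonpos[OF _ assms])

lemma wt_sum_nz: assumes "j \<in> Jp" shows "((%n. wt n j) has_sum 1) {n. n \<noteq> 0}"
 by (rule has_sum_cong_neutral[THEN iffD1, OF _ _ _ wt_sum_n[of j]]) (use assms psi_pos_0 in \<open>auto simp: Jp_def wt_def\<close>)

lemma lam_lower: obtains x0 where "0 < x0" "x0 <= 1" "!!j. j \<in> Jp ==> x0 <= lam j"
proof -
 define F where "F = insert 1 (lam ` {j \<in> Jp. lam j <= 1})"
 have F: "finite F" unfolding F_def using finite_eig[of 1] by (auto intro: finite_subset)
 have "!!j. j \<in> Jp ==> Min F <= lam j"
 proof -
  fix j assume j: "j \<in> Jp"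
  show "Min F <= lam j"
  proof (cases "lam j <= 1")
   case True
   thus ?thesis using F j by (intro Min_le) (auto simp: F_def)
  next
   case False
   moreover have "Min F <= 1" using F by (intro Min_le) (auto simp: F_def)
   ultimately show ?thesis by linarith
  qed
 qed
 moreover have "0 < Min F" using F by (subst Min_gr_iff) (auto simp: F_def Jp_def)
 moreover have "Min F <= 1" using F by (intro Min_le) (auto simp: F_def)
 ultimately show thesis using that by blast
qed

text \<open>Since the weights sum to 1 both ways on \<open>Q\<close>, the sum of all these terms is
  the eigenvalue series minus the series of |n|^(-s), rearranged so that it converges for every
  s.\<close>

definition gterm :: "complex => int \<times> nat => complex" where
 "gterm s p = (case p of (n, j) => of_real (wt n j) * (of_real (lam j) powr (- s) - of_real \<bar>of_int n\<bar> powr (- s)))"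

text \<open>One factor \<psi> j n absorbs lam j - |n| through the eigenvalue equation and becomes (r
  \<psi> j)(n); \<open>smoothing_power\<close> then absorbs (1 + lam j)^K. The inequality between
  products and squares separates the two remaining factors.\<close>

lemma gterm_bound:
 "\<exists>M. M summable_on Q \<and> (\<forall>s p. cmod s <= real K \<longrightarrow> p \<in> Q \<longrightarrow> cmod (gterm s p) <= M p)"
proof -
 obtain x0 where x0: "0 < x0" "x0 <= 1" "!!j. j \<in> Jp ==> x0 <= lam j" by (rule lam_lower) blast
 define C where "C = real K * (1 + (1 / x0) ^ (K + 1))"
 have C: "C >= 0" unfolding C_def using x0 by auto
 obtain s where s: "brapid s" "!!j n. of_real ((1 + lam j) ^ K) * (ISUM k. r n k * \<psi> j k) = (ISUM k. s n k * \<psi> j k)"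
  using smoothing_power by blast
 \<comment> \<open>Both majorants are summed over j first: D1 by the weights, leaving 1/br^2, and D2
   by Parseval, leaving the rapidly small square norm of row n of \<open>s\<close>.\<close>
 define D1 where "D1 p = (case p of (n, j) => wt n j * (1 / br n ^ 2))" for p
 define D2 where "D2 p = (case p of (n, j) => br n ^ (2*K + 2) * (cmod (ISUM k. s n k * \<psi> j k))\<^sup>2)" for p
 have "D1 summable_on (Sigma UNIV (%_. UNIV))"
 proof (rule summable_on_SigmaI[where g="%n. 1 * (1 / br n ^ 2)"])
  show "((%j. D1 (n, j)) has_sum 1 * (1 / br n ^ 2)) UNIV" for n
   unfolding D1_def prod.case by (intro has_sum_cmult_left wt_sum_j)
  show "(%n. 1 * (1 / br n ^ 2)) summable_on UNIV" using summable_br by simp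
 qed (auto simp: D1_def wt_def)
 hence D1: "D1 summable_on Q" by (rule summable_on_subset) auto
 have "D2 summable_on (Sigma UNIV (%_. UNIV))"
 proof (rule summable_on_SigmaI[where g="%n. br n ^ (2*K + 2) * (ISUM k. (cmod (s n k))\<^sup>2)"])
  show "((%j. D2 (n, j)) has_sum br n ^ (2*K + 2) * (ISUM k. (cmod (s n k))\<^sup>2)) UNIV" for n
  proof -
   have rc: "rapid (%k. cnj (s n k))" using brapid_row[OF s(1), of n] by (simp add: rapid_def)
   have "(ISUM k. cnj (s n k) * cnj (\<psi> j k)) = cnj (ISUM k. s n k * \<psi> j k)" for j
    unfolding infsum_cnj[symmetric] by simp
   thus ?thesis
    unfolding D2_def prod.case using has_sum_cmult_right[OF parseval_has_sum[OF rc], of "br n ^ (2*K + 2)"] by simp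
  qed
  show "(%n. br n ^ (2*K + 2) * (ISUM k. (cmod (s n k))\<^sup>2)) summable_on UNIV"
  proof -
   obtain B where B: "B >= 0" "!!n k. br n ^ (2*K+4) * br k ^ (2*K+4) * cmod (s n k) <= B" using s(1) unfolding brapid_def by blast
   have b: "(cmod (s n k))\<^sup>2 <= (B * B / br n ^ (2*K + 4)) * (1 / br k ^ 2)" for n k
   proof -
    let ?x = "cmod (s n k)"
    have "1 * ?x <= (br n ^ (2*K+4) * br k ^ (2*K+4)) * ?x"
     using mult_mono[OF br_power_ge1[of n "2*K+4"] br_power_ge1[of k "2*K+4"]] by (intro mult_right_mono) (auto simp: less_imp_le)
    hence x: "?x <= B" using B(2)[of n k] by linarith
    have "br n ^ (2*K+4) * br k ^ 2 * ?x <= br n ^ (2*K+4) * br k ^ (2*K+4) * ?x"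
     by (intro mult_right_mono mult_left_mono power_increasing br_ge1) (auto simp: less_imp_le)
    hence "br n ^ (2*K+4) * br k ^ 2 * ?x <= B" using B(2)[of n k] by linarith
    hence "(br n ^ (2*K+4) * br k ^ 2 * ?x) * ?x <= B * B" using x B(1) by (intro mult_mono) auto
    thus ?thesis by (simp add: field_simps power2_eq_square)
   qed
   have sm: "(%k. (B * B / br n ^ (2*K + 4)) * (1 / br k ^ 2)) summable_on UNIV" for n by (intro summable_on_cmult_right summable_br)
   have q: "(ISUM k. (cmod (s n k))\<^sup>2) <= (B * B / br n ^ (2*K + 4)) * (ISUM k. 1 / br k ^ 2)" for n
   proof -
    have "(ISUM k. (cmod (s n k))\<^sup>2) <= (ISUM k. (B * B / br n ^ (2*K + 4)) * (1 / br k ^ 2))"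
     by (intro infsum_mono sm b summable_on_comparison_test[OF sm b]) auto
    also have "... = (B * B / br n ^ (2*K + 4)) * (ISUM k. 1 / br k ^ 2)" by (intro infsum_cmult_right summable_br)
    finally show ?thesis .
   qed
   have "norm (br n ^ (2*K + 2) * (ISUM k. (cmod (s n k))\<^sup>2)) <= (B * B * (ISUM k. 1 / br k ^ 2)) / br n ^ 2" for n
   proof -
    have "br n ^ (2*K + 2) * (ISUM k. (cmod (s n k))\<^sup>2) <= br n ^ (2*K + 2) * ((B * B / br n ^ (2*K + 4)) * (ISUM k. 1 / br k ^ 2))"
     by (intro mult_left_mono q) (auto simp: less_imp_le)
    also have "... = (B * B * (ISUM k. 1 / br k ^ 2)) / br n ^ 2"
     by (simp add: power_add field_simps power2_eq_square power4_eq_xxxx)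
    finally show ?thesis by (simp add: infsum_nonneg less_imp_le)
   qed
   thus ?thesis by (rule summable_br_bound(1))
  qed
 qed (auto simp: D2_def less_imp_le)
 hence D2: "D2 summable_on Q" by (rule summable_on_subset) auto
 show ?thesis
 proof (intro exI[of _ "%p. C * (D1 p + D2 p)"] conjI allI impI)
  show "(%p. C * (D1 p + D2 p)) summable_on Q" by (intro summable_on_cmult_right summable_on_add D1 D2)
  fix z p assume z: "cmod z <= real K" and p: "p \<in> Q"
  obtain n j where nj: "p = (n, j)" "n \<noteq> 0" "j \<in> Jp" using p by (auto simp: Q_def)
  have lp: "lam j > 0" using nj by (simp add: Jp_def)
  have n1: "1 <= \<bar>real_of_int n\<bar>" using nj(2) by linarith
  let ?\<rho> = "cmod (ISUM k. r n k * \<psi> j k)" and ?a = "cmod (\<psi> j n)"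
  have rho: "\<bar>lam j - \<bar>of_int n\<bar>\<bar> * ?a = ?\<rho>"
   using psi_eig[of j n] by (metis norm_mult norm_of_real of_int_abs)
  have sig: "(1 + lam j) ^ K * ?\<rho> = cmod (ISUM k. s n k * \<psi> j k)"
   unfolding s(2)[symmetric] norm_mult norm_of_real using lp by simp
  have "cmod (gterm z p) = wt n j * cmod (of_real (lam j) powr (- z) - of_real \<bar>of_int n\<bar> powr (- z))"
   by (simp add: nj gterm_def norm_mult wt_nonneg)
  also have "... = ?a\<^sup>2 * cmod (of_real (lam j) powr (- z) - of_real \<bar>of_int n\<bar> powr (- z))" by (simp only: wt_def)
  also have "... <= ?a\<^sup>2 * (C * (\<bar>lam j - \<bar>of_int n\<bar>\<bar> * ((1 + lam j) ^ K * (1 + \<bar>of_int n\<bar>) ^ K)))"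
   unfolding C_def using x0(3)[OF nj(3)] n1 x0(1,2) z by (intro mult_left_mono powr_diff_bound) auto
  also have "... = C * (?a * (cmod (ISUM k. s n k * \<psi> j k) * br n ^ K))"
   unfolding sig[symmetric] rho[symmetric] by (simp add: br_def power2_eq_square mult_ac)
  also have "... = C * ((?a * (1 / br n)) * (cmod (ISUM k. s n k * \<psi> j k) * br n ^ (K + 1)))" by simp
  also have "... <= C * ((?a * (1 / br n))\<^sup>2 + (cmod (ISUM k. s n k * \<psi> j k) * br n ^ (K + 1))\<^sup>2)"
  proof (intro mult_left_mono C)
   let ?u = "?a * (1 / br n)" and ?v = "cmod (ISUM k. s n k * \<psi> j k) * br n ^ (K + 1)"
   have "0 <= ?u * ?v" by (intro mult_nonneg_nonneg) (auto simp: less_imp_le)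
   thus "?u * ?v <= ?u\<^sup>2 + ?v\<^sup>2" using two_mult_le[of ?u ?v] by linarith
  qed
  also have "... = C * (D1 p + D2 p)"
  proof -
   have "2 * K + 2 = 2 * (K + 1)" by simp
   hence "br n ^ (2 * K + 2) = (br n ^ (K + 1))\<^sup>2" by (simp only: power_even_eq)
   thus ?thesis unfolding nj D1_def D2_def wt_def prod.case by (simp only: power_mult_distrib power_one_over mult.commute)
  qed
  finally show "cmod (gterm z p) <= C * (D1 p + D2 p)" .
 qed
qed

definition Gf :: "complex => complex" where "Gf s = (\<Sum>\<^sub>\<infinity>p\<in>Q. gterm s p)"

lemma gterm_abs: "(%p. cmod (gterm s p)) summable_on Q"
proof -
 obtain M where M: "M summable_on Q" "!!z p. cmod z <= real (nat \<lceil>cmod s\<rceil>) ==> p \<in> Q ==> cmod (gterm z p) <= M p" using gterm_bound by blast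
 show ?thesis by (rule abs_summable_dominated[OF M(1)]) (rule M(2), linarith)
qed

lemma holomorphic_Gf: "Gf holomorphic_on UNIV"
 unfolding Gf_def[abs_def]
proof (rule holomorphic_infsum)
 fix p assume p: "p \<in> Q"
 hence "lam (snd p) \<noteq> 0" "fst p \<noteq> 0" by (auto simp: Q_def Jp_def)
 thus "(%s. gterm s p) holomorphic_on UNIV"
  unfolding gterm_def case_prod_beta by (intro holomorphic_intros) auto
next
 fix z :: complex
 obtain M where M: "M summable_on Q" "!!w p. cmod w <= real (nat \<lceil>cmod z + 1\<rceil>) ==> p \<in> Q ==> cmod (gterm w p) <= M p" using gterm_bound by blast
 have "cmod (gterm w p) <= M p" if "w \<in> cball z 1" "p \<in> Q" for w p
 proof (rule M(2)[OF _ that(2)])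
  have "cmod w <= cmod z + 1" using that(1) norm_triangle_ineq2[of w z] by (simp add: dist_norm norm_minus_commute)
  thus "cmod w <= real (nat \<lceil>cmod z + 1\<rceil>)" by linarith
 qed
 thus "\<exists>d M. d > 0 \<and> cball z d \<subseteq> UNIV \<and> M summable_on Q \<and> (\<forall>p\<in>Q. \<forall>w\<in>cball z d. cmod (gterm w p) <= M p)"
  using M(1) by (intro exI[of _ 1] exI[of _ M]) auto
qed auto

text \<open>For Re s > 1 the weighted integer series and \<open>gterm\<close> are summable
  separately over \<open>Q\<close>. In their sum only the powers of lam j remain, and summing over n
  first removes the weights.\<close>

lemma lam_has_sum:
 assumes s: "Re s > 1" shows "((%j. of_real (lam j) powr (- s)) has_sum (2 * Zc s + Gf s)) Jp"
proof -
 define h where "h p = (case p of (n, j) => of_real (wt n j) * complex_of_real \<bar>of_int n\<bar> powr (- s))" for p :: "int \<times> nat"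
 have ha: "(%p. cmod (h p)) summable_on Q"
  unfolding Q_def
 proof (rule summable_on_SigmaI[where g="%n. 1 * cmod (of_real \<bar>of_int n\<bar> powr (- s))"])
  show "((%j. cmod (h (n, j))) has_sum 1 * cmod (of_real \<bar>of_int n\<bar> powr (- s))) Jp" if "n \<in> {n. n \<noteq> 0}" for n
  proof -
   have "((%j. wt n j * cmod (of_real \<bar>of_int n\<bar> powr (- s))) has_sum 1 * cmod (of_real \<bar>of_int n\<bar> powr (- s))) Jp"
    using that by (intro has_sum_cmult_left wt_sum_Jp) simp
   thus ?thesis by (simp add: h_def norm_mult wt_nonneg)
  qed
  show "(%n. 1 * cmod (of_real \<bar>of_int n\<bar> powr (- s))) summable_on {n. n \<noteq> (0::int)}"
   using zeta_int_has_sum(2)[OF s] by simp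
 qed auto
 have hs: "(h has_sum 2 * Zc s) Q"
  unfolding Q_def
 proof (rule has_sum_SigmaI)
  show "((%j. h (n, j)) has_sum 1 * of_real \<bar>of_int n\<bar> powr (- s)) Jp" if "n \<in> {n. n \<noteq> 0}" for n
   unfolding h_def prod.case using has_sum_of_real[OF wt_sum_Jp, of n, where 'a=complex] that by (intro has_sum_cmult_left) auto
  show "((%n. 1 * of_real \<bar>of_int n\<bar> powr (- s)) has_sum 2 * Zc s) {n. n \<noteq> (0::int)}" using zeta_int_has_sum(1)[OF s] by simp
  show "h summable_on {n. n \<noteq> 0} \<times> Jp" using abs_summable_summable[OF ha] by (simp add: Q_def)
 qed
 have gs: "(gterm s has_sum Gf s) Q" unfolding Gf_def by (intro has_sum_infsum abs_summable_summable[OF gterm_abs])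
 have "((%p. h p + gterm s p) has_sum (2 * Zc s + Gf s)) Q" by (intro has_sum_add hs gs)
 moreover have "h p + gterm s p = (case p of (n, j) => of_real (wt n j) * of_real (lam j) powr (- s))" for p
  by (simp add: h_def gterm_def case_prod_beta algebra_simps)
 ultimately have "((%(n, j). of_real (wt n j) * of_real (lam j) powr (- s)) has_sum (2 * Zc s + Gf s)) ({n. n \<noteq> 0} \<times> Jp)"
  by (simp add: Q_def)
 hence sw: "((%(j, n). of_real (wt n j) * of_real (lam j) powr (- s)) has_sum (2 * Zc s + Gf s)) (Jp \<times> {n. n \<noteq> 0})"
  by (subst (asm) has_sum_swap) (simp add: case_prod_beta)
 show ?thesis
 proof (rule has_sum_SigmaD[OF sw])
  fix j assume "j \<in> Jp"
  from has_sum_cmult_left[OF has_sum_of_real[OF wt_sum_nz[OF this], where 'a=complex], of "of_real (lam j) powr (- s)"]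
  show "((%n. case (j, n) of (j, n) => of_real (wt n j) * of_real (lam j) powr (- s)) has_sum of_real (lam j) powr (- s)) {n. n \<noteq> 0}" by simp
 qed
qed

lemma zeta_series_has_sum:
 assumes s: "Re s > 1"
 shows "((%\<mu>. of_nat (eig_mult b \<mu>) * of_real \<mu> powr (- s)) has_sum (2 * Zc s + Gf s)) (pos_eigs b)"
proof -
 let ?B = "%\<mu>. {j. lam j = \<mu>}"
 have bij: "bij_betw snd (Sigma (pos_eigs b) ?B) Jp"
  by (rule bij_betwI[of _ _ _ "%j. (lam j, j)"]) (auto simp: Jp_def pos_eigs_eq)
 have "((%p. of_real (lam (snd p)) powr (- s)) has_sum (2 * Zc s + Gf s)) (Sigma (pos_eigs b) ?B)"
  using has_sum_reindex_bij_betw[OF bij, of "%j. of_real (lam j) powr (- s)"] lam_has_sum[OF s] by blast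
 thus ?thesis
 proof (rule has_sum_SigmaD)
  fix \<mu> assume mu: "\<mu> \<in> pos_eigs b"
  hence "eig_mult b \<mu> = card (?B \<mu>)" by (intro eig_mult_eq) (simp add: pos_eigs_eq)
  moreover have "((%j. of_real (lam j) powr (- s)) has_sum (\<Sum>j\<in>?B \<mu>. complex_of_real (lam j) powr (- s))) (?B \<mu>)"
   by (intro has_sum_finite finite_eigspace)
  moreover have "(\<Sum>j\<in>?B \<mu>. complex_of_real (lam j) powr (- s)) = of_nat (card (?B \<mu>)) * of_real \<mu> powr (- s)" by simp
  ultimately show "((%j. of_real (lam (snd (\<mu>, j))) powr (- s)) has_sum of_nat (eig_mult b \<mu>) * of_real \<mu> powr (- s)) (?B \<mu>)" by simp
 qed
qed

text \<open>The definite description needs uniqueness: a competing continuation on S agrees with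
  this one on the half plane, hence on S minus \<open>Zpole\<close>, which is still connected and
  contains z because Re z < 1.\<close>

theorem zeta_eq: assumes z: "Re z < 1" shows "zeta b z = 2 * Zc z + Gf z"
 unfolding zeta_def
proof (rule the_equality)
 let ?h = "%s. 2 * Zc s + Gf s"
 have hol: "?h holomorphic_on (- Zpole)"
  using holomorphic_Gf by (intro holomorphic_intros holomorphic_Zc) (auto intro: holomorphic_on_subset)
 have con: "connected (S - Zpole)" if "open S" "connected S" for S
  by (rule connected_open_diff_countable) (use that Zpole_countable in auto)
 have half: "{s. Re s > 1} \<subseteq> - Zpole" using Zpole_Re by force
 have zp: "z \<notin> Zpole" using Zpole_Re z by force
 show "zeta_val b z (?h z)"
  unfolding zeta_val_def
 proof (intro exI conjI allI impI)
  show "open (- Zpole)" using Zpole_closed by auto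
  show "connected (- Zpole)" using con[OF open_UNIV connected_UNIV] by (simp add: Compl_eq_Diff_UNIV)
  show "?h holomorphic_on (- Zpole)" by (rule hol)
  fix s :: complex assume s: "Re s > 1"
  show "(%lam. of_nat (eig_mult b lam) * of_real lam powr - s) summable_on pos_eigs b"
   using zeta_series_has_sum[OF s] has_sum_imp_summable by blast
  show "zeta_series b s = ?h s" unfolding zeta_series_def by (rule infsumI[OF zeta_series_has_sum[OF s]])
 qed (use half zp in auto)
 fix v assume "zeta_val b z v"
 then obtain S f where S: "open S" "connected S" "{s. Re s > 1} \<subseteq> S" "z \<in> S" "f holomorphic_on S"
  "!!s. Re s > 1 ==> zeta_series b s = f s" "f z = v" unfolding zeta_val_def by blast
 have "f z = ?h z"
 proof (rule analytic_continuation_open[of "{s. Re s > 1}" "S - Zpole" f ?h])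
  show "open {s. Re s > 1}" by (rule open_halfspace_Re_gt)
  show "open (S - Zpole)" using S(1) Zpole_closed by auto
  have "2 \<in> {s. Re s > 1}" by simp
  thus "{s. Re s > 1} \<noteq> {}" by blast
  show "connected (S - Zpole)" by (rule con[OF S(1,2)])
  show "{s. Re s > 1} \<subseteq> S - Zpole" using S(3) half by auto
  show "f holomorphic_on S - Zpole" using S(5) by (rule holomorphic_on_subset) auto
  show "?h holomorphic_on S - Zpole" using hol by (rule holomorphic_on_subset) auto
  show "f s = ?h s" if "s \<in> {s. Re s > 1}" for s
   using that S(6)[of s] infsumI[OF zeta_series_has_sum[of s]] by (simp add: zeta_series_def)
  show "z \<in> S - Zpole" using S(4) zp by auto
 qed
 thus "v = ?h z" using S(7) by simp
qed

end

section \<open>Finite traces, cyclicity and positivity for band matrices\<close>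

section \<open>Banded operators on sequences\<close>

definition dl :: "int => int => complex" where "dl k l = (if l = k then 1 else 0)"

definition kop :: "nat => (int => int => complex) => (int => complex) => int => complex" where
 "kop N M f l = (\<Sum>k\<in>{l - int N..l + int N}. M l k * f k)"

text \<open>A band matrix given as a function on sequences; \<open>P (dl k) l\<close> is its entry.
  Quantifying over every finite F that contains the band lets different operators share one
  summation range and keeps all sums finite.\<close>

definition loc :: "nat => ((int => complex) => int => complex) => bool" where
 "loc w P \<longleftrightarrow> (\<forall>f l F. finite F \<longrightarrow> {l - int w..l + int w} \<subseteq> F \<longrightarrow> P f l = (\<Sum>k\<in>F. P (dl k) l * f k))"

lemma locD: "loc w P ==> finite F ==> {l - int w..l + int w} \<subseteq> F ==> P f l = (\<Sum>k\<in>F. P (dl k) l * f k)"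
 unfolding loc_def by blast

lemma kop_entry: "kop N M (dl k) l = (if \<bar>l - k\<bar> <= int N then M l k else 0)"
proof -
 have "kop N M (dl k) l = (\<Sum>j\<in>{l - int N..l + int N}. if j = k then M l k else 0)"
  unfolding kop_def dl_def by (intro sum.cong) auto
 thus ?thesis by (auto simp: sum.delta)
qed

lemma loc_kop: "loc N (kop N M)"
 unfolding loc_def kop_entry
proof (intro allI impI)
 fix f :: "int => complex" and l F assume F: "finite F" "{l - int N..l + int N} \<subseteq> F"
 show "kop N M f l = (\<Sum>k\<in>F. (if \<bar>l - k\<bar> <= int N then M l k else 0) * f k)"
  unfolding kop_def by (rule sum.mono_neutral_cong_left[OF F]) auto
qed

lemma loc_entry: assumes "loc w P" "\<bar>l - k\<bar> > int w" shows "P (dl k) l = 0"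
proof -
 have "P (dl k) l = (\<Sum>j\<in>{l - int w..l + int w}. P (dl j) l * dl k j)" by (rule locD[OF assms(1)]) auto
 also have "... = 0" using assms(2) by (intro sum.neutral) (auto simp: dl_def)
 finally show ?thesis .
qed

lemma locE: "loc w P ==> P f l = (\<Sum>k\<in>{l - int w..l + int w}. P (dl k) l * f k)"
 by (rule locD) auto

lemma loc_add: assumes "loc w P" shows "P (%l. f l + g l) l = P f l + P g l"
 unfolding locE[OF assms, of "%l. f l + g l"] locE[OF assms, of f] locE[OF assms, of g]
 by (simp add: distrib_left sum.distrib)

lemma loc_diff: assumes "loc w P" shows "P (%l. f l - g l) l = P f l - P g l"
 unfolding locE[OF assms, of "%l. f l - g l"] locE[OF assms, of f] locE[OF assms, of g]
 by (simp add: right_diff_distrib sum_subtractf)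

lemma loc_cmult: assumes "loc w P" shows "P (%l. z * f l) l = z * P f l"
 unfolding locE[OF assms, of "%l. z * f l"] locE[OF assms, of f] by (simp add: sum_distrib_left mult.left_commute)

lemma loc_sum: assumes "loc w P" shows "P (%l. \<Sum>x\<in>X. f x l) l = (\<Sum>x\<in>X. P (f x) l)"
proof -
 have "P (%l. \<Sum>x\<in>X. f x l) l = (\<Sum>x\<in>X. \<Sum>k\<in>{l - int w..l + int w}. P (dl k) l * f x k)"
  unfolding locE[OF assms, of "%l. \<Sum>x\<in>X. f x l"] sum_distrib_left by (rule sum.swap)
 also have "... = (\<Sum>x\<in>X. P (f x) l)" by (intro sum.cong refl locE[OF assms, symmetric])
 finally show ?thesis .
qed

lemma loc_comp: assumes P: "loc v P" and Q: "loc w Q" shows "loc (v + w) (%f. P (Q f))"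
 unfolding loc_def
proof (intro allI impI)
 fix f l F assume F: "finite F" "{l - int (v + w)..l + int (v + w)} \<subseteq> F"
 let ?J = "{l - int v..l + int v}"
 have "P (Q f) l = (\<Sum>j\<in>?J. P (dl j) l * Q f j)" by (rule locD[OF P]) auto
 also have "... = (\<Sum>j\<in>?J. P (dl j) l * (\<Sum>k\<in>F. Q (dl k) j * f k))"
 proof (intro sum.cong refl arg_cong2[where f="(*)"])
  fix j assume "j \<in> ?J"
  hence "{j - int w..j + int w} \<subseteq> F" using F(2) by force
  thus "Q f j = (\<Sum>k\<in>F. Q (dl k) j * f k)" by (rule locD[OF Q F(1)])
 qed
 also have "... = (\<Sum>k\<in>F. (\<Sum>j\<in>?J. P (dl j) l * Q (dl k) j) * f k)"
  unfolding sum_distrib_left sum_distrib_right by (subst sum.swap) (simp add: mult.assoc)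
 also have "... = (\<Sum>k\<in>F. P (Q (dl k)) l * f k)"
  by (intro sum.cong refl arg_cong2[where f="(*)"] locE[OF P, symmetric])
 finally show "P (Q f) l = (\<Sum>k\<in>F. P (Q (dl k)) l * f k)" .
qed

lemma loc_mono: "loc v P ==> v <= w ==> loc w P"
 unfolding loc_def by (smt (verit, ccfv_SIG) atLeastatMost_subset_iff of_nat_mono subset_trans)

lemma loc_id: "loc 0 (%f. f)"
 unfolding loc_def
proof (intro allI impI)
 fix f :: "int => complex" and l :: int and F assume F: "finite F" "{l - int 0..l + int 0} \<subseteq> F"
 have "(\<Sum>k\<in>F. dl k l * f k) = (\<Sum>k\<in>F. if k = l then f l else 0)" by (intro sum.cong) (auto simp: dl_def)
 thus "f l = (\<Sum>k\<in>F. dl k l * f k)" using F by simp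
qed

lemma loc_funpow: "loc w P ==> loc (p * w) (P ^^ p)"
proof (induction p)
 case 0
 thus ?case using loc_id by (simp add: id_def)
next
 case (Suc p)
 thus ?case using loc_comp[of w P "p * w" "P ^^ p"] by (simp add: o_def)
qed

lemma loc_minus: "loc w P ==> loc w Q ==> loc w (%f l. P f l - Q f l)"
 unfolding loc_def left_diff_distrib sum_subtractf by (intro allI impI arg_cong2[where f="(-)"]) blast+

text \<open>A truncated diagonal sum. It is a genuine trace only when all nonzero entries lie in the
  window, which is what \<open>fs R\<close> records.\<close>

definition tr :: "int => ((int => complex) => int => complex) => complex" where "tr R P = (\<Sum>l\<in>{-R..R}. P (dl l) l)"

definition fs :: "int => ((int => complex) => int => complex) => bool" where
 "fs R P \<longleftrightarrow> (\<forall>k l. P (dl k) l \<noteq> 0 \<longrightarrow> \<bar>k\<bar> <= R \<and> \<bar>l\<bar> <= R)"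

lemma fs_mono: "fs R P ==> R <= R' ==> fs R' P" unfolding fs_def by (meson order_trans)

text \<open>Finite support of P confines both index sums to the window, although Q is only banded
  and has no trace of its own.\<close>

lemma tr_cyc:
 assumes P: "loc w P" "fs R P" and Q: "loc v Q"
 shows "tr R (%f. P (Q f)) = tr R (%f. Q (P f))"
proof -
 have 1: "P (Q (dl l)) l = (\<Sum>k\<in>{-R..R}. P (dl k) l * Q (dl l) k)" for l
 proof -
  have "P (Q (dl l)) l = (\<Sum>k\<in>{-R..R} \<union> {l - int w..l + int w}. P (dl k) l * Q (dl l) k)" by (rule locD[OF P(1)]) auto
  also have "... = (\<Sum>k\<in>{-R..R}. P (dl k) l * Q (dl l) k)"
   by (rule sum.mono_neutral_right) (use P(2) in \<open>force simp: fs_def\<close>)+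
  finally show ?thesis .
 qed
 have 2: "Q (P (dl l)) l = (\<Sum>k\<in>{-R..R}. Q (dl k) l * P (dl l) k)" for l
 proof -
  have "Q (P (dl l)) l = (\<Sum>k\<in>{-R..R} \<union> {l - int v..l + int v}. Q (dl k) l * P (dl l) k)" by (rule locD[OF Q]) auto
  also have "... = (\<Sum>k\<in>{-R..R}. Q (dl k) l * P (dl l) k)"
   by (rule sum.mono_neutral_right) (use P(2) in \<open>force simp: fs_def\<close>)+
  finally show ?thesis .
 qed
 show ?thesis unfolding tr_def 1 2 by (subst sum.swap) (simp add: mult.commute)
qed

lemma fs_comp_right: assumes P: "fs R P" "loc v P" and Q: "loc w Q" shows "fs (R + int w) (%f. P (Q f))"
 unfolding fs_def
proof (intro allI impI)
 fix k l assume "P (Q (dl k)) l \<noteq> 0"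
 moreover have "P (Q (dl k)) l = (\<Sum>j\<in>{l - int v..l + int v}. P (dl j) l * Q (dl k) j)" by (rule locD[OF P(2)]) auto
 ultimately obtain j where "P (dl j) l * Q (dl k) j \<noteq> 0" by (metis (no_types, lifting) sum.neutral)
 hence j: "P (dl j) l \<noteq> 0" "Q (dl k) j \<noteq> 0" by auto
 hence "\<bar>j - k\<bar> <= int w" using loc_entry[OF Q, of j k] by linarith
 thus "\<bar>k\<bar> <= R + int w \<and> \<bar>l\<bar> <= R + int w" using j(1) P(1) unfolding fs_def by (smt (verit))
qed

definition adj :: "((int => complex) => int => complex) => ((int => complex) => int => complex) => bool" where
 "adj P P' \<longleftrightarrow> (\<forall>k l. P' (dl l) k = cnj (P (dl k) l))"

lemma adj_comp:
 assumes "adj P P'" "adj Q Q'" "loc v P" "loc v' Q'"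
 shows "adj (%f. P (Q f)) (%f. Q' (P' f))"
 unfolding adj_def
proof (intro allI)
 fix k l
 let ?F = "{l - int v..l + int v} \<union> {k - int v'..k + int v'}"
 have "Q' (P' (dl l)) k = (\<Sum>j\<in>?F. Q' (dl j) k * P' (dl l) j)" by (rule locD[OF assms(4)]) auto
 also have "... = cnj (\<Sum>j\<in>?F. P (dl j) l * Q (dl k) j)"
  using assms(1,2) by (simp add: adj_def mult.commute)
 also have "(\<Sum>j\<in>?F. P (dl j) l * Q (dl k) j) = P (Q (dl k)) l" by (rule locD[OF assms(3), symmetric]) auto
 finally show "Q' (P' (dl l)) k = cnj (P (Q (dl k)) l)" .
qed

lemma adj_funpow: "adj P P ==> loc w P ==> adj (P ^^ p) (P ^^ p)"
proof (induction p)
 case 0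
 thus ?case by (auto simp: adj_def dl_def)
next
 case (Suc p)
 have "adj (%f. P ((P ^^ p) f)) (%f. (P ^^ p) (P f))" by (rule adj_comp[OF Suc.prems(1) Suc.IH[OF Suc.prems] Suc.prems(2) loc_funpow[OF Suc.prems(2)]])
 thus ?case by (simp add: o_def funpow_swap1)
qed

definition psd :: "((int => complex) => int => complex) => bool" where
 "psd P \<longleftrightarrow> (\<forall>F y. finite F \<longrightarrow> (\<forall>l. l \<notin> F \<longrightarrow> y l = 0) \<longrightarrow> Re (\<Sum>l\<in>F. cnj (y l) * P y l) >= 0)"

text \<open>The diagonal entry at x of M W M' is the quadratic form of W at the vector M' (dl x),
  because M is the adjoint of M'.\<close>

lemma tr_psd:
 assumes M: "loc w M" "loc w M'" "adj M M'" and W: "psd W"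
 shows "Re (tr R (%f. M (W (M' f)))) >= 0"
proof -
 have "Re (M (W (M' (dl x))) x) >= 0" for x
 proof -
  let ?F = "{x - int w..x + int w}" and ?y = "M' (dl x)"
  have "M (W ?y) x = (\<Sum>k\<in>?F. M (dl k) x * W ?y k)" by (rule locD[OF M(1)]) auto
  also have "... = (\<Sum>k\<in>?F. cnj (?y k) * W ?y k)" using M(3) by (simp add: adj_def)
  finally have e: "M (W ?y) x = (\<Sum>k\<in>?F. cnj (?y k) * W ?y k)" .
  have "\<forall>l. l \<notin> ?F \<longrightarrow> ?y l = 0" using loc_entry[OF M(2), of _ x] by auto
  thus ?thesis unfolding e using W[unfolded psd_def, rule_format, of ?F ?y] by blast
 qed
 thus ?thesis unfolding tr_def by (simp add: sum_nonneg)
qed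

lemma kop_adj: "(!!l k. M' k l = cnj (M l k)) ==> adj (kop N M) (kop N M')"
 by (auto simp: adj_def kop_entry abs_minus_commute)

lemma funpow_telescope:
 assumes T: "loc w T" and U: "loc w U" and d: "!!f l. T f l = U f l + D f l"
 shows "(T ^^ p) f l - (U ^^ p) f l = (\<Sum>i<p. (T ^^ i) (D ((U ^^ (p - 1 - i)) f)) l)"
proof (induction p arbitrary: l)
 case (Suc p)
 have "(T ^^ Suc p) f l - (U ^^ Suc p) f l = T ((T ^^ p) f) l - U ((U ^^ p) f) l" by simp
 also have "... = (T ((T ^^ p) f) l - T ((U ^^ p) f) l) + D ((U ^^ p) f) l" using d[of "(U ^^ p) f" l] by simp
 also have "T ((T ^^ p) f) l - T ((U ^^ p) f) l = T (%l. (T ^^ p) f l - (U ^^ p) f l) l" by (rule loc_diff[OF T, symmetric])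
 also have "... = (\<Sum>i<p. T ((T ^^ i) (D ((U ^^ (p - 1 - i)) f))) l)"
  unfolding Suc.IH by (rule loc_sum[OF T])
 also have "(\<Sum>i<p. T ((T ^^ i) (D ((U ^^ (p - 1 - i)) f))) l) + D ((U ^^ p) f) l = (\<Sum>i<Suc p. (T ^^ i) (D ((U ^^ (Suc p - 1 - i)) f)) l)"
  unfolding sum.lessThan_Suc_shift by simp
 finally show ?case .
qed simp

section \<open>Commutator structure, sign conjugation and finite rank differences\<close>

section \<open>The operators of the flow\<close>

text \<open>The factor is (k - j) sgn j with k = n - j: the part k sgn j comes from (H a)(D a), the
  part -|j| from -a (Lambda a).\<close>

definition fl :: "nat => (int => complex) => int => complex" where
 "fl N a n = (\<Sum>j\<in>{- int N..int N}. of_int ((n - 2 * j) * sgn j) * (a j * a (n - j)))"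

text \<open>The matrix of Lambda^(1/2) a Lambda^(1/2), a symmetric form of a Lambda.\<close>

definition Tk :: "(int => complex) => int => int => complex" where
 "Tk a l k = of_real (sqrt \<bar>of_int l\<bar> * sqrt \<bar>of_int k\<bar>) * a (l - k)"

locale coeffs =
 fixes N :: nat and a :: "int => complex"
 assumes aband: "!!k. \<bar>k\<bar> > int N ==> a k = 0"
  and aherm: "!!k. cnj (a k) = a (- k)"
begin

definition T where "T = kop N (Tk a)"
definition X where "X = kop N (%l k. of_int (sgn l) * Tk a l k)"
definition U where "U = kop N (%l k. of_int (sgn l * sgn k) * Tk a l k)"
definition F where "F = kop N (%l k. if l * k < 0 then Tk a l k else 0)"
text \<open>With M the multiplication by H a, this is Lambda^(1/2) M Lambda^(1/2) J and
  \<open>Kk\<close> is J Lambda^(1/2) M Lambda^(1/2).\<close>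

definition Lk where "Lk = kop N (%l k. of_int (sgn (l - k) * sgn k) * Tk a l k)"
definition Kk where "Kk = kop N (%l k. of_int (sgn l * sgn (l - k)) * Tk a l k)"
definition J :: "(int => complex) => int => complex" where "J f l = of_int (sgn l) * f l"

lemmas op_defs = T_def X_def U_def F_def Lk_def Kk_def

lemma op_loc: "loc N T" "loc N X" "loc N U" "loc N F" "loc N Lk" "loc N Kk"
 unfolding op_defs by (rule loc_kop)+

lemma J_loc: "loc 0 J"
 unfolding loc_def J_def
proof (intro allI impI)
 fix f :: "int => complex" and l :: int and F assume F: "finite F" "{l - int 0..l + int 0} \<subseteq> F"
 have "(\<Sum>k\<in>F. of_int (sgn l) * dl k l * f k) = (\<Sum>k\<in>F. if k = l then of_int (sgn l) * f l else 0)" by (intro sum.cong) (auto simp: dl_def)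
 thus "of_int (sgn l) * f l = (\<Sum>k\<in>F. of_int (sgn l) * dl k l * f k)" using F by simp
qed

lemma X_JT: "X f = J (T f)"
 by (rule ext) (simp add: X_def T_def J_def kop_def sum_distrib_left mult.assoc)

lemma U_JTJ: "U f = J (T (J f))"
 by (rule ext) (simp add: U_def T_def J_def kop_def sum_distrib_left mult_ac)

lemma T_JJ: "T (J (J f)) = T f" "J (J (T f)) = T f"
proof -
 have s: "complex_of_int (sgn k) * of_int (sgn k) = 1" if "k \<noteq> 0" for k :: int
  using that by (auto simp: sgn_if)
 show "T (J (J f)) = T f"
  unfolding T_def J_def kop_def
 proof (intro ext sum.cong refl)
  fix l k
  show "Tk a l k * (of_int (sgn k) * (of_int (sgn k) * f k)) = Tk a l k * f k"
   using s[of k] by (cases "k = 0") (auto simp: Tk_def simp flip: mult.assoc)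
 qed
 show "J (J (T f)) = T f"
 proof
  fix l show "J (J (T f)) l = T f l"
   using s[of l] by (cases "l = 0") (auto simp: T_def J_def kop_def Tk_def simp flip: mult.assoc)
 qed
qed

text \<open>sgn (l - k) (sgn k - sgn l) is 0 for equal signs and -2 for opposite ones. So Lk T - T
  Kk is the commutator of Kk with T minus 2 F T.\<close>

lemma LK_F: "Lk f l - Kk f l = - 2 * F f l"
proof -
 have "of_int (sgn (l - k) * sgn k) * Tk a l k * f k - of_int (sgn l * sgn (l - k)) * Tk a l k * f k = - 2 * ((if l * k < 0 then Tk a l k else 0) * f k)" for k
 proof (cases "l = 0 \<or> k = 0")
  case True
  thus ?thesis by (auto simp: Tk_def)
 next
  case False
  hence "sgn (l - k) * sgn k - sgn l * sgn (l - k) = (if l * k < 0 then - 2 else 0)"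
   by (auto simp: sgn_if mult_less_0_iff)
  hence "of_int (sgn (l - k) * sgn k - sgn l * sgn (l - k)) * Tk a l k * f k = - 2 * ((if l * k < 0 then Tk a l k else 0) * f k)"
   by auto
  thus ?thesis by (simp add: left_diff_distrib)
 qed
 thus ?thesis unfolding Lk_def Kk_def F_def kop_def by (simp add: sum_subtractf[symmetric] sum_distrib_left)
qed

lemma T_U_F: "T f l = U f l + 2 * F f l"
proof -
 have "Tk a l k * f k = of_int (sgn l * sgn k) * Tk a l k * f k + 2 * ((if l * k < 0 then Tk a l k else 0) * f k)" for k
 proof (cases "l = 0 \<or> k = 0")
  case True
  thus ?thesis by (auto simp: Tk_def)
 next
  case False
  hence "sgn l * sgn k = (if l * k < 0 then - 1 else 1)" by (auto simp: sgn_if mult_less_0_iff)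
  thus ?thesis by auto
 qed
 thus ?thesis unfolding T_def U_def F_def kop_def by (simp add: sum.distrib[symmetric] sum_distrib_left)
qed

text \<open>If |n| > N and both j and n - j lie in the band, then both have the sign of n, so j -> n
  - j reverses the factor (n - 2j) sgn j and the sum equals its negative.\<close>

lemma fl_band: assumes "\<bar>n\<bar> > int N" shows "fl N a n = 0"
proof -
 have "fl N a n = (\<Sum>j\<in>{j \<in> {- int N..int N}. \<bar>n - j\<bar> <= int N}. of_int ((n - 2 * j) * sgn j) * (a j * a (n - j)))"
  unfolding fl_def by (rule sum.mono_neutral_right) (auto simp: not_le intro!: aband)
 also have "... = (\<Sum>j\<in>{j \<in> {- int N..int N}. \<bar>n - j\<bar> <= int N}. - (of_int ((n - 2 * j) * sgn j) * (a j * a (n - j))))"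
 proof (rule sum.reindex_bij_witness[of _ "%j. n - j" "%j. n - j"])
  fix j assume j: "j \<in> {j \<in> {- int N..int N}. \<bar>n - j\<bar> <= int N}"
  hence "sgn (n - j) = sgn j" using assms by (auto simp: sgn_if)
  thus "- (of_int ((n - 2 * (n - j)) * sgn (n - j)) * (a (n - j) * a (n - (n - j)))) = of_int ((n - 2 * j) * sgn j) * (a j * a (n - j))"
   by (simp add: algebra_simps)
 qed auto
 also have "... = - (\<Sum>j\<in>{j \<in> {- int N..int N}. \<bar>n - j\<bar> <= int N}. of_int ((n - 2 * j) * sgn j) * (a j * a (n - j)))"
  by (rule sum_negf)
 also have "... = - fl N a n"
  unfolding fl_def by (intro arg_cong[where f=uminus] sum.mono_neutral_left) (auto simp: not_le intro!: aband)
 finally show ?thesis by simp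
qed

lemma kop_eq: assumes "!!l k. \<bar>l - k\<bar> > int N ==> M l k = 0" "finite S" "{l - int N..l + int N} \<subseteq> S"
 shows "kop N M f l = (\<Sum>k\<in>S. M l k * f k)"
 unfolding kop_def by (rule sum.mono_neutral_left) (use assms in auto)

lemma sqrt_sgn: "complex_of_real (sqrt \<bar>of_int j\<bar>) * of_real (sqrt \<bar>of_int j\<bar>) * of_int (sgn j) = of_int j"
proof -
 have "complex_of_real (sqrt \<bar>of_int j\<bar>) * of_real (sqrt \<bar>of_int j\<bar>) = of_real \<bar>of_int j\<bar>" by (simp flip: of_real_mult)
 thus ?thesis by (auto simp: sgn_if)
qed

text \<open>In a product of two kernels the inner roots combine with a sign to the integer j. In
  terms of the shift i the two products carry (l - i) sgn i and (k + i) sgn i, whose difference (l -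
  k - 2i) sgn i is the factor of \<open>fl\<close> at l - k.\<close>

lemma flow_commutator: "kop N (Tk (fl N a)) f l = Lk (T f) l - T (Kk f) l"
proof -
 let ?S = "{l - 2 * int N..l + 2 * int N}" and ?I = "{l - int N..l + int N}"
 define rt where "rt n = complex_of_real (sqrt \<bar>of_int n\<bar>)" for n :: int
 have Tk: "Tk u x y = rt x * rt y * u (x - y)" for u x y by (simp add: Tk_def rt_def)
 have rr: "rt j * rt j * of_int (sgn j) = of_int j" for j unfolding rt_def by (rule sqrt_sgn)
 have 1: "Lk (T f) l = (\<Sum>k\<in>?S. rt l * rt k * (\<Sum>i\<in>{- int N..int N}. of_int ((l - i) * sgn i) * (a i * a (l - k - i))) * f k)"
 proof -
  have "Lk (T f) l = (\<Sum>j\<in>?I. of_int (sgn (l - j) * sgn j) * Tk a l j * (\<Sum>k\<in>?S. Tk a j k * f k))"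
   unfolding Lk_def kop_def[of N _ _ l]
  proof (intro sum.cong refl arg_cong2[where f="(*)"])
   fix j assume "j \<in> ?I"
   thus "T f j = (\<Sum>k\<in>?S. Tk a j k * f k)" unfolding T_def by (intro kop_eq) (auto simp: Tk_def aband)
  qed
  also have "... = (\<Sum>k\<in>?S. \<Sum>j\<in>?I. of_int (sgn (l - j) * sgn j) * Tk a l j * (Tk a j k * f k))"
   unfolding sum_distrib_left by (rule sum.swap)
  also have "... = (\<Sum>k\<in>?S. rt l * rt k * (\<Sum>j\<in>?I. of_int (j * sgn (l - j)) * (a (l - j) * a (j - k))) * f k)"
  proof (intro sum.cong refl)
   fix k
   have "of_int (sgn (l - j) * sgn j) * Tk a l j * (Tk a j k * f k) = rt l * rt k * (of_int (j * sgn (l - j)) * (a (l - j) * a (j - k))) * f k" for j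
   proof -
    have "of_int (sgn (l - j) * sgn j) * Tk a l j * (Tk a j k * f k) = rt l * rt k * ((rt j * rt j * of_int (sgn j)) * of_int (sgn (l - j)) * (a (l - j) * a (j - k))) * f k"
     unfolding Tk by (simp add: mult_ac)
    thus ?thesis unfolding rr by simp
   qed
   thus "(\<Sum>j\<in>?I. of_int (sgn (l - j) * sgn j) * Tk a l j * (Tk a j k * f k)) = rt l * rt k * (\<Sum>j\<in>?I. of_int (j * sgn (l - j)) * (a (l - j) * a (j - k))) * f k"
    by (simp only: sum_distrib_left sum_distrib_right)
  qed
  finally have "Lk (T f) l = (\<Sum>k\<in>?S. rt l * rt k * (\<Sum>j\<in>?I. of_int (j * sgn (l - j)) * (a (l - j) * a (j - k))) * f k)" .
  moreover have "(\<Sum>j\<in>?I. of_int (j * sgn (l - j)) * (a (l - j) * a (j - k))) = (\<Sum>i\<in>{- int N..int N}. of_int ((l - i) * sgn i) * (a i * a (l - k - i)))" for k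
   by (rule sum.reindex_bij_witness[of _ "%i. l - i" "%j. l - j"]) (auto simp: algebra_simps)
  ultimately show ?thesis by (simp only:)
 qed
 have 2: "T (Kk f) l = (\<Sum>k\<in>?S. rt l * rt k * (\<Sum>i\<in>{- int N..int N}. of_int ((k + i) * sgn i) * (a i * a (l - k - i))) * f k)"
 proof -
  have "T (Kk f) l = (\<Sum>j\<in>?I. Tk a l j * (\<Sum>k\<in>?S. of_int (sgn j * sgn (j - k)) * Tk a j k * f k))"
   unfolding T_def kop_def[of N _ _ l]
  proof (intro sum.cong refl arg_cong2[where f="(*)"])
   fix j assume "j \<in> ?I"
   thus "Kk f j = (\<Sum>k\<in>?S. of_int (sgn j * sgn (j - k)) * Tk a j k * f k)" unfolding Kk_def by (intro kop_eq) (auto simp: Tk_def aband)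
  qed
  also have "... = (\<Sum>k\<in>?S. \<Sum>j\<in>?I. Tk a l j * (of_int (sgn j * sgn (j - k)) * Tk a j k * f k))"
   unfolding sum_distrib_left by (rule sum.swap)
  also have "... = (\<Sum>k\<in>?S. rt l * rt k * (\<Sum>j\<in>?I. of_int (j * sgn (j - k)) * (a (l - j) * a (j - k))) * f k)"
  proof (intro sum.cong refl)
   fix k
   have "Tk a l j * (of_int (sgn j * sgn (j - k)) * Tk a j k * f k) = rt l * rt k * (of_int (j * sgn (j - k)) * (a (l - j) * a (j - k))) * f k" for j
   proof -
    have "Tk a l j * (of_int (sgn j * sgn (j - k)) * Tk a j k * f k) = rt l * rt k * ((rt j * rt j * of_int (sgn j)) * of_int (sgn (j - k)) * (a (l - j) * a (j - k))) * f k"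
     unfolding Tk by (simp add: mult_ac)
    thus ?thesis unfolding rr by simp
   qed
   thus "(\<Sum>j\<in>?I. Tk a l j * (of_int (sgn j * sgn (j - k)) * Tk a j k * f k)) = rt l * rt k * (\<Sum>j\<in>?I. of_int (j * sgn (j - k)) * (a (l - j) * a (j - k))) * f k"
    by (simp only: sum_distrib_left sum_distrib_right)
  qed
  finally have "T (Kk f) l = (\<Sum>k\<in>?S. rt l * rt k * (\<Sum>j\<in>?I. of_int (j * sgn (j - k)) * (a (l - j) * a (j - k))) * f k)" .
  moreover have "(\<Sum>j\<in>?I. of_int (j * sgn (j - k)) * (a (l - j) * a (j - k))) = (\<Sum>i\<in>{- int N..int N}. of_int ((k + i) * sgn i) * (a i * a (l - k - i)))" for k
  proof -
   have "(\<Sum>j\<in>?I. of_int (j * sgn (j - k)) * (a (l - j) * a (j - k))) = (\<Sum>j\<in>?I \<inter> {k - int N..k + int N}. of_int (j * sgn (j - k)) * (a (l - j) * a (j - k)))"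
    by (rule sum.mono_neutral_right) (auto simp: aband)
   also have "... = (\<Sum>j\<in>{k - int N..k + int N}. of_int (j * sgn (j - k)) * (a (l - j) * a (j - k)))"
    by (rule sum.mono_neutral_left) (auto simp: not_le intro!: aband)
   also have "... = (\<Sum>i\<in>{- int N..int N}. of_int ((k + i) * sgn i) * (a i * a (l - k - i)))"
    by (rule sum.reindex_bij_witness[of _ "%i. k + i" "%j. j - k"]) (auto simp: algebra_simps)
   finally show ?thesis .
  qed
  ultimately show ?thesis by (simp only:)
 qed
 have "kop N (Tk (fl N a)) f l = (\<Sum>k\<in>?S. rt l * rt k * fl N a (l - k) * f k)"
  by (subst kop_eq[where S="?S"]) (auto simp: Tk fl_band)
 also have "... = (\<Sum>k\<in>?S. rt l * rt k * (\<Sum>i\<in>{- int N..int N}. of_int ((l - i) * sgn i) * (a i * a (l - k - i))) * f k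
  - rt l * rt k * (\<Sum>i\<in>{- int N..int N}. of_int ((k + i) * sgn i) * (a i * a (l - k - i))) * f k)"
 proof (intro sum.cong refl)
  fix k
  have "fl N a (l - k) = (\<Sum>i\<in>{- int N..int N}. of_int ((l - i) * sgn i) * (a i * a (l - k - i))) - (\<Sum>i\<in>{- int N..int N}. of_int ((k + i) * sgn i) * (a i * a (l - k - i)))"
   unfolding fl_def sum_subtractf[symmetric] by (intro sum.cong refl) (simp add: algebra_simps)
  thus "rt l * rt k * fl N a (l - k) * f k = rt l * rt k * (\<Sum>i\<in>{- int N..int N}. of_int ((l - i) * sgn i) * (a i * a (l - k - i))) * f k
  - rt l * rt k * (\<Sum>i\<in>{- int N..int N}. of_int ((k + i) * sgn i) * (a i * a (l - k - i))) * f k" by (simp only: left_diff_distrib right_diff_distrib)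
 qed
 also have "... = Lk (T f) l - T (Kk f) l" unfolding 1 2 by (rule sum_subtractf)
 finally show ?thesis .
qed

lemma op_adj: "adj T T" "adj U U" "adj F F"
proof -
 have h: "Tk a k l = cnj (Tk a l k)" for l k by (simp add: Tk_def aherm mult.commute)
 show "adj T T" "adj U U" "adj F F" unfolding T_def U_def F_def by (auto intro!: kop_adj simp: h[symmetric] mult.commute)
qed

text \<open>Indices of opposite sign at distance at most N are both bounded by N.\<close>

lemma F_fs: "fs (int N) F"
 unfolding fs_def F_def kop_entry by (auto simp: mult_less_0_iff split: if_splits)

lemma F_J: "J (F (J f)) l = - F f l"
proof -
 have "of_int (sgn l) * ((if l * k < 0 then Tk a l k else 0) * (of_int (sgn k) * f k)) = - ((if l * k < 0 then Tk a l k else 0) * f k)" for k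
 proof (cases "l * k < 0")
  case True
  hence "complex_of_int (sgn l) * of_int (sgn k) = - 1" by (auto simp: sgn_if mult_less_0_iff)
  thus ?thesis using True by (simp add: mult_ac) (simp flip: mult.assoc)
 qed auto
 thus ?thesis unfolding J_def F_def kop_def by (simp add: sum_distrib_left sum_negf[symmetric])
qed

lemma U_pow: "p > 0 ==> (U ^^ p) f = J ((T ^^ p) (J f))"
proof (induction p)
 case (Suc p)
 show ?case
 proof (cases "p = 0")
  case False
  hence "(U ^^ p) f = J ((T ^^ p) (J f))" using Suc by blast
  hence "(U ^^ Suc p) f = J (T (J (J ((T ^^ p) (J f)))))" using U_JTJ[of "(U ^^ p) f"] by simp
  thus ?thesis by (simp add: T_JJ)
 qed (simp add: U_JTJ)
qed simp

text \<open>Move half of the even power of B to the front by cyclicity; with M = B^q' F A^q the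
  operator becomes M A M* and A is positive.\<close>

lemma trace_sandwich:
 assumes A: "loc N A" "adj A A" "psd A" and B: "loc N B" "adj B B"
  and R: "R >= int N + int ((2 * q + 1) * N + (N + 2 * q' * N))"
 shows "Re (tr R (%f. F ((A ^^ (2 * q + 1)) (F ((B ^^ (2 * q')) f))))) >= 0"
proof -
 note lF = op_loc(4)
 have lA: "loc (k * N) (A ^^ k)" and lB: "loc (k * N) (B ^^ k)" for k by (rule loc_funpow[OF A(1)], rule loc_funpow[OF B(1)])
 have Ai: "(A ^^ (2 * q + 1)) f = (A ^^ q) (A ((A ^^ q) f))" for f by (simp add: mult_2 funpow_add funpow_swap1)
 have Bj: "(B ^^ (2 * q')) f = (B ^^ q') ((B ^^ q') f)" for f by (simp add: mult_2 funpow_add)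
 define P where "P f = F ((A ^^ (2 * q + 1)) (F ((B ^^ q') f)))" for f
 have lP: "loc (N + ((2 * q + 1) * N + (N + q' * N))) P" unfolding P_def by (intro loc_comp lF lA lB)
 have "fs (int N + int ((2 * q + 1) * N + (N + q' * N))) P" unfolding P_def by (rule fs_comp_right[OF F_fs lF loc_comp[OF lA loc_comp[OF lF lB]]])
 hence fP: "fs R P"
 proof (rule fs_mono)
  have "(2 * q + 1) * N + (N + q' * N) <= (2 * q + 1) * N + (N + 2 * q' * N)" by simp
  thus "int N + int ((2 * q + 1) * N + (N + q' * N)) <= R" using R by linarith
 qed
 have "tr R (%f. F ((A ^^ (2 * q + 1)) (F ((B ^^ (2 * q')) f)))) = tr R (%f. P ((B ^^ q') f))" by (simp only: P_def Bj)
 also have "... = tr R (%f. (B ^^ q') (P f))" by (rule tr_cyc[OF lP fP lB])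
 also have "... = tr R (%f. (%f. (B ^^ q') (F ((A ^^ q) f))) (A ((%f. (A ^^ q) (F ((B ^^ q') f))) f)))" by (simp only: P_def Ai)
 finally have e: "tr R (%f. F ((A ^^ (2 * q + 1)) (F ((B ^^ (2 * q')) f)))) = ..." .
 show ?thesis unfolding e
 proof (rule tr_psd[OF _ _ _ A(3)])
  show "loc (q' * N + (N + q * N)) (%f. (B ^^ q') (F ((A ^^ q) f)))" by (intro loc_comp lF lA lB)
  have "loc (q * N + (N + q' * N)) (%f. (A ^^ q) (F ((B ^^ q') f)))" by (intro loc_comp lF lA lB)
  thus "loc (q' * N + (N + q * N)) (%f. (A ^^ q) (F ((B ^^ q') f)))" by (rule loc_mono) simp
  have "adj (%f. (B ^^ q') ((%f. F ((A ^^ q) f)) f)) (%f. (%f. (A ^^ q) (F f)) ((B ^^ q') f))"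
   by (rule adj_comp[where v="q' * N" and v'="q * N + N"], rule adj_funpow[OF B(2,1)],
     rule adj_comp[where v=N and v'="q * N"], rule op_adj(3), rule adj_funpow[OF A(2,1)],
     rule lF, rule lA, rule lB, rule loc_comp[OF lA lF])
  thus "adj (%f. (B ^^ q') (F ((A ^^ q) f))) (%f. (A ^^ q) (F ((B ^^ q') f)))" by simp
 qed
qed

text \<open>Conjugation by J turns T into U and F into -F, so tr F U^p = - tr F T^p. Telescoping T^p
  - U^p with T - U = 2F gives tr F T^p as a sum of tr F T^i F U^j with i + j = p - 1 odd. One
  exponent is odd and the other even, so each term is a sandwich.\<close>

lemma trace_F_pow:
 assumes p: "p > 0" and R: "R >= int N + int (2 * p * N) + int (2 * N)" and psdT: "psd T"
  and odd: "odd (p - 1)"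
 shows "Re (tr R (%f. F ((T ^^ p) f))) >= 0"
proof -
 note lT = op_loc(1) and lU = op_loc(3) and lF = op_loc(4)
 have lTp: "loc (q * N) (T ^^ q)" and lUp: "loc (q * N) (U ^^ q)" for q by (rule loc_funpow[OF lT], rule loc_funpow[OF lU])
 have psdU: "psd U"
  unfolding psd_def
 proof (intro allI impI)
  fix S and y :: "int => complex" assume S: "finite S" "\<forall>l. l \<notin> S \<longrightarrow> y l = (0::complex)"
  have "(\<Sum>l\<in>S. cnj (y l) * U y l) = (\<Sum>l\<in>S. cnj (J y l) * T (J y) l)" unfolding U_JTJ by (intro sum.cong) (auto simp: J_def)
  moreover have "Re (\<Sum>l\<in>S. cnj (J y l) * T (J y) l) >= 0"
   using psdT[unfolded psd_def, rule_format, of S "J y"] S by (simp add: J_def)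
  ultimately show "Re (\<Sum>l\<in>S. cnj (y l) * U y l) >= 0" by simp
 qed
 have Jt: "tr R (%f. F ((U ^^ p) f)) = - tr R (%f. F ((T ^^ p) f))"
 proof -
  have l: "loc (N + (0 + p * N)) (%f. F (J ((T ^^ p) f)))" by (intro loc_comp lF J_loc lTp)
  have "fs (int N + int (0 + p * N)) (%f. F (J ((T ^^ p) f)))" by (intro fs_comp_right[OF F_fs lF] loc_comp J_loc lTp)
  hence f: "fs R (%f. F (J ((T ^^ p) f)))" 
  proof (rule fs_mono)
   have "int (p * N) <= int (2 * p * N)" by simp
   thus "int N + int (0 + p * N) <= R" using R of_nat_0_le_iff[of "2 * N", where 'a=int] by linarith
  qed
  have "tr R (%f. F ((U ^^ p) f)) = tr R (%f. F (J ((T ^^ p) (J f))))" using U_pow[OF p] by simp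
  also have "... = tr R (%f. J (F (J ((T ^^ p) f))))" by (rule tr_cyc[OF l f J_loc])
  also have "... = - tr R (%f. F ((T ^^ p) f))" unfolding tr_def F_J by (rule sum_negf)
  finally show ?thesis .
 qed
 have "(T ^^ p) f l - (U ^^ p) f l = (\<Sum>i<p. (T ^^ i) ((%l. 2 * F ((U ^^ (p - 1 - i)) f) l)) l)" for f l
  by (rule funpow_telescope[OF lT lU T_U_F])
 hence tel: "(T ^^ p) f l - (U ^^ p) f l = (\<Sum>i<p. 2 * (T ^^ i) (F ((U ^^ (p - 1 - i)) f)) l)" for f l
  by (simp add: loc_cmult[OF lTp])
 have "F ((T ^^ p) f) l - F ((U ^^ p) f) l = (\<Sum>i<p. 2 * F ((T ^^ i) (F ((U ^^ (p - 1 - i)) f))) l)" for f l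
 proof -
  have "F ((T ^^ p) f) l - F ((U ^^ p) f) l = F (%l. (T ^^ p) f l - (U ^^ p) f l) l" by (rule loc_diff[OF lF, symmetric])
  also have "... = (\<Sum>i<p. F (%l. 2 * (T ^^ i) (F ((U ^^ (p - 1 - i)) f)) l) l)" unfolding tel by (rule loc_sum[OF lF])
  finally show ?thesis by (simp add: loc_cmult[OF lF])
 qed
 hence "tr R (%f. F ((T ^^ p) f)) - tr R (%f. F ((U ^^ p) f)) = (\<Sum>i<p. 2 * tr R (%f. F ((T ^^ i) (F ((U ^^ (p - 1 - i)) f)))))"
  unfolding tr_def sum_subtractf[symmetric] by (simp add: sum_distrib_left) (subst sum.swap, simp)
 hence eq: "tr R (%f. F ((T ^^ p) f)) = (\<Sum>i<p. tr R (%f. F ((T ^^ i) (F ((U ^^ (p - 1 - i)) f)))))"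
  unfolding Jt by (simp add: sum_distrib_left[symmetric])
 have "Re (tr R (%f. F ((T ^^ i) (F ((U ^^ (p - 1 - i)) f))))) >= 0" if i: "i < p" for i
 proof -
  define j where "j = p - 1 - i"
  have ij: "i + j = p - 1" using i by (simp add: j_def)
  have "(i + j) * N <= 2 * p * N" using ij by (intro mult_right_mono) auto
  hence "i * N + (N + j * N) <= 2 * p * N + 2 * N" "j * N + (N + i * N) <= 2 * p * N + 2 * N" by (simp_all add: add_mult_distrib)
  hence R': "int N + int (i * N + (N + j * N)) <= R" "int N + int (j * N + (N + i * N)) <= R" using R by linarith+
  show ?thesis unfolding j_def[symmetric]
  proof (cases "odd i")
   case True
   then obtain q where q: "i = 2 * q + 1" by (elim oddE)
   have "even j" using ij odd True by (metis even_add)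
   then obtain q' where q': "j = 2 * q'" by (elim evenE)
   show "Re (tr R (%f. F ((T ^^ i) (F ((U ^^ j) f))))) >= 0"
    using R'(1) unfolding q q' by (rule trace_sandwich[OF lT op_adj(1) psdT lU op_adj(2)])
  next
   case False
   hence "even i" by simp
   then obtain q where q: "i = 2 * q" by (elim evenE)
   have "odd j" using ij odd False by (metis even_add)
   then obtain q' where q': "j = 2 * q' + 1" by (elim oddE)
   have "int (i * N) <= int (i * N + (N + j * N))" by (intro of_nat_mono) simp
   hence "int N + int (i * N) <= R" using R'(1) by linarith
   hence f: "fs R (%f. F ((T ^^ i) f))" by (rule fs_mono[OF fs_comp_right[OF F_fs lF lTp]])
   have "tr R (%f. F ((T ^^ i) (F ((U ^^ j) f)))) = tr R (%f. F ((U ^^ j) (F ((T ^^ i) f))))"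
    by (rule tr_cyc[OF loc_comp[OF lF lTp] f loc_comp[OF lF lUp]])
   moreover have "Re (tr R (%f. F ((U ^^ j) (F ((T ^^ i) f))))) >= 0"
    using R'(2) unfolding q q' by (rule trace_sandwich[OF lU op_adj(2) psdU lT op_adj(1)])
   ultimately show "Re (tr R (%f. F ((T ^^ i) (F ((U ^^ j) f))))) >= 0" by simp
  qed
 qed
 thus ?thesis unfolding eq Re_sum by (intro sum_nonneg) auto
qed

text \<open>A sequence supported far out on the side of sign \<sigma> moves by at most N per
  application of T, so for p steps it stays on that side, where J is multiplication by
  \<sigma>.\<close>

lemma sided_power:
 assumes sg: "\<sigma> = 1 \<or> \<sigma> = -1" and f: "!!l. \<sigma> * l <= c ==> f l = 0" and c: "c >= int (p * N)"
 shows "(X ^^ p) f = (%l. of_int (\<sigma> ^ p) * (T ^^ p) f l) \<and> (\<forall>l. \<sigma> * l <= c - int (p * N) \<longrightarrow> (T ^^ p) f l = 0)"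
 using c
proof (induction p)
 case 0
 thus ?case using f by auto
next
 case (Suc p)
 hence IH: "(X ^^ p) f = (%l. of_int (\<sigma> ^ p) * (T ^^ p) f l)" "!!l. \<sigma> * l <= c - int (p * N) ==> (T ^^ p) f l = 0" by auto
 have z: "(T ^^ Suc p) f l = 0" if l: "\<sigma> * l <= c - int (Suc p * N)" for l
 proof -
  have "(T ^^ Suc p) f l = (\<Sum>k\<in>{l - int N..l + int N}. Tk a l k * (T ^^ p) f k)" by (simp add: T_def kop_def)
  also have "... = 0"
  proof (intro sum.neutral ballI)
   fix k assume "k \<in> {l - int N..l + int N}"
   hence "\<sigma> * k <= c - int (p * N)" using l sg by auto
   thus "Tk a l k * (T ^^ p) f k = 0" by (simp add: IH(2))
  qed
  finally show ?thesis .
 qed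
 have "(X ^^ Suc p) f l = of_int (\<sigma> ^ Suc p) * (T ^^ Suc p) f l" for l
 proof -
  have "(X ^^ Suc p) f l = of_int (sgn l) * T (%l. of_int (\<sigma> ^ p) * (T ^^ p) f l) l" using IH(1) by (simp add: X_JT J_def)
  also have "... = of_int (sgn l) * (of_int (\<sigma> ^ p) * (T ^^ Suc p) f l)" by (simp add: loc_cmult[OF op_loc(1)])
  also have "... = of_int (\<sigma> ^ Suc p) * (T ^^ Suc p) f l"
  proof (cases "\<sigma> * l <= 0")
   case True
   hence "(T ^^ Suc p) f l = 0" using z Suc.prems by (intro z) linarith
   thus ?thesis by simp
  next
   case False
   hence "sgn l = \<sigma>" using sg by (auto simp: sgn_if)
   thus ?thesis by simp
  qed
  finally show ?thesis .
 qed
 thus ?case using z by auto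
qed

text \<open>For even p the p signs of X cancel far from zero, so this difference has finite support.
  \<open>Vp\<close> carries one extra J to do the same for odd p, and composing it with T gives
  \<open>Sp\<close> of the next exponent.\<close>

definition Sp :: "nat => (int => complex) => int => complex" where "Sp p f l = (T ^^ p) f l - (X ^^ p) f l"
definition Vp :: "nat => (int => complex) => int => complex" where "Vp p f l = (T ^^ p) f l - (X ^^ p) (J f) l"

lemma Xp_loc: "loc (p * N) (X ^^ p)" by (rule loc_funpow[OF op_loc(2)])
lemma Tp_loc: "loc (p * N) (T ^^ p)" by (rule loc_funpow[OF op_loc(1)])

lemma Sp_loc: "loc (p * N) (Sp p)" unfolding Sp_def[abs_def] by (intro loc_minus Tp_loc Xp_loc)
lemma Vp_loc: "loc (p * N) (Vp p)"
 unfolding Vp_def[abs_def] using loc_comp[OF Xp_loc J_loc] by (intro loc_minus Tp_loc) auto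

lemma far_column:
 assumes "\<bar>k\<bar> > int (p * N)"
 shows "even p ==> Sp p (dl k) l = 0" "odd p ==> Vp p (dl k) l = 0"
proof -
 define \<sigma> where "\<sigma> = sgn k"
 have "k \<noteq> 0" using assms of_nat_0_le_iff[of "p * N", where 'a=int] by linarith
 hence sg: "\<sigma> = 1 \<or> \<sigma> = -1" by (auto simp: \<sigma>_def sgn_if)
 have k: "\<sigma> * k > int (p * N)" using assms by (auto simp: \<sigma>_def sgn_if split: if_splits)
 have z: "dl k l = 0" if "\<sigma> * l <= int (p * N)" for l using that k by (auto simp: dl_def)
 have X: "(X ^^ p) (dl k) l = of_int (\<sigma> ^ p) * (T ^^ p) (dl k) l" using sided_power[where \<sigma>=\<sigma> and f="dl k" and c="int (p * N)" and p=p, OF sg z] by simp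
 show "Sp p (dl k) l = 0" if "even p" using X that sg by (auto simp: Sp_def)
 show "Vp p (dl k) l = 0" if "odd p"
 proof -
  have "J (dl k) = (%l. of_int \<sigma> * dl k l)" by (auto simp: J_def dl_def \<sigma>_def)
  hence "(X ^^ p) (J (dl k)) l = of_int \<sigma> * (X ^^ p) (dl k) l" by (simp add: loc_cmult[OF Xp_loc])
  thus ?thesis using X that sg by (auto simp: Vp_def)
 qed
qed

lemma Sp_fs: assumes "even p" shows "fs (2 * int (p * N)) (Sp p)"
 unfolding fs_def
proof (intro allI impI)
 fix k l assume nz: "Sp p (dl k) l \<noteq> 0"
 have "\<bar>k\<bar> <= int (p * N)" using far_column(1)[OF _ assms, of k l] nz by linarith
 moreover have "\<bar>l - k\<bar> <= int (p * N)" using loc_entry[OF Sp_loc, of p l k] nz by linarith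
 ultimately show "\<bar>k\<bar> <= 2 * int (p * N) \<and> \<bar>l\<bar> <= 2 * int (p * N)" by linarith
qed

lemma Vp_fs: assumes "odd p" shows "fs (2 * int (p * N)) (Vp p)"
 unfolding fs_def
proof (intro allI impI)
 fix k l assume nz: "Vp p (dl k) l \<noteq> 0"
 have "\<bar>k\<bar> <= int (p * N)" using far_column(2)[OF _ assms, of k l] nz by linarith
 moreover have "\<bar>l - k\<bar> <= int (p * N)" using loc_entry[OF Vp_loc, of p l k] nz by linarith
 ultimately show "\<bar>k\<bar> <= 2 * int (p * N) \<and> \<bar>l\<bar> <= 2 * int (p * N)" by linarith
qed

lemma Vp_T: "Vp p (T f) l = Sp (Suc p) f l"
 by (simp add: Vp_def Sp_def funpow_swap1 X_JT)

end

section \<open>Diagonal sums in the basis of phi as finite traces in the basis of theta\<close>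

section \<open>Special values\<close>

lemma loc_fs:
 assumes "loc w P" "fs R P" shows "P f l = (\<Sum>k\<in>{-R..R}. P (dl k) l * f k)"
proof -
 have "P f l = (\<Sum>k\<in>{-R..R} \<union> {l - int w..l + int w}. P (dl k) l * f k)" by (rule locD[OF assms(1)]) auto
 also have "... = (\<Sum>k\<in>{-R..R}. P (dl k) l * f k)"
  by (rule sum.mono_neutral_right) (use assms(2) in \<open>force simp: fs_def\<close>)+
 finally show ?thesis .
qed

lemma has_sum_diff:
 fixes f :: "'a => 'b::real_normed_field"
 assumes "(f has_sum x) A" "(g has_sum y) A" shows "((%i. f i - g i) has_sum (x - y)) A"
 using has_sum_add[OF assms(1) has_sum_cmult_right[OF assms(2), of "- 1"]] by simp

abbreviation rt :: "int => complex" where "rt l \<equiv> of_real (sqrt \<bar>of_int l\<bar>)"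

lemma rt_rt: "rt l * rt l = of_int \<bar>l\<bar>"
proof -
 have "rt l * rt l = of_real (of_int \<bar>l\<bar>)" unfolding of_real_mult[symmetric] by simp
 thus ?thesis by (simp only: of_real_of_int_eq)
qed

lemma rt_sgn: "rt l * (of_int (sgn l) * (rt l * x)) = of_int l * x"
proof -
 have "rt l * (of_int (sgn l) * (rt l * x)) = of_int (sgn l) * (rt l * rt l) * x" by (simp add: mult_ac)
 thus ?thesis unfolding rt_rt of_int_mult[symmetric] by (simp add: mult.commute[of "sgn l"] abs_mult_sgn)
qed

context trig1
begin

sublocale co: coeffs N bc by unfold_locales (simp_all add: band bc_cnj)

definition dn :: "int => int => complex" where "dn n l = rt l * c n l"

lemma T_rt: "co.T (%l. rt l * x l) l = rt l * Yop x l"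
proof -
 have "co.T (%l. rt l * x l) l = (\<Sum>k\<in>{l - int N..l + int N}. rt l * (bc (l - k) * (rt k * rt k * x k)))"
  unfolding co.T_def kop_def Tk_def by (simp add: mult_ac)
 also have "... = (\<Sum>j\<in>{- int N..int N}. rt l * (bc j * (of_int \<bar>l - j\<bar> * x (l - j))))"
  unfolding rt_rt by (rule sum.reindex_bij_witness[of _ "%j. l - j" "%k. l - k"]) auto
 finally show ?thesis by (simp add: Yop_def conv_def sum_distrib_left)
qed

lemma T_pow_rt: "(co.T ^^ p) (%l. rt l * x l) = (%l. rt l * (Yop ^^ p) x l)"
 by (induction p) (auto simp: T_rt)

text \<open>\<open>c_recursion\<close> in symmetric form: Lambda^(1/2) applied to cis (n \<phi>) is
  an eigenvector of T J with eigenvalue n. Hence powers of X act on J \<open>dn n\<close> as powers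
  of n.\<close>

lemma TJ_dn: "co.T (co.J (dn n)) l = of_int n * dn n l"
proof -
 have "co.T (co.J (dn n)) l = (\<Sum>k\<in>{l - int N..l + int N}. rt l * (bc (l - k) * (rt k * (of_int (sgn k) * (rt k * c n k)))))"
  unfolding co.T_def kop_def Tk_def co.J_def dn_def by (simp add: mult_ac)
 also have "... = (\<Sum>j\<in>{- int N..int N}. rt l * (bc j * of_int (l - j) * c n (l - j)))"
  unfolding rt_sgn by (rule sum.reindex_bij_witness[of _ "%j. l - j" "%k. l - k"]) auto
 also have "... = rt l * (of_int n * c n l)" unfolding sum_distrib_left[symmetric] c_recursion ..
 finally show ?thesis by (simp add: dn_def mult_ac)
qed

lemma XJ_dn: "(co.X ^^ q) (co.J (dn n)) = (%l. of_int (n ^ q) * co.J (dn n) l)"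
proof (induction q)
 case (Suc q)
 have "(co.X ^^ Suc q) (co.J (dn n)) l = of_int (sgn l) * co.T (%l. of_int (n ^ q) * co.J (dn n) l) l" for l
  using co.X_JT[of "(co.X ^^ q) (co.J (dn n))"] unfolding Suc by (simp add: Suc co.J_def)
 hence "(co.X ^^ Suc q) (co.J (dn n)) l = of_int (n ^ Suc q) * co.J (dn n) l" for l
  unfolding loc_cmult[OF co.op_loc(1)] TJ_dn co.J_def[of "dn n" l] by simp
 thus ?case by (rule ext)
qed simp

lemma toth_del: "toth (del n) l = c n l"
 unfolding toth_def by (subst infsum_single[of n]) (auto simp: del_def)

lemma rapid_c: "rapid (c n)"
 using rapid_toth[OF rapid_del[of n]] unfolding toth_del[abs_def] .

lemma rapid_Yop_pow: "rapid x ==> rapid ((Yop ^^ p) x)"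
 by (induction p) (auto intro: rapid_Yop)

text \<open>The first term is the pairing of T^q \<open>dn n\<close> with \<open>dn n\<close>, and
  n^(q+1) is the pairing of X^q J \<open>dn n\<close> with \<open>dn n\<close>, by orthogonality.
  Their difference is the form of \<open>Vp q\<close>, a finite sum.\<close>

lemma odd_power_form:
 assumes q: "odd q" and R: "R >= 2 * int (q * N)"
 shows "toph ((Yop ^^ q) (c n)) n - of_int (n ^ Suc q) = (\<Sum>l\<in>{-R..R}. \<Sum>k\<in>{-R..R}. co.Vp q (dl k) l * (dn n k * cnj (dn n l)))"
proof -
 have d: "dn n = (%l. rt l * c n l)" by (simp add: dn_def[abs_def])
 have "((%l. (Yop ^^ q) (c n) l * (of_int \<bar>l\<bar> * cnj (c n l))) has_sum toph ((Yop ^^ q) (c n)) n) UNIV"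
  unfolding toph_def by (intro has_sum_infsum toph_summable rapid_Yop_pow rapid_c)
 moreover have "(Yop ^^ q) (c n) l * (of_int \<bar>l\<bar> * cnj (c n l)) = (co.T ^^ q) (dn n) l * cnj (dn n l)" for l
  unfolding d T_pow_rt rt_rt[symmetric] by simp
 ultimately have 1: "((%l. (co.T ^^ q) (dn n) l * cnj (dn n l)) has_sum toph ((Yop ^^ q) (c n)) n) UNIV" by simp
 have "((%l. of_int (n ^ q) * (of_int l * c n l * cnj (c n l))) has_sum of_int (n ^ q) * of_int n) UNIV"
  using has_sum_cmult_right[OF c_orthogonality[of n n], of "of_int (n ^ q)"] by simp
 moreover have "of_int (n ^ q) * (of_int l * c n l * cnj (c n l)) = (co.X ^^ q) (co.J (dn n)) l * cnj (dn n l)" for l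
 proof -
  have "(co.X ^^ q) (co.J (dn n)) l * cnj (dn n l) = of_int (n ^ q) * (rt l * (of_int (sgn l) * (rt l * (c n l * cnj (c n l)))))"
   unfolding XJ_dn co.J_def dn_def by (simp add: mult_ac)
  thus ?thesis unfolding rt_sgn by (simp add: mult_ac)
 qed
 ultimately have 2: "((%l. (co.X ^^ q) (co.J (dn n)) l * cnj (dn n l)) has_sum of_int (n ^ Suc q)) UNIV" by (simp add: mult.commute)
 have 3: "((%l. co.Vp q (dn n) l * cnj (dn n l)) has_sum (toph ((Yop ^^ q) (c n)) n - of_int (n ^ Suc q))) UNIV"
  using has_sum_diff[OF 1 2] by (simp add: co.Vp_def left_diff_distrib)
 have f: "fs R (co.Vp q)" by (rule fs_mono[OF co.Vp_fs[OF q] R])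
 have V: "co.Vp q (dn n) l = (\<Sum>k\<in>{-R..R}. co.Vp q (dl k) l * dn n k)" for l by (rule loc_fs[OF co.Vp_loc f])
 have z: "co.Vp q (dn n) l = 0" if "l \<notin> {-R..R}" for l
  unfolding V using f that by (intro sum.neutral) (force simp: fs_def)
 have "((%l. co.Vp q (dn n) l * cnj (dn n l)) has_sum (\<Sum>l\<in>{-R..R}. co.Vp q (dn n) l * cnj (dn n l))) UNIV"
  by (rule has_sum_finite_neutralI) (auto simp: z)
 from has_sum_unique[OF 3 this] show ?thesis unfolding V by (simp add: sum_distrib_right mult.assoc)
qed

text \<open>Summing over n, completeness turns the products of the \<open>dn\<close> into entries of
  T. The finite form becomes the trace of \<open>Vp q\<close> composed with T, which is
  \<open>Sp\<close> of q + 1.\<close>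

lemma trace_has_sum:
 assumes q: "odd q" and R: "R >= 2 * int (q * N)"
 shows "((%n. toph ((Yop ^^ q) (c n)) n - of_int (n ^ Suc q)) has_sum tr R (co.Sp (Suc q))) UNIV"
proof -
 have h: "((%n. dn n k * cnj (dn n l)) has_sum Tk bc k l) UNIV" for k l
  using has_sum_cmult_right[OF c_completeness[of k l], of "rt k * rt l"]
  by (simp add: dn_def Tk_def mult_ac)
 have t: "co.T (dl l) k = Tk bc k l" for k l
  unfolding co.T_def kop_entry by (auto simp: Tk_def band)
 have "tr R (co.Sp (Suc q)) = (\<Sum>l\<in>{-R..R}. \<Sum>k\<in>{-R..R}. co.Vp q (dl k) l * Tk bc k l)"
  unfolding tr_def co.Vp_T[symmetric]
  by (intro sum.cong refl, subst loc_fs[OF co.Vp_loc fs_mono[OF co.Vp_fs[OF q] R]]) (simp add: t)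
 thus ?thesis unfolding odd_power_form[OF assms]
  by (simp only:) (intro has_sum_sum has_sum_cmult_right h finite_atLeastAtMost_int)
qed

definition Aop :: "(int => complex) => int => complex" where "Aop y = toph (toth y)"

lemma Aop_pow: assumes y: "rapid y" shows "(Aop ^^ Suc q) y = toph ((Yop ^^ q) (toth y))"
proof (induction q)
 case (Suc q)
 have "(Aop ^^ Suc (Suc q)) y = toph (toth (toph ((Yop ^^ q) (toth y))))" using Suc Aop_def[of "(Aop ^^ Suc q) y"] by simp
 also have "toth (toph ((Yop ^^ q) (toth y))) = Yop ((Yop ^^ q) (toth y))"
  by (rule ext, rule toth_toph) (intro rapid_Yop_pow rapid_toth y)
 finally show ?case by simp
qed (simp add: Aop_def)

lemma rapid_Aop_pow: "rapid y ==> rapid ((Aop ^^ p) y)"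
 by (induction p) (auto simp: Aop_def intro!: rapid_toph rapid_toth)

end

context trig_eig
begin

lemma GG_Aop_pow: assumes y: "rapid y" shows "GG ((Aop ^^ p) y) (\<psi> j) = of_real (lam j ^ p) * GG y (\<psi> j)"
proof (induction p)
 case (Suc p)
 have ry: "rapid ((Aop ^^ p) y)" by (rule rapid_Aop_pow[OF y])
 have "GG ((Aop ^^ Suc p) y) (\<psi> j) = LL ((Aop ^^ p) y) (\<psi> j) + RR ((Aop ^^ p) y) (\<psi> j)"
  using GG_A[OF ry rapid_VV[OF psi_rapid[of j]]] by (simp add: Aop_def)
 also have "... = of_real (lam j) * GG ((Aop ^^ p) y) (\<psi> j)" by (rule psi_form[OF rapid_VV[OF ry]])
 finally show ?case using Suc by simp
qed simp

lemma parseval_polar: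
 assumes f: "rapid f" and g: "rapid g"
 shows "((%j. Re (GG f (\<psi> j) * cnj (GG g (\<psi> j)))) has_sum Re (GG f g)) UNIV"
proof -
 have p: "((%j. (cmod (GG h (\<psi> j)))\<^sup>2) has_sum Re (GG h h)) UNIV" if "rapid h" for h
  using parseval_has_sum[OF that] infsumI[OF GG_norm[OF rapid_VV[OF that]]] by (simp add: GG_def)
 have fg: "rapid (%n. f n + g n)" by (rule rapid_add[OF f g])
 note V = rapid_VV[OF f] rapid_VV[OF g] rapid_VV[OF fg] rapid_VV[OF psi_rapid]
 have a: "GG (%n. f n + g n) u = GG f u + GG g u" if "u \<in> VV" for u using GG_cmb[OF V(1,2) that, of 1] by simp
 have pt: "(cmod (u + v))\<^sup>2 = (cmod u)\<^sup>2 + (cmod v)\<^sup>2 + 2 * Re (u * cnj v)" for u v :: complex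
  by (simp add: cmod_power2) (simp add: algebra_simps power2_eq_square)
 have "((%j. (1/2) * ((cmod (GG (%n. f n + g n) (\<psi> j)))\<^sup>2 - (cmod (GG f (\<psi> j)))\<^sup>2 - (cmod (GG g (\<psi> j)))\<^sup>2)) has_sum
  (1/2) * (Re (GG (%n. f n + g n) (%n. f n + g n)) - Re (GG f f) - Re (GG g g))) UNIV"
  by (intro has_sum_cmult_right has_sum_diff p f g fg)
 moreover have "Re (GG (%n. f n + g n) (%n. f n + g n)) = Re (GG f f) + Re (GG g g) + 2 * Re (GG f g)"
 proof -
  have "GG (%n. f n + g n) (%n. f n + g n) = cnj (GG (%n. f n + g n) f) + cnj (GG (%n. f n + g n) g)"
   unfolding a[OF V(3)] using GG_herm[of f "%n. f n + g n"] GG_herm[of g "%n. f n + g n"] by simp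
  thus ?thesis unfolding a[OF V(1)] a[OF V(2)] using GG_herm[of g f] by simp
 qed
 ultimately show ?thesis unfolding a[OF V(4)] pt by (simp add: algebra_simps)
qed

lemma lam_pow_has_sum: "((%j. wt n j * lam j ^ p) has_sum Re ((Aop ^^ p) (del n) n)) UNIV"
proof -
 have "((%j. Re (GG ((Aop ^^ p) (del n)) (\<psi> j) * cnj (GG (del n) (\<psi> j)))) has_sum Re (GG ((Aop ^^ p) (del n)) (del n))) UNIV"
  by (intro parseval_polar rapid_Aop_pow rapid_del)
 moreover have "GG f (del n) = f n" for f using GG_herm[of f "del n"] GG_del[of n f] by simp
 moreover have "Re (of_real (lam j ^ p) * cnj (\<psi> j n) * \<psi> j n) = wt n j * lam j ^ p" for j
  unfolding wt_def by (simp add: cmod_power2 del: of_real_power) (simp add: algebra_simps power2_eq_square)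
 ultimately show ?thesis unfolding GG_Aop_pow[OF rapid_del] GG_del by simp
qed

text \<open>At s = -p the powers are polynomial. Summing over j first, the moments of the weights
  are the diagonal entries of the p-th power of the operator, by Parseval.\<close>

lemma Gf_nat:
 assumes p: "p > 0"
 shows "((%n. complex_of_real (Re ((Aop ^^ p) (del n) n) - \<bar>of_int n\<bar> ^ p)) has_sum Gf (- of_nat p)) {n. n \<noteq> 0}"
proof -
 have s: "gterm (- of_nat p) summable_on Q" by (rule abs_summable_summable[OF gterm_abs])
 have "((%j. gterm (- of_nat p) (n, j)) has_sum of_real (Re ((Aop ^^ p) (del n) n) - \<bar>of_int n\<bar> ^ p)) Jp" if n: "n \<noteq> 0" for n
 proof -
  have 1: "((%j. wt n j * lam j ^ p) has_sum Re ((Aop ^^ p) (del n) n)) Jp"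
   by (rule has_sum_cong_neutral[THEN iffD1, OF _ _ _ lam_pow_has_sum[of n p]]) (auto simp: Jp_def wt_def not_less psi_nonpos[OF _ n])
  have 2: "((%j. wt n j * \<bar>of_int n\<bar> ^ p) has_sum \<bar>of_int n\<bar> ^ p) Jp"
   using has_sum_cmult_left[OF wt_sum_Jp[OF n]] by fastforce
  have "((%j. complex_of_real (wt n j * lam j ^ p - wt n j * \<bar>of_int n\<bar> ^ p)) has_sum of_real (Re ((Aop ^^ p) (del n) n) - \<bar>of_int n\<bar> ^ p)) Jp"
   by (rule has_sum_of_real[OF has_sum_diff[OF 1 2]])
  moreover have "gterm (- of_nat p) (n, j) = complex_of_real (wt n j * lam j ^ p - wt n j * \<bar>of_int n\<bar> ^ p)" if "j \<in> Jp" for j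
  proof -
   have "complex_of_real x powr of_nat p = of_real (x ^ p)" if "x > 0" for x
    using that by (simp add: powr_nat')
   from this[of "lam j"] this[of "\<bar>of_int n\<bar>"] show ?thesis using that n
    by (simp add: gterm_def Jp_def right_diff_distrib)
  qed
  ultimately show ?thesis by (simp only: cong: has_sum_cong)
 qed
 moreover have "(gterm (- of_nat p) has_sum Gf (- of_nat p)) (Sigma {n. n \<noteq> 0} (%_. Jp))"
  unfolding Gf_def using has_sum_infsum[OF s] by (simp add: Q_def)
 ultimately show ?thesis by (rule has_sum_SigmaD[rotated]) simp
qed

theorem Gf_even:
 assumes m: "m >= 1" and R: "R >= 2 * int ((2 * m) * N)"
 shows "Gf (- 2 * of_nat m) = of_real (Re (tr R (co.Sp (2 * m))))"
proof -
 define q where "q = 2 * m - 1"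
 have q: "odd q" "Suc q = 2 * m" using m by (auto simp: q_def)
 have qN: "q * N <= 2 * m * N" by (simp add: q_def mult_right_mono)
 hence "int (q * N) <= int (2 * m * N)" by (rule of_nat_mono)
 hence R': "R >= 2 * int (q * N)" using R by linarith
 have t: "((%n. complex_of_real (Re (toph ((Yop ^^ q) (c n)) n - of_int (n ^ Suc q)))) has_sum of_real (Re (tr R (co.Sp (Suc q))))) UNIV"
  by (intro has_sum_of_real has_sum_Re trace_has_sum q R')
 have e: "toph ((Yop ^^ q) (c n)) n = (Aop ^^ (2 * m)) (del n) n" for n
  using Aop_pow[OF rapid_del, of q n] unfolding q(2) toth_del[abs_def] by simp
 have "Re (of_int (n ^ Suc q)) = \<bar>of_int n\<bar> ^ (2 * m)" for n unfolding q(2) by (simp add: power_even_abs)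
 hence t: "((%n. complex_of_real (Re ((Aop ^^ (2 * m)) (del n) n) - \<bar>of_int n\<bar> ^ (2 * m))) has_sum of_real (Re (tr R (co.Sp (2 * m))))) UNIV"
  using t unfolding e q(2) by simp
 have z: "(Aop ^^ (2 * m)) (del 0) 0 = 0"
  unfolding e[symmetric] toph_def by (rule infsum_0) (simp add: c_0)
 have "((%n. complex_of_real (Re ((Aop ^^ (2 * m)) (del n) n) - \<bar>of_int n\<bar> ^ (2 * m))) has_sum of_real (Re (tr R (co.Sp (2 * m))))) {n. n \<noteq> 0}"
  by (rule has_sum_cong_neutral[THEN iffD1, OF _ _ _ t]) (use m z in auto)
 from has_sum_unique[OF Gf_nat[of "2 * m"] this] m show ?thesis by simp
qed

text \<open>The case p = 1, where the diagonal entry of the operator minus |n| is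
  \<open>r n n\<close> itself.\<close>

theorem Gf_one: "Gf (- 1) = of_real (\<Sum>\<^sub>\<infinity>n\<in>{n. n \<noteq> 0}. Re (r n n))"
proof -
 have "Re ((Aop ^^ 1) (del n) n) - \<bar>of_int n\<bar> ^ 1 = Re (r n n)" for n
 proof -
  have "(Aop ^^ 1) (del n) n = am n n"
   by (simp add: Aop_def toph_toth[OF rapid_del]) (subst infsum_single[of n], auto simp: del_def)
  thus ?thesis by (simp add: am_r)
 qed
 hence "((%n. complex_of_real (Re (r n n))) has_sum Gf (- 1)) {n. n \<noteq> 0}" using Gf_nat[of 1] by simp
 from has_sum_Re[OF this] this show ?thesis by (auto simp: complex_eq_iff dest!: infsumI has_sum_Im)
qed

end

section \<open>Picard iteration and uniqueness by an energy estimate\<close>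

section \<open>Lipschitz systems of ordinary differential equations\<close>

lemma at_within_cut: "t < S ==> at t within {0..S} = at t within {0::real..}"
 by (rule at_within_nhd[of t "{..<S}"]) auto

lemma vd_integral:
 fixes g :: "real => complex"
 assumes "continuous_on {0..} g" "t >= 0"
 shows "((%t. integral {0..t} g) has_vd g t) (at t within {0..})"
 using integral_has_vector_derivative[of 0 "t + 1" g t] continuous_on_subset[OF assms(1), of "{0..t+1}"] assms(2)
 by (simp add: at_within_cut)

lemma nonincreasing_of_deriv:
 fixes f :: "real => real"
 assumes "!!t. t \<in> {a..b} ==> (f has_real_derivative f' t) (at t within {a..b})" "!!t. t \<in> {a..b} ==> f' t <= 0" "a <= b"
 shows "f b <= f a"
proof (cases "a < b")
 case True
 obtain x where x: "x \<in> {a<..<b}" "f b - f a = f' x * (b - a)"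
  using mvt_simple[OF True, of f "%x h. f' x * h"] assms(1) unfolding has_field_derivative_def by auto
 thus ?thesis using assms(2)[of x] mult_nonpos_nonneg[of "f' x" "b - a"] by auto
qed (use assms in auto)

text \<open>Only the finitely many coordinates in I evolve; the Lipschitz bound reads just these,
  and the others stay frozen at their initial values.\<close>

locale lip_ode =
 fixes F :: "(int => complex) => int => complex" and I :: "int set" and L :: real
 assumes finI: "finite I" and L0: "L >= 0"
  and lip: "!!x y n. n \<in> I ==> cmod (F x n - F y n) <= L * (\<Sum>k\<in>I. cmod (x k - y k))"
begin

lemma F_tendsto:
 assumes u: "!!k. k \<in> I ==> ((%s. u s k) \<longlongrightarrow> v k) G" and n: "n \<in> I"
 shows "((%s. F (u s) n) \<longlongrightarrow> F v n) G"
proof -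
 have "((%s. L * (\<Sum>k\<in>I. cmod (u s k - v k))) \<longlongrightarrow> L * (\<Sum>k\<in>I. cmod (v k - v k))) G"
  by (intro tendsto_intros u)
 hence z: "((%s. L * (\<Sum>k\<in>I. cmod (u s k - v k))) \<longlongrightarrow> 0) G" by simp
 have "((%s. F (u s) n - F v n) \<longlongrightarrow> 0) G"
  by (rule Lim_null_comparison[OF _ z]) (simp add: lip[OF n])
 thus ?thesis by (simp add: LIM_zero_iff)
qed

lemma F_cont:
 assumes "!!k. k \<in> I ==> continuous_on S (%s. u s k)" "n \<in> I"
 shows "continuous_on S (%s. F (u s) n)"
 using assms unfolding continuous_on_def by (auto intro!: F_tendsto)

fun iter :: "(int => complex) => nat => real => int => complex" where
 "iter x0 0 t n = x0 n"
| "iter x0 (Suc k) t n = x0 n + (if n \<in> I then integral {0..t} (%s. F (iter x0 k s) n) else 0)"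

lemma iter_cont: "continuous_on {0..} (%t. iter x0 k t n)"
proof (induction k arbitrary: n)
 case (Suc k)
 have "continuous_on {0..} (%t. integral {0..t} (%s. F (iter x0 k s) n))" if "n \<in> I"
  by (rule continuous_on_vector_derivative[OF vd_integral[OF F_cont[OF Suc that]]]) auto
 thus ?case by (cases "n \<in> I") (auto intro!: continuous_intros)
qed simp

lemma Fiter_int: "n \<in> I ==> (%s. F (iter x0 k s) n) integrable_on {0..t}"
 by (intro integrable_continuous_real F_cont continuous_on_subset[OF iter_cont]) auto

text \<open>The usual factorial gain: every Picard step integrates the previous bound and multiplies
  it by M = L card I, since the estimate is summed over the coordinates.\<close>

lemma iter_diff:
 assumes t: "t >= 0" and C_def: "C = (\<Sum>n\<in>I. cmod (F x0 n))" and M_def: "M = L * real (card I)"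
 shows "(\<Sum>n\<in>I. cmod (iter x0 (Suc k) t n - iter x0 k t n)) <= C * M ^ k * (t ^ Suc k / fact (Suc k))"
 using t
proof (induction k arbitrary: t)
 case 0
 have z: "iter x0 0 s = x0" for s by auto
 have "cmod (iter x0 (Suc 0) t n - iter x0 0 t n) = cmod (F x0 n) * t" if "n \<in> I" for n
  using 0 that unfolding iter.simps(2) z by (simp add: norm_mult scaleR_conv_of_real)
 hence "(\<Sum>n\<in>I. cmod (iter x0 (Suc 0) t n - iter x0 0 t n)) = C * t" unfolding C_def sum_distrib_right by (intro sum.cong) auto
 thus ?case by simp
next
 case (Suc k)
 have hi: "((%s. L * (C * M ^ k * (s ^ Suc k / fact (Suc k)))) has_integral L * (C * M ^ k * (t ^ Suc (Suc k) / fact (Suc (Suc k))))) {0..t}"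
 proof -
  have "((%s. L * (C * M ^ k * (s ^ Suc (Suc k) / fact (Suc (Suc k))))) has_vd L * (C * M ^ k * (s ^ Suc k / fact (Suc k)))) (at s within {0..t})" for s :: real
  proof -
   have "((%s. s ^ Suc (Suc k) / fact (Suc (Suc k))) has_real_derivative (real (Suc (Suc k)) * s ^ Suc k / fact (Suc (Suc k)))) (at s within {0..t})"
    using DERIV_cdivide[OF DERIV_pow[of "Suc (Suc k)" s "{0..t}"]] by (simp del: fact_Suc of_nat_Suc power_Suc)
   moreover have "real (Suc (Suc k)) * s ^ Suc k / fact (Suc (Suc k)) = s ^ Suc k / fact (Suc k)"
    by (simp add: fact_Suc[of "Suc k"] del: fact_Suc)
   ultimately show ?thesis unfolding has_real_derivative_iff_has_vector_derivative[symmetric] by (intro DERIV_cmult) simp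
  qed
  hence "((%s. L * (C * M ^ k * (s ^ Suc k / fact (Suc k)))) has_integral L * (C * M ^ k * (t ^ Suc (Suc k) / fact (Suc (Suc k))))
   - L * (C * M ^ k * (0 ^ Suc (Suc k) / fact (Suc (Suc k))))) {0..t}"
   by (intro fundamental_theorem_of_calculus Suc.prems)
  thus ?thesis by simp
 qed
 have "cmod (iter x0 (Suc (Suc k)) t n - iter x0 (Suc k) t n) <= L * (C * M ^ k * (t ^ Suc (Suc k) / fact (Suc (Suc k))))" if n: "n \<in> I" for n
 proof -
  have "iter x0 (Suc (Suc k)) t n - iter x0 (Suc k) t n = integral {0..t} (%s. F (iter x0 (Suc k) s) n - F (iter x0 k s) n)"
   using n integral_diff[OF Fiter_int[OF n, of x0 "Suc k" t] Fiter_int[OF n, of x0 k t]] by simp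
  also have "cmod ... <= integral {0..t} (%s. L * (C * M ^ k * (s ^ Suc k / fact (Suc k))))"
  proof (rule integral_norm_bound_integral)
   show "(%s. F (iter x0 (Suc k) s) n - F (iter x0 k s) n) integrable_on {0..t}" by (intro integrable_diff Fiter_int n)
   fix s assume s: "s \<in> {0..t}"
   have "cmod (F (iter x0 (Suc k) s) n - F (iter x0 k s) n) <= L * (\<Sum>n\<in>I. cmod (iter x0 (Suc k) s n - iter x0 k s n))" by (rule lip[OF n])
   also have "... <= L * (C * M ^ k * (s ^ Suc k / fact (Suc k)))" using s by (intro mult_left_mono Suc.IH L0) auto
   finally show "cmod (F (iter x0 (Suc k) s) n - F (iter x0 k s) n) <= L * (C * M ^ k * (s ^ Suc k / fact (Suc k)))" .
  qed (use hi in auto)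
  finally show ?thesis using integral_unique[OF hi] by simp
 qed
 hence "(\<Sum>n\<in>I. cmod (iter x0 (Suc (Suc k)) t n - iter x0 (Suc k) t n)) <= of_nat (card I) * (L * (C * M ^ k * (t ^ Suc (Suc k) / fact (Suc (Suc k)))))"
  by (rule sum_bounded_above)
 thus ?case by (simp add: M_def mult_ac del: fact_Suc)
qed

lemma solution_exists:
 obtains x where "!!n. x 0 n = x0 n" "!!n t. n \<notin> I ==> x t n = x0 n"
  "!!n t. n \<in> I ==> t >= 0 ==> ((%t. x t n) has_vd F (x t) n) (at t within {0..})"
proof -
 define x where "x t n = x0 n + (\<Sum>k. iter x0 (Suc k) t n - iter x0 k t n)" for t n
 have ps: "x0 n + (\<Sum>k<m. iter x0 (Suc k) t n - iter x0 k t n) = iter x0 m t n" for m t n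
  by (induction m) (simp_all del: iter.simps(2) add: algebra_simps)
 have ul: "uniform_limit {0..S} (%m t. iter x0 m t n) (%t. x t n) sequentially" if n: "n \<in> I" for n S
 proof (cases "S >= 0")
  case True
  define C where "C = (\<Sum>n\<in>I. cmod (F x0 n))"
  define M where "M = L * real (card I)"
  have C: "C >= 0" "M >= 0" using L0 by (auto simp: C_def M_def sum_nonneg)
  have "uniform_limit {0..S} (%m t. \<Sum>k<m. iter x0 (Suc k) t n - iter x0 k t n) (%t. \<Sum>k. iter x0 (Suc k) t n - iter x0 k t n) sequentially"
  proof (rule Weierstrass_m_test)
   show "summable (%k. C * S * ((M * S) ^ k /\<^sub>R fact k))" by (intro summable_mult summable_exp_generic)
   fix k t assume t: "t \<in> {0..S}"
   have "cmod (iter x0 (Suc k) t n - iter x0 k t n) <= (\<Sum>n\<in>I. cmod (iter x0 (Suc k) t n - iter x0 k t n))"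
    using finI n by (intro member_le_sum) auto
   also have "... <= C * M ^ k * (t ^ Suc k / fact (Suc k))" using t by (intro iter_diff C_def M_def) auto
   also have "... <= C * M ^ k * (S ^ Suc k / fact k)"
    using t C by (intro mult_left_mono frac_le power_mono) (auto simp: fact_mono)
   also have "... = C * S * ((M * S) ^ k /\<^sub>R fact k)" by (simp add: field_simps power_mult_distrib)
   finally show "norm (iter x0 (Suc k) t n - iter x0 k t n) <= C * S * ((M * S) ^ k /\<^sub>R fact k)" .
  qed
  hence "uniform_limit {0..S} (%m t. x0 n + (\<Sum>k<m. iter x0 (Suc k) t n - iter x0 k t n)) (%t. x t n) sequentially"
   unfolding x_def by (intro uniform_limit_add uniform_limit_const)
  thus ?thesis unfolding ps .
 qed simp
 have pw: "(%m. iter x0 m t n) \<longlonglongrightarrow> x t n" if "t >= 0" "n \<in> I" for t n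
  using tendsto_uniform_limitI[OF ul[OF that(2), of t], of t] that by simp
 have xc: "continuous_on {0..} (%t. x t n)" if n: "n \<in> I" for n
  unfolding continuous_on_eq_continuous_within
 proof
  fix t :: real assume t: "t \<in> {0..}"
  have "continuous_on {0..t+1} (%t. x t n)"
   by (rule uniform_limit_theorem[OF _ ul[OF n]]) (auto intro!: always_eventually continuous_on_subset[OF iter_cont])
  hence "continuous (at t within {0..t+1}) (%t. x t n)" using t by (simp add: continuous_on_eq_continuous_within)
  thus "continuous (at t within {0..}) (%t. x t n)" by (simp add: at_within_cut)
 qed
 have eq: "x t n = x0 n + integral {0..t} (%s. F (x s) n)" if t: "t >= 0" and n: "n \<in> I" for t n
 proof -
  have ulF: "uniform_limit (cbox 0 t) (%m s. F (iter x0 m s) n) (%s. F (x s) n) sequentially"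
   unfolding uniform_limit_iff
  proof (intro allI impI)
   fix e :: real assume e: "e > 0"
   define d where "d = e / (L * real (card I) + 1)"
   have d: "d > 0" using e L0 by (simp add: d_def add_nonneg_pos)
   have "\<forall>\<^sub>F m in sequentially. \<forall>k\<in>I. \<forall>s\<in>{0..t}. dist (iter x0 m s k) (x s k) < d"
    using ul[of _ t] d by (intro eventually_ball_finite finI) (auto simp: uniform_limit_iff)
   thus "\<forall>\<^sub>F m in sequentially. \<forall>s\<in>cbox 0 t. dist (F (iter x0 m s) n) (F (x s) n) < e"
   proof eventually_elim
    case (elim m)
    show ?case
    proof
     fix s assume s: "s \<in> cbox 0 t"
     have "dist (F (iter x0 m s) n) (F (x s) n) <= L * (\<Sum>k\<in>I. cmod (iter x0 m s k - x s k))" unfolding dist_norm by (rule lip[OF n])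
     also have "... <= L * (real (card I) * d)" using elim s L0
      by (intro mult_left_mono sum_bounded_above) (auto simp: dist_norm less_imp_le)
     also have "... = (L * real (card I)) * d" by simp
     also have "... < (L * real (card I) + 1) * d" using d by (simp add: distrib_right)
     also have "... = e" using L0 by (simp add: d_def add_nonneg_pos less_imp_neq[symmetric] add_nonneg_eq_0_iff)
     finally show "dist (F (iter x0 m s) n) (F (x s) n) < e" .
    qed
   qed
  qed
  have "(%m. integral {0..t} (%s. F (iter x0 m s) n)) \<longlonglongrightarrow> integral {0..t} (%s. F (x s) n)"
  proof (rule uniform_limit_integral_cbox[OF ulF])
   show "continuous_on (cbox 0 t) (%s. F (iter x0 m s) n)" for m
    by (intro F_cont[OF continuous_on_subset[OF iter_cont] n]) auto
   fix P Q assume P: "!!m. ((%s. F (iter x0 m s) n) has_integral P m) (cbox 0 t)" "((%s. F (x s) n) has_integral Q) (cbox 0 t)" "P \<longlonglongrightarrow> Q"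
   thus ?thesis using integral_unique[OF P(1)] integral_unique[OF P(2)] by simp
  qed simp
  hence "(%m. x0 n + integral {0..t} (%s. F (iter x0 m s) n)) \<longlonglongrightarrow> x0 n + integral {0..t} (%s. F (x s) n)" by (intro tendsto_intros)
  moreover have "(%m. iter x0 (Suc m) t n) \<longlonglongrightarrow> x t n" using pw[OF t n] by (rule LIMSEQ_Suc)
  ultimately show ?thesis using n by (auto intro: LIMSEQ_unique)
 qed
 show thesis
 proof (rule that)
  show "x t n = x0 n" if "n \<notin> I" for t n
  proof -
   have "iter x0 k t n = x0 n" for k using that by (cases k) auto
   thus ?thesis by (simp add: x_def del: iter.simps)
  qed
  show "x 0 n = x0 n" for n
  proof -
   have "iter x0 k 0 n = x0 n" for k by (cases k) auto
   thus ?thesis by (simp add: x_def del: iter.simps)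
  qed
  fix n t assume n: "n \<in> I" and t: "(t::real) >= 0"
  have "((%t. x0 n + integral {0..t} (%s. F (x s) n)) has_vd 0 + F (x t) n) (at t within {0..})"
   by (rule has_vector_derivative_add[OF has_vector_derivative_const vd_integral[OF F_cont[OF xc n] t]])
  thus "((%t. x t n) has_vd F (x t) n) (at t within {0..})"
   using has_vector_derivative_transform[of t "{0..}" "%t. x t n" "%t. x0 n + integral {0..t} (%s. F (x s) n)" "F (x t) n"] n t eq by simp
 qed
qed

text \<open>Gronwall for h, the sum of squared differences: Cauchy-Schwarz bounds its derivative by
  K h, so h exp (-K t) is nonincreasing and starts at 0.\<close>

lemma solution_unique:
 assumes x: "!!n t. n \<in> I ==> t \<in> {0..S} ==> ((%t. x t n) has_vd F (x t) n) (at t within {0..S})"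
  and y: "!!n t. n \<in> I ==> t \<in> {0..S} ==> ((%t. y t n) has_vd F (y t) n) (at t within {0..S})"
  and eq: "!!n. n \<in> I ==> x 0 n = y 0 n" and S: "S >= 0" and n: "n \<in> I"
 shows "x S n = y S n"
proof -
 define u where "u t n = x t n - y t n" for t n
 define u' where "u' t n = F (x t) n - F (y t) n" for t n
 define h where "h t = (\<Sum>n\<in>I. (cmod (u t n))\<^sup>2)" for t
 define K where "K = 2 * L * real (card I)"
 have du: "((%t. u t n) has_vd u' t n) (at t within {0..S})" if "n \<in> I" "t \<in> {0..S}" for t n
  unfolding u_def u'_def by (intro has_vector_derivative_diff x y that)
 have "((%t. (cmod (u t n))\<^sup>2) has_real_derivative 2 * (u t n \<bullet> u' t n)) (at t within {0..S})" if "n \<in> I" "t \<in> {0..S}" for t n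
 proof -
  have "((%t. u t n \<bullet> u t n) has_derivative (%h. u t n \<bullet> (h *\<^sub>R u' t n) + (h *\<^sub>R u' t n) \<bullet> u t n)) (at t within {0..S})"
   using du[OF that] unfolding has_vector_derivative_def by (intro has_derivative_inner)
  moreover have "(%h. u t n \<bullet> (h *\<^sub>R u' t n) + (h *\<^sub>R u' t n) \<bullet> u t n) = (*) (2 * (u t n \<bullet> u' t n))" by (auto simp: inner_commute)
  ultimately show ?thesis unfolding has_field_derivative_def power2_norm_eq_inner by simp
 qed
 hence dh: "(h has_real_derivative (\<Sum>n\<in>I. 2 * (u t n \<bullet> u' t n))) (at t within {0..S})" if "t \<in> {0..S}" for t
  unfolding h_def[abs_def] using that by (intro DERIV_sum) auto
 have b: "(\<Sum>n\<in>I. 2 * (u t n \<bullet> u' t n)) <= K * h t" for t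
 proof -
  let ?s = "\<Sum>k\<in>I. cmod (u t k)"
  have "(\<Sum>n\<in>I. 2 * (u t n \<bullet> u' t n)) <= (\<Sum>n\<in>I. 2 * (cmod (u t n) * (L * ?s)))"
  proof (intro sum_mono mult_left_mono)
   fix n assume "n \<in> I"
   hence "cmod (u' t n) <= L * ?s" unfolding u_def u'_def by (rule lip)
   thus "u t n \<bullet> u' t n <= cmod (u t n) * (L * ?s)"
    using norm_cauchy_schwarz[of "u t n" "u' t n"] mult_left_mono[of "cmod (u' t n)" "L * ?s" "cmod (u t n)", OF _ norm_ge_zero] order_trans by blast
  qed auto
  also have "... = 2 * L * ?s\<^sup>2" by (simp add: sum_distrib_left[symmetric] sum_distrib_right[symmetric] power2_eq_square)
  also have "... <= 2 * L * (real (card I) * h t)" unfolding h_def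
   using Cauchy_Schwarz_ineq_sum[of "%_. 1" "%k. cmod (u t k)" I] L0 by (intro mult_left_mono) auto
  finally show ?thesis by (simp add: K_def)
 qed
 have "h S * exp (- K * S) <= h 0 * exp (- K * 0)"
 proof (rule nonincreasing_of_deriv[OF _ _ S, where f="%t. h t * exp (- K * t)"])
  fix t assume t: "t \<in> {0..S}"
  show "((%t. h t * exp (- K * t)) has_real_derivative ((\<Sum>n\<in>I. 2 * (u t n \<bullet> u' t n)) - K * h t) * exp (- K * t)) (at t within {0..S})"
   by (rule derivative_eq_intros dh[OF t] refl | simp add: algebra_simps)+
  show "((\<Sum>n\<in>I. 2 * (u t n \<bullet> u' t n)) - K * h t) * exp (- K * t) <= 0" using b[of t] by (intro mult_nonpos_nonneg) auto
 qed
 also have "h 0 * exp (- K * 0) = 0" using eq by (simp add: h_def u_def)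
 finally have "h S <= 0" by (simp add: mult_le_0_iff)
 moreover have "(cmod (u S n))\<^sup>2 <= h S" unfolding h_def using finI n by (intro member_le_sum[of n I "%n. (cmod (u S n))\<^sup>2"]) auto
 ultimately have "(cmod (u S n))\<^sup>2 <= 0" by linarith
 thus ?thesis by (simp add: u_def)
qed

end

section \<open>Smooth dependence on time in all seminorms\<close>

section \<open>Curves of trigonometric polynomials\<close>

definition rp :: "nat => (int => complex) => real => real" where "rp N c t = Re (tp N c t)"

lemma rp_deriv: "(rp N c has_real_derivative rp N (%k. \<i> * of_int k * c k) t) (at t within S)"
 unfolding rp_def[abs_def] has_real_derivative_iff_has_vector_derivative
 by (rule bounded_linear.has_vector_derivative[OF bounded_linear_Re tp_deriv])

lemma rp_derivs: "(deriv ^^ j) (rp N c) = rp N (%k. (\<i> * of_int k) ^ j * c k)"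
proof (induction j)
 case (Suc j)
 have "deriv (rp N (%k. (\<i> * of_int k) ^ j * c k)) t = rp N (%k. \<i> * of_int k * ((\<i> * of_int k) ^ j * c k)) t" for t
  by (rule DERIV_imp_deriv[OF rp_deriv])
 thus ?case using Suc by (auto simp: mult.assoc)
qed simp

lemma rp_smooth: "circ_smooth (rp N c)"
 unfolding circ_smooth_def
proof
 show "smooth_fun (rp N c)"
  by (rule smooth_class[of "range (rp N)"]) (use rp_deriv in blast, simp)
 show "\<forall>x. rp N c (x + 2 * pi) = rp N c x" by (simp add: rp_def tp_period)
qed

lemma rp_le: "\<bar>rp N c t\<bar> <= (\<Sum>k\<in>{- int N..int N}. cmod (c k))"
proof -
 have "\<bar>rp N c t\<bar> <= cmod (tp N c t)" unfolding rp_def by (rule abs_Re_le_cmod)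
 also have "... <= (\<Sum>k\<in>{- int N..int N}. cmod (c k))" unfolding tp_def by (rule sum_norm_le) (simp add: norm_mult)
 finally show ?thesis .
qed

lemma rp_lin: "rp N (%k. c k - d k) t = rp N c t - rp N d t" "rp N (%k. of_real r * c k) t = r * rp N c t"
proof -
 have "tp N (%k. of_real r * c k) t = of_real r * tp N c t" by (simp add: tp_def sum_distrib_left mult.assoc)
 thus "rp N (%k. of_real r * c k) t = r * rp N c t" by (simp add: rp_def)
qed (simp add: rp_def tp_def left_diff_distrib sum_subtractf)

lemma rp_cont: "continuous_on S (rp N c)"
 unfolding rp_def[abs_def] by (intro continuous_intros)

lemma rp_reduce: obtains s where "s \<in> {0..2*pi}" "!!c. rp N c s = rp N c t"
proof
 define m where "m = \<lfloor>t / (2 * pi)\<rfloor>"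
 have "cis (of_int k * (t - 2 * pi * of_int m)) = cis (of_int k * t)" for k
 proof -
  have "of_int k * (t - 2 * pi * of_int m) = of_int k * t + 2 * pi * of_int (- k * m)" by (simp add: algebra_simps)
  thus ?thesis by (simp only: cis_mult[symmetric] cis_multiple_2pi[OF Ints_of_int]) simp
 qed
 thus "rp N c (t - 2 * pi * of_int m) = rp N c t" for c unfolding rp_def tp_def by simp
 have "of_int m <= t / (2 * pi)" "t / (2 * pi) < of_int m + 1" unfolding m_def by linarith+
 thus "t - 2 * pi * of_int m \<in> {0..2*pi}" by (simp add: field_simps)
qed

lemma rp_joint:
 assumes "!!k. continuous_on S (%\<tau>. x \<tau> k)"
 shows "continuous_on (S \<times> A) (%p. rp N (x (fst p)) (snd p))"
 unfolding rp_def tp_def by (intro continuous_intros continuous_on_compose2[OF assms continuous_on_fst]) auto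

lemma rp_tau:
 assumes "!!k. ((%\<tau>. x \<tau> k) has_vd x' k) (at \<tau> within S)"
 shows "((%\<tau>. rp N (x \<tau>) t) has_real_derivative rp N x' t) (at \<tau> within S)"
 unfolding rp_def[abs_def] tp_def has_real_derivative_iff_has_vector_derivative
 by (intro bounded_linear.has_vector_derivative[OF bounded_linear_Re] has_vector_derivative_sum has_vector_derivative_mult_left assms)

lemma vd_quotient:
 fixes f :: "real => complex"
 assumes "(f has_vd f') (at x within S)"
 shows "((%y. of_real (1 / (y - x)) * (f y - f x) - f') \<longlongrightarrow> 0) (at x within S)"
proof -
 have "((%y. (1 / norm (y - x)) *\<^sub>R (f y - (f x + (y - x) *\<^sub>R f'))) \<longlongrightarrow> 0) (at x within S)"
  using assms unfolding has_vector_derivative_def has_derivative_within by blast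
 hence "((%y. norm ((1 / norm (y - x)) *\<^sub>R (f y - (f x + (y - x) *\<^sub>R f')))) \<longlongrightarrow> 0) (at x within S)"
  by (rule tendsto_norm_zero)
 note 1 = this
 have "\<forall>\<^sub>F y in at x within S. norm ((1 / norm (y - x)) *\<^sub>R (f y - (f x + (y - x) *\<^sub>R f'))) = norm (of_real (1 / (y - x)) * (f y - f x) - f')"
  unfolding eventually_at_filter
 proof (intro always_eventually allI impI)
  fix y assume y: "y \<noteq> x"
  have "of_real (1 / (y - x)) * (f y - f x) - f' = of_real (1 / (y - x)) * (f y - (f x + (y - x) *\<^sub>R f'))"
   using y by (simp add: scaleR_conv_of_real field_simps)
  note 2 = this
  have "norm ((1 / norm (y - x)) *\<^sub>R z) = norm (complex_of_real (1 / (y - x)) * z)" for z :: complex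
   by (simp add: norm_mult norm_divide flip: of_real_diff)
  from this[of "f y - (f x + (y - x) *\<^sub>R f')"] show "norm ((1 / norm (y - x)) *\<^sub>R (f y - (f x + (y - x) *\<^sub>R f'))) = norm (of_real (1 / (y - x)) * (f y - f x) - f')"
   unfolding 2[symmetric] .
 qed
 from tendsto_cong[OF this] 1 have "((%y. norm (of_real (1 / (y - x)) * (f y - f x) - f')) \<longlongrightarrow> 0) (at x within S)"
  by blast
 thus ?thesis by (rule tendsto_norm_zero_cancel)
qed

lemma rp_small:
 assumes "!!k. ((%\<sigma>. d \<sigma> k) \<longlongrightarrow> 0) G" "e > 0"
 shows "\<forall>\<^sub>F \<sigma> in G. \<forall>t. \<bar>rp N (%k. (\<i> * of_int k) ^ j * d \<sigma> k) t\<bar> <= e"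
proof -
 have "((%\<sigma>. \<Sum>k\<in>{- int N..int N}. cmod ((\<i> * of_int k) ^ j * d \<sigma> k)) \<longlongrightarrow> (\<Sum>k\<in>{- int N..int N}. cmod ((\<i> * of_int k) ^ j * 0))) G"
  by (intro tendsto_intros assms)
 hence "\<forall>\<^sub>F \<sigma> in G. (\<Sum>k\<in>{- int N..int N}. cmod ((\<i> * of_int k) ^ j * d \<sigma> k)) < e"
  using assms(2) by (intro order_tendstoD(2)) auto
 thus ?thesis
 proof eventually_elim
  case (elim \<sigma>)
  thus ?case using rp_le[of N "%k. (\<i> * of_int k) ^ j * d \<sigma> k"] by (intro allI order_trans[OF _ less_imp_le[OF elim]])
 qed
qed

text \<open>Only finitely many coefficients occur, so their convergence controls the supremum of
  every theta-derivative at once through \<open>rp_le\<close>.\<close>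

lemma curve_deriv_rp:
 assumes "!!k \<tau>. \<tau> >= 0 ==> ((%\<tau>. x \<tau> k) has_vd x' \<tau> k) (at \<tau> within {0..})"
 shows "curve_deriv (%\<tau>. rp N (x \<tau>)) (%\<tau>. rp N (x' \<tau>))"
 unfolding curve_deriv_def rp_derivs
proof (intro allI impI)
 fix j :: nat and \<tau> e :: real assume \<tau>: "\<tau> >= 0" and e: "e > 0"
 have "\<forall>\<^sub>F \<sigma> in at \<tau> within {0..}. \<forall>t. \<bar>rp N (%k. (\<i> * of_int k) ^ j * (of_real (1 / (\<sigma> - \<tau>)) * (x \<sigma> k - x \<tau> k) - x' \<tau> k)) t\<bar> <= e"
  by (intro rp_small vd_quotient assms \<tau> e)
 moreover have "rp N (%k. (\<i> * of_int k) ^ j * (of_real (1 / (\<sigma> - \<tau>)) * (x \<sigma> k - x \<tau> k) - x' \<tau> k)) t =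
  (rp N (%k. (\<i> * of_int k) ^ j * x \<sigma> k) t - rp N (%k. (\<i> * of_int k) ^ j * x \<tau> k) t) / (\<sigma> - \<tau>) - rp N (%k. (\<i> * of_int k) ^ j * x' \<tau> k) t" for \<sigma> t
 proof -
  have "(%k. (\<i> * of_int k) ^ j * (of_real (1 / (\<sigma> - \<tau>)) * (x \<sigma> k - x \<tau> k) - x' \<tau> k)) =
   (%k. of_real (1 / (\<sigma> - \<tau>)) * ((\<i> * of_int k) ^ j * x \<sigma> k - (\<i> * of_int k) ^ j * x \<tau> k) - (\<i> * of_int k) ^ j * x' \<tau> k)"
   by (rule ext) (simp add: right_diff_distrib mult.left_commute)
  thus ?thesis by (simp only: rp_lin) simp
 qed
 ultimately show "\<forall>\<^sub>F \<sigma> in at \<tau> within {0..}. \<forall>t. \<bar>(rp N (%k. (\<i> * of_int k) ^ j * x \<sigma> k) t - rp N (%k. (\<i> * of_int k) ^ j * x \<tau> k) t) / (\<sigma> - \<tau>) - rp N (%k. (\<i> * of_int k) ^ j * x' \<tau> k) t\<bar> <= e"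
  by simp
qed

lemma curve_cont_rp:
 assumes "!!k. continuous_on {0..} (%\<tau>. x \<tau> k)"
 shows "curve_cont (%\<tau>. rp N (x \<tau>))"
 unfolding curve_cont_def rp_derivs
proof (intro allI impI)
 fix j :: nat and \<tau> e :: real assume \<tau>: "\<tau> >= 0" and e: "e > 0"
 have "((%\<sigma>. x \<sigma> k - x \<tau> k) \<longlongrightarrow> 0) (at \<tau> within {0..})" for k
  using assms[of k] \<tau> by (simp add: continuous_on_def LIM_zero_iff)
 hence "\<forall>\<^sub>F \<sigma> in at \<tau> within {0..}. \<forall>t. \<bar>rp N (%k. (\<i> * of_int k) ^ j * (x \<sigma> k - x \<tau> k)) t\<bar> <= e"
  using e by (rule rp_small)
 thus "\<forall>\<^sub>F \<sigma> in at \<tau> within {0..}. \<forall>t. \<bar>rp N (%k. (\<i> * of_int k) ^ j * x \<sigma> k) t - rp N (%k. (\<i> * of_int k) ^ j * x \<tau> k) t\<bar> <= e"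
  by (simp add: right_diff_distrib rp_lin)
qed

text \<open>Taylor coefficients in time of a solution of the quadratic system.\<close>
function Yt :: "nat => (real => int => complex) => nat => real => int => complex" where
 "Yt N x 0 \<tau> m = x \<tau> m"
| "Yt N x (Suc n) \<tau> m = (\<Sum>j\<in>{- int N..int N}. of_int ((m - 2 * j) * sgn j) * (\<Sum>i\<le>n. Yt N x i \<tau> j * Yt N x (n - i) \<tau> (m - j))) / of_nat (Suc n)"
 by pat_completeness auto
termination by (relation "Wellfounded.measure (%(N, x, n, \<tau>, m). n)") auto

text \<open>The recursion expresses each Taylor coefficient by a convolution of earlier ones, so its
  derivative again comes from the recursion; n! times \<open>Yt\<close> is the n-th time
  derivative.\<close>

lemma Yt_deriv:
 assumes x: "!!k \<tau>. \<tau> >= 0 ==> ((%\<tau>. x \<tau> k) has_vd fl N (x \<tau>) k) (at \<tau> within {0..})" and \<tau>: "\<tau> >= 0"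
 shows "((%\<tau>. Yt N x n \<tau> m) has_vd of_nat (Suc n) * Yt N x (Suc n) \<tau> m) (at \<tau> within {0..})"
proof (induction n arbitrary: m rule: less_induct)
 case (less n)
 show ?case
 proof (cases n)
  case 0
  thus ?thesis using x[OF \<tau>, of m] by (simp add: fl_def)
 next
  case (Suc p)
  let ?Y = "%i k. Yt N x i \<tau> k"
  have d: "((%\<tau>. Yt N x i \<tau> k) has_vd of_nat (Suc i) * ?Y (Suc i) k) (at \<tau> within {0..})" if "i <= p" for i k
   using less.IH[of i k] that Suc by simp
  have "((%\<tau>. (1 / of_nat (Suc p)) * (\<Sum>j\<in>{- int N..int N}. of_int ((m - 2 * j) * sgn j) * (\<Sum>i\<le>p. Yt N x i \<tau> j * Yt N x (p - i) \<tau> (m - j)))) has_vd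
   (1 / of_nat (Suc p)) * (\<Sum>j\<in>{- int N..int N}. of_int ((m - 2 * j) * sgn j) * (\<Sum>i\<le>p. ?Y i j * (of_nat (Suc (p - i)) * ?Y (Suc (p - i)) (m - j)) + of_nat (Suc i) * ?Y (Suc i) j * ?Y (p - i) (m - j)))) (at \<tau> within {0..})"
   by (intro has_vector_derivative_mult_right has_vector_derivative_sum has_vector_derivative_mult d) auto
  note A = this
  \<comment> \<open>The product rule puts the weights i and p + 1 - i on the same product; they add
    up to p + 1.\<close>
  have key: "(\<Sum>i\<le>p. u i * (of_nat (Suc (p - i)) * v (Suc (p - i))) + of_nat (Suc i) * u (Suc i) * v (p - i)) = of_nat (Suc p) * (\<Sum>i\<le>Suc p. u i * v (Suc p - i))" for u v :: "nat => complex"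
  proof -
   have "(\<Sum>i\<le>p. of_nat (Suc i) * u (Suc i) * v (p - i)) = (\<Sum>i\<le>Suc p. of_nat i * (u i * v (Suc p - i)))"
    unfolding sum.atMost_Suc_shift by (simp add: mult.assoc)
   moreover have "(\<Sum>i\<le>p. u i * (of_nat (Suc (p - i)) * v (Suc (p - i)))) = (\<Sum>i\<le>Suc p. of_nat (Suc p - i) * (u i * v (Suc p - i)))"
   proof -
    have "(\<Sum>i\<le>p. u i * (of_nat (Suc (p - i)) * v (Suc (p - i)))) = (\<Sum>i\<le>p. of_nat (Suc p - i) * (u i * v (Suc p - i)))"
     by (intro sum.cong refl) (simp only: atMost_iff Suc_diff_le mult.left_commute)
    thus ?thesis by (simp only: sum.atMost_Suc diff_self_eq_0 of_nat_0 mult_zero_left add_0_right)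
   qed
   ultimately have "(\<Sum>i\<le>p. u i * (of_nat (Suc (p - i)) * v (Suc (p - i))) + of_nat (Suc i) * u (Suc i) * v (p - i)) = (\<Sum>i\<le>Suc p. (of_nat (Suc p - i) + of_nat i) * (u i * v (Suc p - i)))"
    by (simp only: sum.distrib distrib_right)
   also have "... = (\<Sum>i\<le>Suc p. of_nat (Suc p) * (u i * v (Suc p - i)))"
    by (intro sum.cong refl) (simp flip: of_nat_add del: of_nat_Suc)
   finally show ?thesis by (simp only: sum_distrib_left)
  qed
  have "((%\<tau>. (1 / of_nat (Suc p)) * (\<Sum>j\<in>{- int N..int N}. of_int ((m - 2 * j) * sgn j) * (\<Sum>i\<le>p. Yt N x i \<tau> j * Yt N x (p - i) \<tau> (m - j)))) has_vd
   (1 / of_nat (Suc p)) * (\<Sum>j\<in>{- int N..int N}. of_int ((m - 2 * j) * sgn j) * (of_nat (Suc p) * (\<Sum>i\<le>Suc p. ?Y i j * ?Y (Suc p - i) (m - j))))) (at \<tau> within {0..})"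
   using A unfolding key[of "%i. Yt N x i \<tau> j" "%i. Yt N x i \<tau> (m - j)" for j] .
  moreover have "(1 / of_nat (Suc p)) * (\<Sum>j\<in>{- int N..int N}. of_int ((m - 2 * j) * sgn j) * (of_nat (Suc p) * (\<Sum>i\<le>Suc p. ?Y i j * ?Y (Suc p - i) (m - j)))) = of_nat (Suc n) * ?Y (Suc n) m"
  proof -
   have "(1 / w) * (\<Sum>j\<in>I. k j * (w * G j)) = (\<Sum>j\<in>I. k j * G j)" if "w \<noteq> 0" for w :: complex and k G and I :: "int set"
    unfolding sum_distrib_left using that by (intro sum.cong refl) simp
   hence "(1 / of_nat (Suc p)) * (\<Sum>j\<in>{- int N..int N}. of_int ((m - 2 * j) * sgn j) * (of_nat (Suc p) * (\<Sum>i\<le>Suc p. ?Y i j * ?Y (Suc p - i) (m - j))))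
    = (\<Sum>j\<in>{- int N..int N}. of_int ((m - 2 * j) * sgn j) * (\<Sum>i\<le>Suc p. ?Y i j * ?Y (Suc p - i) (m - j)))"
    by (simp only: of_nat_eq_0_iff nat.distinct not_False_eq_True)
   also have "... = of_nat (Suc n) * ?Y (Suc n) m" unfolding Suc Yt.simps(2)[of N x "Suc p"] by (simp del: of_nat_Suc sum.atMost_Suc Yt.simps)
   finally show ?thesis .
  qed
  ultimately show ?thesis unfolding Suc by (simp add: field_simps del: of_nat_Suc sum.atMost_Suc Yt.simps(2)) (simp add: Yt.simps(2) field_simps del: of_nat_Suc sum.atMost_Suc)
 qed
qed

lemma smooth_curve_rp:
 assumes x: "!!k \<tau>. \<tau> >= 0 ==> ((%\<tau>. x \<tau> k) has_vd fl N (x \<tau>) k) (at \<tau> within {0..})"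
 shows "smooth_curve (%\<tau>. rp N (x \<tau>))"
proof -
 define X where "X n \<tau> k = fact n * Yt N x n \<tau> k" for n \<tau> k
 have d: "((%\<tau>. X n \<tau> k) has_vd X (Suc n) \<tau> k) (at \<tau> within {0..})" if "\<tau> >= 0" for n \<tau> k
  using has_vector_derivative_mult_right[OF Yt_deriv[OF x that], of "fact n" n k] by (simp add: X_def mult_ac del: Yt.simps)
 have c: "continuous_on {0..} (%\<tau>. X n \<tau> k)" for n k
  by (rule continuous_on_vector_derivative[OF d]) simp
 show ?thesis unfolding smooth_curve_def
  by (intro exI[of _ "%n \<tau>. rp N (X n \<tau>)"] conjI allI impI rp_smooth curve_cont_rp curve_deriv_rp d c) (simp_all add: X_def[abs_def])
qed

section \<open>From the operators Lam, Hil and Dop to the quadratic system\<close>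

section \<open>The flow equation\<close>

lemma tp_real: assumes "!!k. cnj (c k) = c (- k)" shows "tp N c t = of_real (rp N c t)"
proof -
 have "cnj (tp N c t) = (\<Sum>k\<in>{- int N..int N}. c (- k) * cis (- (of_int k * t)))" by (simp add: tp_def assms cis_cnj)
 also have "... = tp N c t" unfolding tp_def by (rule sum.reindex_bij_witness[of _ uminus uminus]) auto
 finally show ?thesis unfolding rp_def by (metis Reals_cnj_iff of_real_Re)
qed

context coeffs
begin

lemma tp_fl: "tp N (fl N a) t = tp N (%j. of_int (sgn j) * a j) t * tp N (%k. of_int k * a k) t - tp N a t * tp N (%j. of_int \<bar>j\<bar> * a j) t"
proof -
 let ?I = "{- int N..int N}" and ?e = "%k. cis (of_int k * t)"
 have "tp N (fl N a) t = (\<Sum>n\<in>{- 2 * int N..2 * int N}. fl N a n * ?e n)"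
  unfolding tp_def by (rule sum.mono_neutral_left) (auto simp: fl_band)
 also have "... = (\<Sum>j\<in>?I. \<Sum>n\<in>{- 2 * int N..2 * int N}. of_int ((n - 2 * j) * sgn j) * (a j * a (n - j)) * ?e n)"
  unfolding fl_def sum_distrib_right by (rule sum.swap)
 also have "... = (\<Sum>j\<in>?I. \<Sum>k\<in>?I. of_int (sgn j) * a j * ?e j * (of_int k * a k * ?e k) - a k * ?e k * (of_int \<bar>j\<bar> * a j * ?e j))"
 proof (rule sum.cong[OF refl])
  fix j assume j: "j \<in> ?I"
  have "(\<Sum>n\<in>{- 2 * int N..2 * int N}. of_int ((n - 2 * j) * sgn j) * (a j * a (n - j)) * ?e n) = (\<Sum>n\<in>{j - int N..j + int N}. of_int ((n - 2 * j) * sgn j) * (a j * a (n - j)) * ?e n)"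
   using j by (intro sum.mono_neutral_right) (auto simp: aband)
  also have "... = (\<Sum>k\<in>?I. of_int ((k - j) * sgn j) * (a j * a k) * (?e j * ?e k))"
   by (rule sum.reindex_bij_witness[of _ "%k. k + j" "%n. n - j"]) (auto simp: cis_mult algebra_simps)
  also have "... = (\<Sum>k\<in>?I. of_int (sgn j) * a j * ?e j * (of_int k * a k * ?e k) - a k * ?e k * (of_int \<bar>j\<bar> * a j * ?e j))"
  proof (intro sum.cong refl)
   fix k
   have "complex_of_int ((k - j) * sgn j) = of_int (sgn j) * of_int k - of_int \<bar>j\<bar>"
    unfolding abs_sgn[of j] by (simp add: algebra_simps)
   thus "of_int ((k - j) * sgn j) * (a j * a k) * (?e j * ?e k) = of_int (sgn j) * a j * ?e j * (of_int k * a k * ?e k) - a k * ?e k * (of_int \<bar>j\<bar> * a j * ?e j)"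
    by (simp only:) (simp add: algebra_simps del: of_int_abs)
  qed
  finally show "(\<Sum>n\<in>{- 2 * int N..2 * int N}. of_int ((n - 2 * j) * sgn j) * (a j * a (n - j)) * ?e n) = ..." .
 qed
 also have "... = tp N (%j. of_int (sgn j) * a j) t * tp N (%k. of_int k * a k) t - tp N a t * tp N (%j. of_int \<bar>j\<bar> * a j) t"
  unfolding tp_def sum_subtractf sum_product by (intro arg_cong2[where f="(-)"] refl) (rule sum.swap)
 finally show ?thesis .
qed

lemma flow_rhs:
 assumes f: "!!t. complex_of_real (f t) = tp N a t"
 shows "- cx f t * Lam (cx f) t + Hil (cx f) t * Dop (cx f) t = tp N (fl N a) t"
proof -
 have cf: "cx f = tp N a" by (rule ext) (simp add: cx_def f)
 have fo: "fourier (tp N a) k = a k" for k by (simp add: fourier_tp aband)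
 have fin: "(ISUM n. g n * a n * cis (of_int n * t)) = tp N (%n. g n * a n) t" for g
  unfolding tp_def by (rule infsumI, rule has_sum_finite_neutralI) (auto simp: aband)
 have "Lam (cx f) t = tp N (%j. of_int \<bar>j\<bar> * a j) t" unfolding cf Lam_eq Fs_def fo by (rule fin)
 moreover have "Hil (cx f) t = tp N (%j. of_int (sgn j) * a j) t" unfolding cf Hil_def fo exp_cis by (rule fin)
 moreover have "Dop (cx f) t = tp N (%k. of_int k * a k) t"
 proof -
  have "tp N (%k. \<i> * of_int k * a k) t = \<i> * tp N (%k. of_int k * a k) t" by (simp add: tp_def sum_distrib_left mult.assoc)
  thus ?thesis unfolding cf Dop_def vector_derivative_at[OF tp_deriv] by (simp flip: mult.assoc)
 qed
 ultimately show ?thesis unfolding tp_fl by (simp add: cf)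
qed

text \<open>The real function -i H a, whose theta-derivative is Lambda a; in these terms the
  equation is a real transport equation.\<close>

definition be where "be = rp N (%j. - \<i> * of_int (sgn j) * a j)"

lemma a_real: "tp N a t = of_real (rp N a t)" by (rule tp_real) (rule aherm)

lemma rp_fl: "rp N (fl N a) t = be t * rp N (%k. \<i> * of_int k * a k) t - rp N a t * rp N (%j. of_int \<bar>j\<bar> * a j) t"
proof -
 have b: "tp N (%j. - \<i> * of_int (sgn j) * a j) t = of_real (be t)"
  unfolding be_def by (rule tp_real) (simp add: aherm)
 have b': "tp N (%j. of_int \<bar>j\<bar> * a j) t = of_real (rp N (%j. of_int \<bar>j\<bar> * a j) t)"
  by (rule tp_real) (simp add: aherm)
 have a': "tp N (%k. \<i> * of_int k * a k) t = of_real (rp N (%k. \<i> * of_int k * a k) t)"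
  by (rule tp_real) (simp add: aherm)
 have 1: "tp N (%j. - \<i> * of_int (sgn j) * a j) t = - \<i> * tp N (%j. of_int (sgn j) * a j) t" by (simp add: tp_def sum_distrib_left mult.assoc sum_negf)
 have 2: "tp N (%k. \<i> * of_int k * a k) t = \<i> * tp N (%k. of_int k * a k) t" by (simp add: tp_def sum_distrib_left mult.assoc)
 have "tp N (%j. of_int (sgn j) * a j) t * tp N (%k. of_int k * a k) t = (- \<i> * tp N (%j. of_int (sgn j) * a j) t) * (\<i> * tp N (%k. of_int k * a k) t)"
  by (simp add: complex_eq_iff algebra_simps)
 also have "... = of_real (be t * rp N (%k. \<i> * of_int k * a k) t)" unfolding 1[symmetric] 2[symmetric] b a' by simp
 finally have "tp N (fl N a) t = of_real (be t * rp N (%k. \<i> * of_int k * a k) t - rp N a t * rp N (%j. of_int \<bar>j\<bar> * a j) t)"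
  unfolding tp_fl a_real b' by simp
 thus ?thesis unfolding rp_def[of N "fl N a"] by simp
qed

lemma be_deriv: "(be has_real_derivative rp N (%j. of_int \<bar>j\<bar> * a j) t) (at t within S)"
proof -
 have "\<i> * of_int k * (- \<i> * of_int (sgn k) * a k) = of_int \<bar>k\<bar> * a k" for k
 proof -
  have "\<i> * of_int k * (- \<i> * of_int (sgn k) * a k) = of_int (k * sgn k) * a k" by (simp add: algebra_simps)
  thus ?thesis by (simp only: abs_sgn)
 qed
 thus ?thesis unfolding be_def using rp_deriv[of N "%j. - \<i> * of_int (sgn j) * a j" t S] by simp
qed

text \<open>A positive function has its largest Fourier coefficient at 0, its mean.\<close>

lemma coeff_le: assumes "!!t. rp N a t > 0" shows "cmod (a n) <= Re (a 0)"
proof -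
 have fo: "fourier (tp N a) k = a k" for k by (simp add: fourier_tp aband)
 have "a n = integral {0..2*pi} (%t. of_real (rp N a t) * cis (- (of_int n * t))) / of_real (2 * pi)" for n
  using fo[of n, symmetric] unfolding fourier_cis a_real .
 note e = this
 have i: "rp N a integrable_on {0..2*pi}" by (intro integrable_continuous_real rp_cont)
 have "cmod (integral {0..2*pi} (%t. of_real (rp N a t) * cis (- (of_int n * t)))) <= integral {0..2*pi} (rp N a)"
  by (rule integral_norm_bound_integral) (auto intro!: integrable_continuous_real continuous_intros rp_cont i simp: norm_mult assms less_imp_le)
 moreover have "Re (a 0) = integral {0..2*pi} (rp N a) / (2 * pi)"
  using e[of 0] integral_linear[OF i bounded_linear_of_real[where 'a=complex]] by (simp add: o_def)
 moreover have "cmod (a n) = cmod (integral {0..2*pi} (%t. of_real (rp N a t) * cis (- (of_int n * t)))) / (2 * pi)"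
  by (subst e[of n]) (simp add: norm_divide)
 ultimately show ?thesis by (simp add: divide_right_mono)
qed

lemma fl_zero_le: "Re (fl N a 0) <= 0"
proof -
 have "Re (of_int ((0 - 2 * j) * sgn j) * (a j * a (0 - j))) <= 0" for j
 proof -
  have "of_int ((0 - 2 * j) * sgn j) * (a j * a (0 - j)) = of_real (- 2 * of_int \<bar>j\<bar> * (cmod (a j))\<^sup>2)"
  proof -
   have 1: "of_real ((cmod (a j))\<^sup>2) = a j * a (0 - j)" using complex_norm_square[of "a j"] aherm[of j] by simp
   have 2: "complex_of_int ((0 - 2 * j) * sgn j) = of_real (- 2 * of_int \<bar>j\<bar>)" by (simp add: abs_sgn)
   show ?thesis unfolding of_real_mult[of "- 2 * of_int \<bar>j\<bar>"] 1 2 ..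
  qed
  thus ?thesis by (simp only: Re_complex_of_real) (simp add: mult_nonpos_nonneg)
 qed
 thus ?thesis unfolding fl_def by (simp only: Re_sum sum_nonpos)
qed

end

section \<open>Minimum principle, truncation and continuation\<close>

section \<open>Positivity and global existence\<close>

text \<open>At the first time and place where exp (K \<tau>) times the solution falls to delta, the
  theta-derivative vanishes, so the transport term drops out. What is left is positive times K -
  Lambda a > 0: the quantity was smaller just before, a contradiction.\<close>

lemma flow_positive:
 assumes S: "S >= 0" and vd: "!!k \<tau>. \<tau> \<in> {0..S} ==> ((%\<tau>. x \<tau> k) has_vd fl N (x \<tau>) k) (at \<tau> within {0..S})"
  and co: "!!\<tau>. \<tau> \<in> {0..S} ==> coeffs N (x \<tau>)" and B: "!!\<tau> k. \<tau> \<in> {0..S} ==> cmod (x \<tau> k) <= B"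
  and pos: "!!t. rp N (x 0) t > 0"
 shows "rp N (x S) t > 0"
proof -
 \<comment> \<open>An upper bound for Lambda of the solution over the whole time interval, plus 1 to
   make the inequality at the touching point strict.\<close>
 define K where "K = (\<Sum>j\<in>{- int N..int N}. \<bar>of_int j\<bar> * B) + 1"
 have xc: "continuous_on {0..S} (%\<tau>. x \<tau> k)" for k by (rule continuous_on_vector_derivative[OF vd])
 define g where "g \<tau> t = exp (K * \<tau>) * rp N (x \<tau>) t" for \<tau> t
 obtain t0 where t0: "t0 \<in> {0..2*pi}" "!!t. t \<in> {0..2*pi} ==> rp N (x 0) t0 <= rp N (x 0) t"
  using continuous_attains_inf[of "{0..2*pi}" "rp N (x 0)"] rp_cont by auto
 define \<delta> where "\<delta> = rp N (x 0) t0 / 2"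
 have \<delta>: "\<delta> > 0" using pos by (simp add: \<delta>_def)
 define Z where "Z = {p \<in> {0..S} \<times> {0..2*pi}. g (fst p) (snd p) <= \<delta>}"
 have gc: "continuous_on ({0..S} \<times> A) (%p. g (fst p) (snd p))" for A
  unfolding g_def by (intro continuous_intros rp_joint xc)
 have "closed Z" unfolding Z_def by (intro continuous_on_closed_Collect_le closed_Times gc continuous_intros closed_atLeastAtMost)
 moreover have "bounded Z" by (rule bounded_subset[OF bounded_Times[OF bounded_closed_interval bounded_closed_interval]]) (auto simp: Z_def)
 ultimately have Zc: "compact Z" by (simp add: compact_eq_bounded_closed)
 have "Z = {}"
 proof (rule ccontr)
  assume "Z \<noteq> {}"
  then obtain p where p: "p \<in> Z" "!!q. q \<in> Z ==> fst p <= fst q"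
   using continuous_attains_inf[OF Zc _ continuous_on_fst[OF continuous_on_id]] by auto
  obtain \<tau> t where pt: "p = (\<tau>, t)" by force
  have \<tau>: "\<tau> \<in> {0..S}" and t: "t \<in> {0..2*pi}" and le: "g \<tau> t <= \<delta>" using p(1) by (auto simp: Z_def pt)
  have before: "g \<sigma> s > \<delta>" if "0 <= \<sigma>" "\<sigma> < \<tau>" for \<sigma> s
  proof (rule ccontr)
   assume n: "\<not> g \<sigma> s > \<delta>"
   obtain s' where s': "s' \<in> {0..2*pi}" "!!c. rp N c s' = rp N c s" using rp_reduce by metis
   hence "(\<sigma>, s') \<in> Z" using n that \<tau> by (auto simp: Z_def g_def)
   thus False using p(2)[of "(\<sigma>, s')"] that by (simp add: pt)
  qed
  have "\<tau> \<noteq> 0" using le t0(2)[OF t] \<delta> by (auto simp: g_def \<delta>_def)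
  hence \<tau>0: "\<tau> > 0" using \<tau> by auto
  have ge: "g \<tau> s >= \<delta>" for s
  proof (rule continuous_ge_on_closure[where S="{0..<\<tau>}" and f="%\<sigma>. g \<sigma> s"])
   have "continuous_on {0..S} (%\<sigma>. g \<sigma> s)"
    using continuous_on_compose2[OF gc[of UNIV] continuous_on_Pair[OF continuous_on_id[of "{0..S}"] continuous_on_const[of _ s]]] by auto
   thus "continuous_on (closure {0..<\<tau>}) (%\<sigma>. g \<sigma> s)" using \<tau>0 \<tau> by (simp add: continuous_on_subset)
   show "\<tau> \<in> closure {0..<\<tau>}" using \<tau>0 by simp
   show "!!\<sigma>. \<sigma> \<in> {0..<\<tau>} ==> \<delta> <= g \<sigma> s" using before by (simp add: less_imp_le)
  qed
  have eq: "g \<tau> t = \<delta>" using le ge[of t] by simp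
  interpret co: coeffs N "x \<tau>" by (rule co[OF \<tau>])
  have "rp N (x \<tau>) t <= rp N (x \<tau>) s" for s using ge[of s] unfolding eq[symmetric] g_def by simp
  \<comment> \<open>Up to this time nothing lies below delta, so t is a global minimum in
    theta.\<close>
  hence z: "rp N (%k. \<i> * of_int k * x \<tau> k) t = 0" by (intro DERIV_local_min[OF rp_deriv zero_less_one]) auto
  have ap: "rp N (x \<tau>) t > 0" using \<delta> unfolding eq[symmetric] g_def by (simp add: zero_less_mult_iff)
  have "rp N (%j. of_int \<bar>j\<bar> * x \<tau> j) t <= (\<Sum>j\<in>{- int N..int N}. cmod (of_int \<bar>j\<bar> * x \<tau> j))" using rp_le abs_le_D1 by blast
  also have "... <= (\<Sum>j\<in>{- int N..int N}. \<bar>of_int j\<bar> * B)" by (intro sum_mono) (simp add: norm_mult mult_left_mono B[OF \<tau>])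
  finally have K: "rp N (%j. of_int \<bar>j\<bar> * x \<tau> j) t < K" by (simp add: K_def)
  have "((%\<sigma>. g \<sigma> t) has_real_derivative exp (K * \<tau>) * (rp N (x \<tau>) t * (K - rp N (%j. of_int \<bar>j\<bar> * x \<tau> j) t))) (at \<tau> within {0..S})"
  proof -
   have "((%\<sigma>. exp (K * \<sigma>)) has_real_derivative exp (K * \<tau>) * K) (at \<tau> within {0..S})"
    by (auto intro!: derivative_eq_intros)
   from DERIV_mult[OF this rp_tau[where x=x and x'="fl N (x \<tau>)" and t=t, OF vd[OF \<tau>]]]
   have "((%\<sigma>. exp (K * \<sigma>) * rp N (x \<sigma>) t) has_real_derivative exp (K * \<tau>) * K * rp N (x \<tau>) t + rp N (fl N (x \<tau>)) t * exp (K * \<tau>)) (at \<tau> within {0..S})" .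
   moreover have "exp (K * \<tau>) * K * rp N (x \<tau>) t + rp N (fl N (x \<tau>)) t * exp (K * \<tau>) = exp (K * \<tau>) * (rp N (x \<tau>) t * (K - rp N (%j. of_int \<bar>j\<bar> * x \<tau> j) t))"
    unfolding co.rp_fl z by (simp add: algebra_simps)
   ultimately show ?thesis unfolding g_def by (simp only:)
  qed
  moreover have "0 < exp (K * \<tau>) * (rp N (x \<tau>) t * (K - rp N (%j. of_int \<bar>j\<bar> * x \<tau> j) t))" using ap K by simp
  ultimately obtain d where d: "d > 0" "!!h. h > 0 ==> \<tau> - h \<in> {0..S} ==> h < d ==> g (\<tau> - h) t < g \<tau> t"
   using has_real_derivative_pos_inc_left by blast
  define h where "h = min d \<tau> / 2"
  have h: "0 < h" "h < d" "h < \<tau>" using d(1) \<tau>0 by (auto simp: h_def)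
  thus False using d(2)[of h] before[of "\<tau> - h" t] eq \<tau> by auto
 qed
 obtain s where s: "s \<in> {0..2*pi}" "!!c. rp N c s = rp N c t" using rp_reduce by metis
 have "(S, s) \<notin> Z" using \<open>Z = {}\<close> by simp
 hence "exp (K * S) * rp N (x S) t > 0" using S s \<delta> by (auto simp: Z_def g_def)
 thus ?thesis by (simp add: zero_less_mult_iff)
qed

text \<open>Clamping real and imaginary parts is 1-Lipschitz and commutes with conjugation; composed
  with it, the quadratic field becomes globally Lipschitz and keeps its reality symmetry.\<close>

definition cl :: "real => complex => complex" where
 "cl B z = Complex (max (- B) (min B (Re z))) (max (- B) (min B (Im z)))"

definition clx :: "nat => real => (int => complex) => int => complex" where
 "clx N B x k = (if \<bar>k\<bar> <= int N then cl B (x k) else 0)"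

lemma cl_lip: "cmod (cl B z - cl B w) <= cmod (z - w)"
proof -
 have "\<bar>max (- B) (min B u) - max (- B) (min B v)\<bar> <= \<bar>u - v\<bar>" for u v :: real by (auto simp: max_def min_def)
 thus ?thesis unfolding cmod_def cl_def by (intro real_sqrt_le_mono add_mono) (simp_all add: abs_le_square_iff[symmetric])
qed

lemma cl_le: "B >= 0 ==> cmod (cl B z) <= 2 * B"
 using cmod_le[of "cl B z"] by (auto simp: cl_def max_def min_def split: if_splits)

lemma cl_id: "cmod z <= B ==> cl B z = z"
 using abs_Re_le_cmod[of z] abs_Im_le_cmod[of z] by (auto simp: cl_def complex_eq_iff)

lemma cl_cnj: "B >= 0 ==> cl B (cnj z) = cnj (cl B z)"
 by (auto simp: cl_def complex_eq_iff max_def min_def)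

lemma clx_id: assumes "coeffs N x" "!!k. cmod (x k) <= B" shows "clx N B x = x"
proof -
 interpret coeffs N x by fact
 show ?thesis by (rule ext) (auto simp: clx_def cl_id assms(2) aband)
qed

text \<open>The factor |n - 2j| is at most 3N, and a difference of products of numbers of size 2B is
  at most 4B times the difference of the factors.\<close>

lemma lip_clx:
 assumes B: "B >= 0"
 shows "lip_ode (%x. fl N (clx N B x)) {- int N..int N} (real (card {- int N..int N}) * (3 * real N * (4 * B)))"
proof
 let ?I = "{- int N..int N}"
 fix x y :: "int => complex" and n assume n: "n \<in> ?I"
 define s where "s = (\<Sum>k\<in>?I. cmod (x k - y k))"
 have d: "cmod (clx N B x k - clx N B y k) <= s" for k
 proof (cases "\<bar>k\<bar> <= int N")
  case True
  have "cmod (x k - y k) <= s" unfolding s_def using True by (intro member_le_sum[of k ?I "%k. cmod (x k - y k)"]) auto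
  thus ?thesis using cl_lip[of B "x k" "y k"] True by (simp add: clx_def)
 qed (simp add: clx_def s_def sum_nonneg)
 have b: "cmod (clx N B x k) <= 2 * B" for x k using cl_le[OF B] B by (simp add: clx_def)
 let ?a = "clx N B x" and ?b = "clx N B y"
 have "cmod (fl N ?a n - fl N ?b n) <= (\<Sum>j\<in>?I. 3 * real N * (4 * B * s))"
  unfolding fl_def sum_subtractf[symmetric] right_diff_distrib[symmetric]
 proof (rule sum_norm_le)
  fix j assume j: "j \<in> ?I"
  have "\<bar>(n - 2 * j) * sgn j\<bar> <= 3 * int N" using n j by (auto simp: abs_mult sgn_if)
  hence c: "cmod (of_int ((n - 2 * j) * sgn j)) <= 3 * real N"
   unfolding norm_of_int of_int_abs[symmetric] by linarith
  have "?a j * ?a (n - j) - ?b j * ?b (n - j) = ?a j * (?a (n - j) - ?b (n - j)) + (?a j - ?b j) * ?b (n - j)" by (simp add: algebra_simps)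
  also have "cmod ... <= 2 * B * s + s * (2 * B)"
   by (intro norm_triangle_le add_mono) (simp_all only: norm_mult, (intro mult_mono b d norm_ge_zero order_trans[OF norm_ge_zero d] | use B in simp)+)
  finally have "cmod (?a j * ?a (n - j) - ?b j * ?b (n - j)) <= 4 * B * s" by simp
  thus "cmod (of_int ((n - 2 * j) * sgn j) * (?a j * ?a (n - j) - ?b j * ?b (n - j))) <= 3 * real N * (4 * B * s)"
   unfolding norm_mult[of "of_int ((n - 2 * j) * sgn j)"] using c by (intro mult_mono) auto
 qed
 thus "cmod (fl N ?a n - fl N ?b n) <= real (card ?I) * (3 * real N * (4 * B)) * (\<Sum>k\<in>?I. cmod (x k - y k))"
  unfolding s_def[symmetric] by (simp only: sum_constant mult_ac)
qed (use B in auto)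

lemma fl_refl: "fl N (%k. cnj (a (- k))) n = cnj (fl N a (- n))"
 unfolding fl_def cnj_sum
 by (rule sum.reindex_bij_witness[of _ uminus uminus]) (auto simp: algebra_simps)

text \<open>Solve the clamped system globally and show that the clamp is never active. While it is
  inactive, positivity bounds all coefficients by the mean, and the mean does not increase, so they
  stay strictly below B.\<close>

theorem flow_exists:
 assumes co0: "coeffs N a" and pos0: "!!t. rp N a t > 0"
 obtains x where "x 0 = a" "!!\<tau>. \<tau> >= 0 ==> coeffs N (x \<tau>)" "!!\<tau> t. \<tau> >= 0 ==> rp N (x \<tau>) t > 0"
  "!!k \<tau>. \<tau> >= 0 ==> ((%\<tau>. x \<tau> k) has_vd fl N (x \<tau>) k) (at \<tau> within {0..})"
proof -
 let ?I = "{- int N..int N}"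
 interpret a: coeffs N a by (rule co0)
 \<comment> \<open>The a priori bound is \<open>Re (a 0)\<close>; the margin 1 makes the inequality
   strict, so that the first violation can be excluded.\<close>
 define B where "B = Re (a 0) + 1"
 have a0: "cmod (a n) <= Re (a 0)" for n by (rule a.coeff_le[OF pos0])
 have B: "B >= 0" using a0[of 0] norm_ge_zero[of "a 0"] unfolding B_def by linarith
 interpret lip_ode "%x. fl N (clx N B x)" ?I "real (card ?I) * (3 * real N * (4 * B))" by (rule lip_clx[OF B])
 obtain x where x0: "!!n. x 0 n = a n" and xout: "!!n t. n \<notin> ?I ==> x t n = a n"
  and xd: "!!n t. n \<in> ?I ==> t >= 0 ==> ((%t. x t n) has_vd fl N (clx N B (x t)) n) (at t within {0..})"
  by (rule solution_exists[of a]) blast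
 \<comment> \<open>The reflected conjugate of a solution solves the same clamped system with the
   same initial value, so uniqueness gives the reality condition.\<close>
 have herm: "cnj (x t k) = x t (- k)" if t: "t >= 0" for t k
 proof (cases "k \<in> ?I")
  case True
  have r: "clx N B (%k. cnj (x s (- k))) = (%k. cnj (clx N B (x s) (- k)))" for s
   by (rule ext) (simp add: clx_def cl_cnj[OF B])
  have "(%k. cnj (x t (- k))) (- k) = x t (- k)"
  proof (rule solution_unique[where x="%t k. cnj (x t (- k))" and y=x and S=t])
   fix n s assume n: "n \<in> ?I" and s: "s \<in> {0..t}"
   show d: "((%t. x t n) has_vd fl N (clx N B (x s)) n) (at s within {0..t})" if "n \<in> ?I" for n
    by (rule has_vector_derivative_within_subset[OF xd[OF that]]) (use s in auto)
   have "((%t. cnj (x t (- n))) has_vd cnj (fl N (clx N B (x s)) (- n))) (at s within {0..t})"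
    by (rule bounded_linear.has_vector_derivative[OF bounded_linear_cnj d]) (use n in auto)
   thus "((%t. cnj (x t (- n))) has_vd fl N (clx N B (%k. cnj (x s (- k)))) n) (at s within {0..t})"
    unfolding r fl_refl .
  qed (use True t x0 a.aherm in auto)
  thus ?thesis by simp
 next
  case False
  thus ?thesis using xout[of k] xout[of "- k"] a.aherm[of k] by auto
 qed
 have co: "coeffs N (x t)" if "t >= 0" for t
 proof
  show "x t k = 0" if "\<bar>k\<bar> > int N" for k using xout[of k t] a.aband[OF that] that by (cases "k \<in> ?I") auto
 qed (rule herm[OF that])
 have xc: "continuous_on {0..} (%t. x t n)" for n
 proof (cases "n \<in> ?I")
  case True
  show ?thesis by (rule continuous_on_vector_derivative[OF xd[OF True]]) simp
 qed (simp add: xout)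
 \<comment> \<open>A bound strictly before t extends to t by continuity, so up to t the true flow is
   solved; positivity and the monotone mean then improve the bound at t to a strict one.\<close>
 have step: "(\<forall>s. rp N (x t) s > 0) \<and> (\<forall>n. cmod (x t n) < B) \<and> (\<forall>k. ((%\<tau>. x \<tau> k) has_vd fl N (x t) k) (at t within {0..t}))"
  if t: "t >= 0" and b: "!!s n. 0 <= s ==> s < t ==> cmod (x s n) < B" for t
 proof -
  have le: "cmod (x s n) <= B" if s: "s \<in> {0..t}" for s n
  proof (cases "s < t \<or> t = 0")
   case True
   thus ?thesis using b[of s n] s a0[of n] x0[of n] by (auto simp: B_def)
  next
   case False
   hence st: "s = t" "t > 0" using s t by auto
   show ?thesis
   proof (rule continuous_le_on_closure[where S="{0..<t}" and f="%s. cmod (x s n)"])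
    show "continuous_on (closure {0..<t}) (%s. cmod (x s n))"
     using st by (intro continuous_intros continuous_on_subset[OF xc]) auto
    show "s \<in> closure {0..<t}" using st by simp
    show "!!s. s \<in> {0..<t} ==> cmod (x s n) <= B" using b[of _ n] by (simp add: less_imp_le)
   qed
  qed
  have vd: "((%\<tau>. x \<tau> k) has_vd fl N (x s) k) (at s within {0..t})" if s: "s \<in> {0..t}" for s k
  proof -
   interpret s: coeffs N "x s" by (rule co) (use s in auto)
   have e: "clx N B (x s) = x s" by (rule clx_id[OF s.coeffs_axioms le[OF s]])
   show ?thesis
   proof (cases "k \<in> ?I")
    case True
    have "((%\<tau>. x \<tau> k) has_vd fl N (clx N B (x s)) k) (at s within {0..t})"
     by (rule has_vector_derivative_within_subset[OF xd[OF True]]) (use s in auto)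
    thus ?thesis unfolding e .
   next
    case False
    hence "fl N (x s) k = 0" by (intro s.fl_band) auto
    thus ?thesis using False by (simp add: xout)
   qed
  qed
  have p: "rp N (x t) s > 0" for s
   by (rule flow_positive[OF t vd co le]) (auto simp: x0[abs_def] pos0)
  interpret t: coeffs N "x t" by (rule co[OF t])
  have "Re (x t 0) <= Re (x 0 0)"
  proof (rule nonincreasing_of_deriv[OF _ _ t])
   fix s assume s: "s \<in> {0..t}"
   interpret s: coeffs N "x s" by (rule co) (use s in auto)
   show "((%s. Re (x s 0)) has_real_derivative Re (fl N (x s) 0)) (at s within {0..t})"
    unfolding has_real_derivative_iff_has_vector_derivative
    by (rule bounded_linear.has_vector_derivative[OF bounded_linear_Re vd[OF s]])
   show "Re (fl N (x s) 0) <= 0" by (rule s.fl_zero_le)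
  qed
  hence "cmod (x t n) < B" for n using t.coeff_le[OF p, of n] x0[of 0] by (simp add: B_def)
  thus ?thesis using p vd[of t] t by auto
 qed
 have bound: "cmod (x t n) < B" if "t >= 0" for t n
 proof (rule ccontr)
  assume n: "\<not> cmod (x t n) < B"
  \<comment> \<open>The set of times violating the bound is closed; its infimum satisfies the
    hypothesis of \<open>step\<close>, which contradicts membership.\<close>
  define bad where "bad = (\<Union>k\<in>?I. {s \<in> {0..}. B <= cmod (x s k)})"
  have out: "cmod (x s k) < B" if "k \<notin> ?I" for s k using xout[OF that] a0[of k] by (simp add: B_def)
  have "n \<in> ?I" using n out by blast
  hence "t \<in> bad" using n that by (auto simp: bad_def not_less)
  moreover have "closed bad" unfolding bad_def
   by (intro closed_UN ballI continuous_on_closed_Collect_le continuous_intros xc) auto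
  moreover have bb: "bdd_below bad" by (intro bdd_belowI[of _ 0]) (auto simp: bad_def)
  ultimately have I: "Inf bad \<in> bad" by (intro closed_contains_Inf) auto
  have "cmod (x s k) < B" if "0 <= s" "s < Inf bad" for s k
  proof (rule ccontr)
   assume "\<not> cmod (x s k) < B"
   moreover from this have "k \<in> ?I" using out by blast
   ultimately have "s \<in> bad" using that(1) by (auto simp: bad_def not_less)
   thus False using cInf_lower[OF _ bb, of s] that(2) by simp
  qed
  moreover have "Inf bad >= 0" using I unfolding bad_def by blast
  ultimately have nb: "\<forall>n. cmod (x (Inf bad) n) < B" using step[of "Inf bad"] by blast
  obtain k where "B <= cmod (x (Inf bad) k)" using I unfolding bad_def by blast
  thus False using nb[rule_format, of k] by simp
 qed
 have vd: "((%\<tau>. x \<tau> k) has_vd fl N (x t) k) (at t within {0..})" if t: "t >= 0" for t k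
 proof -
  interpret t: coeffs N "x t" by (rule co[OF t])
  have e: "clx N B (x t) = x t" by (rule clx_id[OF t.coeffs_axioms less_imp_le[OF bound[OF t]]])
  show ?thesis
  proof (cases "k \<in> ?I")
   case True
   show ?thesis using xd[OF True t] unfolding e .
  next
   case False
   hence "fl N (x t) k = 0" by (intro t.fl_band) auto
   thus ?thesis using False by (simp add: xout)
  qed
 qed
 have p: "rp N (x t) s > 0" if "t >= 0" for t s using step[OF that] bound by blast
 show thesis by (rule that[of x]) (auto simp: x0 co p vd)
qed

text \<open>On 0..S both solutions are bounded, so with B above both bounds they solve the same
  clamped Lipschitz system.\<close>

lemma flow_unique:
 assumes x: "!!\<tau>. \<tau> >= 0 ==> coeffs N (x \<tau>)" "!!k \<tau>. \<tau> >= 0 ==> ((%\<tau>. x \<tau> k) has_vd fl N (x \<tau>) k) (at \<tau> within {0..})"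
  and y: "!!\<tau>. \<tau> >= 0 ==> coeffs N (y \<tau>)" "!!k \<tau>. \<tau> >= 0 ==> ((%\<tau>. y \<tau> k) has_vd fl N (y \<tau>) k) (at \<tau> within {0..})"
  and eq: "x 0 = y 0" and S: "S >= 0"
 shows "x S = y S"
proof -
 let ?I = "{- int N..int N}"
 have bd: "\<exists>C. \<forall>\<tau>\<in>{0..S}. \<forall>k. cmod (z \<tau> k) <= C" if z: "!!\<tau>. \<tau> >= 0 ==> coeffs N (z \<tau>)" "!!k \<tau>. \<tau> >= 0 ==> ((%\<tau>. z \<tau> k) has_vd fl N (z \<tau>) k) (at \<tau> within {0..})" for z
 proof -
  have "continuous_on {0..} (%\<tau>. z \<tau> k)" for k by (rule continuous_on_vector_derivative[OF z(2)]) simp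
  hence "continuous_on {0..S} (%\<tau>. z \<tau> k)" for k by (rule continuous_on_subset) auto
  hence "continuous_on {0..S} (%\<tau>. \<Sum>k\<in>?I. cmod (z \<tau> k))" by (intro continuous_on_sum continuous_on_norm)
  hence "bounded ((%\<tau>. \<Sum>k\<in>?I. cmod (z \<tau> k)) ` {0..S})" by (intro compact_imp_bounded compact_continuous_image) auto
  then obtain C where "\<forall>v\<in>(%\<tau>. \<Sum>k\<in>?I. cmod (z \<tau> k)) ` {0..S}. norm v <= C" unfolding bounded_iff by blast
  hence C: "!!\<tau>. \<tau> \<in> {0..S} ==> \<bar>\<Sum>k\<in>?I. cmod (z \<tau> k)\<bar> <= C" by simp
  have "cmod (z \<tau> k) <= C" if \<tau>: "\<tau> \<in> {0..S}" for \<tau> k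
  proof (cases "k \<in> ?I")
   case True
   hence "cmod (z \<tau> k) <= (\<Sum>k\<in>?I. cmod (z \<tau> k))" by (intro member_le_sum[of k ?I "%k. cmod (z \<tau> k)"]) auto
   thus ?thesis using C[OF \<tau>] by linarith
  next
   case False
   hence "z \<tau> k = 0" using coeffs.aband[OF z(1)[of \<tau>], of k] \<tau> by auto
   thus ?thesis using C[OF \<tau>] by simp
  qed
  thus ?thesis by blast
 qed
 obtain C1 C2 where C: "!!\<tau> k. \<tau> \<in> {0..S} ==> cmod (x \<tau> k) <= C1" "!!\<tau> k. \<tau> \<in> {0..S} ==> cmod (y \<tau> k) <= C2"
  using bd[OF x] bd[OF y] by metis
 define B where "B = max C1 C2"
 have "B >= 0" using C(1)[of 0 0] S norm_ge_zero[of "x 0 0"] unfolding B_def by (simp add: le_max_iff_disj) (meson order_trans norm_ge_zero)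
 then interpret lip_ode "%x. fl N (clx N B x)" ?I "real (card ?I) * (3 * real N * (4 * B))" by (rule lip_clx)
 have d: "((%\<tau>. z \<tau> k) has_vd fl N (clx N B (z \<tau>)) k) (at \<tau> within {0..S})"
  if z: "coeffs N (z \<tau>)" "((%\<tau>. z \<tau> k) has_vd fl N (z \<tau>) k) (at \<tau> within {0..})" "!!k. cmod (z \<tau> k) <= B" for z \<tau> k
  unfolding clx_id[OF z(1,3)] by (rule has_vector_derivative_within_subset[OF z(2)]) auto
 have "x S n = y S n" for n
 proof (cases "n \<in> ?I")
  case True
  show ?thesis
   by (rule solution_unique[OF d d _ S True]) (use C eq x y in \<open>auto simp: B_def le_max_iff_disj\<close>)
 next
  case False
  thus ?thesis using coeffs.aband[OF x(1)[OF S], of n] coeffs.aband[OF y(1)[OF S], of n] by auto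
 qed
 thus ?thesis by (rule ext)
qed

section \<open>Lax type equations and the values at negative even integers\<close>

section \<open>Monotone traces along the flow\<close>

text \<open>The quadratic form at y is the mean of a |g|^2, where g has the coefficients |k|^(1/2) y
  k.\<close>

lemma (in coeffs) psd_T: assumes pos: "!!t. rp N a t > 0" shows "psd T"
 unfolding psd_def
proof (intro allI impI)
 fix S and y :: "int => complex" assume S: "finite S" "\<forall>l. l \<notin> S \<longrightarrow> y l = 0"
 define z where "z k = rt k * y k" for k
 define g where "g t = (\<Sum>k\<in>S. z k * cis (of_int k * t))" for t
 have "T y l = (\<Sum>k\<in>S. rt l * rt k * a (l - k) * y k)" for l
 proof -
  have "T y l = (\<Sum>k\<in>{l - int N..l + int N} \<union> S. Tk a l k * y k)"
   unfolding T_def by (rule kop_eq) (auto simp: Tk_def aband S)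
  also have "... = (\<Sum>k\<in>S. Tk a l k * y k)" by (rule sum.mono_neutral_right) (use S in auto)
  finally show ?thesis by (simp add: Tk_def)
 qed
 hence "(\<Sum>l\<in>S. cnj (y l) * T y l) = (\<Sum>l\<in>S. \<Sum>k\<in>S. cnj (z l) * z k * a (l - k))"
  by (simp add: z_def sum_distrib_left mult_ac)
 also have "... = (\<Sum>l\<in>S. \<Sum>k\<in>S. fourier (%t. cnj (z l) * z k * (cis (of_int (k - l) * t) * tp N a t)) 0)"
  unfolding fourier_cmult fourier_shift fourier_tp by (intro sum.cong refl) (auto simp: aband)
 also have "... = fourier (%t. \<Sum>l\<in>S. \<Sum>k\<in>S. cnj (z l) * z k * (cis (of_int (k - l) * t) * tp N a t)) 0"
  by (subst fourier_sum, (intro continuous_intros)[1], intro sum.cong refl, rule fourier_sum[symmetric], intro continuous_intros)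
 also have "(%t. \<Sum>l\<in>S. \<Sum>k\<in>S. cnj (z l) * z k * (cis (of_int (k - l) * t) * tp N a t)) = (%t. of_real (rp N a t * (cmod (g t))\<^sup>2))"
 proof
  fix t
  have "cis (of_int (k - l) * t) = cnj (cis (of_int l * t)) * cis (of_int k * t)" for k l
   by (simp add: cis_cnj cis_mult algebra_simps)
  hence "(\<Sum>l\<in>S. \<Sum>k\<in>S. cnj (z l) * z k * (cis (of_int (k - l) * t) * tp N a t)) = (\<Sum>l\<in>S. \<Sum>k\<in>S. cnj (z l * cis (of_int l * t)) * (z k * cis (of_int k * t))) * tp N a t"
   by (simp add: sum_distrib_left sum_distrib_right mult_ac)
  also have "(\<Sum>l\<in>S. \<Sum>k\<in>S. cnj (z l * cis (of_int l * t)) * (z k * cis (of_int k * t))) = cnj (g t) * g t"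
   unfolding g_def cnj_sum sum_product ..
  also have "... = of_real ((cmod (g t))\<^sup>2)" using complex_norm_square[of "g t"] by (simp add: mult.commute)
  finally show "(\<Sum>l\<in>S. \<Sum>k\<in>S. cnj (z l) * z k * (cis (of_int (k - l) * t) * tp N a t)) = of_real (rp N a t * (cmod (g t))\<^sup>2)"
   by (simp add: a_real mult.commute)
 qed
 finally have e: "(\<Sum>l\<in>S. cnj (y l) * T y l) = fourier (%t. of_real (rp N a t * (cmod (g t))\<^sup>2)) 0" .
 have i: "(%t. rp N a t * (cmod (g t))\<^sup>2) integrable_on {0..2*pi}"
  unfolding g_def by (intro integrable_continuous_real continuous_intros rp_cont)
 have "Re (fourier (%t. of_real (rp N a t * (cmod (g t))\<^sup>2)) 0) = integral {0..2*pi} (%t. rp N a t * (cmod (g t))\<^sup>2) / (2 * pi)"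
  using integral_linear[OF i bounded_linear_of_real[where 'a=complex]] by (simp add: fourier_cis o_def)
 also have "... >= 0" by (intro divide_nonneg_pos integral_nonneg i) (auto simp: pos less_imp_le)
 finally show "Re (\<Sum>l\<in>S. cnj (y l) * T y l) >= 0" unfolding e .
qed

lemma (in coeffs) JL: "J (Lk f) = Kk (J f)"
 by (rule ext) (simp add: J_def Lk_def Kk_def kop_def sum_distrib_left mult_ac)

locale flow_line =
 fixes N :: nat and x :: "real => int => complex"
 assumes co: "!!\<tau>. \<tau> >= 0 ==> coeffs N (x \<tau>)"
  and pos: "!!\<tau> t. \<tau> >= 0 ==> rp N (x \<tau>) t > 0"
  and vd: "!!k \<tau>. \<tau> >= 0 ==> ((%\<tau>. x \<tau> k) has_vd fl N (x \<tau>) k) (at \<tau> within {0..})"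
  and vol0: "integral {0..2*pi} (%t. 1 / rp N (x 0) t) = 2 * pi"
begin

abbreviation Tt where "Tt \<tau> \<equiv> coeffs.T N (x \<tau>)"
abbreviation Xt where "Xt \<tau> \<equiv> coeffs.X N (x \<tau>)"
abbreviation Kt where "Kt \<tau> \<equiv> coeffs.Kk N (x \<tau>)"
abbreviation Ft where "Ft \<tau> \<equiv> coeffs.F N (x \<tau>)"
abbreviation Spt where "Spt \<tau> \<equiv> coeffs.Sp N (x \<tau>)"

lemma T_step:
 assumes \<tau>: "\<tau> >= 0" and f: "!!l. ((%\<tau>. f \<tau> l) has_vd f' l) (at \<tau> within {0..})"
 shows "((%\<tau>. Tt \<tau> (f \<tau>) l) has_vd Tt \<tau> f' l + kop N (Tk (fl N (x \<tau>))) (f \<tau>) l) (at \<tau> within {0..})"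
proof -
 have "((%\<sigma>. \<Sum>k\<in>{l - int N..l + int N}. rt l * rt k * x \<sigma> (l - k) * f \<sigma> k) has_vd
  (\<Sum>k\<in>{l - int N..l + int N}. rt l * rt k * x \<tau> (l - k) * f' k + rt l * rt k * fl N (x \<tau>) (l - k) * f \<tau> k)) (at \<tau> within {0..})"
  by (intro has_vector_derivative_sum has_vector_derivative_mult has_vector_derivative_mult_right vd f \<tau>)
 moreover have "((%\<sigma>. Tt \<sigma> (f \<sigma>) l) has_vd D) (at \<tau> within {0..}) \<longleftrightarrow>
   ((%\<sigma>. \<Sum>k\<in>{l - int N..l + int N}. rt l * rt k * x \<sigma> (l - k) * f \<sigma> k) has_vd D) (at \<tau> within {0..})" for D
 proof -
  have "Tt \<sigma> (f \<sigma>) l = (\<Sum>k\<in>{l - int N..l + int N}. rt l * rt k * x \<sigma> (l - k) * f \<sigma> k)" if "\<sigma> >= 0" for \<sigma>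
   unfolding coeffs.T_def[OF co[OF that]] kop_def Tk_def by simp
  thus ?thesis using \<tau> by (intro has_vector_derivative_cong_ev[unfolded eventually_nhds] always_eventually) auto
 qed
 ultimately show ?thesis unfolding coeffs.T_def[OF co[OF \<tau>]] kop_def Tk_def sum.distrib by simp
qed

text \<open>T' is the commutator of K with T minus 2 F T. The commutator part of a power telescopes
  to a commutator, and each factor leaves one term with F.\<close>

lemma T_pow_deriv:
 assumes \<tau>: "\<tau> >= 0"
 shows "((%\<tau>. (Tt \<tau> ^^ p) f l) has_vd
  Kt \<tau> ((Tt \<tau> ^^ p) f) l - (Tt \<tau> ^^ p) (Kt \<tau> f) l + (\<Sum>i<p. (Tt \<tau> ^^ i) (%l. - 2 * Ft \<tau> ((Tt \<tau> ^^ (p - i)) f) l) l)) (at \<tau> within {0..})"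
proof (induction p arbitrary: l)
 case (Suc p)
 interpret c: coeffs N "x \<tau>" by (rule co[OF \<tau>])
 let ?u = "(c.T ^^ p) f" and ?G = "%i l. - 2 * c.F ((c.T ^^ (p - i)) f) l"
 have "((%\<tau>. Tt \<tau> ((Tt \<tau> ^^ p) f) l) has_vd
   c.T (%l. c.Kk ?u l - (c.T ^^ p) (c.Kk f) l + (\<Sum>i<p. (c.T ^^ i) (?G i) l)) l + kop N (Tk (fl N (x \<tau>))) ?u l) (at \<tau> within {0..})"
  by (rule T_step[OF \<tau> Suc.IH])
 note A = this
 have e1: "c.T (%l. c.Kk ?u l - (c.T ^^ p) (c.Kk f) l + (\<Sum>i<p. (c.T ^^ i) (?G i) l)) l
  = c.T (c.Kk ?u) l - c.T ((c.T ^^ p) (c.Kk f)) l + (\<Sum>i<p. c.T ((c.T ^^ i) (?G i)) l)"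
  unfolding loc_add[OF c.op_loc(1)] loc_diff[OF c.op_loc(1)] loc_sum[OF c.op_loc(1)] ..
 have e2: "kop N (Tk (fl N (x \<tau>))) ?u l = c.Kk (c.T ?u) l - 2 * c.F (c.T ?u) l - c.T (c.Kk ?u) l"
  using c.flow_commutator[of ?u l] c.LK_F[of "c.T ?u" l] by (simp add: diff_eq_eq)
 have e3: "(\<Sum>i<Suc p. (c.T ^^ i) (%l. - 2 * c.F ((c.T ^^ (Suc p - i)) f) l) l) = - 2 * c.F (c.T ?u) l + (\<Sum>i<p. c.T ((c.T ^^ i) (?G i)) l)"
  unfolding sum.lessThan_Suc_shift by simp
 have eq: "(A1 - A2 + S) + (A3 - 2 * A4 - A1) = A3 - A2 + (- 2 * A4 + S)" for A1 A2 S A3 A4 :: complex by simp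
 show ?case using A unfolding e1 e2 eq unfolding e3[symmetric] by (simp only: funpow.simps o_apply)
qed simp

text \<open>J intertwines Lk with Kk, so X = J T satisfies an exact commutator equation, without the
  defect F.\<close>

lemma X_pow_deriv:
 assumes \<tau>: "\<tau> >= 0"
 shows "((%\<tau>. (Xt \<tau> ^^ p) f l) has_vd Kt \<tau> ((Xt \<tau> ^^ p) f) l - (Xt \<tau> ^^ p) (Kt \<tau> f) l) (at \<tau> within {0..})"
proof (induction p arbitrary: l)
 case (Suc p)
 interpret c: coeffs N "x \<tau>" by (rule co[OF \<tau>])
 let ?u = "(c.X ^^ p) f"
 have Xe: "Xt \<sigma> g l = of_int (sgn l) * Tt \<sigma> g l" if "\<sigma> >= 0" for \<sigma> g l
  using coeffs.X_JT[OF co[OF that]] coeffs.J_def[OF co[OF that]] by metis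
 have "((%\<tau>. of_int (sgn l) * Tt \<tau> ((Xt \<tau> ^^ p) f) l) has_vd
   of_int (sgn l) * (c.T (%l. c.Kk ?u l - (c.X ^^ p) (c.Kk f) l) l + kop N (Tk (fl N (x \<tau>))) ?u l)) (at \<tau> within {0..})"
  by (rule has_vector_derivative_mult_right[OF T_step[OF \<tau> Suc.IH]])
 moreover have "of_int (sgn l) * (c.T (%l. c.Kk ?u l - (c.X ^^ p) (c.Kk f) l) l + kop N (Tk (fl N (x \<tau>))) ?u l) = c.Kk (c.X ?u) l - c.X ((c.X ^^ p) (c.Kk f)) l"
 proof -
  have "of_int (sgn l) * c.Lk (c.T ?u) l = c.Kk (c.X ?u) l"
   using fun_cong[OF c.JL, of "c.T ?u" l] c.X_JT[of ?u] by (simp add: c.J_def)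
  thus ?thesis unfolding loc_diff[OF c.op_loc(1)] c.flow_commutator using Xe[OF \<tau>] by (simp add: algebra_simps)
 qed
 moreover have "((%\<sigma>. (Xt \<sigma> ^^ Suc p) f l) has_vd D) (at \<tau> within {0..}) \<longleftrightarrow> ((%\<sigma>. of_int (sgn l) * Tt \<sigma> ((Xt \<sigma> ^^ p) f) l) has_vd D) (at \<tau> within {0..})" for D
  using \<tau> Xe by (intro has_vector_derivative_cong_ev[unfolded eventually_nhds] always_eventually) auto
 ultimately show ?case by simp
qed simp

text \<open>The commutator of Kt with \<open>Sp\<close> is traceless because \<open>Sp\<close> has
  finite support; by cyclicity each of the p defect terms contributes -2 tr F T^p, and
  \<open>trace_F_pow\<close> fixes the sign. R is a fixed window containing all supports
  involved.\<close>

theorem trace_nonincreasing: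
 assumes m: "m >= 1" and \<tau>: "\<tau> >= 0" and R: "R = 2 * int N + 2 * int (2 * (2 * m) * N) + 2 * int (2 * N)"
 shows "Re (tr R (Spt \<tau> (2 * m))) <= Re (tr R (Spt 0 (2 * m)))"
proof -
 define p where "p = 2 * m"
 have p: "p > 0" "even p" "odd (p - 1)" using m by (auto simp: p_def)
 let ?D = "%\<sigma>. \<Sum>l\<in>{-R..R}. Kt \<sigma> (Spt \<sigma> p (dl l)) l - Spt \<sigma> p (Kt \<sigma> (dl l)) l + (\<Sum>i<p. (Tt \<sigma> ^^ i) (%l'. - 2 * Ft \<sigma> ((Tt \<sigma> ^^ (p - i)) (dl l)) l') l)"
 have d: "((%\<sigma>. tr R (Spt \<sigma> p)) has_vd ?D \<sigma>) (at \<sigma> within {0..\<tau>})" if \<sigma>: "\<sigma> \<in> {0..\<tau>}" for \<sigma>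
 proof -
  have s0: "\<sigma> >= 0" using \<sigma> by simp
  interpret c: coeffs N "x \<sigma>" by (rule co[OF s0])
  have "((%\<sigma>. (Tt \<sigma> ^^ p) (dl l) l - (Xt \<sigma> ^^ p) (dl l) l) has_vd
   (Kt \<sigma> ((Tt \<sigma> ^^ p) (dl l)) l - (Tt \<sigma> ^^ p) (Kt \<sigma> (dl l)) l + (\<Sum>i<p. (Tt \<sigma> ^^ i) (%l'. - 2 * Ft \<sigma> ((Tt \<sigma> ^^ (p - i)) (dl l)) l') l))
   - (Kt \<sigma> ((Xt \<sigma> ^^ p) (dl l)) l - (Xt \<sigma> ^^ p) (Kt \<sigma> (dl l)) l)) (at \<sigma> within {0..})" for l
   by (intro has_vector_derivative_diff T_pow_deriv X_pow_deriv s0)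
  note A = this
  have "c.Kk (c.Sp p (dl l)) l = c.Kk ((c.T ^^ p) (dl l)) l - c.Kk ((c.X ^^ p) (dl l)) l" for l
   unfolding c.Sp_def[abs_def] by (rule loc_diff[OF c.op_loc(6)])
  hence e: "(Kt \<sigma> ((Tt \<sigma> ^^ p) (dl l)) l - (Tt \<sigma> ^^ p) (Kt \<sigma> (dl l)) l + z) - (Kt \<sigma> ((Xt \<sigma> ^^ p) (dl l)) l - (Xt \<sigma> ^^ p) (Kt \<sigma> (dl l)) l)
   = c.Kk (c.Sp p (dl l)) l - c.Sp p (c.Kk (dl l)) l + z" for l z by (simp add: c.Sp_def)
  have "((%\<sigma>. \<Sum>l\<in>{-R..R}. (Tt \<sigma> ^^ p) (dl l) l - (Xt \<sigma> ^^ p) (dl l) l) has_vd ?D \<sigma>) (at \<sigma> within {0..})"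
   using A unfolding e by (intro has_vector_derivative_sum) auto
  hence "((%\<sigma>. \<Sum>l\<in>{-R..R}. (Tt \<sigma> ^^ p) (dl l) l - (Xt \<sigma> ^^ p) (dl l) l) has_vd ?D \<sigma>) (at \<sigma> within {0..\<tau>})"
   by (rule has_vector_derivative_within_subset) auto
  thus ?thesis
   by (rule has_vector_derivative_transform[OF \<sigma>, rotated]) (auto simp: tr_def coeffs.Sp_def[OF co])
 qed
 have D: "?D \<sigma> = of_nat p * (- 2 * tr R (%f. Ft \<sigma> ((Tt \<sigma> ^^ p) f)))" if s0: "\<sigma> >= 0" for \<sigma>
 proof -
  interpret c: coeffs N "x \<sigma>" by (rule co[OF s0])
  have R1: "2 * int (p * N) <= R" unfolding R p_def by simp
  have cyc: "tr R (%f. c.Sp p (c.Kk f)) = tr R (%f. c.Kk (c.Sp p f))"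
   by (rule tr_cyc[OF c.Sp_loc fs_mono[OF c.Sp_fs[OF p(2)] R1] c.op_loc(6)])
  have t: "tr R (%f. (c.T ^^ i) (%l'. - 2 * c.F ((c.T ^^ (p - i)) f) l')) = - 2 * tr R (%f. c.F ((c.T ^^ p) f))" if i: "i < p" for i
  proof -
   have "int N + int ((p - i) * N) <= R"
   proof -
    have "(p - i) * N <= p * N" by (intro mult_right_mono) auto
    hence "int ((p - i) * N) <= int (p * N)" by (rule of_nat_mono)
    moreover have "0 <= int (p * N)" by simp
    moreover have "int N + 2 * int (p * N) <= R" unfolding R p_def by simp
    ultimately show ?thesis by linarith
   qed
   hence f: "fs R (%f. c.F ((c.T ^^ (p - i)) f))" by (rule fs_mono[OF fs_comp_right[OF c.F_fs c.op_loc(4) c.Tp_loc]])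
   have "tr R (%f. c.F ((c.T ^^ (p - i)) ((c.T ^^ i) f))) = tr R (%f. (c.T ^^ i) (c.F ((c.T ^^ (p - i)) f)))"
    by (rule tr_cyc[OF loc_comp[OF c.op_loc(4) c.Tp_loc] f c.Tp_loc])
   moreover have "(c.T ^^ (p - i)) ((c.T ^^ i) f) = (c.T ^^ p) f" for f using i funpow_add[of "p - i" i c.T] by (simp add: fun_eq_iff)
   ultimately show ?thesis unfolding tr_def loc_cmult[OF c.Tp_loc] by (simp add: sum_distrib_left[symmetric] sum_negf)
  qed
  have "?D \<sigma> = tr R (%f. c.Kk (c.Sp p f)) - tr R (%f. c.Sp p (c.Kk f)) + (\<Sum>l\<in>{-R..R}. \<Sum>i<p. (c.T ^^ i) (%l'. - 2 * c.F ((c.T ^^ (p - i)) (dl l)) l') l)"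
   unfolding tr_def by (simp add: sum.distrib sum_subtractf)
  also have "(\<Sum>l\<in>{-R..R}. \<Sum>i<p. (c.T ^^ i) (%l'. - 2 * c.F ((c.T ^^ (p - i)) (dl l)) l') l) = (\<Sum>i<p. tr R (%f. (c.T ^^ i) (%l'. - 2 * c.F ((c.T ^^ (p - i)) f) l')))"
   unfolding tr_def by (rule sum.swap)
  finally show ?thesis using t cyc by simp
 qed
 have "Re (tr R (Spt \<tau> p)) <= Re (tr R (Spt 0 p))"
 proof (rule nonincreasing_of_deriv[OF _ _ \<tau>])
  fix \<sigma> assume \<sigma>: "\<sigma> \<in> {0..\<tau>}"
  hence s0: "\<sigma> >= 0" by simp
  interpret c: coeffs N "x \<sigma>" by (rule co[OF s0])
  show "((%\<sigma>. Re (tr R (Spt \<sigma> p))) has_real_derivative Re (?D \<sigma>)) (at \<sigma> within {0..\<tau>})"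
   unfolding has_real_derivative_iff_has_vector_derivative by (rule bounded_linear.has_vector_derivative[OF bounded_linear_Re d[OF \<sigma>]])
  have "Re (tr R (%f. c.F ((c.T ^^ p) f))) >= 0"
   by (rule c.trace_F_pow[OF p(1) _ c.psd_T[OF pos[OF s0]] p(3)]) (simp add: R p_def)
  thus "Re (?D \<sigma>) <= 0" unfolding D[OF s0] by simp
 qed
 thus ?thesis by (simp add: p_def)
qed

end

section \<open>Sign of the formal time derivative at -1\<close>

section \<open>The flux of the first special value\<close>

lemma has_sum_sum_real:
 fixes f :: "'x => 'a => real"
 assumes "finite X" "!!x. x \<in> X ==> (f x has_sum s x) A"
 shows "((%i. \<Sum>x\<in>X. f x i) has_sum (\<Sum>x\<in>X. s x)) A"
 using assms by (induction X rule: finite_induct) (auto intro: has_sum_add)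

context trig1
begin

text \<open>The terms of \<open>Re (r n n)\<close>: the weight |l| - sgn n * l is 2|l| for opposite
  signs and 0 for equal ones. The double series over n and l therefore represents G(-1).\<close>

definition hh :: "int \<times> int => real" where
 "hh p = (case p of (n, l) => if n * l < 0 then 2 * of_int \<bar>l\<bar> * (cmod (c n l))\<^sup>2 else 0)"

text \<open>The time derivative of c n l along the flow up to an infinitesimal rotation (see
  \<open>C_tau\<close>); \<open>hd1\<close> is the resulting derivative of
  \<open>hh\<close>.\<close>

definition W :: "int => int => complex" where
 "W n l = (\<Sum>j\<in>{- int N..int N}. of_int (sgn j) * bc j * (of_int (l - j) * c n (l - j)))"

definition hd1 :: "int \<times> int => real" where
 "hd1 p = (case p of (n, l) => if n * l < 0 then 4 * of_int \<bar>l\<bar> * Re (cnj (c n l) * W n l) else 0)"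

lemma pair_summable:
 fixes f :: "int \<times> int => real"
 assumes "!!n l. \<bar>f (n, l)\<bar> <= D * (1 / (br n ^ 2 * br l ^ 2))"
 shows "f summable_on UNIV"
proof (rule abs_summable_summable)
 show "(%p. norm (f p)) summable_on UNIV"
  by (rule abs_summable_dominated[OF summable_on_cmult_right[OF summable_br2, of D]])
   (use assms in \<open>auto simp: case_prod_beta split: prod.splits\<close>)
qed

lemma r_diag_sum: "(\<Sum>\<^sub>\<infinity>n\<in>{n. n \<noteq> 0}. Re (r n n)) = (ISUM p. hh p)" and hh_summable: "hh summable_on UNIV"
proof -
 obtain C where C: "C >= 0" "!!n l. n * l <= 0 ==> br n ^ 4 * br l ^ 4 * cmod (c n l) <= C" using c_cross[where K=4] by blast
 have "\<bar>hh (n, l)\<bar> <= (2 * C) * (1 / (br n ^ 2 * br l ^ 2))" for n l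
 proof (cases "n * l < 0")
  case True
  have "(br n ^ 2 * br l ^ 2) * (2 * \<bar>of_int l\<bar> * (cmod (c n l))\<^sup>2) <= (br n ^ 4 * br l ^ 3) * (2 * br l * (cmod (c n l) * 1))"
   unfolding power2_eq_square[of "cmod (c n l)"]
   by (intro mult_mono power_increasing br_ge1 br_abs_le norm_c_le_1 mult_nonneg_nonneg) (auto simp: less_imp_le)
  also have "... = 2 * (br n ^ 4 * br l ^ 4 * cmod (c n l))" by (simp add: power_numeral_reduce mult_ac)
  also have "... <= 2 * C" using C(2)[of n l] True by simp
  finally show ?thesis using True by (simp add: hh_def field_simps)
 qed (use C in \<open>simp add: hh_def less_imp_le\<close>)
 thus s: "hh summable_on UNIV" by (rule pair_summable)
 have s': "(%(n, l). hh (n, l)) summable_on (UNIV \<times> UNIV)" using s by simp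
 have "Re (r n n) = (ISUM l. hh (n, l))" if n: "n \<noteq> 0" for n
 proof -
  have "(%l. hh (n, l)) summable_on UNIV" using summable_on_SigmaD1[OF s', of n] by simp
  hence "((%l. complex_of_real (hh (n, l))) has_sum of_real (ISUM l. hh (n, l))) UNIV"
   by (intro has_sum_of_real has_sum_infsum)
  moreover have "complex_of_real (hh (n, l)) = of_int (\<bar>l\<bar> - sgn n * l) * cnj (c n l) * c n l" for l
  proof -
   have 1: "cnj (c n l) * c n l = of_real ((cmod (c n l))\<^sup>2)" using complex_norm_square[of "c n l"] by (simp add: mult.commute)
   have 2: "\<bar>l\<bar> - sgn n * l = (if n * l < 0 then 2 * \<bar>l\<bar> else 0)"
    using n by (auto simp: sgn_if mult_less_0_iff)
   have 3: "hh (n, l) = of_int (if n * l < 0 then 2 * \<bar>l\<bar> else 0) * (cmod (c n l))\<^sup>2" by (simp add: hh_def)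
   show ?thesis unfolding 3 2 mult.assoc 1 of_real_mult of_real_of_int_eq ..
  qed
  ultimately have "((%l. of_int (\<bar>l\<bar> - sgn n * l) * cnj (c n l) * c n l) has_sum of_real (ISUM l. hh (n, l))) UNIV" by simp
  thus ?thesis unfolding r_def by (simp add: infsumI)
 qed
 hence "(\<Sum>\<^sub>\<infinity>n\<in>{n. n \<noteq> 0}. Re (r n n)) = (\<Sum>\<^sub>\<infinity>n\<in>{n. n \<noteq> 0}. ISUM l. hh (n, l))" by (intro infsum_cong) simp
 also have "... = (ISUM n. ISUM l. hh (n, l))" by (rule infsum_cong_neutral) (auto simp: hh_def)
 also have "... = (ISUM p. hh p)" using infsum_Sigma'_banach[OF s'] by simp
 finally show "(\<Sum>\<^sub>\<infinity>n\<in>{n. n \<noteq> 0}. Re (r n n)) = (ISUM p. hh p)" .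
qed

lemma W_window: "W n l = (\<Sum>k\<in>{l - int N..l + int N}. of_int (sgn (l - k)) * bc (l - k) * (of_int k * c n k))"
 unfolding W_def by (rule sum.reindex_bij_witness[of _ "%k. l - k" "%j. l - j"]) auto

definition fx :: "int => int => int => real" where
 "fx n l k = 4 * of_int \<bar>l\<bar> * Re (cnj (c n l) * (of_int (sgn (l - k)) * bc (l - k) * (of_int k * c n k)))"

text \<open>The triple sum is split by the side of k: here k lies on the side of l, in
  \<open>fB\<close> on the side of n.\<close>

definition fA :: "int => int => int => real" where "fA n l k = (if n * l < 0 \<and> n * k < 0 then fx n l k else 0)"
definition fB :: "int => int => int => real" where "fB n l k = (if n * l < 0 \<and> n * k > 0 then fx n l k else 0)"

definition zz :: "int => int => int => real" where "zz n l k = Re (bc (l - k) * (c n k * cnj (c n l)))"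

lemma zz_sym: "zz n k l = zz n l k"
proof -
 have "cnj (bc (k - l) * (c n l * cnj (c n k))) = bc (l - k) * (c n k * cnj (c n l))"
  using bc_cnj[of "k - l"] by (simp add: mult_ac)
 from this[symmetric] show ?thesis unfolding zz_def by (simp only: cnj.simps)
qed

lemma fx_zz: "fx n l k = 4 * of_int \<bar>l\<bar> * (of_int (sgn (l - k)) * of_int k) * zz n l k"
proof -
 have "cnj (c n l) * (of_int (sgn (l - k)) * bc (l - k) * (of_int k * c n k)) = of_real (of_int (sgn (l - k)) * of_int k) * (bc (l - k) * (c n k * cnj (c n l)))"
  by (simp add: mult_ac)
 moreover have "Re (of_real u * z) = u * Re z" for u z by simp
 ultimately show ?thesis unfolding fx_def zz_def by (simp only: mult.assoc)
qed

lemma fx_le: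
 assumes M: "!!k. cmod (bc k) <= M"
 shows "\<bar>fx n l k\<bar> <= 4 * M * (\<bar>of_int l\<bar> * cmod (c n l)) * (\<bar>of_int k\<bar> * cmod (c n k))"
proof -
 have "\<bar>zz n l k\<bar> <= M * (cmod (c n k) * cmod (c n l))"
  unfolding zz_def by (rule order_trans[OF abs_Re_le_cmod]) (simp add: norm_mult mult_right_mono M)
 hence "(4 * \<bar>of_int l\<bar> * \<bar>of_int k\<bar>) * \<bar>zz n l k\<bar> <= (4 * \<bar>of_int l\<bar> * \<bar>of_int k\<bar>) * (M * (cmod (c n k) * cmod (c n l)))"
  by (rule mult_left_mono) auto
 moreover have "\<bar>fx n l k\<bar> <= (4 * \<bar>of_int l\<bar> * \<bar>of_int k\<bar>) * \<bar>zz n l k\<bar>"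
  unfolding fx_zz abs_mult by (intro mult_right_mono) (auto simp: sgn_if)
 ultimately show ?thesis by (simp add: mult_ac)
qed

lemma fx_band: "\<bar>l - k\<bar> > int N ==> fx n l k = 0" by (simp add: fx_def band)

lemma hd1_split: "hd1 (n, l) = (\<Sum>k\<in>{l - int N..l + int N}. fA n l k) + (\<Sum>k\<in>{l - int N..l + int N}. fB n l k)"
proof (cases "n * l < 0")
 case True
 have "fx n l k = fA n l k + fB n l k" for k
  using True by (auto simp: fA_def fB_def fx_def not_less le_less)
 moreover have "hd1 (n, l) = (\<Sum>k\<in>{l - int N..l + int N}. fx n l k)"
  using True unfolding hd1_def W_window fx_def sum_distrib_left Re_sum by simp
 ultimately show ?thesis by (simp add: sum.distrib)
qed (simp add: hd1_def fA_def fB_def)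

text \<open>For l and k of the same sign the coefficient |l| k is symmetric while sgn (l - k) is
  antisymmetric; the absolutely convergent sum equals its own negative.\<close>

lemma fA_sum: "(ISUM l. \<Sum>k\<in>{l - int N..l + int N}. fA n l k) = 0"
proof -
 obtain \<delta> M where "trig_fam {()} N \<delta> M (%_. bc) (%_. b) (%_. \<phi>)" by (rule fam_exists)
 from trig_fam.bc_bound[OF this] have M: "!!k. cmod (bc k) <= M" by simp
 have M0: "M >= 0" using order_trans[OF norm_ge_zero M] .
 have e: "(\<Sum>k\<in>{l - int N..l + int N}. fA n l k) = (ISUM k. fA n l k)" for l
  by (rule infsumI[symmetric], rule has_sum_finite_neutralI) (auto simp: fA_def fx_band)
 have anti: "fA n k l = - fA n l k" for k l
 proof (cases "n * l < 0 \<and> n * k < 0")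
  case True
  have sg: "sgn (k - l) = - sgn (l - k)" by (simp add: sgn_if)
  have lk: "of_int \<bar>l\<bar> * of_int k = (of_int \<bar>k\<bar> * of_int l :: real)" using True by (auto simp: mult_less_0_iff abs_if)
  have 1: "fx n k l = 4 * (of_int \<bar>k\<bar> * of_int l) * of_int (sgn (k - l)) * zz n l k" unfolding fx_zz zz_sym[of n k l] by simp
  have 2: "fx n l k = 4 * (of_int \<bar>l\<bar> * of_int k) * of_int (sgn (l - k)) * zz n l k" unfolding fx_zz by simp
  show ?thesis using True unfolding fA_def 1 2 sg lk by simp
 qed (auto simp: fA_def)
 define g where "g l = \<bar>real_of_int l\<bar> * cmod (c n l)" for l
 have gs: "g summable_on UNIV" unfolding g_def by (rule c_abs_summable)
 have "(%(l, k). (4 * M * g l) * g k) summable_on UNIV"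
  by (intro summable_product summable_on_cmult_right gs) (auto simp: g_def M0)
 note gg = this
 have sm: "(%(l, k). fA n l k) summable_on UNIV"
 proof (rule abs_summable_summable, rule abs_summable_dominated[OF gg])
  fix p :: "int \<times> int"
  obtain l k where p: "p = (l, k)" by force
  have "\<bar>fA n l k\<bar> <= \<bar>fx n l k\<bar>" by (simp add: fA_def)
  thus "norm (case p of (l, k) => fA n l k) <= (case p of (l, k) => 4 * M * g l * g k)"
   using fx_le[OF M, of n l k] unfolding p g_def prod.case real_norm_def by linarith
 qed
 let ?S = "ISUM l. ISUM k. fA n l k"
 have "?S = (ISUM k. ISUM l. fA n l k)" by (rule infsum_swap_banach) (use sm in simp)
 also have "... = (ISUM k. ISUM l. - fA n k l)" by (intro infsum_cong) (rule anti)
 also have "... = - ?S" unfolding infsum_uminus ..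
 finally show ?thesis unfolding e by simp
qed

definition vv :: "int => int => int => real" where "vv n l k = - 4 * of_int \<bar>l * k\<bar> * zz n l k"

lemma vv_sym: "vv n k l = vv n l k" by (simp add: vv_def zz_sym[of n k l] mult.commute[of k l])

lemma fB_vv: assumes "n * l < 0" "n * k > 0" shows "fB n l k = vv n l k"
proof -
 have "of_int (sgn (l - k)) * of_int k = (- of_int \<bar>k\<bar> :: real)" using assms by (auto simp: mult_less_0_iff zero_less_mult_iff sgn_if)
 thus ?thesis using assms by (simp add: fB_def fx_zz vv_def abs_mult)
qed

text \<open>Opposite signs and bandwidth N leave a finite box of pairs. By the symmetry of
  \<open>vv\<close>, positive and negative n give the same expression, which prepares the sum over
  n.\<close>

lemma fB_sum: "(ISUM l. \<Sum>k\<in>{l - int N..l + int N}. fB n l k) = (\<Sum>l\<in>{- int N..-1}. \<Sum>k\<in>{1..int N}. vv n l k)"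
proof -
 have band_vv: "vv n l k = 0" if "\<bar>l - k\<bar> > int N" for l k using that by (simp add: vv_def zz_def band)
 have "n > 0 \<or> n < 0 \<or> n = 0" by linarith
 thus ?thesis
 proof (elim disjE)
  assume n: "n > 0"
  have i: "(\<Sum>k\<in>{l - int N..l + int N}. fB n l k) = (if l < 0 then \<Sum>k\<in>{1..int N}. vv n l k else 0)" for l
  proof (cases "l < 0")
   case True
   have "(\<Sum>k\<in>{l - int N..l + int N}. fB n l k) = (\<Sum>k\<in>{l - int N..l + int N} \<inter> {1..int N}. fB n l k)"
    using True n by (intro sum.mono_neutral_right) (auto simp: fB_def zero_less_mult_iff)
   also have "... = (\<Sum>k\<in>{1..int N}. vv n l k)"
    using True n by (intro sum.mono_neutral_cong_left) (auto simp: fB_vv mult_less_0_iff zero_less_mult_iff intro!: band_vv)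
   finally show ?thesis using True by simp
  qed (use n in \<open>auto simp: fB_def mult_less_0_iff\<close>)
  show ?thesis unfolding i
   by (rule infsumI, rule has_sum_finite_neutralI[of "{- int N..-1}"]) (auto intro!: sum.neutral band_vv sum.cong)
 next
  assume n: "n < 0"
  have i: "(\<Sum>k\<in>{l - int N..l + int N}. fB n l k) = (if l > 0 then \<Sum>k\<in>{- int N..-1}. vv n l k else 0)" for l
  proof (cases "l > 0")
   case True
   have "(\<Sum>k\<in>{l - int N..l + int N}. fB n l k) = (\<Sum>k\<in>{l - int N..l + int N} \<inter> {- int N..-1}. fB n l k)"
    using True n by (intro sum.mono_neutral_right) (auto simp: fB_def zero_less_mult_iff)
   also have "... = (\<Sum>k\<in>{- int N..-1}. vv n l k)"
    using True n by (intro sum.mono_neutral_cong_left) (auto simp: fB_vv mult_less_0_iff zero_less_mult_iff intro!: band_vv)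
   finally show ?thesis using True by simp
  qed (use n in \<open>auto simp: fB_def mult_less_0_iff\<close>)
  have "(ISUM l. if l > 0 then \<Sum>k\<in>{- int N..-1}. vv n l k else 0) = (\<Sum>l\<in>{1..int N}. \<Sum>k\<in>{- int N..-1}. vv n l k)"
   by (rule infsumI, rule has_sum_finite_neutralI[of "{1..int N}"]) (auto intro!: sum.neutral band_vv sum.cong)
  also have "... = (\<Sum>l\<in>{- int N..-1}. \<Sum>k\<in>{1..int N}. vv n l k)" by (subst sum.swap) (simp add: vv_sym)
  finally show ?thesis unfolding i .
 next
  assume "n = 0"
  thus ?thesis by (auto simp: fB_def vv_def zz_def c_0 intro!: sum.neutral)
 qed
qed

text \<open>The part \<open>fA\<close> cancels. In \<open>fB\<close> the sum over n is done last,
  where completeness replaces the products of the \<open>c\<close> by coefficients of b and leaves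
  -4 |l k| |bc (l - k)|^2.\<close>

theorem flux_nonpos: "(ISUM p. hd1 p) <= 0"
proof -
 obtain \<delta> M where "trig_fam {()} N \<delta> M (%_. bc) (%_. b) (%_. \<phi>)" by (rule fam_exists)
 from trig_fam.bc_bound[OF this] have M: "!!k. cmod (bc k) <= M" by simp
 have M0: "M >= 0" using order_trans[OF norm_ge_zero M] .
 obtain C where C: "C >= 0" "!!n l. n * l <= 0 ==> br n ^ 4 * br l ^ 4 * cmod (c n l) <= C" using c_cross[where K=4] by blast
 define D where "D = 4 * M * C * (1 + real N)"
 have fxb: "\<bar>fx n l k\<bar> <= D * (1 / (br n ^ 2 * br l ^ 2))" if nl: "n * l < 0" and k: "k \<in> {l - int N..l + int N}" for n l k
 proof -
  have "\<bar>real_of_int k\<bar> <= \<bar>real_of_int l\<bar> + real N" using k by auto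
  also have "... <= (1 + real N) * br l" by (simp add: br_def algebra_simps)
  finally have kb: "\<bar>real_of_int k\<bar> * cmod (c n k) <= (1 + real N) * br l * 1"
   by (intro mult_mono norm_c_le_1) (auto simp: less_imp_le)
  have "\<bar>fx n l k\<bar> <= 4 * M * (br l * cmod (c n l)) * ((1 + real N) * br l * 1)"
   by (rule order_trans[OF fx_le[OF M]]) (intro mult_mono kb br_abs_le mult_nonneg_nonneg, auto simp: M0 less_imp_le)
  hence "(br n ^ 2 * br l ^ 2) * \<bar>fx n l k\<bar> <= (br n ^ 4 * br l ^ 2) * (4 * M * (br l * cmod (c n l)) * ((1 + real N) * br l * 1))"
   by (intro mult_mono power_increasing br_ge1) (auto simp: less_imp_le M0)
  also have "... = 4 * M * (1 + real N) * (br n ^ 4 * br l ^ 4 * cmod (c n l))" by (simp add: power_numeral_reduce mult_ac)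
  also have "... <= 4 * M * (1 + real N) * C" using C(2)[of n l] nl M0 by (intro mult_left_mono) auto
  finally show ?thesis by (simp add: D_def field_simps)
 qed
 have D0: "D >= 0" using M0 C by (simp add: D_def)
 have b: "\<bar>\<Sum>k\<in>{l - int N..l + int N}. g n l k\<bar> <= (real (2 * N + 1) * D) * (1 / (br n ^ 2 * br l ^ 2))"
  if g: "!!k. g n l k = 0 \<or> n * l < 0 \<and> g n l k = fx n l k" for g n l
 proof -
  have "\<bar>\<Sum>k\<in>{l - int N..l + int N}. g n l k\<bar> <= (\<Sum>k\<in>{l - int N..l + int N}. D * (1 / (br n ^ 2 * br l ^ 2)))"
  proof (rule order_trans[OF sum_abs sum_mono])
   fix k assume "k \<in> {l - int N..l + int N}"
   thus "\<bar>g n l k\<bar> <= D * (1 / (br n ^ 2 * br l ^ 2))" using g[of k] fxb[of n l k] D0 by (auto simp: less_imp_le)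
  qed
  thus ?thesis by (simp add: algebra_simps)
 qed
 have sA: "(%p. \<Sum>k\<in>{snd p - int N..snd p + int N}. fA (fst p) (snd p) k) summable_on UNIV"
  by (rule pair_summable, unfold fst_conv snd_conv, rule b) (simp add: fA_def)
 have sB: "(%p. \<Sum>k\<in>{snd p - int N..snd p + int N}. fB (fst p) (snd p) k) summable_on UNIV"
  by (rule pair_summable, unfold fst_conv snd_conv, rule b) (simp add: fB_def)
 have A: "(ISUM p. \<Sum>k\<in>{snd p - int N..snd p + int N}. fA (fst p) (snd p) k) = 0"
  using infsum_Sigma'_banach[of "%n l. \<Sum>k\<in>{l - int N..l + int N}. fA n l k" UNIV "%_. UNIV"] sA unfolding split_def by (simp add: fA_sum)
 have B: "(ISUM p. \<Sum>k\<in>{snd p - int N..snd p + int N}. fB (fst p) (snd p) k) = (ISUM n. \<Sum>l\<in>{- int N..-1}. \<Sum>k\<in>{1..int N}. vv n l k)"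
  using infsum_Sigma'_banach[of "%n l. \<Sum>k\<in>{l - int N..l + int N}. fB n l k" UNIV "%_. UNIV"] sB unfolding split_def by (simp add: fB_sum)
 have v: "((%n. vv n l k) has_sum (- 4 * of_int \<bar>l * k\<bar> * (cmod (bc (l - k)))\<^sup>2)) UNIV" for l k
 proof -
  have "((%n. - 4 * of_int \<bar>l * k\<bar> * Re (bc (l - k) * (c n k * cnj (c n l)))) has_sum (- 4 * of_int \<bar>l * k\<bar> * Re (bc (l - k) * bc (k - l)))) UNIV"
   by (rule has_sum_cmult_right[OF has_sum_Re[OF has_sum_cmult_right[OF c_completeness]]])
  moreover have "Re (bc (l - k) * bc (k - l)) = (cmod (bc (l - k)))\<^sup>2"
   using bc_cnj[of "l - k"] complex_norm_square[of "bc (l - k)"] by (metis minus_diff_eq Re_complex_of_real)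
  ultimately show ?thesis by (simp only: vv_def zz_def)
 qed
 have "((%n. \<Sum>l\<in>{- int N..-1}. \<Sum>k\<in>{1..int N}. vv n l k) has_sum (\<Sum>l\<in>{- int N..-1}. \<Sum>k\<in>{1..int N}. - 4 * of_int \<bar>l * k\<bar> * (cmod (bc (l - k)))\<^sup>2)) UNIV"
  by (intro has_sum_sum_real v) auto
 hence B': "(ISUM n. \<Sum>l\<in>{- int N..-1}. \<Sum>k\<in>{1..int N}. vv n l k) <= 0"
  by (simp only: infsumI) (intro sum_nonpos, simp)
 have "hd1 = (%p. (\<Sum>k\<in>{snd p - int N..snd p + int N}. fA (fst p) (snd p) k) + (\<Sum>k\<in>{snd p - int N..snd p + int N}. fB (fst p) (snd p) k))"
  using hd1_split by auto
 hence "(ISUM p. hd1 p) = (ISUM p. \<Sum>k\<in>{snd p - int N..snd p + int N}. fA (fst p) (snd p) k) + (ISUM p. \<Sum>k\<in>{snd p - int N..snd p + int N}. fB (fst p) (snd p) k)"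
  using infsum_add[OF sA sB] by simp
 thus ?thesis using A B B' by simp
qed

end

section \<open>Transport of 1/alpha and of its primitive\<close>

section \<open>Evolution of the change of variables\<close>

text \<open>An integral over an empty interval is 0, so the two terms take turns for t >= 0 and t <
  0.\<close>

lemma antiderivative_real:
 fixes f :: "real => real"
 assumes f: "continuous_on UNIV f"
 shows "((%t. integral {0..t} f - integral {t..0} f) has_real_derivative f t) (at t)"
proof -
 define R where "R = \<bar>t\<bar> + 1"
 have R: "t \<in> {-R<..<R}" "R > 0" by (auto simp: R_def)
 have i: "f integrable_on {u..v}" for u v by (rule integrable_continuous_real[OF continuous_on_subset[OF f]]) simp
 have e: "integral {-R..s} f - integral {-R..0} f = integral {0..s} f - integral {s..0} f" if "s \<in> {-R<..<R}" for s
 proof (cases "s >= 0")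
  case True
  thus ?thesis using Henstock_Kurzweil_Integration.integral_combine[of "-R" 0 s f] i R by (cases "s = 0") auto
 next
  case False
  thus ?thesis using Henstock_Kurzweil_Integration.integral_combine[of "-R" s 0 f] i that by auto
 qed
 have "((%s. integral {-R..s} f) has_real_derivative f t) (at t within {-R..R})"
  by (rule integral_has_real_derivative) (use R continuous_on_subset[OF f] in auto)
 hence "((%s. integral {-R..s} f) has_real_derivative f t) (at t)"
  using at_within_interior[of t "{-R..R}"] R by simp
 from DERIV_diff[OF this DERIV_const[of "integral {-R..0} f"]]
 have "((%s. integral {-R..s} f - integral {-R..0} f) has_real_derivative f t) (at t)" by simp
 thus ?thesis by (rule has_field_derivative_transform_within_open[where S="{-R<..<R}"]) (use R e in auto)
qed

context flow_line
begin

text \<open>The flux beta/alpha of the conservation law: its theta-derivative \<open>q1\<close> is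
  also the time derivative of 1/alpha.\<close>

definition q where "q \<tau> t = rp N (%j. - \<i> * of_int (sgn j) * x \<tau> j) t / rp N (x \<tau>) t"
definition q1 where "q1 \<tau> t = - rp N (fl N (x \<tau>)) t / (rp N (x \<tau>) t)\<^sup>2"
definition ph where "ph \<tau> t = integral {0..t} (%s. 1 / rp N (x \<tau>) s) - integral {t..0} (%s. 1 / rp N (x \<tau>) s)"

lemma xc: "continuous_on {0..} (%\<tau>. x \<tau> k)"
 by (rule continuous_on_vector_derivative[OF vd]) simp

lemma flc: "continuous_on {0..} (%\<tau>. fl N (x \<tau>) k)"
 unfolding fl_def by (intro continuous_intros xc)

lemma al_nz: "\<tau> >= 0 ==> rp N (x \<tau>) t \<noteq> 0" using pos[of \<tau> t] by simp

lemma q_theta: assumes "\<tau> >= 0" shows "(q \<tau> has_real_derivative q1 \<tau> t) (at t within S)"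
proof -
 interpret c: coeffs N "x \<tau>" by (rule co[OF assms])
 from DERIV_divide[OF c.be_deriv rp_deriv al_nz[OF assms], of t S] show ?thesis
  unfolding q_def[abs_def] q1_def c.rp_fl c.be_def power2_eq_square by (simp add: algebra_simps)
qed

lemma inv_tau: assumes "\<tau> >= 0" shows "((%\<tau>. 1 / rp N (x \<tau>) t) has_real_derivative q1 \<tau> t) (at \<tau> within {0..})"
proof -
 have "((%\<tau>. rp N (x \<tau>) t) has_real_derivative rp N (fl N (x \<tau>)) t) (at \<tau> within {0..})"
  by (rule rp_tau) (rule vd[OF assms])
 from DERIV_divide[OF DERIV_const[of 1] this al_nz[OF assms]] show ?thesis
  unfolding q1_def power2_eq_square by simp
qed

lemma joint: "continuous_on ({0..} \<times> A) (%p. rp N (x (fst p)) (snd p))"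
 "continuous_on ({0..} \<times> A) (%p. q1 (fst p) (snd p))" "continuous_on ({0..} \<times> A) (%p. q (fst p) (snd p))"
 unfolding q1_def q_def by (auto intro!: continuous_intros rp_joint xc flc simp: al_nz)

lemma inv_cont: "\<tau> >= 0 ==> continuous_on S (%t. 1 / rp N (x \<tau>) t)"
 by (intro continuous_intros rp_cont) (auto simp: al_nz)

lemma int_tau:
 assumes \<tau>: "\<tau> >= 0" and t: "t >= 0"
 shows "((%\<tau>. integral {0..t} (%s. 1 / rp N (x \<tau>) s)) has_real_derivative q \<tau> t - q \<tau> 0) (at \<tau> within {0..})"
proof -
 have "((%\<tau>. integral (cbox 0 t) (%s. 1 / rp N (x \<tau>) s)) has_real_derivative integral (cbox 0 t) (q1 \<tau>)) (at \<tau> within {0..})"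
 proof (rule leibniz_rule_field_derivative)
  show "continuous_on ({0..} \<times> cbox 0 t) (%(\<tau>, s). q1 \<tau> s)" unfolding split_def by (rule joint)
  show "(%s. 1 / rp N (x \<sigma>) s) integrable_on cbox 0 t" if "\<sigma> \<in> {0..}" for \<sigma>
   using that by (intro integrable_continuous inv_cont) auto
 qed (use \<tau> inv_tau in auto)
 moreover have "(q1 \<tau> has_integral q \<tau> t - q \<tau> 0) {0..t}"
  by (rule fundamental_theorem_of_calculus[OF t]) (use q_theta[OF \<tau>] in \<open>simp add: has_real_derivative_iff_has_vector_derivative\<close>)
 ultimately show ?thesis by (simp add: integral_unique)
qed

lemma q_per: "q \<tau> (t + 2 * pi) = q \<tau> t" unfolding q_def rp_def tp_period ..

text \<open>The time derivative is the increment of the periodic flux over one period, hence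
  0.\<close>

lemma vol: assumes "\<tau> >= 0" shows "integral {0..2*pi} (%s. 1 / rp N (x \<tau>) s) = 2 * pi"
proof -
 have z: "q \<sigma> (2 * pi) - q \<sigma> 0 = 0" for \<sigma> using q_per[of \<sigma> 0] by simp
 have "\<exists>c. \<forall>\<sigma>\<in>{0..}. integral {0..2*pi} (%s. 1 / rp N (x \<sigma>) s) = c"
 proof (rule has_field_derivative_zero_constant)
  show "((%\<sigma>. integral {0..2*pi} (%s. 1 / rp N (x \<sigma>) s)) has_real_derivative 0) (at \<sigma> within {0..})" if "\<sigma> \<in> {0..}" for \<sigma>
   using int_tau[of \<sigma> "2 * pi"] that unfolding z by simp
 qed simp
 thus ?thesis using vol0 assms by (metis atLeast_iff order_refl)
qed

lemma ph_d: "\<tau> >= 0 ==> (ph \<tau> has_real_derivative 1 / rp N (x \<tau>) t) (at t)"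
 unfolding ph_def[abs_def] by (rule antiderivative_real[OF inv_cont])

lemma ph_0: "ph \<tau> 0 = 0" by (simp add: ph_def)

lemma al_per: "rp N c (t + 2 * pi) = rp N c t" by (simp add: rp_def tp_period)

lemma ph_p: assumes \<tau>: "\<tau> >= 0" shows "ph \<tau> (t + 2 * pi) = ph \<tau> t + 2 * pi"
proof -
 have "((%t. ph \<tau> (t + 2 * pi) - ph \<tau> t) has_real_derivative 0) (at t)" for t
 proof -
  have "((%t. ph \<tau> (t + 2 * pi)) has_real_derivative 1 / rp N (x \<tau>) t) (at t)"
   using ph_d[OF \<tau>, of "t + 2 * pi"] unfolding al_per by (simp add: DERIV_shift)
  from DERIV_diff[OF this ph_d[OF \<tau>]] show ?thesis by simp
 qed
 hence "ph \<tau> (t + 2 * pi) - ph \<tau> t = ph \<tau> (0 + 2 * pi) - ph \<tau> 0" by (intro DERIV_isconst_all) auto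
 also have "... = 2 * pi" using vol[OF \<tau>] by (simp add: ph_def)
 finally show ?thesis by simp
qed

lemma trig: assumes \<tau>: "\<tau> >= 0" shows "trig1 N (x \<tau>) (rp N (x \<tau>)) (ph \<tau>)"
proof -
 interpret c: coeffs N "x \<tau>" by (rule co[OF \<tau>])
 show ?thesis by unfold_locales (auto simp: c.aband c.a_real pos \<tau> ph_p intro!: ph_d)
qed

text \<open>Rescaling the primitive to the fixed interval 0..1 reduces joint continuity to that of a
  parameter integral.\<close>

lemma ph_joint: "continuous_on ({0..} \<times> A) (%p. ph (fst p) (snd p))"
proof -
 have e: "ph \<tau> t = integral {0..1} (%s. t * (1 / rp N (x \<tau>) (t * s)))" if \<tau>: "\<tau> >= 0" for \<tau> t
 proof -
  have "((%s. ph \<tau> (t * s)) has_vd t * (1 / rp N (x \<tau>) (t * s))) (at s within {0..1})" for s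
   unfolding has_real_derivative_iff_has_vector_derivative[symmetric]
   using DERIV_chain2[OF ph_d[OF \<tau>, of "t * s"] DERIV_cmult_Id[of t s "{0..1}"]] by (simp add: mult.commute)
  hence "((%s. t * (1 / rp N (x \<tau>) (t * s))) has_integral ph \<tau> (t * 1) - ph \<tau> (t * 0)) {0..1}"
   by (intro fundamental_theorem_of_calculus) auto
  thus ?thesis by (simp add: integral_unique ph_0)
 qed
 have c: "continuous_on (({0..} \<times> A) \<times> cbox 0 1) (%z. snd (fst z) * (1 / rp N (x (fst (fst z))) (snd (fst z) * snd z)))"
 proof (intro continuous_intros)
  have "continuous_on (({0..} \<times> A) \<times> cbox (0::real) 1) (%z. (fst (fst z), snd (fst z) * snd z))" by (intro continuous_intros)
  moreover have "(%z. (fst (fst z), snd (fst z) * snd z)) ` (({0..} \<times> A) \<times> cbox (0::real) 1) \<subseteq> {0..} \<times> UNIV" by auto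
  ultimately show "continuous_on (({0..} \<times> A) \<times> cbox 0 1) (%z. rp N (x (fst (fst z))) (snd (fst z) * snd z))"
   using continuous_on_compose2[OF joint(1)[of UNIV]] by fastforce
  show "\<forall>z\<in>({0..} \<times> A) \<times> cbox 0 1. rp N (x (fst (fst z))) (snd (fst z) * snd z) \<noteq> 0" by (auto simp: al_nz)
 qed
 have "continuous_on ({0..} \<times> A) (%p. integral (cbox 0 1) (%s. snd p * (1 / rp N (x (fst p)) (snd p * s))))"
  by (rule integral_continuous_on_param) (use c in \<open>simp add: split_def\<close>)
 thus ?thesis by (rule continuous_on_cong[THEN iffD1, OF refl, rotated]) (auto simp: e)
qed

abbreviation C where "C \<tau> \<equiv> trig1.c (ph \<tau>)"

text \<open>The primitive based at 0 has time derivative q \<tau> t - q \<tau> 0. The first part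
  times i n En is beta times the theta-derivative of En, a finite convolution with sgn j x j; the
  second part only rotates the phase.\<close>

lemma C_tau:
 assumes \<tau>: "\<tau> >= 0"
 shows "((%\<tau>. C \<tau> n l) has_vd trig1.W N (x \<tau>) (ph \<tau>) n l - \<i> * of_int n * of_real (q \<tau> 0) * C \<tau> n l) (at \<tau> within {0..})"
proof -
 define E where "E \<sigma> t = cis (of_int n * ph \<sigma> t)" for \<sigma> t
 define E1 where "E1 \<sigma> t = \<i> * of_real (of_int n * (q \<sigma> t - q \<sigma> 0)) * E \<sigma> t * cis (- (of_int l * t))" for \<sigma> t
 have Ce: "C \<sigma> n l = integral (cbox 0 (2*pi)) (%t. E \<sigma> t * cis (- (of_int l * t))) / of_real (2 * pi)" if "\<sigma> >= 0" for \<sigma>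
  unfolding trig1.c_def[OF trig[OF that]] trig1.En_def[OF trig[OF that], abs_def] fourier_cis E_def by simp
 have Ec: "continuous_on ({0..} \<times> A) (%p. E (fst p) (snd p))" for A
  unfolding E_def by (intro continuous_intros ph_joint)
 have L: "((%\<sigma>. integral (cbox 0 (2*pi)) (%t. E \<sigma> t * cis (- (of_int l * t)))) has_vd integral (cbox 0 (2*pi)) (E1 \<tau>)) (at \<tau> within {0..})"
 proof (rule leibniz_rule_vector_derivative)
  fix \<sigma> t :: real assume s: "\<sigma> \<in> {0..}" and t: "t \<in> cbox 0 (2*pi)"
  have "ph \<sigma> t = integral {0..t} (%s. 1 / rp N (x \<sigma>) s)" for \<sigma> using t by (cases "t = 0") (auto simp: ph_def)
  hence "((%\<sigma>. ph \<sigma> t) has_real_derivative q \<sigma> t - q \<sigma> 0) (at \<sigma> within {0..})" using int_tau[of \<sigma> t] s t by simp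
  hence "((%\<sigma>. E \<sigma> t) has_vd \<i> * of_real (of_int n * (q \<sigma> t - q \<sigma> 0)) * E \<sigma> t) (at \<sigma> within {0..})"
   unfolding E_def using has_vector_derivative_cis[of "%\<sigma>. ph \<sigma> t" "q \<sigma> t - q \<sigma> 0" \<sigma> "{0..}" "of_int n"] by (simp add: mult_ac)
  from has_vector_derivative_mult_left[OF this] show "((%\<sigma>. E \<sigma> t * cis (- (of_int l * t))) has_vd E1 \<sigma> t) (at \<sigma> within {0..})"
   unfolding E1_def .
 next
  show "(%t. E \<sigma> t * cis (- (of_int l * t))) integrable_on cbox 0 (2*pi)" if "\<sigma> \<in> {0..}" for \<sigma>
  proof -
   have "continuous_on (cbox 0 (2*pi)) (E \<sigma>)"
    using continuous_on_compose2[OF Ec[of UNIV] continuous_on_Pair[OF continuous_on_const[of _ \<sigma>] continuous_on_id[of "cbox 0 (2*pi)"]]] that by auto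
   thus ?thesis by (intro integrable_continuous continuous_intros)
  qed
  have q0: "continuous_on ({0..} \<times> cbox 0 (2*pi)) (%p. q (fst p) 0)"
  proof -
   have "(%p. (fst p, 0)) ` ({0..} \<times> cbox 0 (2*pi)) \<subseteq> {0..} \<times> (UNIV :: real set)" by auto
   from continuous_on_compose2[OF joint(3)[of UNIV] continuous_on_Pair[OF continuous_on_fst[OF continuous_on_id] continuous_on_const] this]
   show ?thesis by simp
  qed
  show "continuous_on ({0..} \<times> cbox 0 (2*pi)) (%(\<sigma>, t). E1 \<sigma> t)"
   unfolding E1_def split_def by (intro continuous_intros Ec joint q0)
 qed (use \<tau> in auto)
 interpret g: trig1 N "x \<tau>" "rp N (x \<tau>)" "ph \<tau>" by (rule trig[OF \<tau>])
 have ev: "integral (cbox 0 (2*pi)) (E1 \<tau>) / of_real (2 * pi) = g.W n l - \<i> * of_int n * of_real (q \<tau> 0) * g.c n l"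
 proof -
  define u where "u t = \<i> * of_int n * (1 / of_real (rp N (x \<tau>) t)) * g.En n t" for t
  have uc: "continuous_on S u" for S unfolding u_def by (intro continuous_intros rp_cont) (auto simp: al_nz \<tau>)
  have fu: "fourier u m = \<i> * of_int m * g.c n m" for m unfolding u_def by (rule g.fourier_En_deriv)
  have b: "complex_of_real (rp N (%j. - \<i> * of_int (sgn j) * x \<tau> j) t) = tp N (%j. - \<i> * of_int (sgn j) * x \<tau> j) t" for t
   by (rule tp_real[symmetric]) (simp add: g.co.aherm)
  have "E1 \<tau> t = ((\<Sum>j\<in>{- int N..int N}. (- \<i> * of_int (sgn j) * x \<tau> j) * (cis (of_int j * t) * u t)) - \<i> * of_int n * of_real (q \<tau> 0) * g.En n t) * cis (- (of_int l * t))" for t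
  proof -
   have "of_real (q \<tau> t) * (\<i> * of_int n * g.En n t) = of_real (rp N (%j. - \<i> * of_int (sgn j) * x \<tau> j) t) * u t"
    unfolding q_def u_def by (simp add: al_nz \<tau>)
   also have "... = (\<Sum>j\<in>{- int N..int N}. (- \<i> * of_int (sgn j) * x \<tau> j) * (cis (of_int j * t) * u t))"
    unfolding b tp_def by (simp add: sum_distrib_right mult.assoc)
   finally show ?thesis unfolding E1_def E_def g.En_def[symmetric] by (simp add: algebra_simps)
  qed
  hence Ee: "E1 \<tau> = (%t. ((\<Sum>j\<in>{- int N..int N}. (- \<i> * of_int (sgn j) * x \<tau> j) * (cis (of_int j * t) * u t)) - \<i> * of_int n * of_real (q \<tau> 0) * g.En n t) * cis (- (of_int l * t)))"
   by (rule ext)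
  have "integral (cbox 0 (2*pi)) (E1 \<tau>) / of_real (2 * pi)
   = fourier (%t. (\<Sum>j\<in>{- int N..int N}. (- \<i> * of_int (sgn j) * x \<tau> j) * (cis (of_int j * t) * u t)) - \<i> * of_int n * of_real (q \<tau> 0) * g.En n t) l"
   unfolding fourier_cis box_real(2) Ee ..
  also have "... = fourier (%t. \<Sum>j\<in>{- int N..int N}. (- \<i> * of_int (sgn j) * x \<tau> j) * (cis (of_int j * t) * u t)) l - fourier (%t. \<i> * of_int n * of_real (q \<tau> 0) * g.En n t) l"
   unfolding fourier_cis left_diff_distrib
   by (subst integral_diff) (auto intro!: integrable_continuous_real continuous_intros uc simp: diff_divide_distrib)
  also have "fourier (%t. \<i> * of_int n * of_real (q \<tau> 0) * g.En n t) l = \<i> * of_int n * of_real (q \<tau> 0) * g.c n l"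
   unfolding fourier_cmult g.c_def ..
  also have "fourier (%t. \<Sum>j\<in>{- int N..int N}. (- \<i> * of_int (sgn j) * x \<tau> j) * (cis (of_int j * t) * u t)) l = g.W n l"
  proof -
   have i: "(- \<i> * s * y) * (\<i> * m * z) = s * y * (m * z)" for s y m z
   proof -
    have "(- \<i> * s * y) * (\<i> * m * z) = - (\<i> * \<i>) * (s * y * (m * z))" by algebra
    thus ?thesis by simp
   qed
   have "fourier (%t. \<Sum>j\<in>{- int N..int N}. (- \<i> * of_int (sgn j) * x \<tau> j) * (cis (of_int j * t) * u t)) l
    = (\<Sum>j\<in>{- int N..int N}. fourier (%t. (- \<i> * of_int (sgn j) * x \<tau> j) * (cis (of_int j * t) * u t)) l)"
    by (rule fourier_sum) (intro continuous_intros uc)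
   thus ?thesis unfolding g.W_def fourier_cmult fourier_shift fu i .
  qed
  finally show ?thesis .
 qed
 have "((%\<sigma>. integral (cbox 0 (2*pi)) (%t. E \<sigma> t * cis (- (of_int l * t))) * (1 / of_real (2 * pi))) has_vd integral (cbox 0 (2*pi)) (E1 \<tau>) * (1 / of_real (2 * pi))) (at \<tau> within {0..})"
  by (rule has_vector_derivative_mult_left[OF L])
 hence "((%\<sigma>. integral (cbox 0 (2*pi)) (%t. E \<sigma> t * cis (- (of_int l * t))) / of_real (2 * pi)) has_vd integral (cbox 0 (2*pi)) (E1 \<tau>) / of_real (2 * pi)) (at \<tau> within {0..})" by simp
 thus ?thesis unfolding ev[symmetric]
  by (rule has_vector_derivative_transform[rotated 2]) (use \<tau> Ce in auto)
qed

end

section \<open>Integration of the flux and the zeta inequalities\<close>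

section \<open>Monotonicity of the special values\<close>

context flow_line
begin

lemma x0_mono: assumes "\<tau> >= 0" shows "Re (x \<tau> 0) <= Re (x 0 0)"
proof (rule nonincreasing_of_deriv[OF _ _ assms])
 fix s assume s: "s \<in> {0..\<tau>}"
 show "((%s. Re (x s 0)) has_real_derivative Re (fl N (x s) 0)) (at s within {0..\<tau>})"
  unfolding has_real_derivative_iff_has_vector_derivative
  by (rule bounded_linear.has_vector_derivative[OF bounded_linear_Re], rule has_vector_derivative_within_subset[OF vd]) (use s in auto)
 show "Re (fl N (x s) 0) <= 0" using coeffs.fl_zero_le[OF co] s by auto
qed

lemma x_bound: assumes "\<tau> >= 0" shows "cmod (x \<tau> k) <= Re (x 0 0)"
 using coeffs.coeff_le[OF co[OF assms] pos[OF assms], of k] x0_mono[OF assms] by linarith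

text \<open>Compactness of 0..S times one period gives a common positive lower bound, and
  \<open>x_bound\<close> a common coefficient bound, as required for uniform decay.\<close>

lemma family: assumes S: "S >= 0" obtains \<delta> where "trig_fam {0..S} N \<delta> (Re (x 0 0)) x (%\<tau>. rp N (x \<tau>)) ph"
proof -
 let ?K = "{0..S} \<times> {0..2*pi}"
 have "continuous_on ?K (%p. rp N (x (fst p)) (snd p))" by (rule continuous_on_subset[OF joint(1)]) auto
 then obtain p where p: "p \<in> ?K" "!!r. r \<in> ?K ==> rp N (x (fst p)) (snd p) <= rp N (x (fst r)) (snd r)"
  using continuous_attains_inf[of ?K "%p. rp N (x (fst p)) (snd p)"] S by (auto simp: compact_Times)
 have low: "rp N (x (fst p)) (snd p) <= rp N (x \<tau>) t" if "\<tau> \<in> {0..S}" for \<tau> t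
 proof -
  obtain s where s: "s \<in> {0..2*pi}" "!!c. rp N c s = rp N c t" using rp_reduce by metis
  thus ?thesis using p(2)[of "(\<tau>, s)"] that by simp
 qed
 have "trig_fam {0..S} N (rp N (x (fst p)) (snd p)) (Re (x 0 0)) x (%\<tau>. rp N (x \<tau>)) ph"
  by (rule trig_fam.intro) (use p(1) pos trig x_bound low in auto)
 thus thesis by (rule that)
qed

abbreviation hht where "hht \<tau> \<equiv> trig1.hh (ph \<tau>)"
abbreviation hdt where "hdt \<tau> \<equiv> trig1.hd1 N (x \<tau>) (ph \<tau>)"

text \<open>Only |c|^2 enters, so the rotation term of \<open>C_tau\<close> drops out.\<close>

lemma hh_tau: assumes \<tau>: "\<tau> >= 0" shows "((%\<tau>. hht \<tau> (n, l)) has_real_derivative hdt \<tau> (n, l)) (at \<tau> within {0..})"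
proof -
 interpret g: trig1 N "x \<tau>" "rp N (x \<tau>)" "ph \<tau>" by (rule trig[OF \<tau>])
 let ?c' = "g.W n l - \<i> * of_int n * of_real (q \<tau> 0) * g.c n l"
 have "((%\<tau>. C \<tau> n l * cnj (C \<tau> n l)) has_vd g.c n l * cnj ?c' + ?c' * cnj (g.c n l)) (at \<tau> within {0..})"
  by (rule has_vector_derivative_mult[OF C_tau[OF \<tau>] bounded_linear.has_vector_derivative[OF bounded_linear_cnj C_tau[OF \<tau>]]])
 hence "((%\<tau>. Re (C \<tau> n l * cnj (C \<tau> n l))) has_real_derivative Re (g.c n l * cnj ?c' + ?c' * cnj (g.c n l))) (at \<tau> within {0..})"
  unfolding has_real_derivative_iff_has_vector_derivative by (rule bounded_linear.has_vector_derivative[OF bounded_linear_Re])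
 moreover have "Re (c * cnj (w - \<i> * of_int n * of_real r * c) + (w - \<i> * of_int n * of_real r * c) * cnj c) = 2 * Re (cnj c * w)" for c w r
  by (simp add: algebra_simps)
 moreover have "Re (c * cnj c) = (cmod c)\<^sup>2" for c by (simp flip: complex_norm_square)
 ultimately have d: "((%\<tau>. (cmod (C \<tau> n l))\<^sup>2) has_real_derivative 2 * Re (cnj (g.c n l) * g.W n l)) (at \<tau> within {0..})" by simp
 have "((%\<tau>. if n * l < 0 then 2 * of_int \<bar>l\<bar> * (cmod (C \<tau> n l))\<^sup>2 else 0) has_real_derivative hdt \<tau> (n, l)) (at \<tau> within {0..})"
  using DERIV_cmult[OF d, of "2 * of_int \<bar>l\<bar>"] by (simp add: g.hd1_def mult_ac)
 thus ?thesis
  by (rule has_field_derivative_transform_within[OF _ zero_less_one]) (use \<tau> trig1.hh_def[OF trig] in auto)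
qed

lemma hd_cont: "continuous_on {0..} (%\<tau>. hdt \<tau> (n, l))"
proof -
 have Cc: "continuous_on {0..} (%\<tau>. C \<tau> n l)" for n l by (rule continuous_on_vector_derivative[OF C_tau]) simp
 have "continuous_on {0..} (%\<tau>. 4 * of_int \<bar>l\<bar> * Re (cnj (C \<tau> n l) * (\<Sum>j\<in>{- int N..int N}. of_int (sgn j) * x \<tau> j * (of_int (l - j) * C \<tau> n (l - j)))))"
  by (intro continuous_intros Cc xc)
 hence "continuous_on {0..} (%\<tau>. if n * l < 0 then 4 * of_int \<bar>l\<bar> * Re (cnj (C \<tau> n l) * (\<Sum>j\<in>{- int N..int N}. of_int (sgn j) * x \<tau> j * (of_int (l - j) * C \<tau> n (l - j)))) else 0)"
  by (cases "n * l < 0") (simp_all only: if_True if_False continuous_on_const)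
 thus ?thesis
  by (rule continuous_on_cong[THEN iffD1, OF refl, rotated]) (simp add: trig1.hd1_def[OF trig] trig1.W_def[OF trig])
qed

lemma hd_bound:
 assumes S: "S >= 0"
 obtains D where "!!\<tau> n l. \<tau> \<in> {0..S} ==> \<bar>hdt \<tau> (n, l)\<bar> <= D * (1 / (br n ^ 2 * br l ^ 2))"
proof -
 obtain \<delta> where "trig_fam {0..S} N \<delta> (Re (x 0 0)) x (%\<tau>. rp N (x \<tau>)) ph" by (rule family[OF S])
 then interpret f: trig_fam "{0..S}" N \<delta> "Re (x 0 0)" x "%\<tau>. rp N (x \<tau>)" ph .
 obtain B where B: "B >= 0" "!!\<tau> n l. \<tau> \<in> {0..S} ==> n * l <= 0 ==> br n ^ 4 * br l ^ 4 * cmod (C \<tau> n l) <= B"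
  using f.cc_cross[of 4] by meson
 define M where "M = Re (x 0 0)"
 have M: "M >= 0" using order_trans[OF norm_ge_zero x_bound[of 0 0]] by (simp add: M_def)
 define w where "w = real (2 * N + 1) * (M * (1 + real N))"
 have w0: "w >= 0" using M by (simp add: w_def)
 have "\<bar>hdt \<tau> (n, l)\<bar> <= (4 * w * B) * (1 / (br n ^ 2 * br l ^ 2))" if \<tau>: "\<tau> \<in> {0..S}" for \<tau> n l
 proof -
  have \<tau>0: "\<tau> >= 0" using \<tau> by simp
  interpret g: trig1 N "x \<tau>" "rp N (x \<tau>)" "ph \<tau>" by (rule trig[OF \<tau>0])
  show ?thesis
  proof (cases "n * l < 0")
   case True
   have "cmod (g.W n l) <= (\<Sum>j\<in>{- int N..int N}. M * ((1 + real N) * br l))"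
    unfolding g.W_def
   proof (rule sum_norm_le)
    fix j assume j: "j \<in> {- int N..int N}"
    have "\<bar>real_of_int (l - j)\<bar> <= \<bar>real_of_int l\<bar> + real N" using j by auto
    also have "... <= (1 + real N) * br l" by (simp add: br_def algebra_simps)
    finally have 1: "\<bar>real_of_int (l - j)\<bar> * cmod (g.c n (l - j)) <= (1 + real N) * br l * 1"
     by (intro mult_mono g.norm_c_le_1) (auto simp: less_imp_le)
    have "cmod (of_int (sgn j) * x \<tau> j) <= 1 * M"
     unfolding norm_mult M_def by (intro mult_mono x_bound \<tau>0) (auto simp: sgn_if)
    thus "cmod (of_int (sgn j) * x \<tau> j * (of_int (l - j) * g.c n (l - j))) <= M * ((1 + real N) * br l)"
     unfolding norm_mult[of "of_int (sgn j) * x \<tau> j"] using 1 M by (intro mult_mono) (auto simp: norm_mult simp del: of_int_diff)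
   qed
   hence W: "cmod (g.W n l) <= w * br l" by (simp add: w_def algebra_simps)
   have "\<bar>hdt \<tau> (n, l)\<bar> <= 4 * br l * (cmod (g.c n l) * (w * br l))"
    using True unfolding g.hd1_def prod.case if_P[OF True] abs_mult
    by (intro mult_mono order_trans[OF abs_Re_le_cmod] br_abs_le) (auto simp: norm_mult W mult_left_mono less_imp_le w0 intro!: br_abs_le)
   hence "(br n ^ 2 * br l ^ 2) * \<bar>hdt \<tau> (n, l)\<bar> <= (br n ^ 4 * br l ^ 2) * (4 * br l * (cmod (g.c n l) * (w * br l)))"
    by (intro mult_mono power_increasing br_ge1) (auto simp: less_imp_le w0)
   also have "... = 4 * w * (br n ^ 4 * br l ^ 4 * cmod (g.c n l))" by (simp add: power_numeral_reduce mult_ac)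
   also have "... <= 4 * w * B" using B(2)[OF \<tau>, of n l] True w0 by (intro mult_left_mono) auto
   finally show ?thesis by (simp add: field_simps)
  qed (use B(1) w0 in \<open>simp add: g.hd1_def less_imp_le\<close>)
 qed
 thus thesis by (rule that)
qed

text \<open>Each term is the integral of its continuous derivative; the uniform majorant moves the
  sum inside the integral, where the flux is nonpositive at every time. The infinite series is never
  differentiated.\<close>

theorem first_nonincreasing: assumes S: "S >= 0" shows "(ISUM p. hht S p) <= (ISUM p. hht 0 p)"
proof -
 obtain D where D: "!!\<tau> n l. \<tau> \<in> {0..S} ==> \<bar>hdt \<tau> (n, l)\<bar> <= D * (1 / (br n ^ 2 * br l ^ 2))" by (rule hd_bound[OF S]) blast
 let ?I = "integral {0..S} (%\<tau>. ISUM p. hdt \<tau> p)"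
 have "((%p. integral {0..S} (%\<tau>. hdt \<tau> p)) has_sum ?I) UNIV"
 proof (rule has_sum_integral[where M="%p. D * (case p of (n, l) => 1 / (br n ^ 2 * br l ^ 2))"])
  show "continuous_on {0..S} (%\<tau>. hdt \<tau> p)" for p using continuous_on_subset[OF hd_cont[of "fst p" "snd p"], of "{0..S}"] by simp
  show "norm (hdt \<tau> p) <= D * (case p of (n, l) => 1 / (br n ^ 2 * br l ^ 2))" if "\<tau> \<in> {0..S}" for p \<tau>
   using D[OF that, of "fst p" "snd p"] by (simp add: split_def)
 qed (intro summable_on_cmult_right summable_br2)
 moreover have "integral {0..S} (%\<tau>. hdt \<tau> p) = hht S p - hht 0 p" for p
 proof (rule integral_unique, rule fundamental_theorem_of_calculus[OF S])
  fix \<tau> assume \<tau>: "\<tau> \<in> {0..S}"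
  have "((%\<tau>. hht \<tau> (fst p, snd p)) has_real_derivative hdt \<tau> (fst p, snd p)) (at \<tau> within {0..S})"
   by (rule DERIV_subset[OF hh_tau]) (use \<tau> in auto)
  thus "((%\<tau>. hht \<tau> p) has_vd hdt \<tau> p) (at \<tau> within {0..S})" by (simp add: has_real_derivative_iff_has_vector_derivative)
 qed
 ultimately have "((%p. hht S p - hht 0 p) has_sum ?I) UNIV" by simp
 moreover have "((%p. hht S p - hht 0 p) has_sum ((ISUM p. hht S p) - (ISUM p. hht 0 p))) UNIV"
  by (intro has_sum_diff has_sum_infsum trig1.hh_summable[OF trig] S order_refl)
 ultimately have "(ISUM p. hht S p) - (ISUM p. hht 0 p) = ?I" using has_sum_unique by blast
 moreover have "?I <= 0"
 \<comment> \<open>The integral of a non-integrable function is 0 by convention, so that case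
   satisfies the inequality as well.\<close>
 proof (cases "(%\<tau>. ISUM p. hdt \<tau> p) integrable_on {0..S}")
  case True
  have "?I <= integral {0..S} (%\<tau>. 0::real)" by (rule integral_le[OF True]) (use trig1.flux_nonpos[OF trig] in auto)
  thus ?thesis by simp
 qed (simp add: not_integrable_integral)
 ultimately show ?thesis by linarith
qed

lemma zeta_one_value: assumes \<tau>: "\<tau> >= 0" shows "zeta (rp N (x \<tau>)) (- 1) = 2 * Zc (- 1) + of_real (ISUM p. hht \<tau> p)"
proof -
 interpret g: trig1 N "x \<tau>" "rp N (x \<tau>)" "ph \<tau>" by (rule trig[OF \<tau>])
 obtain \<psi> lam where "trig_eig N (x \<tau>) (rp N (x \<tau>)) (ph \<tau>) \<psi> lam" by (rule g.eig_exists)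
 then interpret e: trig_eig N "x \<tau>" "rp N (x \<tau>)" "ph \<tau>" \<psi> lam .
 show ?thesis using e.zeta_eq[of "- 1"] unfolding e.Gf_one g.r_diag_sum by simp
qed

lemma zeta_even_value:
 assumes \<tau>: "\<tau> >= 0" and m: "m >= 1" and R: "R >= 2 * int ((2 * m) * N)"
 shows "zeta (rp N (x \<tau>)) (- 2 * of_nat m) = 2 * Zc (- 2 * of_nat m) + of_real (Re (tr R (Spt \<tau> (2 * m))))"
proof -
 interpret g: trig1 N "x \<tau>" "rp N (x \<tau>)" "ph \<tau>" by (rule trig[OF \<tau>])
 obtain \<psi> lam where "trig_eig N (x \<tau>) (rp N (x \<tau>)) (ph \<tau>) \<psi> lam" by (rule g.eig_exists)
 then interpret e: trig_eig N "x \<tau>" "rp N (x \<tau>)" "ph \<tau>" \<psi> lam .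
 have "Re (- 2 * of_nat m :: complex) < 1" by simp
 from e.zeta_eq[OF this] show ?thesis unfolding e.Gf_even[OF m R] .
qed

theorem zeta_one_mono: "\<tau> >= 0 ==> Re (zeta (rp N (x \<tau>)) (- 1)) <= Re (zeta (rp N (x 0)) (- 1))"
 using first_nonincreasing[of \<tau>] by (simp add: zeta_one_value)

theorem zeta_even_mono:
 assumes "\<tau> >= 0" "m >= 1" shows "Re (zeta (rp N (x \<tau>)) (- 2 * of_nat m)) <= Re (zeta (rp N (x 0)) (- 2 * of_nat m))"
proof -
 define R where "R = 2 * int N + 2 * int (2 * (2 * m) * N) + 2 * int (2 * N)"
 have R: "2 * int ((2 * m) * N) <= R" unfolding R_def by simp
 show ?thesis
  unfolding zeta_even_value[OF assms R] zeta_even_value[OF order_refl assms(2) R]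
  using trace_nonincreasing[OF assms(2,1) R_def] by (simp only: plus_complex.simps Re_complex_of_real add_le_cancel_left)
qed

end

section \<open>Arbitrary solutions reduced to the coefficient system\<close>

section \<open>Solutions of the flow equation\<close>

lemma band_limited:
 assumes f: "circ_smooth f" and band: "\<forall>k. \<bar>k\<bar> > int N \<longrightarrow> fourier (cx f) k = 0"
 shows "coeffs N (fourier (cx f))" "!!t. complex_of_real (f t) = tp N (fourier (cx f)) t" "f = rp N (fourier (cx f))"
proof -
 have s: "circ_smooth_c (cx f)" using f smooth_const[of 0] by (simp add: circ_smooth_c_def cx_def circ_smooth_def)
 show "coeffs N (fourier (cx f))"
 proof
  show "cnj (fourier (cx f) k) = fourier (cx f) (- k)" for k
   using cnj_fourier[OF circ_smooth_c_cont[OF s], of k] by (simp add: cx_def)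
 qed (use band in auto)
 show t: "complex_of_real (f t) = tp N (fourier (cx f)) t" for t
 proof -
  have "complex_of_real (f t) = Fs (fourier (cx f)) t" using Fs_inversion[OF s, of t] by (simp add: cx_def)
  also have "... = tp N (fourier (cx f)) t"
   unfolding Fs_def tp_def by (rule infsumI, rule has_sum_finite_neutralI) (use band in auto)
  finally show ?thesis .
 qed
 show "f = rp N (fourier (cx f))" by (rule ext) (simp add: rp_def flip: t)
qed

lemma vd_of_quotient:
 fixes f :: "real => complex"
 assumes "!!e. e > 0 ==> \<forall>\<^sub>F y in at x within S. norm (of_real (1 / (y - x)) * (f y - f x) - f') <= e"
 shows "(f has_vd f') (at x within S)"
 unfolding has_vector_derivative_def has_derivative_within
proof (intro conjI bounded_linear_scaleR_left tendstoI)
 fix e :: real assume e: "e > 0"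
 have A: "\<forall>\<^sub>F y in at x within S. norm (of_real (1 / (y - x)) * (f y - f x) - f') <= e / 2" by (rule assms) (use e in simp)
 have "\<forall>\<^sub>F y in at x within S. y \<noteq> x" by (simp add: eventually_at_filter)
 thus "\<forall>\<^sub>F y in at x within S. dist ((1 / norm (y - x)) *\<^sub>R (f y - (f x + (y - x) *\<^sub>R f'))) 0 < e"
  using A
 proof eventually_elim
  case (elim y)
  have 1: "of_real (1 / (y - x)) * (f y - f x) - f' = of_real (1 / (y - x)) * (f y - (f x + (y - x) *\<^sub>R f'))"
   using elim(1) by (simp add: scaleR_conv_of_real field_simps)
  have "norm ((1 / norm (y - x)) *\<^sub>R z) = norm (complex_of_real (1 / (y - x)) * z)" for z :: complex
   by (simp add: norm_mult norm_divide flip: of_real_diff)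
  hence "dist ((1 / norm (y - x)) *\<^sub>R (f y - (f x + (y - x) *\<^sub>R f'))) 0 = norm (of_real (1 / (y - x)) * (f y - f x) - f')"
   unfolding dist_norm diff_zero 1 .
  thus ?case using elim(2) e by linarith
 qed
qed

lemma (in coeffs) fl_herm: "cnj (fl N a k) = fl N a (- k)"
 using fl_refl[of N a "- k"] aherm[of "- k" for k] by simp

text \<open>The seminorm of order 0 bounds the difference quotients uniformly in theta, and a
  Fourier coefficient is bounded by the supremum; so each coefficient is differentiable and follows
  \<open>fl\<close>.\<close>

lemma flow_sol_coeffs:
 assumes b: "flow_sol N a b" and \<tau>: "\<tau> >= 0"
 shows "coeffs N (fourier (cx (b \<tau>)))" "b \<tau> = rp N (fourier (cx (b \<tau>)))"
  "((%\<tau>. fourier (cx (b \<tau>)) k) has_vd fl N (fourier (cx (b \<tau>))) k) (at \<tau> within {0..})"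
proof -
 define y where "y \<tau> = fourier (cx (b \<tau>))" for \<tau>
 have sm: "circ_smooth (b \<sigma>)" if "\<sigma> >= 0" for \<sigma>
 proof -
  from b have "smooth_curve b" by (simp add: flow_sol_def)
  then obtain A where A: "A 0 = b" "\<forall>n. (\<forall>\<tau>\<ge>0. circ_smooth (A n \<tau>)) \<and> curve_cont (A n) \<and> curve_deriv (A n) (A (Suc n))"
   unfolding smooth_curve_def by metis
  from A(2)[THEN spec, of 0] that show ?thesis unfolding A(1) by blast
 qed
 have bd: "\<forall>k. \<bar>k\<bar> > int N \<longrightarrow> fourier (cx (b \<sigma>)) k = 0" if "\<sigma> >= 0" for \<sigma> using b that unfolding flow_sol_def by blast
 have bl: "coeffs N (y \<sigma>)" "!!t. complex_of_real (b \<sigma> t) = tp N (y \<sigma>) t" "b \<sigma> = rp N (y \<sigma>)" if "\<sigma> >= 0" for \<sigma>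
  unfolding y_def by (rule band_limited[OF sm[OF that] bd[OF that]])+
 show "coeffs N (fourier (cx (b \<tau>)))" "b \<tau> = rp N (fourier (cx (b \<tau>)))" using bl(1,3)[OF \<tau>] unfolding y_def .
 obtain g where g: "curve_deriv b g" "!!\<tau> t. \<tau> >= 0 ==> complex_of_real (g \<tau> t) = - cx (b \<tau>) t * Lam (cx (b \<tau>)) t + Hil (cx (b \<tau>)) t * Dop (cx (b \<tau>)) t"
  using b unfolding flow_sol_def by blast
 interpret c: coeffs N "y \<tau>" by (rule bl(1)[OF \<tau>])
 have ge: "g \<tau> t = rp N (fl N (y \<tau>)) t" for t
 proof -
  have "complex_of_real (g \<tau> t) = tp N (fl N (y \<tau>)) t"
   unfolding g(2)[OF \<tau>] by (rule c.flow_rhs[OF bl(2)[OF \<tau>]])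
  thus ?thesis unfolding rp_def by (metis Re_complex_of_real)
 qed
 have "((%\<tau>. y \<tau> k) has_vd fl N (y \<tau>) k) (at \<tau> within {0..})"
 proof (rule vd_of_quotient)
  fix e :: real assume e: "e > 0"
  have "\<forall>\<^sub>F \<sigma> in at \<tau> within {0..}. \<forall>t. \<bar>((deriv ^^ 0) (b \<sigma>) t - (deriv ^^ 0) (b \<tau>) t) / (\<sigma> - \<tau>) - (deriv ^^ 0) (g \<tau>) t\<bar> <= e"
   using g(1) \<tau> e unfolding curve_deriv_def by blast
  moreover have "\<forall>\<^sub>F \<sigma> in at \<tau> within {0..}. \<sigma> >= 0" by (simp add: eventually_at_filter)
  ultimately show "\<forall>\<^sub>F \<sigma> in at \<tau> within {0..}. norm (of_real (1 / (\<sigma> - \<tau>)) * (y \<sigma> k - y \<tau> k) - fl N (y \<tau>) k) <= e"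
  proof eventually_elim
   case (elim \<sigma>)
   interpret s: coeffs N "y \<sigma>" by (rule bl(1)[OF elim(2)])
   define d where "d k = of_real (1 / (\<sigma> - \<tau>)) * (y \<sigma> k - y \<tau> k) - fl N (y \<tau>) k" for k
   have "rp N d t = (rp N (y \<sigma>) t - rp N (y \<tau>) t) / (\<sigma> - \<tau>) - rp N (fl N (y \<tau>)) t" for t
    unfolding d_def rp_lin by simp
   hence "rp N d t = (b \<sigma> t - b \<tau> t) / (\<sigma> - \<tau>) - g \<tau> t" for t
    using bl(3)[OF elim(2)] bl(3)[OF \<tau>] ge by metis
   hence le: "\<bar>rp N d t\<bar> <= e" for t using elim(1) by simp
   have h: "cnj (d k) = d (- k)" for k unfolding d_def by (simp add: s.aherm c.aherm c.fl_herm)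
   have "cmod (fourier (tp N d) k) <= e"
    by (rule norm_fourier_le[OF tp_cont]) (simp add: tp_real[of d, OF h] le)
   moreover have "fourier (tp N d) k = d k" unfolding fourier_tp using s.aband[of k] c.aband[of k] c.fl_band[of k] by (auto simp: d_def)
   ultimately show ?case by (simp add: d_def)
  qed
 qed
 thus "((%\<tau>. fourier (cx (b \<tau>)) k) has_vd fl N (fourier (cx (b \<tau>))) k) (at \<tau> within {0..})" by (simp add: y_def)
qed

theorem theorem6p2:
  fixes a :: "real \<Rightarrow> real" and N :: nat
  assumes "circ_smooth a"
    and "\<forall>\<theta>. a \<theta> > 0"
    and "integral {0..2*pi} (\<lambda>\<theta>. 1 / a \<theta>) = 2 * pi"
    and "\<forall>k::int. \<bar>k\<bar> > int N \<longrightarrow> fourier (cx a) k = 0"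
  shows "\<exists>\<alpha>. flow_sol N a \<alpha> \<and>
           (\<forall>\<beta>. flow_sol N a \<beta> \<longrightarrow> (\<forall>\<tau>\<ge>0. \<beta> \<tau> = \<alpha> \<tau>)) \<and>
           (\<forall>c::nat \<Rightarrow> real. (\<forall>k. c k > 0) \<and> c 0 \<ge> Re (fourier (cx a) 0) \<and>
              c 1 \<ge> Re (zeta a (-1)) \<and>
              (\<forall>m::nat. m \<ge> 1 \<longrightarrow> c (m + 1) \<ge> Re (zeta a (- 2 * of_nat m)))
            \<longrightarrow> (\<forall>\<tau>\<ge>0. \<alpha> \<tau> \<in> Kc c))"
proof -
 note bl = band_limited[OF assms(1,4)]
 have p0: "rp N (fourier (cx a)) t > 0" for t using assms(2) bl(3) by metis
 obtain x where x: "x 0 = fourier (cx a)" "!!\<tau>. \<tau> >= 0 ==> coeffs N (x \<tau>)" "!!\<tau> t. \<tau> >= 0 ==> rp N (x \<tau>) t > 0"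
  "!!k \<tau>. \<tau> >= 0 ==> ((%\<tau>. x \<tau> k) has_vd fl N (x \<tau>) k) (at \<tau> within {0..})"
  by (rule flow_exists[OF bl(1) p0]) blast
 have a0: "rp N (x 0) = a" using bl(3) x(1) by simp
 interpret flow_line N x by (rule flow_line.intro) (use x a0 assms(3) in simp_all)
 define \<alpha> where "\<alpha> \<tau> = rp N (x \<tau>)" for \<tau>
 have tp: "cx (\<alpha> \<tau>) = tp N (x \<tau>)" if "\<tau> >= 0" for \<tau>
  unfolding cx_def \<alpha>_def by (rule ext) (simp add: coeffs.a_real[OF x(2)[OF that]])
 have fo: "fourier (cx (\<alpha> \<tau>)) k = x \<tau> k" if "\<tau> >= 0" for \<tau> k
  unfolding tp[OF that] fourier_tp using coeffs.aband[OF x(2)[OF that], of k] by auto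
 have "flow_sol N a \<alpha>"
  unfolding flow_sol_def
 proof (intro conjI allI impI exI[of _ "%\<tau>. rp N (fl N (x \<tau>))"])
  show "smooth_curve \<alpha>" unfolding \<alpha>_def[abs_def] by (rule smooth_curve_rp[OF x(4)])
  show "\<alpha> 0 = a" by (simp add: \<alpha>_def a0)
  show "curve_deriv \<alpha> (%\<tau>. rp N (fl N (x \<tau>)))" unfolding \<alpha>_def[abs_def] by (rule curve_deriv_rp[OF x(4)])
  fix \<tau> :: real assume \<tau>: "\<tau> >= 0"
  interpret c: coeffs N "x \<tau>" by (rule x(2)[OF \<tau>])
  show "\<alpha> \<tau> t > 0" for t using x(3)[OF \<tau>] by (simp add: \<alpha>_def)
  have e: "complex_of_real (\<alpha> \<tau> t) = tp N (x \<tau>) t" for t using fun_cong[OF tp[OF \<tau>], of t] by (simp add: cx_def)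
  show "complex_of_real (rp N (fl N (x \<tau>)) t) = - cx (\<alpha> \<tau>) t * Lam (cx (\<alpha> \<tau>)) t + Hil (cx (\<alpha> \<tau>)) t * Dop (cx (\<alpha> \<tau>)) t" for t
   unfolding c.flow_rhs[OF e] by (rule tp_real[symmetric]) (rule c.fl_herm)
  show "fourier (cx (\<alpha> \<tau>)) k = 0" if "\<bar>k\<bar> > int N" for k unfolding fo[OF \<tau>] by (rule c.aband[OF that])
 qed
 moreover have "b \<tau> = \<alpha> \<tau>" if b: "flow_sol N a b" and \<tau>: "\<tau> >= 0" for b \<tau>
 proof -
  note s = flow_sol_coeffs[OF b]
  have b0: "b 0 = a" using b unfolding flow_sol_def by blast
  \<comment> \<open>Uniqueness is decided for the coefficient curves; band limitation then recovers
    the function from its coefficients.\<close>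
  have "(%\<tau>. fourier (cx (b \<tau>))) \<tau> = x \<tau>"
   by (rule flow_unique[OF s(1) s(3) x(2) x(4) _ \<tau>]) (simp_all add: b0 x(1))
  thus ?thesis using s(2)[OF \<tau>] by (simp add: \<alpha>_def)
 qed
 moreover have "\<alpha> \<tau> \<in> Kc c"
  if c: "c 0 >= Re (fourier (cx a) 0)" "c 1 >= Re (zeta a (-1))" "\<forall>m::nat. m >= 1 \<longrightarrow> c (m + 1) >= Re (zeta a (- 2 * of_nat m))" and \<tau>: "\<tau> >= 0" for c \<tau>
  unfolding Kc_def mem_Collect_eq
 proof (intro conjI allI impI)
  show "circ_smooth (\<alpha> \<tau>)" unfolding \<alpha>_def by (rule rp_smooth)
  show "\<alpha> \<tau> t > 0" for t using x(3)[OF \<tau>] by (simp add: \<alpha>_def)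
  show "integral {0..2*pi} (%t. 1 / \<alpha> \<tau> t) = 2 * pi" unfolding \<alpha>_def by (rule vol[OF \<tau>])
  show "Re (fourier (cx (\<alpha> \<tau>)) 0) <= c 0" using x0_mono[OF \<tau>] c(1) fo[OF \<tau>] x(1) by simp
  show "Re (zeta (\<alpha> \<tau>) (- 1)) <= c 1" using zeta_one_mono[OF \<tau>] c(2) unfolding a0 \<alpha>_def by linarith
  show "Re (zeta (\<alpha> \<tau>) (- 2 * of_nat m)) <= c (m + 1)" if "m >= 1" for m
   using zeta_even_mono[OF \<tau> that] c(3)[rule_format, OF that] unfolding a0 \<alpha>_def by linarith
 qed
 ultimately show ?thesis by blast
qed

end
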